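(* Let $f\colon(\mathbb{R}^2,0)\to(\mathbb{R},0)$ be the germ of a definable continuous function. A minimal pizza associated with $f$ is unique up to combinatorial equivalence; that is, any two minimal pizzas associated with $f$ are combinatorially equivalent.
   Context: Fix a polynomially bounded o-minimal structure $\mathcal{A}$ over $\mathbb{R}$ with field of exponents $\mathbb{F}\subset\mathbb{R}$; $\mathbb{F}_+$ denotes the set of positive elements of $\mathbb{F}$. "Definable" means definable in $\mathcal{A}$. Functions are identified with their germs at the origin of $\mathbb{R}^2$. Arcs, orders. An arc is (the germ at the origin of) a continuous definable map $\gamma\colon[0,\epsilon)\to\mathbb{R}^2$ with $\gamma(0)=0$, parameterized by the distance to the origin, $|\gamma(t)|=t$; it is identified with its image. The order of tangency of two distinct arcs is the exponent $\mathrm{tord}(\gamma_1,\gamma_2)=\beta\in\mathbb{F}$, $\beta\ge1$, with $|\gamma_1(t)-\gamma_2(t)|=bt^\beta+o(t^\beta)$, $b\ne0$. For a continuous definable function $f$ vanishing at $0$, $\mathrm{ord}_\gamma(f)\in\mathbb{F}_+$ is the exponent $\alpha$ with $f(\gamma(t))=at^\alpha+o(t^\alpha)$, $a\neq0$; $\mathrm{ord}_\gamma(f)=\infty$ if $f|_\gamma\equiv0$. Hölder triangles. Two arcs $\gamma_1,\gamma_2$ divide the germ of $\mathbb{R}^2$ at the origin into two components. If $\beta=\mathrm{tord}(\gamma_1,\gamma_2)>1$, the closure of the smaller component (the one not containing a half-plane) is a $\beta$-Hölder triangle; if $\mathrm{tord}(\gamma_1,\gamma_2)=1$, the closure of each of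 the two components is a $1$-Hölder triangle. $\beta$ is its exponent, $\gamma_1,\gamma_2$ its sides, and $T(\gamma_1,\gamma_2)$ denotes a Hölder triangle with sides $\gamma_1,\gamma_2$. For a Hölder triangle $T$, $Q_f(T)=\{\mathrm{ord}_\gamma(f):\gamma\subset T \text{ an arc}\}\subset\mathbb{F}_+\cup\{\infty\}$. $T$ is elementary with respect to $f$ if for any two disjoint arcs $\gamma_1,\gamma_2\subset T$ with $\mathrm{ord}_{\gamma_1}(f)=\mathrm{ord}_{\gamma_2}(f)=q$, the order of $f$ is $q$ on any arc in the Hölder triangle $T(\gamma_1,\gamma_2)\subset T$. For an arc $\gamma\subset T$, the relative width $\mu_T^*(\gamma)=\mu_T^*(\gamma,f)$ is the infimum of the exponents of Hölder triangles $\tilde T$ with $\gamma\subset\tilde T\subset T$ such that $Q_f(\tilde T)$ is a point ($\infty$ if there are none). Pizzas. A Hölder complex on $\mathbb{R}^2$ is a definable triangulation of the germ of $\mathbb{R}^2$ at the origin (into Hölder triangles, cyclically ordered). An abstract Hölder complex is a finite sequence of exponents $\beta_i\in\mathbb{F}$, $\beta_i\ge1$, considered with the cyclic order, at least one of which equals $1$; a Hölder complex $\{T_i\}$ corresponds to it if $T_i$ has exponent $\beta_i$ for all $i$. An abstract pizza (or pizza) is a finite collection $\mathcal{H}=\{\beta_i,Q_i,s_i,\mu_i\}_{i\in I}$, where $I=\{1,\dots,k\}$ mod $k$ with the cyclic order, such that: (1) $\{\beta_i\}$ is an abstract Hölder complex; (2) each $Q_i=[a_i,b_i]$ is a closed directed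 segment of $\mathbb{F}_+\cup\{\infty\}$ (either $a_i<b_i$, or $a_i>b_i$, or $a_i=b_i$ when $Q_i$ is a point), with $a_{i+1}=b_i$ for all $i$; (3) each $s_i$ is a sign $+$, $-$ or $0$, with $s_i=s_{i+1}$ unless $b_i=a_{i+1}=\infty$; (4) $\mu_i\colon Q_i\to\mathbb{F}\cup\{\infty\}$ is an affine function with $\min(\mu_i(a_i),\mu_i(b_i))=\beta_i$. Here affine means of the form $q\mapsto cq+d$, $c,d\in\mathbb{F}$; if $\infty\in Q_i\ne\{\infty\}$ the value at $\infty$ is the limit as $q\to\infty$, and if $Q_i=\{\infty\}$ the value is any element of $\mathbb{F}\cup\{\infty\}$. A pizza $\mathcal{H}=\{\beta_i,Q_i,s_i,\mu_i\}_{i\in I}$ is associated with a continuous definable germ $f\colon(\mathbb{R}^2,0)\to(\mathbb{R},0)$ if there is a Hölder complex $\{T_i\}_{i\in I}$ on $\mathbb{R}^2$, where each $T_i=T(\gamma_i,\gamma_{i+1})$ is a $\beta_i$-Hölder triangle elementary with respect to $f$ and the arcs $\gamma_i$ are either counterclockwise or clockwise oriented with respect to the cyclic order on $I$, such that (1) $Q_i=Q_f(T_i)$, as directed segments with $a_i=\mathrm{ord}_{\gamma_i}(f)$, $b_i=\mathrm{ord}_{\gamma_{i+1}}(f)$; (2) for each arc $\gamma\subset T_i$, $\mu_{T_i}^*(\gamma)=\mu_i(\mathrm{ord}_\gamma(f))$; (3) the sign of $f$ on the interior of $T_i$ is $s_i$. Equivalence of pizzas. Two pizzas $\{\beta_i,Q_i,s_i,\mu_i\}_{i=1}^k$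 and $\{\beta'_j,Q'_j,s'_j,\mu'_j\}_{j=1}^{k'}$ are combinatorially equivalent if $k=k'$ and there is a bijection $i\mapsto j(i)$ of the index sets, either preserving or reversing the cyclic order, with $\beta'_{j(i)}=\beta_i$ for all $i$, such that: either $s'_{j(i)}=s_i$ for all $i$ or $s'_{j(i)}=-s_i$ for all $i$; $Q'_{j(i)}=Q_i$ for all $i$ if the cyclic order is preserved, or $Q'_{j(i)}=-Q_i$ for all $i$ (where $-Q_i$ is $Q_i$ with opposite direction) if it is reversed; and $\mu'_{j(i)}=\mu_i$ for all $i$. Simplification. A simplification of a pizza $\mathcal{H}=\{\beta_i,Q_i,s_i,\mu_i\}$ is a pizza obtained from it by the following operations, each of which replaces two consecutive entries $i,i+1$ by a single entry $(\tilde\beta_i,\tilde Q_i,\tilde s_i,\tilde\mu_i)$, leaving the other entries and the cyclic order unchanged (so $k$ drops to $k-1$). Operation 1: suppose $Q_i=[a_i,b_i]$ and $Q_{i+1}=[a_{i+1},b_{i+1}]$ are not points, $s_i=s_{i+1}$, either $a_i<b_i=a_{i+1}<b_{i+1}$ or $a_i>b_i=a_{i+1}>b_{i+1}$, and there is an affine function $\tilde\mu$ with $\mu_j=\tilde\mu|_{Q_j}$ for $j=i,i+1$. Then set $\tilde\beta_i=\min\{\beta_i,\beta_{i+1}\}$, $\tilde Q_i=Q_i\cup Q_{i+1}=[a_i,b_{i+1}]$, $\tilde s_i=s_i$, $\tilde\mu_i=\tilde\mu|_{Q_i\cup Q_{i+1}}$. Operation 2: suppose $s_i=s_{i+1}$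 and at least one of $Q_i,Q_{i+1}$ is a point. If $Q_i=[a,a]$, $Q_{i+1}=[a,b]$ and $\beta_i\ge\mu_{i+1}(a)$, set $\tilde\beta_i=\beta_{i+1}$, $\tilde Q_i=Q_{i+1}$, $\tilde s_i=s_i$, $\tilde\mu_i=\mu_{i+1}$. If $Q_i=[a,b]$, $Q_{i+1}=[b,b]$ and $\beta_{i+1}\ge\mu_i(b)$, set $\tilde\beta_i=\beta_i$, $\tilde Q_i=Q_i$, $\tilde s_i=s_i$, $\tilde\mu_i=\mu_i$. A pizza is simplified if none of these operations can be applied. A minimal pizza associated with $f$ is a simplified pizza obtained by these operations from some pizza associated with $f$. *)

theory Defs
  imports "HOL-Analysis.Analysis" "HOL-Library.Landau_Symbols"
begin

text \<open>A structure is the family of its definable sets: \<open>S n\<close> consists of the definable subsets of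
  the real \<open>n\<close>-space, whose points are the lists of length \<open>n\<close>. Singletons are definable by the last
  clause, so definability is with real parameters; the order is definable from the field operations.
  A finite union of points and open intervals is the same as a finite union of sets satisfying
  \<^const>\<open>is_interval\<close>.\<close>

definition o_minimal_structure :: "(nat \<Rightarrow> real list set set) \<Rightarrow> bool" where
  "o_minimal_structure S \<longleftrightarrow>
     (\<forall>n. S n \<subseteq> Pow {xs. length xs = n} \<and> {} \<in> S n \<and>
          (\<forall>A\<in>S n. {xs. length xs = n} - A \<in> S n) \<and>
          (\<forall>A\<in>S n. \<forall>B\<in>S n. A \<union> B \<in> S n)) \<and>
     (\<forall>n. \<forall>A\<in>S n. {x # xs | x xs. xs \<in> A} \<in> S (Suc n) \<and> {xs @ [x] | x xs. xs \<in> A} \<in> S (Suc n)) \<and>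
     (\<forall>n i j. i < n \<and> j < n \<longrightarrow> {xs. length xs = n \<and> xs ! i = xs ! j} \<in> S n) \<and>
     (\<forall>n. \<forall>A\<in>S (Suc n). butlast ` A \<in> S n) \<and>
     {[x, y, x + y] | x y. True} \<in> S 3 \<and>
     {[x, y, x * y] | x y. True} \<in> S 3 \<and>
     S 1 = {(\<lambda>x. [x]) ` \<Union>J | J. finite J \<and> (\<forall>I\<in>J. is_interval I)}"

definition polynomially_bounded :: "(nat \<Rightarrow> real list set set) \<Rightarrow> bool" where
  "polynomially_bounded S \<longleftrightarrow>
     (\<forall>g :: real \<Rightarrow> real. {[x, g x] | x. True} \<in> S 2 \<longrightarrow>
        (\<exists>N :: nat. \<forall>\<^sub>F x in at_top. \<bar>g x\<bar> \<le> x ^ N))"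

definition exponents :: "(nat \<Rightarrow> real list set set) \<Rightarrow> real set" where
  "exponents S = {r. {[x, x powr r] | x. 0 < x} \<in> S 2}"

definition order_values :: "(nat \<Rightarrow> real list set set) \<Rightarrow> ereal set" where
  "order_values S = ereal ` {r \<in> exponents S. 0 < r} \<union> {\<infinity>}"

text \<open>The plane is \<^typ>\<open>real \<times> real\<close>, with the Euclidean norm. Germs at the origin of functions, arcs
  and sets are given by representatives; all notions below depend only on the germs.\<close>

definition definable_continuous_germ ::
    "(nat \<Rightarrow> real list set set) \<Rightarrow> (real \<times> real \<Rightarrow> real) \<Rightarrow> bool" where
  "definable_continuous_germ S f \<longleftrightarrow>
     f 0 = 0 \<and>
     (\<exists>\<epsilon>>0. continuous_on (ball 0 \<epsilon>) f \<and>
            {[x, y, f (x, y)] | x y. (x, y) \<in> ball 0 \<epsilon>} \<in> S 3)"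

definition arc_germ :: "(nat \<Rightarrow> real list set set) \<Rightarrow> (real \<Rightarrow> real \<times> real) \<Rightarrow> bool" where
  "arc_germ S \<gamma> \<longleftrightarrow>
     (\<exists>\<epsilon>>0. continuous_on {0..<\<epsilon>} \<gamma> \<and> (\<forall>t\<in>{0..<\<epsilon>}. norm (\<gamma> t) = t) \<and>
            {[t, fst (\<gamma> t), snd (\<gamma> t)] | t. t \<in> {0..<\<epsilon>}} \<in> S 3)"

definition arc_eq :: "(real \<Rightarrow> real \<times> real) \<Rightarrow> (real \<Rightarrow> real \<times> real) \<Rightarrow> bool" where
  "arc_eq \<gamma>1 \<gamma>2 \<longleftrightarrow> (\<forall>\<^sub>F t in at_right 0. \<gamma>1 t = \<gamma>2 t)"

text \<open>Since arcs are parameterized by the distance to the origin, their images can only meet at equal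
  parameters. Disjoint means disjoint outside the origin.\<close>

definition arc_disjoint :: "(real \<Rightarrow> real \<times> real) \<Rightarrow> (real \<Rightarrow> real \<times> real) \<Rightarrow> bool" where
  "arc_disjoint \<gamma>1 \<gamma>2 \<longleftrightarrow> (\<forall>\<^sub>F t in at_right 0. \<gamma>1 t \<noteq> \<gamma>2 t)"

definition arc_in :: "(real \<Rightarrow> real \<times> real) \<Rightarrow> (real \<times> real) set \<Rightarrow> bool" where
  "arc_in \<gamma> T \<longleftrightarrow> (\<forall>\<^sub>F t in at_right 0. \<gamma> t \<in> T)"

definition germ_subset :: "(real \<times> real) set \<Rightarrow> (real \<times> real) set \<Rightarrow> bool" where
  "germ_subset A B \<longleftrightarrow> (\<exists>\<epsilon>>0. A \<inter> ball 0 \<epsilon> \<subseteq> B)"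

text \<open>Meaningful for arcs that are not \<^const>\<open>arc_eq\<close>.\<close>

definition tord ::
    "(nat \<Rightarrow> real list set set) \<Rightarrow> (real \<Rightarrow> real \<times> real) \<Rightarrow> (real \<Rightarrow> real \<times> real) \<Rightarrow> real" where
  "tord S \<gamma>1 \<gamma>2 =
     (THE \<beta>. \<beta> \<in> exponents S \<and> 1 \<le> \<beta> \<and>
        (\<exists>b. b \<noteq> 0 \<and> (\<lambda>t. norm (\<gamma>1 t - \<gamma>2 t) - b * t powr \<beta>) \<in> o[at_right 0](\<lambda>t. t powr \<beta>)))"

definition ord_along ::
    "(nat \<Rightarrow> real list set set) \<Rightarrow> (real \<times> real \<Rightarrow> real) \<Rightarrow> (real \<Rightarrow> real \<times> real) \<Rightarrow> ereal" where
  "ord_along S f \<gamma> =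
     (if \<forall>\<^sub>F t in at_right 0. f (\<gamma> t) = 0 then \<infinity>
      else ereal (THE \<alpha>. \<alpha> \<in> exponents S \<and> 0 < \<alpha> \<and>
        (\<exists>a. a \<noteq> 0 \<and> (\<lambda>t. f (\<gamma> t) - a * t powr \<alpha>) \<in> o[at_right 0](\<lambda>t. t powr \<alpha>))))"

text \<open>For given sides, the germ of \<open>T\<close> is unique if \<open>\<beta> > 1\<close> (the component without a half-plane germ);
  for \<open>\<beta> = 1\<close> there are two such germs.\<close>

definition holder_triangle ::
    "(nat \<Rightarrow> real list set set) \<Rightarrow> real \<Rightarrow> (real \<Rightarrow> real \<times> real) \<Rightarrow> (real \<Rightarrow> real \<times> real) \<Rightarrow>
     (real \<times> real) set \<Rightarrow> bool" where
  "holder_triangle S \<beta> \<gamma>1 \<gamma>2 T \<longleftrightarrow>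
     arc_germ S \<gamma>1 \<and> arc_germ S \<gamma>2 \<and> \<not> arc_eq \<gamma>1 \<gamma>2 \<and> \<beta> = tord S \<gamma>1 \<gamma>2 \<and>
     (\<forall>\<^sub>F \<epsilon> in at_right 0.
        \<exists>C \<in> components (ball 0 \<epsilon> - (\<gamma>1 ` {0..<\<epsilon>} \<union> \<gamma>2 ` {0..<\<epsilon>})).
          T \<inter> ball 0 \<epsilon> = closure C \<inter> ball 0 \<epsilon> \<and>
          (\<beta> > 1 \<longrightarrow> \<not> (\<exists>v. v \<noteq> 0 \<and> {x \<in> ball 0 \<epsilon>. 0 < v \<bullet> x} \<subseteq> C)))"

definition order_set ::
    "(nat \<Rightarrow> real list set set) \<Rightarrow> (real \<times> real \<Rightarrow> real) \<Rightarrow> (real \<times> real) set \<Rightarrow> ereal set" where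
  "order_set S f T = {ord_along S f \<gamma> | \<gamma>. arc_germ S \<gamma> \<and> arc_in \<gamma> T}"

definition elementary ::
    "(nat \<Rightarrow> real list set set) \<Rightarrow> (real \<times> real \<Rightarrow> real) \<Rightarrow> (real \<times> real) set \<Rightarrow> bool" where
  "elementary S f T \<longleftrightarrow>
     (\<forall>\<gamma>1 \<gamma>2 q \<beta> T' \<gamma>.
        arc_germ S \<gamma>1 \<and> arc_in \<gamma>1 T \<and> arc_germ S \<gamma>2 \<and> arc_in \<gamma>2 T \<and> arc_disjoint \<gamma>1 \<gamma>2 \<and>
        ord_along S f \<gamma>1 = q \<and> ord_along S f \<gamma>2 = q \<and>
        holder_triangle S \<beta> \<gamma>1 \<gamma>2 T' \<and> germ_subset T' T \<and>
        arc_germ S \<gamma> \<and> arc_in \<gamma> T' \<longrightarrow> ord_along S f \<gamma> = q)"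

definition relative_width ::
    "(nat \<Rightarrow> real list set set) \<Rightarrow> (real \<times> real \<Rightarrow> real) \<Rightarrow> (real \<times> real) set \<Rightarrow>
     (real \<Rightarrow> real \<times> real) \<Rightarrow> ereal" where
  "relative_width S f T \<gamma> =
     Inf {ereal \<beta> | \<beta>. \<exists>\<gamma>1 \<gamma>2 T'. holder_triangle S \<beta> \<gamma>1 \<gamma>2 T' \<and> arc_in \<gamma> T' \<and> germ_subset T' T \<and>
                        (\<exists>q. order_set S f T' = {q})}"

text \<open>The triangle \<open>Ts ! i\<close> has sides \<open>\<gamma>s ! i\<close> and \<open>\<gamma>s ! (i + 1)\<close>, indices modulo the length. Two distinct
  triangles meet exactly in the origin and their common sides.\<close>

definition holder_complex ::
    "(nat \<Rightarrow> real list set set) \<Rightarrow> real list \<Rightarrow> (real \<Rightarrow> real \<times> real) list \<Rightarrow>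
     (real \<times> real) set list \<Rightarrow> bool" where
  "holder_complex S \<beta>s \<gamma>s Ts \<longleftrightarrow>
     (let k = length \<beta>s in
      k \<noteq> 0 \<and> length \<gamma>s = k \<and> length Ts = k \<and>
      (\<forall>i<k. holder_triangle S (\<beta>s ! i) (\<gamma>s ! i) (\<gamma>s ! (Suc i mod k)) (Ts ! i)) \<and>
      (\<forall>\<^sub>F \<epsilon> in at_right 0.
         ball 0 \<epsilon> \<subseteq> (\<Union>i<k. Ts ! i) \<and>
         (\<forall>i<k. \<forall>j<k. i \<noteq> j \<longrightarrow>
            Ts ! i \<inter> Ts ! j \<inter> ball 0 \<epsilon> =
              {0} \<union> (\<Union>m \<in> {i, Suc i mod k} \<inter> {j, Suc j mod k}. (\<gamma>s ! m) ` {0..<\<epsilon>}))))"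

definition counterclockwise :: "(real \<Rightarrow> real \<times> real) list \<Rightarrow> bool" where
  "counterclockwise \<gamma>s \<longleftrightarrow>
     (\<forall>\<^sub>F t in at_right 0. \<exists>\<theta> :: nat \<Rightarrow> real.
        (\<forall>i<length \<gamma>s. (\<gamma>s ! i) t = (t * cos (\<theta> i), t * sin (\<theta> i))) \<and>
        (\<forall>i j. i < j \<and> j < length \<gamma>s \<longrightarrow> \<theta> i < \<theta> j \<and> \<theta> j < \<theta> i + 2 * pi))"

definition clockwise :: "(real \<Rightarrow> real \<times> real) list \<Rightarrow> bool" where
  "clockwise \<gamma>s \<longleftrightarrow> counterclockwise (rev \<gamma>s)"

text \<open>An entry \<open>(\<beta>, Q, s, \<mu>)\<close> with directed segment \<open>Q = [seg_from, seg_to]\<close>; a pizza is a nonempty list of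
  entries, with indices modulo the length. The function \<open>slice_width\<close> is relevant only on \<open>Q\<close>.\<close>

datatype slice = Slice
  (slice_exp: real) (seg_from: ereal) (seg_to: ereal) (slice_sign: int)
  (slice_width: "ereal \<Rightarrow> ereal")

definition seg_set :: "(nat \<Rightarrow> real list set set) \<Rightarrow> slice \<Rightarrow> ereal set" where
  "seg_set S x = {q \<in> order_values S.
     min (seg_from x) (seg_to x) \<le> q \<and> q \<le> max (seg_from x) (seg_to x)}"

text \<open>In \<^typ>\<open>ereal\<close>, \<open>c * \<infinity> + d\<close> is the limit of \<open>c * q + d\<close> at infinity, also for \<open>c = 0\<close>; the
  condition on the values rules out \<open>c < 0\<close> in that case.\<close>

definition affine_width :: "(nat \<Rightarrow> real list set set) \<Rightarrow> ereal set \<Rightarrow> (ereal \<Rightarrow> ereal) \<Rightarrow> bool" where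
  "affine_width S Q \<mu> \<longleftrightarrow>
     (\<forall>q\<in>Q. \<mu> q \<in> ereal ` exponents S \<union> {\<infinity>}) \<and>
     (Q = {\<infinity>} \<or>
      (\<exists>c\<in>exponents S. \<exists>d\<in>exponents S. \<forall>q\<in>Q. \<mu> q = ereal c * q + ereal d))"

definition abstract_holder_complex :: "(nat \<Rightarrow> real list set set) \<Rightarrow> real list \<Rightarrow> bool" where
  "abstract_holder_complex S \<beta>s \<longleftrightarrow> (\<forall>\<beta>\<in>set \<beta>s. \<beta> \<in> exponents S \<and> 1 \<le> \<beta>) \<and> 1 \<in> set \<beta>s"

definition abstract_pizza :: "(nat \<Rightarrow> real list set set) \<Rightarrow> slice list \<Rightarrow> bool" where
  "abstract_pizza S H \<longleftrightarrow>
     abstract_holder_complex S (map slice_exp H) \<and>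
     (\<forall>i<length H.
        let x = H ! i; y = H ! (Suc i mod length H) in
        seg_from x \<in> order_values S \<and> seg_to x \<in> order_values S \<and>
        seg_from y = seg_to x \<and>
        slice_sign x \<in> {-1, 0, 1} \<and>
        (slice_sign x = slice_sign y \<or> seg_to x = \<infinity>) \<and>
        affine_width S (seg_set S x) (slice_width x) \<and>
        min (slice_width x (seg_from x)) (slice_width x (seg_to x)) = ereal (slice_exp x))"

definition associated_pizza ::
    "(nat \<Rightarrow> real list set set) \<Rightarrow> (real \<times> real \<Rightarrow> real) \<Rightarrow> slice list \<Rightarrow> bool" where
  "associated_pizza S f H \<longleftrightarrow>
     abstract_pizza S H \<and>
     (\<exists>\<gamma>s Ts.
        holder_complex S (map slice_exp H) \<gamma>s Ts \<and>
        (counterclockwise \<gamma>s \<or> clockwise \<gamma>s) \<and>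
        (\<forall>i<length H.
           let x = H ! i; T = Ts ! i in
           elementary S f T \<and>
           order_set S f T = seg_set S x \<and>
           seg_from x = ord_along S f (\<gamma>s ! i) \<and>
           seg_to x = ord_along S f (\<gamma>s ! (Suc i mod length H)) \<and>
           (\<forall>\<gamma>. arc_germ S \<gamma> \<and> arc_in \<gamma> T \<longrightarrow>
                relative_width S f T \<gamma> = slice_width x (ord_along S f \<gamma>)) \<and>
           (\<exists>\<epsilon>>0. \<forall>p \<in> interior T \<inter> ball 0 \<epsilon>. sgn (f p) = of_int (slice_sign x))))"

definition cyclic_preserving :: "nat \<Rightarrow> (nat \<Rightarrow> nat) \<Rightarrow> bool" where
  "cyclic_preserving k j \<longleftrightarrow> (\<forall>i<k. j (Suc i mod k) = Suc (j i) mod k)"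

definition cyclic_reversing :: "nat \<Rightarrow> (nat \<Rightarrow> nat) \<Rightarrow> bool" where
  "cyclic_reversing k j \<longleftrightarrow> (\<forall>i<k. j i = Suc (j (Suc i mod k)) mod k)"

definition combinatorially_equivalent ::
    "(nat \<Rightarrow> real list set set) \<Rightarrow> slice list \<Rightarrow> slice list \<Rightarrow> bool" where
  "combinatorially_equivalent S H H' \<longleftrightarrow>
     length H = length H' \<and>
     (\<exists>j. bij_betw j {..<length H} {..<length H'} \<and>
        (\<forall>i<length H. slice_exp (H' ! j i) = slice_exp (H ! i)) \<and>
        ((\<forall>i<length H. slice_sign (H' ! j i) = slice_sign (H ! i)) \<or>
         (\<forall>i<length H. slice_sign (H' ! j i) = - slice_sign (H ! i))) \<and>
        (cyclic_preserving (length H) j \<and>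
           (\<forall>i<length H. seg_from (H' ! j i) = seg_from (H ! i) \<and> seg_to (H' ! j i) = seg_to (H ! i)) \<or>
         cyclic_reversing (length H) j \<and>
           (\<forall>i<length H. seg_from (H' ! j i) = seg_to (H ! i) \<and> seg_to (H' ! j i) = seg_from (H ! i))) \<and>
        (\<forall>i<length H. \<forall>q \<in> seg_set S (H ! i). slice_width (H' ! j i) q = slice_width (H ! i) q))"

text \<open>\<open>merge1 S x y z\<close> and \<open>merge2 x y z\<close>: the consecutive entries \<open>x\<close>, \<open>y\<close> may be replaced by \<open>z\<close>.\<close>

definition merge1 :: "(nat \<Rightarrow> real list set set) \<Rightarrow> slice \<Rightarrow> slice \<Rightarrow> slice \<Rightarrow> bool" where
  "merge1 S x y z \<longleftrightarrow>
     slice_sign x = slice_sign y \<and>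
     seg_to x = seg_from y \<and>
     (seg_from x < seg_to x \<and> seg_from y < seg_to y \<or>
      seg_from x > seg_to x \<and> seg_from y > seg_to y) \<and>
     (\<exists>\<mu>. affine_width S (seg_set S x \<union> seg_set S y) \<mu> \<and>
          (\<forall>q\<in>seg_set S x. slice_width x q = \<mu> q) \<and>
          (\<forall>q\<in>seg_set S y. slice_width y q = \<mu> q) \<and>
          z = Slice (min (slice_exp x) (slice_exp y)) (seg_from x) (seg_to y) (slice_sign x) \<mu>)"

definition merge2 :: "slice \<Rightarrow> slice \<Rightarrow> slice \<Rightarrow> bool" where
  "merge2 x y z \<longleftrightarrow>
     slice_sign x = slice_sign y \<and>
     seg_to x = seg_from y \<and>
     (seg_from x = seg_to x \<and> ereal (slice_exp x) \<ge> slice_width y (seg_from y) \<and> z = y \<or>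
      seg_from y = seg_to y \<and> ereal (slice_exp y) \<ge> slice_width x (seg_to x) \<and> z = x)"

text \<open>The list is rotated so that the two entries to be merged come first; this covers the pair
  consisting of the last and the first entry. A pizza with one entry has no two consecutive entries.\<close>

definition simplify_step ::
    "(nat \<Rightarrow> real list set set) \<Rightarrow> slice list \<Rightarrow> slice list \<Rightarrow> bool" where
  "simplify_step S H H' \<longleftrightarrow>
     (\<exists>n x y z zs. rotate n H = x # y # zs \<and> (merge1 S x y z \<or> merge2 x y z) \<and> H' = z # zs)"

definition simplified_pizza :: "(nat \<Rightarrow> real list set set) \<Rightarrow> slice list \<Rightarrow> bool" where
  "simplified_pizza S H \<longleftrightarrow> abstract_pizza S H \<and> \<not> (\<exists>H'. simplify_step S H H')"

definition minimal_pizza ::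
    "(nat \<Rightarrow> real list set set) \<Rightarrow> (real \<times> real \<Rightarrow> real) \<Rightarrow> slice list \<Rightarrow> bool" where
  "minimal_pizza S f H \<longleftrightarrow>
     simplified_pizza S H \<and> (\<exists>H0. associated_pizza S f H0 \<and> (simplify_step S)\<^sup>*\<^sup>* H0 H)"

end

theory Submission
  imports Defs
begin

text \<open>Up to germs, a Hoelder triangle is the sector swept counterclockwise from one arc to another, and the
  arcs inside it are linearly ordered by position; the order of tangency of two arcs is the minimum of
  the orders of tangency of the gaps between them. The slice of a sector that is elementary for \<open>f\<close> is
  determined by the sector, and if the sector is cut along any arc inside it, the slices of the two
  halves merge back to the slice of the whole by one of the two operations. Hence all pizzas of \<open>f\<close> are
  simplifications of pizzas on a common refinement: insert the arcs of both and one fixed ray, and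
  compare the resulting cyclic lists of slices. It remains to see that the simplified form of a pizza
  does not depend on the order of the operations; since every operation shortens the list, local
  confluence is enough.\<close>

text \<open>Two obstacles shape the proof. Cutting a sector destroys the test triangles that cross
  the cut, so the width of an arc might grow. This can only concern arcs with the order of the cut
  arc; the others keep their widths, and continuity of the affine width function settles the
  remaining ones. The other obstacle is that a sector of opening near 2 pi has nearly coinciding
  sides, so distance no longer measures angle. Hoelder triangles are precisely the sectors whose
  opening stays bounded away from 2 pi, and on them chord and angle are comparable. O-minimality
  enters through one dichotomy: a definable condition on small t > 0 eventually holds or eventually
  fails. Angles need not be definable, so positions are compared through a half-angle parameter in
  which the points of a circle are rational functions. Polynomial boundedness makes the orders
  exist. The fixed ray turns cyclic lists into sorted linear ones. A pizza read clockwise is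
  replaced by its mirror image, which is where the order-reversing equivalences come from.\<close>

section \<open>Definability in o-minimal structures\<close>

text \<open>Points of nested product types are flattened to coordinate lists whose length depends
  only on the type. Definability can then be stated for predicates and functions on products of
  reals, although the structure itself is a family of sets of lists.\<close>

class real_tuple =
  fixes coords :: "'a \<Rightarrow> real list"
    and arity :: "'a itself \<Rightarrow> nat"
  assumes inj_coords: "inj coords"
    and range_coords: "range coords = {xs. length xs = arity TYPE('a)}"

instantiation real :: real_tuple
begin

definition coords_real :: "real \<Rightarrow> real list" where
  "coords_real x = [x]"

definition arity_real :: "real itself \<Rightarrow> nat" where
  "arity_real _ = 1"

instance
proof
  show "inj (coords :: real \<Rightarrow> real list)"
    by (auto simp: inj_def coords_real_def)
  show "range (coords :: real \<Rightarrow> real list) = {xs. length xs = arity TYPE(real)}"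
    by (auto simp: coords_real_def arity_real_def length_Suc_conv image_iff)
qed

end

instantiation prod :: (real_tuple, real_tuple) real_tuple
begin

definition coords_prod :: "'a \<times> 'b \<Rightarrow> real list" where
  "coords_prod z = coords (fst z) @ coords (snd z)"

definition arity_prod :: "('a \<times> 'b) itself \<Rightarrow> nat" where
  "arity_prod _ = arity TYPE('a) + arity TYPE('b)"

instance
proof
  have len: "length (coords (x::'c::real_tuple)) = arity TYPE('c)" for x
    using range_coords[where 'a='c] by auto
  show "inj (coords :: 'a \<times> 'b \<Rightarrow> real list)"
    by (auto simp: inj_def coords_prod_def len intro: injD[OF inj_coords])
  show "range (coords :: 'a \<times> 'b \<Rightarrow> real list) = {xs. length xs = arity TYPE('a \<times> 'b)}"
  proof (intro set_eqI iffI)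
    fix xs :: "real list" assume "xs \<in> {xs. length xs = arity TYPE('a \<times> 'b)}"
    then have l: "length xs = arity TYPE('a) + arity TYPE('b)" by (simp add: arity_prod_def)
    then have "take (arity TYPE('a)) xs \<in> range (coords :: 'a \<Rightarrow> _)"
      and "drop (arity TYPE('a)) xs \<in> range (coords :: 'b \<Rightarrow> _)"
      by (simp_all add: range_coords)
    then obtain x :: 'a and y :: 'b
      where "coords x = take (arity TYPE('a)) xs" "coords y = drop (arity TYPE('a)) xs"
      by (metis rangeE)
    then have "coords (x, y) = xs" by (simp add: coords_prod_def)
    then show "xs \<in> range (coords :: 'a \<times> 'b \<Rightarrow> _)" by (metis rangeI)
  qed (auto simp: coords_prod_def arity_prod_def len)
qed

end

lemma length_coords [simp]: "length (coords (x::'a::real_tuple)) = arity TYPE('a)"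
  using range_coords[where 'a='a] by auto

lemma coords_eq_iff [simp]: "coords x = coords y \<longleftrightarrow> x = y"
  using inj_coords by (auto simp: inj_def)

lemma obtain_coords:
  assumes "length xs = arity TYPE('a::real_tuple)"
  obtains x :: "'a::real_tuple" where "coords x = xs"
  using assms range_coords[where 'a='a] by (metis (mono_tags, lifting) mem_Collect_eq rangeE)

text \<open>Maps that permute, repeat or drop coordinates. \<open>S_reindex\<close> handles them
  directly, and substitution of general definable functions is built on them.\<close>

definition coord_map :: "('a::real_tuple \<Rightarrow> 'b::real_tuple) \<Rightarrow> bool" where
  "coord_map r \<longleftrightarrow> (\<exists>\<sigma>. set \<sigma> \<subseteq> {..<arity TYPE('a)} \<and> (\<forall>x. coords (r x) = map (\<lambda>i. coords x ! i) \<sigma>))"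

lemma coord_map_id: "coord_map (\<lambda>x::'a::real_tuple. x)"
  unfolding coord_map_def
  by (rule exI[of _ "[0..<arity TYPE('a)]"]) (auto, metis length_coords map_nth)

lemma coord_map_pair:
  assumes "coord_map r" "coord_map s"
  shows "coord_map (\<lambda>x. (r x, s x))"
proof -
  from assms obtain \<sigma> \<tau> where "set \<sigma> \<subseteq> {..<arity TYPE('a)}" "set \<tau> \<subseteq> {..<arity TYPE('a)}"
    "\<forall>x. coords (r x) = map (\<lambda>i. coords x ! i) \<sigma>" "\<forall>x. coords (s x) = map (\<lambda>i. coords x ! i) \<tau>"
    unfolding coord_map_def by blast
  then show ?thesis
    unfolding coord_map_def by (intro exI[of _ "\<sigma> @ \<tau>"]) (auto simp: coords_prod_def)
qed

lemma coord_map_fst: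
  fixes r :: "'a::real_tuple \<Rightarrow> 'b::real_tuple \<times> 'c::real_tuple"
  assumes "coord_map r"
  shows "coord_map (\<lambda>x. fst (r x))"
proof -
  from assms obtain \<sigma> where \<sigma>: "set \<sigma> \<subseteq> {..<arity TYPE('a)}"
    "\<And>x. coords (r x) = map (\<lambda>i. coords x ! i) \<sigma>"
    unfolding coord_map_def by blast
  have "coords (fst (r x)) = take (arity TYPE('b)) (coords (r x))" for x
    by (simp add: coords_prod_def)
  then show ?thesis
    unfolding coord_map_def using \<sigma>
    by (intro exI[of _ "take (arity TYPE('b)) \<sigma>"]) (auto simp: take_map dest: in_set_takeD)
qed

lemma coord_map_snd:
  fixes r :: "'a::real_tuple \<Rightarrow> 'b::real_tuple \<times> 'c::real_tuple"
  assumes "coord_map r"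
  shows "coord_map (\<lambda>x. snd (r x))"
proof -
  from assms obtain \<sigma> where \<sigma>: "set \<sigma> \<subseteq> {..<arity TYPE('a)}"
    "\<And>x. coords (r x) = map (\<lambda>i. coords x ! i) \<sigma>"
    unfolding coord_map_def by blast
  have "coords (snd (r x)) = drop (arity TYPE('b)) (coords (r x))" for x
    by (simp add: coords_prod_def)
  then show ?thesis
    unfolding coord_map_def using \<sigma>
    by (intro exI[of _ "drop (arity TYPE('b)) \<sigma>"]) (auto simp: drop_map dest: in_set_dropD)
qed

section \<open>Closure properties of the family of definable sets\<close>

locale o_minimal =
  fixes S :: "nat \<Rightarrow> real list set set"
  assumes o_min: "o_minimal_structure S"
begin

lemma
  shows S_length: "A \<in> S n \<Longrightarrow> xs \<in> A \<Longrightarrow> length xs = n"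
    and S_empty: "{} \<in> S n"
    and S_compl: "A \<in> S n \<Longrightarrow> {xs. length xs = n} - A \<in> S n"
    and S_Un: "A \<in> S n \<Longrightarrow> B \<in> S n \<Longrightarrow> A \<union> B \<in> S n"
proof -
  have *: "S n \<subseteq> Pow {xs. length xs = n}" "{} \<in> S n" "\<forall>A\<in>S n. {xs. length xs = n} - A \<in> S n"
    "\<forall>A\<in>S n. \<forall>B\<in>S n. A \<union> B \<in> S n"
    using conjunct1[OF o_min[unfolded o_minimal_structure_def]] by simp_all
  show "A \<in> S n \<Longrightarrow> xs \<in> A \<Longrightarrow> length xs = n" using *(1) by blast
  show "{} \<in> S n" by (rule *(2))
  show "A \<in> S n \<Longrightarrow> {xs. length xs = n} - A \<in> S n" using *(3) by blast
  show "A \<in> S n \<Longrightarrow> B \<in> S n \<Longrightarrow> A \<union> B \<in> S n" using *(4) by blast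
qed

lemma
  shows S_Cons: "A \<in> S n \<Longrightarrow> {x # xs | x xs. xs \<in> A} \<in> S (Suc n)"
    and S_snoc: "A \<in> S n \<Longrightarrow> {xs @ [x] | x xs. xs \<in> A} \<in> S (Suc n)"
    and S_diag: "i < n \<Longrightarrow> j < n \<Longrightarrow> {xs. length xs = n \<and> xs ! i = xs ! j} \<in> S n"
    and S_butlast: "A \<in> S (Suc n) \<Longrightarrow> butlast ` A \<in> S n"
    and S_add: "{[x, y, x + y] | x y. True} \<in> S 3"
    and S_mult: "{[x, y, x * y] | x y. True} \<in> S 3"
    and S_1: "S 1 = {(\<lambda>x. [x]) ` \<Union>J | J. finite J \<and> (\<forall>I\<in>J. is_interval I)}"
proof -
  note * = o_min[unfolded o_minimal_structure_def, THEN conjunct2]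
  show "A \<in> S n \<Longrightarrow> {x # xs | x xs. xs \<in> A} \<in> S (Suc n)"
    using *[THEN conjunct1] by blast
  show "A \<in> S n \<Longrightarrow> {xs @ [x] | x xs. xs \<in> A} \<in> S (Suc n)"
    using *[THEN conjunct1] by blast
  show "i < n \<Longrightarrow> j < n \<Longrightarrow> {xs. length xs = n \<and> xs ! i = xs ! j} \<in> S n"
    using *[THEN conjunct2, THEN conjunct1] by blast
  show "A \<in> S (Suc n) \<Longrightarrow> butlast ` A \<in> S n"
    using *[THEN conjunct2, THEN conjunct2, THEN conjunct1] by blast
  show "{[x, y, x + y] | x y. True} \<in> S 3"
    by (rule *[THEN conjunct2, THEN conjunct2, THEN conjunct2, THEN conjunct1])
  show "{[x, y, x * y] | x y. True} \<in> S 3"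
    by (rule *[THEN conjunct2, THEN conjunct2, THEN conjunct2, THEN conjunct2, THEN conjunct1])
  show "S 1 = {(\<lambda>x. [x]) ` \<Union>J | J. finite J \<and> (\<forall>I\<in>J. is_interval I)}"
    by (rule *[THEN conjunct2, THEN conjunct2, THEN conjunct2, THEN conjunct2, THEN conjunct2])
qed

lemma S_full: "{xs. length xs = n} \<in> S n"
  using S_compl[OF S_empty[of n]] by simp

lemma S_Int: assumes "A \<in> S n" "B \<in> S n" shows "A \<inter> B \<in> S n"
proof -
  let ?F = "{xs. length xs = n}"
  have "A \<inter> B = ?F - ((?F - A) \<union> (?F - B))"
    using S_length assms by blast
  then show ?thesis using assms by (metis S_compl S_Un)
qed

lemma S_Int_finite:
  fixes m :: nat
  assumes "\<And>j. j < m \<Longrightarrow> B j \<in> S n"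
  shows "{xs. length xs = n \<and> (\<forall>j<m. xs \<in> B j)} \<in> S n"
  using assms
proof (induction m)
  case 0 then show ?case by (simp add: S_full)
next
  case (Suc m)
  have "{xs. length xs = n \<and> (\<forall>j<Suc m. xs \<in> B j)} = {xs. length xs = n \<and> (\<forall>j<m. xs \<in> B j)} \<inter> B m"
    by (auto simp: less_Suc_eq)
  then show ?case using Suc by (simp add: S_Int)
qed

lemma S_prepend:
  fixes n :: nat
  assumes "A \<in> S m" shows "{xs @ ys | xs ys. length xs = n \<and> ys \<in> A} \<in> S (n + m)"
proof (induction n)
  case 0 then show ?case using assms by simp
next
  case (Suc n)
  have "{xs @ ys | xs ys. length xs = Suc n \<and> ys \<in> A}
      = {x # zs | x zs. zs \<in> {xs @ ys | xs ys. length xs = n \<and> ys \<in> A}}"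
    by (auto simp: length_Suc_conv) (metis append_Cons)+
  then show ?case using S_Cons[OF Suc] by simp
qed

lemma S_take:
  assumes "A \<in> S (n + m)" shows "take n ` A \<in> S n"
  using assms
proof (induction m arbitrary: A)
  case 0
  then have "take n ` A = A" using S_length by force
  then show ?case using 0 by simp
next
  case (Suc m)
  have "take n ` A = take n ` butlast ` A"
    using S_length[OF Suc.prems] by (force simp: image_image take_butlast intro!: image_cong)
  then show ?case using Suc.IH[OF S_butlast] Suc.prems by simp
qed

text \<open>The axioms contain no permutation of coordinates, so it is simulated: append
  \<open>length \<sigma>\<close> coordinates that range over \<open>A\<close>, equate each of them
  by a diagonal with the coordinate that \<open>\<sigma>\<close> selects, and project the appended
  ones away.\<close>

lemma S_reindex:
  assumes A: "A \<in> S (length \<sigma>)" and \<sigma>: "set \<sigma> \<subseteq> {..<n}"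
  shows "{xs. length xs = n \<and> map (\<lambda>i. xs ! i) \<sigma> \<in> A} \<in> S n"
proof -
  define m where "m = length \<sigma>"
  define B where "B = {xs @ ys | xs ys. length xs = n \<and> ys \<in> A}"
  define C where "C j = {zs :: real list. length zs = n + m \<and> zs ! (n + j) = zs ! (\<sigma> ! j)}" for j
  have "B \<in> S (n + m)" unfolding B_def m_def by (rule S_prepend[OF A])
  moreover have "C j \<in> S (n + m)" if "j < m" for j
    unfolding C_def
  proof (rule S_diag)
    have "\<sigma> ! j \<in> set \<sigma>" using that by (simp add: m_def)
    then show "\<sigma> ! j < n + m" using \<sigma> by auto
  qed (use that in auto)
  then have "{zs. length zs = n + m \<and> (\<forall>j<m. zs \<in> C j)} \<in> S (n + m)" by (rule S_Int_finite)
  ultimately have "take n ` (B \<inter> {zs. length zs = n + m \<and> (\<forall>j<m. zs \<in> C j)}) \<in> S n"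
    by (intro S_take[of _ n m] S_Int)
  also have "take n ` (B \<inter> {zs. length zs = n + m \<and> (\<forall>j<m. zs \<in> C j)})
      = {xs. length xs = n \<and> map (\<lambda>i. xs ! i) \<sigma> \<in> A}"
  proof (intro set_eqI iffI)
    fix us assume "us \<in> take n ` (B \<inter> {zs. length zs = n + m \<and> (\<forall>j<m. zs \<in> C j)})"
    then obtain ys where *: "length us = n" "ys \<in> A" "\<And>j. j < m \<Longrightarrow> us @ ys \<in> C j"
      unfolding B_def by auto
    have l: "length ys = m" using S_length[OF A] * by (simp add: m_def)
    have "map (\<lambda>i. us ! i) \<sigma> = ys"
    proof (rule nth_equalityI)
      fix j assume "j < length (map (\<lambda>i. us ! i) \<sigma>)"
      then have j: "j < m" by (simp add: m_def)
      then have "\<sigma> ! j < n" using \<sigma> nth_mem unfolding m_def by blast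
      then show "map (\<lambda>i. us ! i) \<sigma> ! j = ys ! j"
        using *(3)[OF j] j *(1) unfolding C_def by (simp add: nth_append m_def)
    qed (simp add: l m_def)
    then show "us \<in> {xs. length xs = n \<and> map (\<lambda>i. xs ! i) \<sigma> \<in> A}" using * by simp
  next
    fix us assume "us \<in> {xs. length xs = n \<and> map (\<lambda>i. xs ! i) \<sigma> \<in> A}"
    then have *: "length us = n" "map (\<lambda>i. us ! i) \<sigma> \<in> A" by auto
    let ?z = "us @ map (\<lambda>i. us ! i) \<sigma>"
    have "?z \<in> B" unfolding B_def using * by auto
    moreover have "?z \<in> C j" if "j < m" for j
    proof -
      have "\<sigma> ! j < n" using that \<sigma> nth_mem unfolding m_def by blast
      then show ?thesis using * that unfolding C_def by (simp add: nth_append m_def)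
    qed
    ultimately show "us \<in> take n ` (B \<inter> {zs. length zs = n + m \<and> (\<forall>j<m. zs \<in> C j)})"
      using * by (intro image_eqI[of _ _ ?z]) (auto simp: m_def)
  qed
  finally show ?thesis .
qed

section \<open>Definable predicates and functions, closed under first-order formulas\<close>

definition D :: "('a::real_tuple \<Rightarrow> bool) \<Rightarrow> bool" where
  "D P \<longleftrightarrow> coords ` {x. P x} \<in> S (arity TYPE('a))"

definition DF :: "('a::real_tuple \<Rightarrow> 'b::real_tuple) \<Rightarrow> bool" where
  "DF g \<longleftrightarrow> D (\<lambda>z. snd z = g (fst z))"

lemma D_not: "D P \<Longrightarrow> D (\<lambda>x. \<not> P x)"
proof -
  have "coords ` {x::'a. \<not> P x} = {xs. length xs = arity TYPE('a)} - coords ` {x. P x}"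
    by (auto intro: obtain_coords)
  then show "D P \<Longrightarrow> ?thesis" unfolding D_def by (simp add: S_compl)
qed

lemma D_disj: "D P \<Longrightarrow> D Q \<Longrightarrow> D (\<lambda>x. P x \<or> Q x)"
  unfolding D_def using S_Un by (fastforce simp: Collect_disj_eq image_Un)

lemma D_conj:
  assumes "D P" "D Q" shows "D (\<lambda>x. P x \<and> Q x)"
proof -
  have "D (\<lambda>x. \<not> (\<not> P x \<or> \<not> Q x))" by (intro D_not D_disj assms)
  then show ?thesis by simp
qed

lemma D_imp:
  assumes "D P" "D Q" shows "D (\<lambda>x. P x \<longrightarrow> Q x)"
proof -
  have "D (\<lambda>x. \<not> P x \<or> Q x)" by (intro D_not D_disj assms)
  then show ?thesis unfolding imp_conv_disj .
qed

lemma D_reindex: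
  fixes r :: "'a::real_tuple \<Rightarrow> 'b::real_tuple"
  assumes "D P" "coord_map r"
  shows "D (\<lambda>x. P (r x))"
proof -
  from assms obtain \<sigma> where \<sigma>: "set \<sigma> \<subseteq> {..<arity TYPE('a)}"
    "\<And>x. coords (r x) = map (\<lambda>i. coords x ! i) \<sigma>"
    unfolding coord_map_def by blast
  have l: "length \<sigma> = arity TYPE('b)"
    by (metis \<sigma>(2) length_coords length_map)
  have "{xs. length xs = arity TYPE('a) \<and> map (\<lambda>i. xs ! i) \<sigma> \<in> coords ` {x. P x}} \<in> S (arity TYPE('a))"
    using assms(1) \<sigma>(1) unfolding D_def l[symmetric] by (rule S_reindex)
  also have "{xs. length xs = arity TYPE('a) \<and> map (\<lambda>i. xs ! i) \<sigma> \<in> coords ` {x. P x}}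
      = coords ` {x. P (r x)}"
  proof (intro set_eqI iffI)
    fix xs assume *: "xs \<in> {xs. length xs = arity TYPE('a) \<and> map (\<lambda>i. xs ! i) \<sigma> \<in> coords ` {x. P x}}"
    then obtain x :: 'a where x: "xs = coords x" by (auto intro: obtain_coords)
    then show "xs \<in> coords ` {x. P (r x)}" using * \<sigma>(2)[of x, symmetric] by auto
  qed (auto simp: \<sigma>(2)[symmetric])
  finally show ?thesis unfolding D_def .
qed

lemma D_ex:
  fixes P :: "'a::real_tuple \<Rightarrow> 'b::real_tuple \<Rightarrow> bool"
  assumes "D (\<lambda>z. P (fst z) (snd z))"
  shows "D (\<lambda>x. \<exists>y. P x y)"
proof -
  have "take (arity TYPE('a)) ` coords ` {z. P (fst z) (snd z)} \<in> S (arity TYPE('a))"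
    using assms unfolding D_def arity_prod_def by (rule S_take)
  also have "take (arity TYPE('a)) ` coords ` {z. P (fst z) (snd z)} = coords ` {x. \<exists>y. P x y}"
    by (force simp: coords_prod_def image_iff)
  finally show ?thesis unfolding D_def .
qed

lemma D_all:
  fixes P :: "'a::real_tuple \<Rightarrow> 'b::real_tuple \<Rightarrow> bool"
  assumes "D (\<lambda>z. P (fst z) (snd z))"
  shows "D (\<lambda>x. \<forall>y. P x y)"
  using D_not[OF D_ex[OF D_not[OF assms]]] by simp

lemma D_diag: "D (\<lambda>z::'a::real_tuple \<times> 'a. fst z = snd z)"
proof -
  let ?k = "arity TYPE('a)"
  let ?C = "\<lambda>j. {xs::real list. length xs = ?k + ?k \<and> xs ! j = xs ! (?k + j)}"
  have "{xs. length xs = ?k + ?k \<and> (\<forall>j<?k. xs \<in> ?C j)} \<in> S (?k + ?k)"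
    by (intro S_Int_finite S_diag) auto
  also have "{xs. length xs = ?k + ?k \<and> (\<forall>j<?k. xs \<in> ?C j)} = coords ` {z::'a \<times> 'a. fst z = snd z}"
  proof (intro set_eqI iffI)
    fix xs assume *: "xs \<in> {xs. length xs = ?k + ?k \<and> (\<forall>j<?k. xs \<in> ?C j)}"
    then obtain z :: "'a \<times> 'a" where z: "coords z = xs"
      using obtain_coords[where 'a="'a \<times> 'a"] by (auto simp: arity_prod_def)
    have "coords (fst z) = coords (snd z)"
    proof (rule nth_equalityI)
      fix j assume "j < length (coords (fst z))"
      then show "coords (fst z) ! j = coords (snd z) ! j"
        using * unfolding z[symmetric] by (auto simp: coords_prod_def nth_append)
    qed simp
    then show "xs \<in> coords ` {z::'a \<times> 'a. fst z = snd z}" using z by auto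
  qed (auto simp: coords_prod_def nth_append)
  finally show ?thesis unfolding D_def arity_prod_def .
qed

lemma D_subst:
  assumes "D P" "DF g"
  shows "D (\<lambda>x. P (g x))"
proof -
  have "D (\<lambda>x. \<exists>y. y = g x \<and> P y)"
    using assms unfolding DF_def
    by (intro D_ex D_conj D_reindex[OF assms(1)] coord_map_snd coord_map_id)
  then show ?thesis by simp
qed

lemma DF_coord_map:
  fixes r :: "'a::real_tuple \<Rightarrow> 'b::real_tuple"
  assumes "coord_map r"
  shows "DF r"
proof -
  have "coord_map (\<lambda>z::'a \<times> 'b. r (fst z))"
  proof -
    obtain \<sigma> where \<sigma>: "set \<sigma> \<subseteq> {..<arity TYPE('a)}"
      "\<And>x. coords (r x) = map (\<lambda>i. coords x ! i) \<sigma>"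
      using assms unfolding coord_map_def by blast
    have "coords (r (fst z)) = map (\<lambda>i. coords z ! i) \<sigma>" for z :: "'a \<times> 'b"
      using \<sigma> by (auto simp: coords_prod_def nth_append)
    then show ?thesis
      unfolding coord_map_def using \<sigma>(1) by (intro exI[of _ \<sigma>]) (auto simp: arity_prod_def)
  qed
  then have "coord_map (\<lambda>z::'a \<times> 'b. (snd z, r (fst z)))"
    by (intro coord_map_pair coord_map_snd coord_map_id)
  from D_reindex[OF D_diag this] show ?thesis unfolding DF_def by simp
qed

lemma DF_id: "DF (\<lambda>x. x)"
  by (rule DF_coord_map[OF coord_map_id])

lemma DF_comp:
  fixes h :: "'a::real_tuple \<Rightarrow> 'c::real_tuple" and g :: "'c \<Rightarrow> 'b::real_tuple"
  assumes "DF g" "DF h"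
  shows "DF (\<lambda>x. g (h x))"
proof -
  have "D (\<lambda>z. \<exists>w. w = h (fst z) \<and> snd z = g w)"
  proof (intro D_ex D_conj)
    show "D (\<lambda>z::('a \<times> 'b) \<times> 'c. snd z = h (fst (fst z)))"
      using D_reindex[OF assms(2)[unfolded DF_def], of "\<lambda>z::('a \<times> 'b) \<times> 'c. (fst (fst z), snd z)"]
      by (simp add: coord_map_pair coord_map_fst coord_map_snd coord_map_id)
    show "D (\<lambda>z::('a \<times> 'b) \<times> 'c. snd (fst z) = g (snd z))"
      using D_reindex[OF assms(1)[unfolded DF_def], of "\<lambda>z::('a \<times> 'b) \<times> 'c. (snd z, snd (fst z))"]
      by (simp add: coord_map_pair coord_map_fst coord_map_snd coord_map_id)
  qed
  then show ?thesis unfolding DF_def by simp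
qed

lemma DF_fst: "DF r \<Longrightarrow> DF (\<lambda>x. fst (r x))"
  by (rule DF_comp[OF DF_coord_map[OF coord_map_fst[OF coord_map_id]]])

lemma DF_snd: "DF r \<Longrightarrow> DF (\<lambda>x. snd (r x))"
  by (rule DF_comp[OF DF_coord_map[OF coord_map_snd[OF coord_map_id]]])

lemma DF_Pair:
  fixes r :: "'a::real_tuple \<Rightarrow> 'b::real_tuple" and s :: "'a \<Rightarrow> 'c::real_tuple"
  assumes "DF r" "DF s"
  shows "DF (\<lambda>x. (r x, s x))"
proof -
  have "D (\<lambda>z::'a \<times> ('b \<times> 'c). fst (snd z) = r (fst z) \<and> snd (snd z) = s (fst z))"
    using D_reindex[OF assms(1)[unfolded DF_def], of "\<lambda>z::'a \<times> ('b \<times> 'c). (fst z, fst (snd z))"]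
      D_reindex[OF assms(2)[unfolded DF_def], of "\<lambda>z::'a \<times> ('b \<times> 'c). (fst z, snd (snd z))"]
    by (intro D_conj) (simp_all add: coord_map_pair coord_map_fst coord_map_snd coord_map_id)
  then show ?thesis unfolding DF_def by (simp add: prod_eq_iff)
qed

lemma D_eq: "DF f \<Longrightarrow> DF g \<Longrightarrow> D (\<lambda>x. f x = g x)"
  using D_subst[OF D_diag DF_Pair, of f g] by simp

lemma DF_const_real: "DF (\<lambda>x. c :: real)"
proof -
  have "(\<lambda>x. [x]) ` \<Union>{{c}} \<in> S 1" unfolding S_1 by (rule CollectI, rule exI[of _ "{{c}}"]) (simp add: is_interval_1)
  then have "D (\<lambda>x::real. x = c)" unfolding D_def by (simp add: arity_real_def coords_real_def)
  from D_subst[OF this DF_snd[OF DF_id]] show ?thesis unfolding DF_def .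
qed

lemma DF_const_pair: "DF (\<lambda>x. c :: real \<times> real)"
  using DF_Pair[OF DF_const_real[of "fst c"] DF_const_real[of "snd c"]] by simp

lemma DF_add:
  fixes f g :: "'a::real_tuple \<Rightarrow> real"
  assumes "DF f" "DF g" shows "DF (\<lambda>x. f x + g x)"
proof -
  have "coords ` {z::(real \<times> real) \<times> real. snd z = fst (fst z) + snd (fst z)} = {[x, y, x + y] | x y. True}"
    by (auto simp: coords_prod_def coords_real_def image_iff)
  then have "DF (\<lambda>z::real \<times> real. fst z + snd z)"
    using S_add unfolding DF_def D_def by (simp add: arity_prod_def arity_real_def numeral_3_eq_3)
  from DF_comp[OF this DF_Pair[OF assms]] show ?thesis by simp
qed

lemma DF_mult:
  fixes f g :: "'a::real_tuple \<Rightarrow> real"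
  assumes "DF f" "DF g" shows "DF (\<lambda>x. f x * g x)"
proof -
  have "coords ` {z::(real \<times> real) \<times> real. snd z = fst (fst z) * snd (fst z)} = {[x, y, x * y] | x y. True}"
    by (auto simp: coords_prod_def coords_real_def image_iff)
  then have "DF (\<lambda>z::real \<times> real. fst z * snd z)"
    using S_mult unfolding DF_def D_def by (simp add: arity_prod_def arity_real_def numeral_3_eq_3)
  from DF_comp[OF this DF_Pair[OF assms]] show ?thesis by simp
qed

lemma DF_uminus: "DF (f :: 'a::real_tuple \<Rightarrow> real) \<Longrightarrow> DF (\<lambda>x. - f x)"
  using DF_mult[OF DF_const_real[of "-1"], of f] by simp

lemma DF_diff: "DF (f :: 'a::real_tuple \<Rightarrow> real) \<Longrightarrow> DF g \<Longrightarrow> DF (\<lambda>x. f x - g x)"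
  using DF_add[OF _ DF_uminus, of f g] by simp

lemma D_less: "DF (f :: 'a::real_tuple \<Rightarrow> real) \<Longrightarrow> DF g \<Longrightarrow> D (\<lambda>x. f x < g x)"
proof -
  \<comment> \<open>The order is not among the primitive relations: a positive difference is a
    nonzero square.\<close>
  have *: "u < v \<longleftrightarrow> (\<exists>w. w \<noteq> 0 \<and> v = u + w * w)" for u v :: real
  proof
    assume "u < v"
    then show "\<exists>w. w \<noteq> 0 \<and> v = u + w * w" by (intro exI[of _ "sqrt (v - u)"]) simp
  next
    assume "\<exists>w. w \<noteq> 0 \<and> v = u + w * w"
    then show "u < v" using not_real_square_gt_zero by fastforce
  qed
  have "D (\<lambda>z::real \<times> real. fst z < snd z)"
    unfolding * by (intro D_ex D_conj D_not D_eq DF_add DF_mult DF_fst DF_snd DF_id DF_const_real)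
  from D_subst[OF this DF_Pair, of f g] show "DF f \<Longrightarrow> DF g \<Longrightarrow> ?thesis" by simp
qed

lemma D_le: "DF (f :: 'a::real_tuple \<Rightarrow> real) \<Longrightarrow> DF g \<Longrightarrow> D (\<lambda>x. f x \<le> g x)"
  using D_not[OF D_less[of g f]] by (simp add: not_less)

lemma D_const: "D (\<lambda>x. b)"
proof -
  have "D (\<lambda>x::'a. (0::real) = (if b then 0 else 1))" by (intro D_eq DF_const_real)
  then show ?thesis by (cases b) simp_all
qed

lemmas def_intros = D_not D_conj D_disj D_imp D_ex D_all D_eq D_less D_le D_const
  DF_id DF_fst DF_snd DF_Pair DF_add DF_mult DF_diff DF_uminus DF_const_real DF_const_pair

lemma DF_if:
  assumes "D P" "DF f" "DF g" shows "DF (\<lambda>x. if P x then f x else g x)"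
proof -
  have *: "y = (if P x then f x else g x) \<longleftrightarrow> (P x \<and> y = f x) \<or> (\<not> P x \<and> y = g x)" for x y
    by simp
  show ?thesis unfolding DF_def *
    by (intro def_intros D_subst[OF assms(1)] DF_comp[OF assms(2)] DF_comp[OF assms(3)])
qed

lemma DF_divide:
  fixes f g :: "'a::real_tuple \<Rightarrow> real"
  assumes "DF f" "DF g" shows "DF (\<lambda>x. f x / g x)"
proof -
  have *: "y = u / v \<longleftrightarrow> (v = 0 \<and> y = 0) \<or> (v \<noteq> 0 \<and> y * v = u)" for u v y :: real
    by (cases "v = 0") (auto simp: nonzero_eq_divide_eq)
  show ?thesis unfolding DF_def *
    by (intro def_intros DF_comp[OF assms(1)] DF_comp[OF assms(2)])
qed

lemma DF_abs: "DF (f :: 'a::real_tuple \<Rightarrow> real) \<Longrightarrow> DF (\<lambda>x. \<bar>f x\<bar>)"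
  unfolding abs_if by (intro def_intros DF_if)

lemma DF_norm:
  assumes "DF (f :: 'a::real_tuple \<Rightarrow> real \<times> real)" shows "DF (\<lambda>x. norm (f x))"
proof -
  have *: "y = norm p \<longleftrightarrow> 0 \<le> y \<and> y * y = fst p * fst p + snd p * snd p" for y :: real and p :: "real \<times> real"
    by (cases p) (auto simp: norm_Pair power2_eq_square[symmetric] real_sqrt_unique)
  have "D (\<lambda>z. snd z = norm (f (fst z)))"
    unfolding * by (intro def_intros DF_comp[OF assms])
  then show ?thesis unfolding DF_def .
qed

lemma DF_minus_pair: "DF (f :: 'a::real_tuple \<Rightarrow> real \<times> real) \<Longrightarrow> DF g \<Longrightarrow> DF (\<lambda>x. f x - g x)"
  unfolding minus_prod_def by (intro def_intros)

text \<open>The source of definable choices, since being a greatest lower bound is a first-order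
  condition. The value 0 in the degenerate cases makes the function total. It yields the generalised
  inverse in \<open>subpolynomial_bounded\<close> and the first crossing in
  \<open>intermediate_arc\<close>.\<close>

lemma DF_Inf:
  fixes P :: "'a::real_tuple \<Rightarrow> real \<Rightarrow> bool"
  assumes "D (\<lambda>z. P (fst z) (snd z))"
  shows "DF (\<lambda>x. if (\<exists>y. P x y) \<and> (\<exists>b. \<forall>y. P x y \<longrightarrow> b \<le> y) then Inf {y. P x y} else 0)"
    (is "DF ?I")
proof -
  let ?c = "\<lambda>x. (\<exists>y. P x y) \<and> (\<exists>b. \<forall>y. P x y \<longrightarrow> b \<le> y)"
  have *: "m = ?I x \<longleftrightarrow> (?c x \<and> (\<forall>y. P x y \<longrightarrow> m \<le> y) \<and> (\<forall>b. (\<forall>y. P x y \<longrightarrow> b \<le> y) \<longrightarrow> b \<le> m))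
      \<or> (\<not> ?c x \<and> m = 0)" for m x
  proof (cases "?c x")
    case True
    then have ne: "{y. P x y} \<noteq> {}" and bd: "bdd_below {y. P x y}" by (auto simp: bdd_below_def)
    have "m = Inf {y. P x y} \<longleftrightarrow> (\<forall>y. P x y \<longrightarrow> m \<le> y) \<and> (\<forall>b. (\<forall>y. P x y \<longrightarrow> b \<le> y) \<longrightarrow> b \<le> m)"
    proof
      assume "m = Inf {y. P x y}"
      then show "(\<forall>y. P x y \<longrightarrow> m \<le> y) \<and> (\<forall>b. (\<forall>y. P x y \<longrightarrow> b \<le> y) \<longrightarrow> b \<le> m)"
        using bd ne by (auto intro: cInf_lower cInf_greatest)
    next
      assume *: "(\<forall>y. P x y \<longrightarrow> m \<le> y) \<and> (\<forall>b. (\<forall>y. P x y \<longrightarrow> b \<le> y) \<longrightarrow> b \<le> m)"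
      show "m = Inf {y. P x y}"
      proof (rule antisym)
        show "m \<le> Inf {y. P x y}" using * ne by (intro cInf_greatest) auto
        have "\<forall>y. P x y \<longrightarrow> Inf {y. P x y} \<le> y" using bd by (auto intro: cInf_lower)
        then show "Inf {y. P x y} \<le> m" using * by blast
      qed
    qed
    with True show ?thesis by simp
  qed auto
  have PP: "D (\<lambda>z. P (h1 z) (h2 z))" if "DF h1" "DF h2" for h1 :: "'c::real_tuple \<Rightarrow> _" and h2
    using D_subst[OF assms DF_Pair[OF that]] by simp
  have "D (\<lambda>z. snd z = ?I (fst z))"
    unfolding * by (intro def_intros PP)
  then show ?thesis unfolding DF_def .
qed

subsection \<open>Definable sets and functions of one variable\<close>

lemma D_real_intervals:
  assumes "D (P :: real \<Rightarrow> bool)"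
  obtains J where "finite J" "\<forall>I\<in>J. is_interval I" "{x. P x} = \<Union>J"
proof -
  have "(\<lambda>x. [x]) ` {x. P x} \<in> S 1"
    using assms unfolding D_def by (simp add: arity_real_def coords_real_def[abs_def])
  then obtain J where J: "finite J" "\<forall>I\<in>J. is_interval I" "(\<lambda>x. [x]) ` {x. P x} = (\<lambda>x. [x]) ` \<Union>J"
    unfolding S_1 by blast
  have "inj (\<lambda>x::real. [x])" by (auto simp: inj_def)
  then have "{x. P x} = \<Union>J" using J(3) by (rule inj_image_eq_iff[THEN iffD1])
  with J that show ?thesis by blast
qed

text \<open>A single interval either contains all points just to the right of \<open>a\<close> or
  misses them all, and a definable set is a finite union of intervals. The later comparisons of
  germs rest on this dichotomy.\<close>

lemma eventually_right_cases:
  assumes "D (P :: real \<Rightarrow> bool)"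
  shows "eventually P (at_right a) \<or> eventually (\<lambda>x. \<not> P x) (at_right a)"
proof -
  obtain J where J: "finite J" "\<forall>I\<in>J. is_interval I" "{x. P x} = \<Union>J"
    using D_real_intervals[OF assms] .
  have I: "eventually (\<lambda>x. x \<in> I) (at_right a) \<or> eventually (\<lambda>x. x \<notin> I) (at_right a)"
    if "is_interval I" for I
  proof (cases "\<forall>d>a. \<exists>x\<in>I. a < x \<and> x < d")
    case True
    then obtain x where x: "x \<in> I" "a < x" by (meson gt_ex)
    have "y \<in> I" if "a < y" "y < x" for y
    proof -
      obtain z where "z \<in> I" "a < z" "z < y" using True \<open>a < y\<close> by blast
      then show ?thesis
        using \<open>is_interval I\<close> x that unfolding is_interval_1 by (meson less_imp_le)
    qed
    then show ?thesis using x by (auto simp: eventually_at_right_field)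
  qed (fastforce simp: eventually_at_right_field)
  show ?thesis
  proof (cases "\<exists>I\<in>J. eventually (\<lambda>x. x \<in> I) (at_right a)")
    case True
    then obtain I where "I \<in> J" "eventually (\<lambda>x. x \<in> I) (at_right a)" by blast
    then have "eventually P (at_right a)" using J(3) by (auto elim!: eventually_mono)
    then show ?thesis ..
  next
    case False
    then have "eventually (\<lambda>x. \<forall>I\<in>J. x \<notin> I) (at_right a)"
      using I J by (intro eventually_ball_finite) auto
    then have "eventually (\<lambda>x. \<not> P x) (at_right a)" using J(3) by (auto elim!: eventually_mono)
    then show ?thesis ..
  qed
qed

lemma eventually_left_cases:
  assumes "D (P :: real \<Rightarrow> bool)"
  shows "eventually P (at_left a) \<or> eventually (\<lambda>x. \<not> P x) (at_left a)"
proof -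
  have "D (\<lambda>x. P (- x))" by (intro D_subst[OF assms] def_intros)
  from eventually_right_cases[OF this, of "- a"] show ?thesis
    by (simp add: eventually_at_left_to_right at_left_minus eventually_filtermap)
qed

end

text \<open>The limit is the supremum of the levels that \<open>g\<close> eventually exceeds; by the
  dichotomy, every level above the supremum is eventually not exceeded.\<close>

lemma tendsto_ereal_if_cases:
  fixes g :: "'a \<Rightarrow> real"
  assumes "\<And>c. eventually (\<lambda>x. c < g x) F \<or> eventually (\<lambda>x. \<not> c < g x) F"
  obtains L where "((\<lambda>x. ereal (g x)) \<longlongrightarrow> L) F"
proof
  define L where "L = Sup (ereal ` {c. eventually (\<lambda>x. c < g x) F})"
  show "((\<lambda>x. ereal (g x)) \<longlongrightarrow> L) F"
  proof (rule order_tendstoI)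
    fix l assume "l < L"
    then obtain c where "l < ereal c" "eventually (\<lambda>x. c < g x) F"
      unfolding L_def less_Sup_iff by blast
    then show "eventually (\<lambda>x. l < ereal (g x)) F"
      by (auto elim!: eventually_mono intro: less_trans)
  next
    fix u assume "L < u"
    then obtain c where c: "L < ereal c" "ereal c < u" using ereal_dense2 by blast
    then have "\<not> eventually (\<lambda>x. c < g x) F"
      unfolding L_def by (metis (mono_tags, lifting) Sup_upper image_eqI leD mem_Collect_eq)
    then have "eventually (\<lambda>x. \<not> c < g x) F" using assms by blast
    then show "eventually (\<lambda>x. ereal (g x) < u) F"
    proof (rule eventually_mono)
      fix x assume "\<not> c < g x"
      then have "ereal (g x) \<le> ereal c" by simp
      then show "ereal (g x) < u" using c(2) by (rule le_less_trans)
    qed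
  qed
qed

context o_minimal
begin

lemma limit_right:
  assumes "DF (g :: real \<Rightarrow> real)"
  obtains L where "((\<lambda>x. ereal (g x)) \<longlongrightarrow> L) (at_right a)"
proof -
  have "eventually (\<lambda>x. c < g x) (at_right a) \<or> eventually (\<lambda>x. \<not> c < g x) (at_right a)" for c
    by (intro eventually_right_cases D_less DF_const_real assms)
  then show ?thesis using tendsto_ereal_if_cases that by blast
qed

lemma limit_left:
  assumes "DF (g :: real \<Rightarrow> real)"
  obtains L where "((\<lambda>x. ereal (g x)) \<longlongrightarrow> L) (at_left a)"
proof -
  have "eventually (\<lambda>x. c < g x) (at_left a) \<or> eventually (\<lambda>x. \<not> c < g x) (at_left a)" for c
    by (intro eventually_left_cases D_less DF_const_real assms)
  then show ?thesis using tendsto_ereal_if_cases that by blast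
qed

text \<open>A discontinuity is witnessed by a pair of rationals: a level strictly between the value and a
  one-sided limit, and a bound for the interval on which the function stays beyond that level. Each
  pair serves at most one point, so there are only countably many discontinuities.\<close>

lemma countable_discontinuities:
  assumes g: "DF (g :: real \<Rightarrow> real)"
  shows "countable {x. \<not> isCont g x}"
proof -
  \<comment> \<open>\<open>A1\<close> and \<open>A2\<close> witness a right-hand limit above or
    below the value, \<open>A3\<close> and \<open>A4\<close> a left-hand limit above or below
    it.\<close>
  define A1 where "A1 r s = {x. x < s \<and> g x < r \<and> (\<forall>y. x < y \<and> y < s \<longrightarrow> r < g y)}" for r s
  define A2 where "A2 r s = {x. x < s \<and> r < g x \<and> (\<forall>y. x < y \<and> y < s \<longrightarrow> g y < r)}" for r s
  define A3 where "A3 r s = {x. s < x \<and> g x < r \<and> (\<forall>y. s < y \<and> y < x \<longrightarrow> r < g y)}" for r s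
  define A4 where "A4 r s = {x. s < x \<and> r < g x \<and> (\<forall>y. s < y \<and> y < x \<longrightarrow> g y < r)}" for r s
  have cnt: "countable A" if "\<And>x y. x \<in> A \<Longrightarrow> y \<in> A \<Longrightarrow> \<not> x < y" for A :: "real set"
  proof -
    have "\<exists>x. A \<subseteq> {x}" using that by (metis (full_types) linorder_neqE singletonI subsetI)
    then show ?thesis by (metis countable_empty countable_insert countable_subset)
  qed
  have "countable (A1 r s)" for r s
    unfolding A1_def by (rule cnt) (use less_asym in blast)
  moreover have "countable (A2 r s)" for r s
    unfolding A2_def by (rule cnt) (use less_asym in blast)
  moreover have "countable (A3 r s)" for r s
    unfolding A3_def by (rule cnt) (use less_asym in blast)
  moreover have "countable (A4 r s)" for r s
    unfolding A4_def by (rule cnt) (use less_asym in blast)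
  ultimately have "countable (\<Union>r\<in>\<rat>. \<Union>s\<in>\<rat>. A1 r s \<union> A2 r s \<union> A3 r s \<union> A4 r s)"
    by (intro countable_UN countable_rat countable_Un) auto
  moreover have "{x. \<not> isCont g x} \<subseteq> (\<Union>r\<in>\<rat>. \<Union>s\<in>\<rat>. A1 r s \<union> A2 r s \<union> A3 r s \<union> A4 r s)"
  proof (rule subsetI, rule ccontr)
    fix x assume x: "x \<in> {x. \<not> isCont g x}"
      and "x \<notin> (\<Union>r\<in>\<rat>. \<Union>s\<in>\<rat>. A1 r s \<union> A2 r s \<union> A3 r s \<union> A4 r s)"
    then have nA: "x \<notin> A1 r s" "x \<notin> A2 r s" "x \<notin> A3 r s" "x \<notin> A4 r s" if "r \<in> \<rat>" "s \<in> \<rat>" for r s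
      using that by auto
    have rat: "\<exists>r\<in>\<rat>. a < ereal r \<and> ereal r < b" if "a < b" for a b :: ereal
    proof -
      from that obtain u where u: "a < ereal u" "ereal u < b" using ereal_dense2 by blast
      from u(2) obtain v where v: "ereal u < ereal v" "ereal v < b" using ereal_dense2 by blast
      then obtain r where "r \<in> \<rat>" "u < r" "r < v" using Rats_dense_in_real[of u v] by auto
      then show ?thesis using u v by (meson less_ereal.simps(1) less_trans)
    qed
    obtain L where L: "((\<lambda>x. ereal (g x)) \<longlongrightarrow> L) (at_right x)" using limit_right[OF g] .
    obtain M where M: "((\<lambda>x. ereal (g x)) \<longlongrightarrow> M) (at_left x)" using limit_left[OF g] .
    have "\<not> ereal (g x) < L"
    proof
      assume "ereal (g x) < L"
      then obtain r where r: "r \<in> \<rat>" "g x < r" "ereal r < L" using rat by force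
      from order_tendstoD(1)[OF L r(3)] obtain b where b: "x < b" "\<forall>y>x. y < b \<longrightarrow> r < g y"
        by (auto simp: eventually_at_right_field)
      obtain s where "s \<in> \<rat>" "x < s" "s < b" using Rats_dense_in_real[OF b(1)] by blast
      then have "x \<in> A1 r s" using b r by (auto simp: A1_def)
      then show False using nA(1)[OF r(1) \<open>s \<in> \<rat>\<close>] by simp
    qed
    moreover have "\<not> L < ereal (g x)"
    proof
      assume "L < ereal (g x)"
      then obtain r where r: "r \<in> \<rat>" "r < g x" "L < ereal r" using rat by force
      from order_tendstoD(2)[OF L r(3)] obtain b where b: "x < b" "\<forall>y>x. y < b \<longrightarrow> g y < r"
        by (auto simp: eventually_at_right_field)
      obtain s where "s \<in> \<rat>" "x < s" "s < b" using Rats_dense_in_real[OF b(1)] by blast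
      then have "x \<in> A2 r s" using b r by (auto simp: A2_def)
      then show False using nA(2)[OF r(1) \<open>s \<in> \<rat>\<close>] by simp
    qed
    moreover have "\<not> ereal (g x) < M"
    proof
      assume "ereal (g x) < M"
      then obtain r where r: "r \<in> \<rat>" "g x < r" "ereal r < M" using rat by force
      from order_tendstoD(1)[OF M r(3)] obtain b where b: "b < x" "\<forall>y>b. y < x \<longrightarrow> r < g y"
        by (auto simp: eventually_at_left_field)
      obtain s where "s \<in> \<rat>" "b < s" "s < x" using Rats_dense_in_real[OF b(1)] by blast
      then have "x \<in> A3 r s" using b r by (auto simp: A3_def)
      then show False using nA(3)[OF r(1) \<open>s \<in> \<rat>\<close>] by simp
    qed
    moreover have "\<not> M < ereal (g x)"
    proof
      assume "M < ereal (g x)"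
      then obtain r where r: "r \<in> \<rat>" "r < g x" "M < ereal r" using rat by force
      from order_tendstoD(2)[OF M r(3)] obtain b where b: "b < x" "\<forall>y>b. y < x \<longrightarrow> g y < r"
        by (auto simp: eventually_at_left_field)
      obtain s where "s \<in> \<rat>" "b < s" "s < x" using Rats_dense_in_real[OF b(1)] by blast
      then have "x \<in> A4 r s" using b r by (auto simp: A4_def)
      then show False using nA(4)[OF r(1) \<open>s \<in> \<rat>\<close>] by simp
    qed
    ultimately have "L = ereal (g x)" "M = ereal (g x)" by auto
    then have "(g \<longlongrightarrow> g x) (at x)"
      using L M by (intro filterlim_split_at) auto
    then show False using x by (simp add: isCont_def)
  qed
  ultimately show ?thesis by (rule countable_subset[rotated])
qed

text \<open>Continuity at a point is a first-order condition, so near \<open>a\<close> it holds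
  throughout or fails throughout; failure on a whole interval is excluded because the
  discontinuities are countable.\<close>

lemma eventually_isCont:
  assumes g: "DF (g :: real \<Rightarrow> real)"
  shows "eventually (isCont g) (at_right a)"
proof (rule ccontr)
  assume ncont: "\<not> ?thesis"
  have "D (\<lambda>x. \<forall>e. e > 0 \<longrightarrow> (\<exists>d. d > 0 \<and> (\<forall>y. \<bar>y - x\<bar> < d \<longrightarrow> \<bar>g y - g x\<bar> < e)))"
    by (intro def_intros DF_abs DF_comp[OF g])
  moreover have "isCont g = (\<lambda>x. \<forall>e. e > 0 \<longrightarrow> (\<exists>d. d > 0 \<and> (\<forall>y. \<bar>y - x\<bar> < d \<longrightarrow> \<bar>g y - g x\<bar> < e)))"
    by (auto simp: fun_eq_iff continuous_at_real_range)
  ultimately have "D (isCont g)" by simp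
  with ncont have "eventually (\<lambda>x. \<not> isCont g x) (at_right a)"
    using eventually_right_cases by blast
  then obtain b where b: "a < b" "\<forall>x>a. x < b \<longrightarrow> \<not> isCont g x"
    by (auto simp: eventually_at_right_field)
  then have "{a<..<b} \<subseteq> {x. \<not> isCont g x}" by auto
  then have "countable {a<..<b}" using countable_discontinuities[OF g] countable_subset by blast
  then show False using b(1) uncountable_open_interval by blast
qed

end

section \<open>Asymptotics in polynomially bounded structures\<close>

locale pb_o_minimal = o_minimal +
  assumes pb: "polynomially_bounded S"
begin

lemma pb_at_top:
  assumes "DF (g :: real \<Rightarrow> real)"
  shows "\<exists>N. eventually (\<lambda>x. \<bar>g x\<bar> \<le> x ^ N) at_top"
proof -
  have "coords ` {z. snd z = g (fst z)} = {[x, g x] | x. True}"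
    by (auto simp: coords_prod_def coords_real_def image_iff)
  then have "{[x, g x] | x. True} \<in> S 2"
    using assms unfolding DF_def D_def by (simp add: arity_prod_def arity_real_def numeral_2_eq_2)
  then show ?thesis using pb unfolding polynomially_bounded_def by blast
qed

lemma pb_at_0:
  assumes "DF (g :: real \<Rightarrow> real)"
  shows "\<exists>N::nat. eventually (\<lambda>t. \<bar>g t\<bar> \<le> t powr - real N) (at_right 0)"
proof -
  have "DF (\<lambda>x. g (1 / x))" by (intro DF_comp[OF assms] DF_divide def_intros)
  then obtain N where "eventually (\<lambda>x. \<bar>g (1 / x)\<bar> \<le> x ^ N) at_top" using pb_at_top by blast
  then have "eventually (\<lambda>x. \<bar>g (inverse x)\<bar> \<le> inverse x powr - real N) at_top"
    using eventually_gt_at_top[of 0]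
  proof eventually_elim
    case (elim x)
    then show ?case by (simp add: powr_minus powr_realpow inverse_eq_divide power_one_over powr_divide field_simps)
  qed
  then show ?thesis unfolding eventually_at_right_to_top by blast
qed

section \<open>Exponents of definable powers\<close>

abbreviation E :: "real set" where "E \<equiv> exponents S"

text \<open>The power function on positive arguments, extended by 0 because \<open>DF\<close> speaks
  of total functions.\<close>

definition pw :: "real \<Rightarrow> real \<Rightarrow> real" where
  "pw r x = (if 0 < x then x powr r else 0)"

lemma E_iff: "r \<in> E \<longleftrightarrow> DF (pw r)"
proof -
  have "coords ` {z. 0 < fst z \<and> snd z = fst z powr r} = {[x, x powr r] | x. 0 < x}"
    by (auto simp: coords_prod_def coords_real_def image_iff)
  then have *: "r \<in> E \<longleftrightarrow> D (\<lambda>z::real \<times> real. 0 < fst z \<and> snd z = fst z powr r)"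
    unfolding exponents_def D_def by (simp add: arity_prod_def arity_real_def numeral_2_eq_2)
  show ?thesis
  proof
    assume "r \<in> E"
    then have "D (\<lambda>z::real \<times> real. 0 < fst z \<and> snd z = fst z powr r)" using * by blast
    then have "D (\<lambda>z::real \<times> real. (0 < fst z \<and> snd z = fst z powr r) \<or> (\<not> 0 < fst z \<and> snd z = 0))"
      by (rule D_disj) (intro def_intros)
    moreover have "(\<lambda>z::real \<times> real. (0 < fst z \<and> snd z = fst z powr r) \<or> (\<not> 0 < fst z \<and> snd z = 0))
        = (\<lambda>z. snd z = pw r (fst z))" by (auto simp: pw_def fun_eq_iff)
    ultimately show "DF (pw r)" unfolding DF_def by simp
  next
    assume "DF (pw r)"
    then have "D (\<lambda>z::real \<times> real. snd z = pw r (fst z))" unfolding DF_def .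
    then have "D (\<lambda>z::real \<times> real. 0 < fst z \<and> snd z = pw r (fst z))"
      by (rule D_conj[rotated]) (intro def_intros)
    moreover have "(\<lambda>z::real \<times> real. 0 < fst z \<and> snd z = pw r (fst z))
        = (\<lambda>z. 0 < fst z \<and> snd z = fst z powr r)" by (auto simp: pw_def fun_eq_iff)
    ultimately show "r \<in> E" using * by simp
  qed
qed

lemma DF_pw: "r \<in> E \<Longrightarrow> DF h \<Longrightarrow> DF (\<lambda>x. pw r (h x))"
  unfolding E_iff by (rule DF_comp)

lemma E_0: "0 \<in> E"
proof -
  have "pw 0 = (\<lambda>x. if 0 < x then 1 else 0)" by (auto simp: pw_def fun_eq_iff)
  then show ?thesis unfolding E_iff by (simp only:) (intro DF_if def_intros)
qed

lemma E_1: "1 \<in> E"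
proof -
  have "pw 1 = (\<lambda>x. if 0 < x then x else 0)" by (auto simp: pw_def fun_eq_iff)
  then show ?thesis unfolding E_iff by (simp only:) (intro DF_if def_intros)
qed

lemma E_add: assumes "r \<in> E" "s \<in> E" shows "r + s \<in> E"
proof -
  have "pw (r + s) = (\<lambda>x. pw r x * pw s x)" by (auto simp: pw_def fun_eq_iff powr_add)
  then show ?thesis using assms unfolding E_iff by (simp only:) (intro DF_mult)
qed

lemma E_uminus: assumes "r \<in> E" shows "- r \<in> E"
proof -
  have "pw (- r) = (\<lambda>x. 1 / pw r x)" by (auto simp: pw_def fun_eq_iff powr_minus divide_inverse)
  then show ?thesis using assms unfolding E_iff by (simp only:) (intro DF_divide def_intros)
qed

lemma E_diff: "r \<in> E \<Longrightarrow> s \<in> E \<Longrightarrow> r - s \<in> E"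
  using E_add[OF _ E_uminus, of r s] by simp

lemma DF_power: "DF (f :: 'a::real_tuple \<Rightarrow> real) \<Longrightarrow> DF (\<lambda>x. f x ^ n)"
proof (induction n)
  case 0 show ?case using DF_const_real[of 1] by simp
next
  case (Suc n) then show ?case using DF_mult[OF Suc.prems Suc.IH] by simp
qed

lemma E_divide: assumes "r \<in> E" "0 < n" shows "r / real n \<in> E"
proof -
  have *: "y = pw (r / real n) x \<longleftrightarrow> (0 < x \<and> 0 < y \<and> y ^ n = pw r x) \<or> (\<not> 0 < x \<and> y = 0)" for x y
  proof (cases "0 < x")
    case True
    have "(x powr (r / real n)) ^ n = x powr r"
      using assms(2) True by (simp add: powr_realpow[symmetric] powr_powr)
    then show ?thesis
      using True assms(2) power_eq_iff_eq_base[of n y "x powr (r / real n)"] by (auto simp: pw_def)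
  qed (auto simp: pw_def)
  show ?thesis unfolding E_iff DF_def *
    by (intro def_intros DF_pw assms DF_power)
qed

text \<open>The exponents are thereby dense in the reals. A definable germ can be compared with a
  power once the exponent is known to lie in \<open>E\<close>, so this supplies the comparison
  functions.\<close>

lemma Rats_subset_E: "\<rat> \<subseteq> E"
proof
  fix q :: real assume "q \<in> \<rat>"
  then obtain m :: int and n :: int where q: "q = of_int m / of_int n" "n > 0"
    by (metis Rats_cases')
  have nat: "real k \<in> E" for k by (induction k) (auto simp: E_0 intro: E_add[OF E_1, simplified])
  have "of_int m \<in> E"
    by (cases m rule: int_cases2) (auto simp: nat intro: E_uminus)
  then have "of_int m / real (nat n) \<in> E" by (intro E_divide) (use q in auto)
  then show "q \<in> E" using q by simp
qed

section \<open>Growth exponents and asymptotics by a power\<close>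

lemma eventually_le_powr_cases:
  assumes "DF (g :: real \<Rightarrow> real)" "p \<in> E"
  shows "eventually (\<lambda>t. g t \<le> t powr p) (at_right 0) \<or> eventually (\<lambda>t. t powr p < g t) (at_right 0)"
proof -
  have "D (\<lambda>t. g t \<le> pw p t)" by (intro def_intros assms DF_pw)
  from eventually_right_cases[OF this, of 0] show ?thesis
    by (auto simp: eventually_at_right_field pw_def not_le)
qed

lemma eventually_at_right_less: "0 < b \<Longrightarrow> eventually (\<lambda>t::real. t < b) (at_right 0)"
  by (auto simp: eventually_at_right_field)

lemma eventually_at_right_pos: "eventually (\<lambda>t::real. 0 < t) (at_right 0)"
  by (auto simp: eventually_at_right_field intro: gt_ex)

text \<open>The supremum is taken over rational \<open>p\<close> only, since these lie in
  \<open>E\<close> and the comparison with t^p is then decided. Polynomial bounds for g and for 1 /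
  g make the set nonempty and bounded above; monotonicity of powers passes from rational to
  arbitrary \<open>p\<close>.\<close>

lemma growth_exponent:
  assumes g: "DF (g :: real \<Rightarrow> real)" and pos: "eventually (\<lambda>t. 0 < g t) (at_right 0)"
  obtains r where "\<And>p. p < r \<Longrightarrow> eventually (\<lambda>t. g t \<le> t powr p) (at_right 0)"
    and "\<And>p. r < p \<Longrightarrow> eventually (\<lambda>t. t powr p \<le> g t) (at_right 0)"
proof
  define A where "A = {p \<in> \<rat>. eventually (\<lambda>t. g t \<le> t powr p) (at_right 0)}"
  obtain N where "eventually (\<lambda>t. \<bar>g t\<bar> \<le> t powr - real N) (at_right 0)" using pb_at_0[OF g] by blast
  then have "eventually (\<lambda>t. g t \<le> t powr - real N) (at_right 0)" by (auto elim!: eventually_mono)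
  then have "- real N \<in> A" unfolding A_def by simp
  obtain M where M: "eventually (\<lambda>t. \<bar>1 / g t\<bar> \<le> t powr - real M) (at_right 0)"
    using pb_at_0[OF DF_divide[OF DF_const_real g]] by blast
  have bd: "p \<le> real M" if "p \<in> A" for p
  proof (rule ccontr)
    assume "\<not> p \<le> real M"
    moreover have "eventually (\<lambda>t. g t \<le> t powr p) (at_right 0)" using that unfolding A_def by simp
    then have "eventually (\<lambda>t::real. False) (at_right 0)"
      using M pos eventually_at_right_less[OF zero_less_one] eventually_at_right_pos
    proof eventually_elim
      case (elim t)
      have "1 \<le> t powr - real M * g t" using elim by (simp add: divide_le_eq)
      also have "\<dots> \<le> t powr - real M * t powr p" using elim by (intro mult_left_mono) auto
      also have "\<dots> = t powr (p - real M)" by (simp add: powr_add[symmetric])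
      also have "\<dots> < 1" using elim \<open>\<not> p \<le> real M\<close> powr_less_mono'[of t 0 "p - real M"] by simp
      finally show ?case by simp
    qed
    then show False by simp
  qed
  then have bdd: "bdd_above A" by (auto simp: bdd_above_def)
  fix p
  show "eventually (\<lambda>t. g t \<le> t powr p) (at_right 0)" if pA: "p < Sup A"
  proof -
    obtain p' where p': "p' \<in> A" "p < p'" using less_cSupD[OF _ pA] \<open>- real N \<in> A\<close> by auto
    have "eventually (\<lambda>t. g t \<le> t powr p') (at_right 0)" using p' unfolding A_def by simp
    then show ?thesis
      using eventually_at_right_less[OF zero_less_one] eventually_at_right_pos
    proof eventually_elim
      case (elim t)
      then have "t powr p' \<le> t powr p" using p'(2) by (intro powr_mono') auto
      then show ?case using elim by simp
    qed
  qed
  show "eventually (\<lambda>t. t powr p \<le> g t) (at_right 0)" if Ap: "Sup A < p"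
  proof -
    obtain p' where p': "p' \<in> \<rat>" "Sup A < p'" "p' < p" using Rats_dense_in_real[OF Ap] by blast
    then have "p' \<notin> A" using cSup_upper[OF _ bdd, of p'] by auto
    then have "\<not> eventually (\<lambda>t. g t \<le> t powr p') (at_right 0)" using p'(1) unfolding A_def by simp
    then have "eventually (\<lambda>t. t powr p' < g t) (at_right 0)"
      using eventually_le_powr_cases[OF g] Rats_subset_E p'(1) by blast
    then show ?thesis
      using eventually_at_right_less[OF zero_less_one] eventually_at_right_pos
    proof eventually_elim
      case (elim t)
      then have "t powr p \<le> t powr p'" using p'(3) by (intro powr_mono') auto
      then show ?case using elim by simp
    qed
  qed
qed

text \<open>Otherwise g (s t) \<le> l g t near 0, and iteration along t = s^n c gives the geometric
  decay g (s^n c) \<le> a^n g c with a = s^p and p > r. This contradicts the lower bound t^p' for an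
  exponent p' strictly between r and p.\<close>

lemma scaling_lower_bound:
  assumes g: "DF (g :: real \<Rightarrow> real)" and pos: "eventually (\<lambda>t. 0 < g t) (at_right 0)"
    and low: "\<And>p. r < p \<Longrightarrow> eventually (\<lambda>t. t powr p \<le> g t) (at_right 0)"
    and s: "0 < s" "s < 1" and l: "l < s powr r"
  shows "eventually (\<lambda>t. l < g (s * t) / g t) (at_right 0)"
proof (rule ccontr)
  assume n: "\<not> ?thesis"
  have "D (\<lambda>t. l < g (s * t) / g t)" by (intro def_intros DF_divide DF_comp[OF g])
  then have le: "eventually (\<lambda>t. g (s * t) / g t \<le> l) (at_right 0)"
    using n eventually_right_cases by (force simp: not_less)
  \<comment> \<open>\<open>l\<close> may be zero or negative. Raising it to at least s^(r + 1),
    which is still below s^r, gives a positive number of the form s^p.\<close>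
  define a where "a = max l (s powr (r + 1))"
  have a: "0 < a" "a < s powr r" using s l by (auto simp: a_def powr_add less_max_iff_disj)
  define p where "p = ln a / ln s"
  have "s powr p = a" using s a unfolding p_def powr_def by simp
  have "s powr p < s powr r" using a by (simp add: \<open>s powr p = a\<close>)
  then have "r < p" using s by (metis less_imp_le not_le powr_mono')
  then obtain p' where p': "r < p'" "p' < p" using dense by blast
  have "eventually (\<lambda>t. g (s * t) / g t \<le> l \<and> 0 < g t \<and> t powr p' \<le> g t) (at_right 0)"
    using le pos low[OF p'(1)] by eventually_elim auto
  then obtain b where b: "0 < b" and B: "\<And>t. 0 < t \<Longrightarrow> t < b \<Longrightarrow> g (s * t) / g t \<le> l \<and> 0 < g t \<and> t powr p' \<le> g t"
    by (auto simp: eventually_at_right_field)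
  define c where "c = b / 2"
  have c: "0 < c" "c < b" using b by (auto simp: c_def)
  have sc: "0 < s ^ n * c \<and> s ^ n * c < b" for n
  proof -
    have "s ^ n * c \<le> 1 * c" using s c by (intro mult_right_mono power_le_one) auto
    then have "s ^ n * c < b" using c by linarith
    then show ?thesis using s c by simp
  qed
  have it: "g (s ^ n * c) \<le> a ^ n * g c" for n
  proof (induction n)
    case (Suc n)
    have "g (s * (s ^ n * c)) \<le> l * g (s ^ n * c)"
      using B[of "s ^ n * c"] sc[of n] by (simp add: divide_le_eq)
    also have "\<dots> \<le> a * g (s ^ n * c)" using B[of "s ^ n * c"] sc[of n] by (intro mult_right_mono) (auto simp: a_def)
    also have "\<dots> \<le> a * (a ^ n * g c)" using Suc a by (intro mult_left_mono) auto
    finally show ?case by (simp add: mult.assoc)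
  qed simp
  have "c powr p' / g c \<le> (s powr (p - p')) ^ n" for n
  proof -
    have "s powr (p' * n) * c powr p' = (s ^ n * c) powr p'"
      using s c by (simp add: powr_mult powr_realpow[symmetric] powr_powr mult.commute)
    also have "\<dots> \<le> a ^ n * g c" using it[of n] B[of "s ^ n * c"] sc[of n] by linarith
    also have "a ^ n = s powr (p * n)"
      using s by (simp add: \<open>s powr p = a\<close>[symmetric] powr_powr[symmetric] powr_realpow)
    finally have "s powr (p' * n) * c powr p' \<le> s powr (p * n) * g c" .
    then have "c powr p' / g c \<le> s powr (p * n) / s powr (p' * n)"
      using B[of c] c s by (simp add: field_simps)
    also have "\<dots> = (s powr (p - p')) ^ n"
      using s by (simp add: powr_diff[symmetric] powr_realpow[symmetric] powr_powr left_diff_distrib)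
    finally show ?thesis .
  qed
  moreover have "(\<lambda>n. (s powr (p - p')) ^ n) \<longlonglongrightarrow> 0"
    using s p' by (intro LIMSEQ_power_zero) (use powr_less_mono'[of s 0 "p - p'"] in simp)
  ultimately have "c powr p' / g c \<le> 0" by (intro LIMSEQ_le_const) auto
  moreover have "0 < c powr p' / g c" using B[of c] c by simp
  ultimately show False by simp
qed

text \<open>The upper bound is the lower bound for 1 / g, whose growth exponent is - r.\<close>

lemma scaling_limit:
  assumes g: "DF (g :: real \<Rightarrow> real)" and pos: "eventually (\<lambda>t. 0 < g t) (at_right 0)"
    and up: "\<And>p. p < r \<Longrightarrow> eventually (\<lambda>t. g t \<le> t powr p) (at_right 0)"
    and low: "\<And>p. r < p \<Longrightarrow> eventually (\<lambda>t. t powr p \<le> g t) (at_right 0)"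
    and s: "0 < s" "s < 1"
  shows "((\<lambda>t. g (s * t) / g t) \<longlongrightarrow> s powr r) (at_right 0)"
proof (rule order_tendstoI)
  fix l assume "l < s powr r"
  then show "eventually (\<lambda>t. l < g (s * t) / g t) (at_right 0)"
    using scaling_lower_bound[OF g pos low s] by blast
next
  fix u assume u: "s powr r < u"
  have u0: "0 < u" using u s powr_gt_zero[of s r] by linarith
  have "eventually (\<lambda>t. 1 / u < (1 / g (s * t)) / (1 / g t)) (at_right 0)"
  proof (rule scaling_lower_bound[where r = "- r"])
    show "DF (\<lambda>t. 1 / g t)" by (intro DF_divide def_intros g)
    show "eventually (\<lambda>t. 0 < 1 / g t) (at_right 0)" using pos by (auto elim!: eventually_mono)
    show "1 / u < s powr - r" using u u0 s by (simp add: powr_minus field_simps)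
    fix p assume "- r < p"
    then have "eventually (\<lambda>t. g t \<le> t powr - p) (at_right 0)" using up by simp
    then show "eventually (\<lambda>t. t powr p \<le> 1 / g t) (at_right 0)"
      using pos eventually_at_right_pos
      by eventually_elim (simp add: powr_minus field_simps)
  qed (use s in auto)
  moreover have "eventually (\<lambda>t. 0 < g (s * t)) (at_right 0)"
  proof -
    obtain b where "0 < b" "\<And>t. 0 < t \<Longrightarrow> t < b \<Longrightarrow> 0 < g t"
      using pos by (auto simp: eventually_at_right_field)
    moreover have "s * t < b" if "0 < t" "t < b" for t
      using mult_strict_right_mono[OF s(2) that(1)] that(2) by simp
    ultimately show ?thesis using s unfolding eventually_at_right_field by (intro exI[of _ b]) auto
  qed
  ultimately show "eventually (\<lambda>t. g (s * t) / g t < u) (at_right 0)"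
    using pos by eventually_elim (use u0 in \<open>simp add: field_simps\<close>)
qed

text \<open>For 0 < s < 1 the value s^r is the limit of g (s t) / g t as t tends to 0, and such a
  limit is definable by quantifiers. Arguments above 1 are reached by reciprocals.\<close>

lemma growth_exponent_in_E:
  assumes g: "DF (g :: real \<Rightarrow> real)" and pos: "eventually (\<lambda>t. 0 < g t) (at_right 0)"
    and up: "\<And>p. p < r \<Longrightarrow> eventually (\<lambda>t. g t \<le> t powr p) (at_right 0)"
    and low: "\<And>p. r < p \<Longrightarrow> eventually (\<lambda>t. t powr p \<le> g t) (at_right 0)"
  shows "r \<in> E"
proof -
  define L where "L s y \<longleftrightarrow> (\<forall>e. e > 0 \<longrightarrow> (\<exists>d. 0 < d \<and> (\<forall>t. 0 < t \<and> t < d \<longrightarrow> \<bar>g (s * t) / g t - y\<bar> < e)))" for s y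
  have L: "L s y \<longleftrightarrow> y = s powr r" if "0 < s" "s < 1" for s y
  proof -
    have "L s y \<longleftrightarrow> ((\<lambda>t. g (s * t) / g t) \<longlongrightarrow> y) (at_right 0)"
      unfolding L_def tendsto_iff dist_real_def eventually_at_right_field by (simp add: imp_conjL)
    also have "\<dots> \<longleftrightarrow> y = s powr r"
      using scaling_limit[OF g pos up low that] tendsto_unique[OF trivial_limit_at_right_real] by blast
    finally show ?thesis .
  qed
  have LD: "D (\<lambda>z. L (h1 z) (h2 z))" if "DF h1" "DF h2" for h1 h2 :: "'c::real_tuple \<Rightarrow> real"
    unfolding L_def by (intro def_intros DF_abs DF_divide DF_comp[OF g] DF_comp[OF that(1)] DF_comp[OF that(2)])
  have *: "y = pw r x \<longleftrightarrow> (x \<le> 0 \<and> y = 0) \<or> (x = 1 \<and> y = 1) \<or> (0 < x \<and> x < 1 \<and> L x y)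
      \<or> (1 < x \<and> y \<noteq> 0 \<and> L (1 / x) (1 / y))" for x y
  proof -
    consider "x \<le> 0" | "x = 1" | "0 < x" "x < 1" | "1 < x" by linarith
    then show ?thesis
    proof cases
      case 4
      have "y = x powr r \<longleftrightarrow> y \<noteq> 0 \<and> 1 / y = (1 / x) powr r"
        using 4 by (auto simp: powr_divide divide_simps)
      then show ?thesis using 4 L[of "1 / x" "1 / y"] by (auto simp: pw_def)
    qed (auto simp: pw_def L)
  qed
  show ?thesis unfolding E_iff DF_def *
    by (intro def_intros LD DF_divide)
qed

text \<open>If \<open>h\<close> grew to infinity more slowly than every power, a generalised inverse of \<open>h\<close> would decay
  faster than every power.\<close>

lemma subpolynomial_bounded:
  assumes h: "DF (h :: real \<Rightarrow> real)"
    and up: "\<And>p. p > 0 \<Longrightarrow> eventually (\<lambda>t. h t \<le> t powr - p) (at_right 0)"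
  shows "\<not> filterlim h at_top (at_right 0)"
proof
  assume top: "filterlim h at_top (at_right 0)"
  let ?P = "\<lambda>y t. 0 < t \<and> h t \<le> y"
  \<comment> \<open>\<open>m y\<close> is the generalised inverse: the infimum of the positive
    points at which \<open>h\<close> is at most \<open>y\<close>.\<close>
  define m where "m y = (if (\<exists>t. ?P y t) \<and> (\<exists>b. \<forall>t. ?P y t \<longrightarrow> b \<le> t) then Inf {t. ?P y t} else 0)" for y
  have "D (\<lambda>z::real \<times> real. ?P (fst z) (snd z))" by (intro def_intros DF_comp[OF h])
  from DF_Inf[OF this] have "DF m" unfolding m_def .
  then have "DF (\<lambda>y. 1 / m y)" by (intro DF_divide def_intros)
  then obtain N where N: "eventually (\<lambda>y. \<bar>1 / m y\<bar> \<le> y ^ N) at_top" using pb_at_top by blast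
  \<comment> \<open>With this power the point t = 1 / y^(N + 1) satisfies h t \<le> y. Hence m y
    \<le> 1 / y^(N + 1), against the bound 1 / m y \<le> y^N for large y.\<close>
  have "eventually (\<lambda>t. h t \<le> t powr - (1 / real (Suc N))) (at_right 0)" by (rule up) simp
  then obtain d where d: "0 < d" "\<And>t. 0 < t \<Longrightarrow> t < d \<Longrightarrow> h t \<le> t powr - (1 / real (Suc N))"
    by (auto simp: eventually_at_right_field)
  have "eventually (\<lambda>y. 1 / y ^ Suc N < d) at_top"
  proof -
    have "((\<lambda>y::real. 1 / y ^ Suc N) \<longlongrightarrow> 0) at_top" by (rule tendsto_divide_0[OF tendsto_const], rule filterlim_at_top_imp_at_infinity, rule filterlim_pow_at_top) (auto intro: filterlim_ident)
    from order_tendstoD(2)[OF this d(1)] show ?thesis .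
  qed
  then have "eventually (\<lambda>y::real. False) at_top"
    using N eventually_gt_at_top[of 1]
  proof eventually_elim
    case (elim y)
    define t where "t = 1 / y ^ Suc N"
    have t: "0 < t" "t < d" using elim by (auto simp: t_def)
    have "h t \<le> t powr - (1 / real (Suc N))" using d t by blast
    also have "t powr - (1 / real (Suc N)) = y"
    proof -
      have "t = y powr - real (Suc N)"
        using elim unfolding t_def by (subst powr_minus, subst powr_realpow) (auto simp: divide_inverse)
      then show ?thesis using elim by (simp add: powr_powr del: of_nat_Suc)
    qed
    finally have Pt: "?P y t" using t(1) by simp
    obtain e where e: "0 < e" "\<And>t. 0 < t \<Longrightarrow> t < e \<Longrightarrow> y < h t"
      using top unfolding filterlim_at_top_dense by (auto simp: eventually_at_right_field)
    have lb: "e \<le> t" if "?P y t" for t using e(2)[of t] that by force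
    then have my: "m y = Inf {t. ?P y t}" using Pt unfolding m_def by auto
    have "e \<le> m y" unfolding my using lb Pt by (intro cInf_greatest) auto
    moreover have "m y \<le> t"
      unfolding my by (rule cInf_lower) (use Pt lb in \<open>auto simp: bdd_below_def\<close>)
    ultimately have "1 / t \<le> 1 / m y" using e(1) by (intro divide_left_mono) (auto intro: mult_pos_pos t)
    moreover have "1 / t = y ^ Suc N" unfolding t_def by simp
    ultimately have "y ^ Suc N \<le> y ^ N" using elim(2) by linarith
    moreover have "y ^ N < y ^ Suc N" using elim by (intro power_strict_increasing) auto
    ultimately show ?case by simp
  qed
  then show False by simp
qed

text \<open>Miller's asymptotics: \<open>r\<close> is the growth exponent, and \<open>g t / t\<^sup>r\<close> can tend neither to
  infinity nor to zero.\<close>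

lemma asymptotic_pos:
  assumes g: "DF (g :: real \<Rightarrow> real)" and pos: "eventually (\<lambda>t. 0 < g t) (at_right 0)"
  obtains r c where "r \<in> E" "c > 0" "((\<lambda>t. g t / t powr r) \<longlongrightarrow> c) (at_right 0)"
proof -
  obtain r where up: "\<And>p. p < r \<Longrightarrow> eventually (\<lambda>t. g t \<le> t powr p) (at_right 0)"
    and low: "\<And>p. r < p \<Longrightarrow> eventually (\<lambda>t. t powr p \<le> g t) (at_right 0)"
    using growth_exponent[OF g pos] by blast
  have r: "r \<in> E" by (rule growth_exponent_in_E[OF g pos up low])
  define h where "h t = g t / pw r t" for t
  have hDF: "DF h" unfolding h_def by (intro DF_divide DF_pw def_intros g r)
  have hpos: "eventually (\<lambda>t. 0 < h t) (at_right 0)"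
    using pos eventually_at_right_pos by eventually_elim (simp add: h_def pw_def)
  obtain L where L: "((\<lambda>t. ereal (h t)) \<longlongrightarrow> L) (at_right 0)" using limit_right[OF hDF] .
  have "L \<noteq> \<infinity>"
  proof
    assume "L = \<infinity>"
    then have "filterlim h at_top (at_right 0)" using L by (simp add: tendsto_PInfty_eq_at_top)
    moreover have "eventually (\<lambda>t. h t \<le> t powr - p) (at_right 0)" if "0 < p" for p
    proof -
      have "eventually (\<lambda>t. g t \<le> t powr (r - p)) (at_right 0)" using that by (intro up) simp
      then show ?thesis
        using eventually_at_right_pos
        by eventually_elim (simp add: h_def pw_def powr_diff powr_minus field_simps)
    qed
    ultimately show False using subpolynomial_bounded[OF hDF] by blast
  qed
  moreover have "L \<noteq> 0"
  proof
    assume "L = 0"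
    then have "(h \<longlongrightarrow> 0) (at_right 0)" using L by (simp add: zero_ereal_def)
    then have "filterlim h (at_right 0) (at_right 0)"
      using hpos by (auto simp: filterlim_at elim!: eventually_mono)
    then have "filterlim (\<lambda>t. inverse (h t)) at_top (at_right 0)"
      by (rule filterlim_compose[OF filterlim_inverse_at_top_right])
    moreover have "eventually (\<lambda>t. inverse (h t) \<le> t powr - p) (at_right 0)" if "0 < p" for p
    proof -
      have "eventually (\<lambda>t. t powr (r + p) \<le> g t) (at_right 0)" using that by (intro low) simp
      then show ?thesis
        using eventually_at_right_pos pos
        by eventually_elim (simp add: h_def pw_def powr_add powr_minus field_simps)
    qed
    moreover have "DF (\<lambda>t. inverse (h t))" unfolding inverse_eq_divide by (intro DF_divide def_intros hDF)
    ultimately show False using subpolynomial_bounded by blast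
  qed
  moreover have "0 \<le> L"
    by (rule tendsto_lowerbound[OF L]) (use hpos in \<open>auto elim!: eventually_mono\<close>)
  ultimately obtain c where c: "L = ereal c" "c > 0" by (cases L) auto
  then have "(h \<longlongrightarrow> c) (at_right 0)" using L by simp
  then have "((\<lambda>t. g t / t powr r) \<longlongrightarrow> c) (at_right 0)"
  proof (rule Lim_transform_eventually)
    show "eventually (\<lambda>t. h t = g t / t powr r) (at_right 0)"
      using eventually_at_right_pos by eventually_elim (simp add: h_def pw_def)
  qed
  with r c that show ?thesis by blast
qed

lemma asymptotic:
  assumes g: "DF (g :: real \<Rightarrow> real)" and nz: "\<not> eventually (\<lambda>t. g t = 0) (at_right 0)"
  obtains r c where "r \<in> E" "c \<noteq> 0" "((\<lambda>t. g t / t powr r) \<longlongrightarrow> c) (at_right 0)"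
proof -
  have "D (\<lambda>t. 0 < g t)" "D (\<lambda>t. g t < 0)" by (intro def_intros g)+
  note cases = this[THEN eventually_right_cases, of 0]
  have "eventually (\<lambda>t. 0 < g t) (at_right 0) \<or> eventually (\<lambda>t. g t < 0) (at_right 0)"
  proof (rule ccontr)
    assume "\<not> ?thesis"
    then have "eventually (\<lambda>t. \<not> 0 < g t) (at_right 0)" "eventually (\<lambda>t. \<not> g t < 0) (at_right 0)"
      using cases by blast+
    then have "eventually (\<lambda>t. g t = 0) (at_right 0)" by eventually_elim simp
    then show False using nz by blast
  qed
  then show ?thesis
  proof
    assume "eventually (\<lambda>t. 0 < g t) (at_right 0)"
    from asymptotic_pos[OF g this] show ?thesis using that by (metis less_irrefl)
  next
    assume "eventually (\<lambda>t. g t < 0) (at_right 0)"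
    then have "eventually (\<lambda>t. 0 < - g t) (at_right 0)" by simp
    from asymptotic_pos[OF DF_uminus[OF g] this] obtain r c
      where rc: "r \<in> E" "c > 0" "((\<lambda>t. - g t / t powr r) \<longlongrightarrow> c) (at_right 0)" .
    from tendsto_minus[OF rc(3)] have "((\<lambda>t. g t / t powr r) \<longlongrightarrow> - c) (at_right 0)" by simp
    then show ?thesis using that[of r "- c"] rc by simp
  qed
qed

end

section \<open>Angles and sectors in the plane\<close>

definition cx :: "real \<times> real \<Rightarrow> complex" where
  "cx p = Complex (fst p) (snd p)"

definition rot :: "real \<times> real \<Rightarrow> real \<Rightarrow> real \<times> real" where
  "rot p \<theta> = (fst p * cos \<theta> - snd p * sin \<theta>, fst p * sin \<theta> + snd p * cos \<theta>)"

text \<open>The counterclockwise angle from \<open>p\<close> to \<open>q\<close> in [0, 2 pi). The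
  base point is variable because arcs are ordered by position as seen from a side of the sector at
  hand.\<close>

definition ang :: "real \<times> real \<Rightarrow> real \<times> real \<Rightarrow> real" where
  "ang p q = Arg2pi (cx q / cx p)"

lemma cx_eq_iff [simp]: "cx p = cx q \<longleftrightarrow> p = q"
  by (auto simp: cx_def prod_eq_iff)

lemma cx_eq_0_iff [simp]: "cx p = 0 \<longleftrightarrow> p = 0"
  by (auto simp: cx_def prod_eq_iff complex_eq_iff)

lemma cmod_cx [simp]: "cmod (cx p) = norm p"
  by (cases p) (simp add: cx_def cmod_def norm_Pair)

lemma cx_diff: "cx (p - q) = cx p - cx q"
  by (simp add: cx_def complex_eq_iff)

lemma cx_rot: "cx (rot p \<theta>) = cx p * cis \<theta>"
  by (simp add: cx_def rot_def complex_eq_iff)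

lemma continuous_on_cx [continuous_intros]:
  "continuous_on A f \<Longrightarrow> continuous_on A (\<lambda>x. cx (f x))"
  unfolding cx_def Complex_eq by (intro continuous_intros)

lemma continuous_on_rot [continuous_intros]:
  fixes f :: "'a::t2_space \<Rightarrow> real \<times> real"
  shows
  "continuous_on A f \<Longrightarrow> continuous_on A g \<Longrightarrow> continuous_on A (\<lambda>x. rot (f x) (g x))"
  unfolding rot_def by (intro continuous_intros)

lemma norm_rot [simp]: "norm (rot p \<theta>) = norm p"
  using cmod_cx[of "rot p \<theta>"] by (simp add: cx_rot norm_mult)

lemma rot_0 [simp]: "rot p 0 = p"
  by (simp add: rot_def)

lemma rot_2pi [simp]: "rot p (\<theta> + 2 * pi) = rot p \<theta>"
  by (simp add: rot_def)

lemma rot_rot: "rot (rot p a) b = rot p (a + b)"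
proof -
  have "cx (rot (rot p a) b) = cx (rot p (a + b))" by (simp add: cx_rot cis_mult)
  then show ?thesis by simp
qed

lemma norm_rot_diff: "norm (rot p a - rot p b) = 2 * norm p * \<bar>sin ((a - b) / 2)\<bar>"
proof -
  have "norm (rot p a - rot p b) = norm p * cmod (cis a - cis b)"
    by (simp add: cmod_cx[symmetric] cx_diff cx_rot right_diff_distrib[symmetric] norm_mult del: cmod_cx)
  moreover have "cmod (cis a - cis b) = 2 * \<bar>sin ((a - b) / 2)\<bar>"
  proof -
    have "cis a - cis b = 2 * \<i> * sin ((a - b) / 2) * cis ((a + b) / 2)"
      by (simp add: complex_eq_iff cos_diff_cos sin_diff_sin)
        (simp add: minus_divide_left[symmetric] diff_divide_distrib add_divide_distrib sin_diff algebra_simps)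
    then show ?thesis by (simp add: norm_mult)
  qed
  ultimately show ?thesis by simp
qed

lemma ang_bounds: "0 \<le> ang p q" "ang p q < 2 * pi"
  by (simp_all add: ang_def Arg2pi_ge_0 Arg2pi_lt_2pi)

lemma ang_rot: "p \<noteq> 0 \<Longrightarrow> 0 \<le> \<theta> \<Longrightarrow> \<theta> < 2 * pi \<Longrightarrow> ang p (rot p \<theta>) = \<theta>"
  unfolding ang_def cx_rot by (rule Arg2pi_unique[of 1]) (auto simp: cis_conv_exp)

lemma ang_self [simp]: "p \<noteq> 0 \<Longrightarrow> ang p p = 0"
  using ang_rot[of p 0] by simp

lemma rot_ang:
  assumes "norm q = norm p" "p \<noteq> 0" shows "rot p (ang p q) = q"
proof -
  have "cmod (cx q / cx p) = 1" using assms by (simp add: norm_divide)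
  then have "cx q / cx p = cis (ang p q)"
    using Arg2pi_eq[of "cx q / cx p"] by (simp add: ang_def cis_conv_exp)
  then have "cx (rot p (ang p q)) = cx q" using assms by (simp add: cx_rot field_simps)
  then show ?thesis by simp
qed

lemma ang_inj:
  "norm q = norm p \<Longrightarrow> norm r = norm p \<Longrightarrow> p \<noteq> 0 \<Longrightarrow> ang p q = ang p r \<longleftrightarrow> q = r"
  using rot_ang by metis

lemma ang_eq_0_iff: "norm q = norm p \<Longrightarrow> p \<noteq> 0 \<Longrightarrow> ang p q = 0 \<longleftrightarrow> q = p"
  using ang_inj[of q p p] by auto

lemma ang_shift:
  assumes "norm q = norm p" "norm r = norm p" "p \<noteq> 0"
  shows "ang q r = (if ang p q \<le> ang p r then ang p r - ang p q else ang p r - ang p q + 2 * pi)"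
proof -
  have q: "q \<noteq> 0" using assms by auto
  have "r = rot q (ang p r - ang p q)"
    using rot_ang[OF assms(1,3)] rot_ang[OF assms(2,3)] rot_rot[of p "ang p q" "ang p r - ang p q"] by simp
  moreover from this have "r = rot q (ang p r - ang p q + 2 * pi)" by simp
  ultimately show ?thesis
    using ang_rot[OF q, of "ang p r - ang p q"] ang_rot[OF q, of "ang p r - ang p q + 2 * pi"]
      ang_bounds[of p q] ang_bounds[of p r]
    by (smt (verit, best))
qed

text \<open>The last hypothesis says that the turn from \<open>v\<close> to \<open>w\<close> does
  not pass \<open>p\<close>, so that on this sector the change of base point from \<open>p\<close>
  to \<open>v\<close> is a translation of angles.\<close>

lemma ang_between_iff:
  assumes "norm v = norm p" "norm w = norm p" "norm q = norm p" "p \<noteq> 0" "ang p v \<le> ang p w"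
  shows "ang v q \<le> ang v w \<longleftrightarrow> ang p v \<le> ang p q \<and> ang p q \<le> ang p w"
  using assms ang_shift[of v p q] ang_shift[of v p w] ang_bounds[of p q] ang_bounds[of p w] ang_bounds[of p v]
  by (auto split: if_splits)

lemma ang_swap:
  "norm q = norm p \<Longrightarrow> p \<noteq> 0 \<Longrightarrow> ang q p = (if q = p then 0 else 2 * pi - ang p q)"
  using ang_shift[of q p p] ang_eq_0_iff[of q p] ang_bounds[of p q] by (auto split: if_splits)

lemma norm_diff_ang:
  assumes "norm q = norm p" "norm r = norm p" "p \<noteq> 0"
  shows "norm (q - r) = 2 * norm p * \<bar>sin ((ang p q - ang p r) / 2)\<bar>"
  using norm_rot_diff[of p "ang p q" "ang p r"] rot_ang assms by simp

lemma norm_diff_le_ang: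
  assumes "norm q = norm p" "norm r = norm p" "p \<noteq> 0"
  shows "norm (q - r) \<le> norm p * \<bar>ang p q - ang p r\<bar>"
proof -
  have "\<bar>sin ((ang p q - ang p r) / 2)\<bar> \<le> \<bar>(ang p q - ang p r) / 2\<bar>" by (rule abs_sin_x_le_abs_x)
  then have "2 * norm p * \<bar>sin ((ang p q - ang p r) / 2)\<bar> \<le> 2 * norm p * \<bar>(ang p q - ang p r) / 2\<bar>"
    by (intro mult_left_mono) auto
  then show ?thesis by (simp add: norm_diff_ang[OF assms])
qed

text \<open>The chord is comparable to the angle as long as the angle stays \<open>c\<close> away
  from a full turn. Up to \<open>c\<close> this is concavity of sin on [0, pi]. Beyond
  \<open>c\<close>, sin (x / 2) is at least sin (c / 2), directly or by symmetry about pi / 2, and x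
  / (2 pi) is at most 1.\<close>

lemma sin_half_lower:
  assumes "0 < c" "c \<le> pi" "0 \<le> x" "x \<le> 2 * pi - c"
  shows "sin (c / 2) * x / (2 * pi) \<le> sin (x / 2)"
proof (cases "x \<le> c")
  case True
  have conc: "concave_on {0..pi} sin"
    by (rule f''_le0_imp_concave[where f' = cos and f'' = "\<lambda>x. - sin x"])
      (auto intro!: derivative_eq_intros sin_ge_zero)
  have "x / c * sin (c / 2) + (1 - x / c) * sin 0 \<le> sin ((1 - x / c) *\<^sub>R 0 + (x / c) *\<^sub>R (c / 2))"
    using concave_onD[OF conc, of "x / c" 0 "c / 2"] True assms by simp
  then have "x / c * sin (c / 2) \<le> sin (x / 2)" using assms by simp
  moreover have "sin (c / 2) * x / (2 * pi) \<le> x / c * sin (c / 2)"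
  proof -
    have "0 \<le> sin (c / 2) * x" using assms by (intro mult_nonneg_nonneg sin_ge_zero) auto
    then have "sin (c / 2) * x / (2 * pi) \<le> sin (c / 2) * x / c"
      using assms by (intro divide_left_mono) (auto intro!: mult_pos_pos)
    then show ?thesis by (simp add: mult.commute)
  qed
  ultimately show ?thesis by linarith
next
  case False
  have "sin (c / 2) \<le> sin (x / 2)"
  proof (cases "x \<le> pi")
    case True
    then show ?thesis using False assms by (intro sin_monotone_2pi_le) auto
  next
    case F: False
    have "sin (c / 2) \<le> sin (pi - x / 2)" using F assms by (intro sin_monotone_2pi_le) auto
    then show ?thesis by simp
  qed
  moreover have "sin (c / 2) * x / (2 * pi) \<le> sin (c / 2)"
  proof -
    have "sin (c / 2) * x \<le> sin (c / 2) * (2 * pi)"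
      using assms by (intro mult_left_mono sin_ge_zero) auto
    then show ?thesis by (simp add: divide_le_eq)
  qed
  ultimately show ?thesis by linarith
qed

section \<open>Sectors between two arcs and the components of their complement\<close>

definition sec :: "(real \<Rightarrow> real \<times> real) \<Rightarrow> (real \<Rightarrow> real \<times> real) \<Rightarrow> (real \<times> real) set" where
  "sec \<gamma> \<delta> = {p. p = 0 \<or> ang (\<gamma> (norm p)) p \<le> ang (\<gamma> (norm p)) (\<delta> (norm p))}"

definition open_sec :: "(real \<Rightarrow> real \<times> real) \<Rightarrow> (real \<Rightarrow> real \<times> real) \<Rightarrow> real \<Rightarrow> (real \<times> real) set" where
  "open_sec \<gamma> \<delta> \<epsilon> = {p \<in> ball 0 \<epsilon>. p \<noteq> 0 \<and> 0 < ang (\<gamma> (norm p)) p \<and>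
     ang (\<gamma> (norm p)) p < ang (\<gamma> (norm p)) (\<delta> (norm p))}"

text \<open>Representatives of two arcs together with one radius up to which all germ conditions
  already hold, so that the components of the ball without the arcs can be computed as sets.\<close>

locale two_arcs =
  fixes \<gamma> \<delta> :: "real \<Rightarrow> real \<times> real" and \<epsilon> :: real
  assumes eps: "0 < \<epsilon>"
    and cont: "continuous_on {0..<\<epsilon>} \<gamma>" "continuous_on {0..<\<epsilon>} \<delta>"
    and norms: "\<And>t. 0 \<le> t \<Longrightarrow> t < \<epsilon> \<Longrightarrow> norm (\<gamma> t) = t" "\<And>t. 0 \<le> t \<Longrightarrow> t < \<epsilon> \<Longrightarrow> norm (\<delta> t) = t"
    and disj: "\<And>t. 0 < t \<Longrightarrow> t < \<epsilon> \<Longrightarrow> \<gamma> t \<noteq> \<delta> t"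
begin

lemma swap: "two_arcs \<delta> \<gamma> \<epsilon>"
  using eps cont norms disj by unfold_locales metis+

lemma nz: "0 < t \<Longrightarrow> t < \<epsilon> \<Longrightarrow> \<gamma> t \<noteq> 0" "0 < t \<Longrightarrow> t < \<epsilon> \<Longrightarrow> \<delta> t \<noteq> 0"
  using norms[of t] by auto

lemma opening_pos:
  assumes "0 < t" "t < \<epsilon>" shows "0 < ang (\<gamma> t) (\<delta> t)"
  using ang_eq_0_iff[of "\<delta> t" "\<gamma> t"] norms[of t] disj[of t] nz[of t] ang_bounds(1)[of "\<gamma> t" "\<delta> t"] assms
  by (simp add: less_le)

text \<open>\<open>Arg2pi\<close> is continuous off the nonnegative real axis. As the norms agree,
  the quotient meets this axis only at 1, that is where \<open>g x = f x\<close>, which the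
  hypothesis excludes.\<close>

lemma continuous_on_ang:
  assumes "continuous_on A f" "continuous_on A g"
    and "\<And>x. x \<in> A \<Longrightarrow> f x \<noteq> 0 \<and> norm (g x) = norm (f x) \<and> g x \<noteq> f x"
  shows "continuous_on A (\<lambda>x. ang (f x) (g x))"
proof -
  have c1: "continuous_on A (\<lambda>x. cx (g x) / cx (f x))"
    using assms by (intro continuous_intros) auto
  have c2: "continuous_on (- nonneg_Reals) Arg2pi"
    by (intro continuous_at_imp_continuous_on ballI continuous_at_Arg2pi) auto
  have "cx (g x) / cx (f x) \<notin> \<real>\<^sub>\<ge>\<^sub>0" if "x \<in> A" for x
  proof
    assume *: "cx (g x) / cx (f x) \<in> \<real>\<^sub>\<ge>\<^sub>0"
    moreover have "cmod (cx (g x) / cx (f x)) = 1" using assms(3)[OF that] by (simp add: norm_divide)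
    ultimately have "cx (g x) / cx (f x) = 1"
      by (auto elim!: nonneg_Reals_cases)
    then show False using assms(3)[OF that] by (simp add: divide_eq_1_iff)
  qed
  then have "(\<lambda>x. cx (g x) / cx (f x)) ` A \<subseteq> - nonneg_Reals" by blast
  then show ?thesis
    unfolding ang_def by (rule continuous_on_compose2[OF c2 c1])
qed

lemma continuous_on_norm_comp:
  assumes "A \<subseteq> ball 0 \<epsilon>"
  shows "continuous_on A (\<lambda>p. \<gamma> (norm p))" "continuous_on A (\<lambda>p. \<delta> (norm p))"
  using assms by (auto intro!: continuous_on_compose2[OF cont(1)] continuous_on_compose2[OF cont(2)] continuous_intros)

lemma open_open_sec: "open (open_sec \<gamma> \<delta> \<epsilon>)"
proof -
  let ?B = "ball (0::real \<times> real) \<epsilon> - {0}"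
  define U where "U = ?B \<inter> (\<lambda>p. p - \<gamma> (norm p)) -` (- {0})"
  have "open U"
    unfolding U_def
    by (intro continuous_open_preimage continuous_intros continuous_on_norm_comp) (auto simp: open_Diff)
  have U: "p \<in> ball 0 \<epsilon>" "p \<noteq> 0" "p \<noteq> \<gamma> (norm p)" if "p \<in> U" for p using that by (auto simp: U_def)
  have UB: "norm p < \<epsilon> \<and> \<gamma> (norm p) \<noteq> 0 \<and> norm (\<gamma> (norm p)) = norm p \<and> norm (\<delta> (norm p)) = norm p
      \<and> \<delta> (norm p) \<noteq> \<gamma> (norm p) \<and> p \<noteq> \<gamma> (norm p)" if "p \<in> U" for p
    using U[OF that] norms[of "norm p"] disj[of "norm p"] nz[of "norm p"] by auto
  have "continuous_on U (\<lambda>p. ang (\<gamma> (norm p)) (\<delta> (norm p)) - ang (\<gamma> (norm p)) p)"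
    by (intro continuous_intros continuous_on_ang continuous_on_norm_comp)
      (use UB in \<open>auto dest!: UB\<close>)
  then have "open (U \<inter> (\<lambda>p. ang (\<gamma> (norm p)) (\<delta> (norm p)) - ang (\<gamma> (norm p)) p) -` {0<..})"
    using \<open>open U\<close> by (intro continuous_open_preimage) auto
  also have "\<dots> = open_sec \<gamma> \<delta> \<epsilon>"
  proof -
    have "0 < ang (\<gamma> (norm p)) p \<longleftrightarrow> p \<noteq> \<gamma> (norm p)" if "p \<in> ?B" for p
      using ang_eq_0_iff[of p "\<gamma> (norm p)"] that norms(1)[of "norm p"] nz(1)[of "norm p"]
        ang_bounds(1)[of "\<gamma> (norm p)" p] by (simp add: less_le)
    then show ?thesis by (auto simp: U_def open_sec_def)
  qed
  finally show ?thesis .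
qed

lemma rot_in_open_sec:
  assumes "0 < t" "t < \<epsilon>" "0 < s" "s < 1"
  shows "rot (\<gamma> t) (s * ang (\<gamma> t) (\<delta> t)) \<in> open_sec \<gamma> \<delta> \<epsilon>"
proof -
  have "s * ang (\<gamma> t) (\<delta> t) < 1 * ang (\<gamma> t) (\<delta> t)"
    using assms opening_pos by (intro mult_strict_right_mono) auto
  then have "ang (\<gamma> t) (rot (\<gamma> t) (s * ang (\<gamma> t) (\<delta> t))) = s * ang (\<gamma> t) (\<delta> t)"
  proof (intro ang_rot)
    show "s * ang (\<gamma> t) (\<delta> t) < 2 * pi"
      using \<open>s * _ < _\<close> ang_bounds(2)[of "\<gamma> t" "\<delta> t"] by linarith
  qed (use assms nz opening_pos[of t] in auto)
  then show ?thesis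
    using assms \<open>s * _ < _\<close> opening_pos[of t] norms(1)[of t] nz(1)[of t]
    by (auto simp: open_sec_def dest: arg_cong[of _ 0 norm])
qed

text \<open>The sector is the image of a rectangle under the two coordinates radius and fraction of
  the opening angle.\<close>

lemma connected_open_sec: "connected (open_sec \<gamma> \<delta> \<epsilon>)"
proof -
  let ?X = "{0<..<\<epsilon>} \<times> {0<..<1::real}"
  let ?F = "\<lambda>x. rot (\<gamma> (fst x)) (snd x * ang (\<gamma> (fst x)) (\<delta> (fst x)))"
  have c: "continuous_on ?X (\<lambda>x. \<gamma> (fst x))" "continuous_on ?X (\<lambda>x. \<delta> (fst x))"
    by (auto intro!: continuous_on_compose2[OF cont(1)] continuous_on_compose2[OF cont(2)] continuous_intros)
  have B: "\<gamma> (fst x) \<noteq> 0 \<and> norm (\<gamma> (fst x)) = norm (\<delta> (fst x)) \<and> \<delta> (fst x) \<noteq> \<gamma> (fst x)" if "x \<in> ?X" for x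
    using norms[of "fst x"] disj[of "fst x"] nz[of "fst x"] that by auto
  have "continuous_on ?X ?F"
    by (intro continuous_intros continuous_on_ang c) (use B in auto)
  moreover have "connected ?X"
    by (intro convex_connected convex_Times convex_real_interval)
  ultimately have "connected (?F ` ?X)" by (rule connected_continuous_image)
  also have "?F ` ?X = open_sec \<gamma> \<delta> \<epsilon>"
  proof (intro set_eqI iffI)
    fix p assume p: "p \<in> open_sec \<gamma> \<delta> \<epsilon>"
    define t where "t = norm p"
    have t: "0 < t" "t < \<epsilon>" using p by (auto simp: open_sec_def t_def)
    define s where "s = ang (\<gamma> t) p / ang (\<gamma> t) (\<delta> t)"
    have s: "0 < s" "s < 1" "s * ang (\<gamma> t) (\<delta> t) = ang (\<gamma> t) p"
      using p opening_pos[OF t] by (auto simp: s_def open_sec_def t_def)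
    have "p = ?F (t, s)" using rot_ang[of p "\<gamma> t"] s norms t nz by (simp add: t_def)
    then show "p \<in> ?F ` ?X" using t s by (intro image_eqI[of _ _ "(t, s)"]) auto
  qed (auto intro: rot_in_open_sec)
  finally show ?thesis .
qed

lemma open_sec_nonempty: "open_sec \<gamma> \<delta> \<epsilon> \<noteq> {}"
  using rot_in_open_sec[of "\<epsilon> / 2" "1 / 2"] eps by auto

lemma open_sec_swap: "open_sec \<delta> \<gamma> \<epsilon> = {p \<in> ball 0 \<epsilon>. p \<noteq> 0 \<and> ang (\<gamma> (norm p)) (\<delta> (norm p)) < ang (\<gamma> (norm p)) p}"
proof -
  have "0 < ang (\<delta> t) p \<and> ang (\<delta> t) p < ang (\<delta> t) (\<gamma> t) \<longleftrightarrow> ang (\<gamma> t) (\<delta> t) < ang (\<gamma> t) p"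
    if "norm p = t" "0 < t" "t < \<epsilon>" for p t
    using that ang_shift[of "\<delta> t" "\<gamma> t" p] ang_shift[of "\<delta> t" "\<gamma> t" "\<gamma> t"] norms[of t] nz[of t]
      opening_pos[of t] ang_bounds[of "\<gamma> t" p] ang_bounds[of "\<gamma> t" "\<delta> t"]
    by (auto split: if_splits)
  then show ?thesis unfolding open_sec_def by auto
qed

lemma sec_Int_ball: "sec \<gamma> \<delta> \<inter> ball 0 \<epsilon> = ball 0 \<epsilon> - open_sec \<delta> \<gamma> \<epsilon>"
  unfolding open_sec_swap sec_def by auto

lemma sec_Int_ball': "sec \<gamma> \<delta> \<inter> ball 0 \<epsilon> = open_sec \<gamma> \<delta> \<epsilon> \<union> (\<gamma> ` {0..<\<epsilon>} \<union> \<delta> ` {0..<\<epsilon>})"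
proof (intro set_eqI iffI)
  fix p assume p: "p \<in> sec \<gamma> \<delta> \<inter> ball 0 \<epsilon>"
  show "p \<in> open_sec \<gamma> \<delta> \<epsilon> \<union> (\<gamma> ` {0..<\<epsilon>} \<union> \<delta> ` {0..<\<epsilon>})"
  proof (cases "p = 0")
    case True
    then show ?thesis using norms(1)[of 0] eps by (auto intro!: image_eqI[of _ _ 0])
  next
    case False
    define t where "t = norm p"
    have t: "0 < t" "t < \<epsilon>" using p False by (auto simp: t_def)
    have le: "ang (\<gamma> t) p \<le> ang (\<gamma> t) (\<delta> t)" using p False by (auto simp: sec_def t_def)
    consider "ang (\<gamma> t) p = 0" | "ang (\<gamma> t) p = ang (\<gamma> t) (\<delta> t)"
      | "0 < ang (\<gamma> t) p" "ang (\<gamma> t) p < ang (\<gamma> t) (\<delta> t)"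
      using le ang_bounds(1)[of "\<gamma> t" p] by linarith
    then show ?thesis
    proof cases
      case 1
      then have "p = \<gamma> t" using ang_eq_0_iff[of p "\<gamma> t"] t norms nz by (simp add: t_def)
      then show ?thesis using t by auto
    next
      case 2
      then have "p = \<delta> t" using ang_inj[of p "\<gamma> t" "\<delta> t"] t norms nz by (simp add: t_def)
      then show ?thesis using t by auto
    next
      case 3
      then show ?thesis using False t by (auto simp: open_sec_def t_def)
    qed
  qed
next
  fix p assume p: "p \<in> open_sec \<gamma> \<delta> \<epsilon> \<union> (\<gamma> ` {0..<\<epsilon>} \<union> \<delta> ` {0..<\<epsilon>})"
  have "p \<in> sec \<gamma> \<delta> \<inter> ball 0 \<epsilon>" if "p = \<gamma> t" "0 \<le> t" "t < \<epsilon>" for t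
    using that norms[of t] nz[of t] by (cases "t = 0") (auto simp: sec_def ang_bounds)
  moreover have "p \<in> sec \<gamma> \<delta> \<inter> ball 0 \<epsilon>" if "p = \<delta> t" "0 \<le> t" "t < \<epsilon>" for t
    using that norms[of t] by (auto simp: sec_def)
  moreover have "p \<in> sec \<gamma> \<delta> \<inter> ball 0 \<epsilon>" if "p \<in> open_sec \<gamma> \<delta> \<epsilon>"
    using that by (auto simp: sec_def open_sec_def)
  ultimately show "p \<in> sec \<gamma> \<delta> \<inter> ball 0 \<epsilon>" using p by auto
qed

text \<open>The opposite open sector keeps the closure away. Conversely, points of the two arcs are
  limits along a circle, where the fraction of the opening tends to 0 or to 1, and the origin is the
  limit of an arc.\<close>

lemma closure_open_sec: "closure (open_sec \<gamma> \<delta> \<epsilon>) \<inter> ball 0 \<epsilon> = sec \<gamma> \<delta> \<inter> ball 0 \<epsilon>"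
proof
  have "open_sec \<delta> \<gamma> \<epsilon> \<inter> closure (open_sec \<gamma> \<delta> \<epsilon>) = {}"
    using two_arcs.open_open_sec[OF swap] open_Int_closure_eq_empty[of "open_sec \<delta> \<gamma> \<epsilon>" "open_sec \<gamma> \<delta> \<epsilon>"]
    by (auto simp: open_sec_swap) (auto simp: open_sec_def)
  then show "closure (open_sec \<gamma> \<delta> \<epsilon>) \<inter> ball 0 \<epsilon> \<subseteq> sec \<gamma> \<delta> \<inter> ball 0 \<epsilon>"
    unfolding sec_Int_ball by auto
next
  have lim: "\<gamma> t \<in> closure (open_sec \<gamma> \<delta> \<epsilon>) \<and> \<delta> t \<in> closure (open_sec \<gamma> \<delta> \<epsilon>)" if t: "0 < t" "t < \<epsilon>" for t
  proof
    let ?F = "\<lambda>s. rot (\<gamma> t) (s * ang (\<gamma> t) (\<delta> t))"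
    have c: "continuous_on UNIV ?F" by (intro continuous_intros)
    have "eventually (\<lambda>s. ?F s \<in> closure (open_sec \<gamma> \<delta> \<epsilon>)) (at_right 0)"
      unfolding eventually_at_right_field
      using rot_in_open_sec[OF t] closure_subset by (intro exI[of _ 1]) auto
    moreover have "(?F \<longlongrightarrow> ?F 0) (at_right 0)"
      using c by (intro continuous_on_tendsto_compose[OF c] tendsto_ident_at) auto
    ultimately have "?F 0 \<in> closure (open_sec \<gamma> \<delta> \<epsilon>)"
      by (intro Lim_in_closed_set[of _ ?F "at_right 0"]) auto
    then show "\<gamma> t \<in> closure (open_sec \<gamma> \<delta> \<epsilon>)" by simp
    have "eventually (\<lambda>s. ?F s \<in> closure (open_sec \<gamma> \<delta> \<epsilon>)) (at_left 1)"
      unfolding eventually_at_left_field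
      using rot_in_open_sec[OF t] closure_subset by (intro exI[of _ 0]) auto
    moreover have "(?F \<longlongrightarrow> ?F 1) (at_left 1)"
      using c by (intro continuous_on_tendsto_compose[OF c] tendsto_ident_at) auto
    ultimately have "?F 1 \<in> closure (open_sec \<gamma> \<delta> \<epsilon>)"
      by (intro Lim_in_closed_set[of _ ?F "at_left 1"]) auto
    then show "\<delta> t \<in> closure (open_sec \<gamma> \<delta> \<epsilon>)"
      using rot_ang[of "\<delta> t" "\<gamma> t"] norms[of t] nz[of t] t by simp
  qed
  moreover have "0 \<in> closure (open_sec \<gamma> \<delta> \<epsilon>)"
  proof (rule Lim_in_closed_set[of _ \<gamma> "at_right 0"])
    show "eventually (\<lambda>t. \<gamma> t \<in> closure (open_sec \<gamma> \<delta> \<epsilon>)) (at_right 0)"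
      unfolding eventually_at_right_field using lim eps by (intro exI[of _ \<epsilon>]) auto
    have "((\<lambda>t. norm (\<gamma> t)) \<longlongrightarrow> 0) (at_right 0)"
    proof (rule Lim_transform_eventually[OF tendsto_ident_at])
      show "eventually (\<lambda>t. t = norm (\<gamma> t)) (at_right 0)"
        unfolding eventually_at_right_field using norms eps by (intro exI[of _ \<epsilon>]) auto
    qed
    then show "(\<gamma> \<longlongrightarrow> 0) (at_right 0)" by (rule tendsto_norm_zero_cancel)
  qed auto
  ultimately have "\<gamma> t \<in> closure (open_sec \<gamma> \<delta> \<epsilon>) \<and> \<delta> t \<in> closure (open_sec \<gamma> \<delta> \<epsilon>)" if "0 \<le> t" "t < \<epsilon>" for t
    using that norms[of 0] eps by (cases "t = 0") auto
  then show "sec \<gamma> \<delta> \<inter> ball 0 \<epsilon> \<subseteq> closure (open_sec \<gamma> \<delta> \<epsilon>) \<inter> ball 0 \<epsilon>"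
    unfolding sec_Int_ball' using norms closure_subset[of "open_sec \<gamma> \<delta> \<epsilon>"] by (auto simp: open_sec_def)
qed

lemma components_two_arcs:
  "components (ball 0 \<epsilon> - (\<gamma> ` {0..<\<epsilon>} \<union> \<delta> ` {0..<\<epsilon>})) = {open_sec \<gamma> \<delta> \<epsilon>, open_sec \<delta> \<gamma> \<epsilon>}"
proof (rule components_open_unique)
  have set_eq: "\<Union>{X, Y} = B - I" if "X \<inter> I = {}" "Y \<inter> I = {}" "B = X \<union> I \<union> Y" for X Y B I :: "(real \<times> real) set"
    using that by blast
  have "open_sec \<gamma> \<delta> \<epsilon> \<inter> open_sec \<delta> \<gamma> \<epsilon> = {}"
    by (auto simp: open_sec_swap) (auto simp: open_sec_def)
  then show "pairwise disjnt {open_sec \<gamma> \<delta> \<epsilon>, open_sec \<delta> \<gamma> \<epsilon>}"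
    by (auto simp: pairwise_def disjnt_def)
  have "open_sec \<gamma> \<delta> \<epsilon> \<inter> (\<gamma> ` {0..<\<epsilon>} \<union> \<delta> ` {0..<\<epsilon>}) = {}"
    using norms nz by (auto simp: open_sec_def)
  moreover have "open_sec \<delta> \<gamma> \<epsilon> \<inter> (\<gamma> ` {0..<\<epsilon>} \<union> \<delta> ` {0..<\<epsilon>}) = {}"
    using sec_Int_ball sec_Int_ball' by blast
  moreover have "ball 0 \<epsilon> = open_sec \<gamma> \<delta> \<epsilon> \<union> (\<gamma> ` {0..<\<epsilon>} \<union> \<delta> ` {0..<\<epsilon>}) \<union> open_sec \<delta> \<gamma> \<epsilon>"
  proof -
    have "ball 0 \<epsilon> = (ball 0 \<epsilon> - open_sec \<delta> \<gamma> \<epsilon>) \<union> open_sec \<delta> \<gamma> \<epsilon>" by (auto simp: open_sec_def)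
    then show ?thesis unfolding sec_Int_ball[symmetric] sec_Int_ball' .
  qed
  ultimately show "\<Union>{open_sec \<gamma> \<delta> \<epsilon>, open_sec \<delta> \<gamma> \<epsilon>} = ball 0 \<epsilon> - (\<gamma> ` {0..<\<epsilon>} \<union> \<delta> ` {0..<\<epsilon>})"
    by (rule set_eq)
  fix X assume "X \<in> {open_sec \<gamma> \<delta> \<epsilon>, open_sec \<delta> \<gamma> \<epsilon>}"
  then show "open X \<and> connected X \<and> X \<noteq> {}"
    using open_open_sec connected_open_sec open_sec_nonempty
      two_arcs.open_open_sec[OF swap] two_arcs.connected_open_sec[OF swap] two_arcs.open_sec_nonempty[OF swap]
    by auto
qed

end

section \<open>Arcs, orders and Hoelder triangles\<close>

abbreviation ev :: "(real \<Rightarrow> bool) \<Rightarrow> bool" where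
  "ev P \<equiv> eventually P (at_right 0)"

lemma ev_pos: "ev (\<lambda>t. 0 < t)"
  by (auto simp: eventually_at_right_field intro: gt_ex)

lemma ev_less: "0 < b \<Longrightarrow> ev (\<lambda>t. t < b)"
  by (auto simp: eventually_at_right_field)

lemma evE:
  assumes "ev P" obtains \<epsilon> where "0 < \<epsilon>" "\<And>t. 0 < t \<Longrightarrow> t < \<epsilon> \<Longrightarrow> P t"
  using assms by (auto simp: eventually_at_right_field)

lemma ev_iff_cases:
  assumes "ev R \<or> ev (\<lambda>t. \<not> R t)" "ev (\<lambda>t. P t \<longleftrightarrow> R t)"
  shows "ev P \<or> ev (\<lambda>t. \<not> P t)"
  using assms(1)
proof
  assume "ev R"
  with assms(2) have "ev P" by eventually_elim simp
  then show ?thesis ..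
next
  assume "ev (\<lambda>t. \<not> R t)"
  with assms(2) have "ev (\<lambda>t. \<not> P t)" by eventually_elim simp
  then show ?thesis ..
qed

lemma powr_le_imp:
  assumes "ev (\<lambda>t. k * t powr a \<le> K * t powr b)" "0 < k"
  shows "b \<le> a"
proof (rule ccontr)
  assume n: "\<not> b \<le> a"
  have "((\<lambda>t::real. K * t powr (b - a)) \<longlongrightarrow> K * 0) (at_right 0)"
    by (intro tendsto_mult tendsto_const tendsto_zero_powrI[where b = "b - a"] tendsto_ident_at)
      (use n ev_pos in \<open>auto elim!: eventually_mono\<close>)
  moreover have "ev (\<lambda>t. k \<le> K * t powr (b - a))"
    using assms(1) ev_pos by eventually_elim (simp add: powr_diff field_simps)
  ultimately have "k \<le> K * 0" by (intro tendsto_lowerbound) auto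
  then show False using assms by simp
qed

lemma smallo_powr_iff:
  fixes g :: "real \<Rightarrow> real"
  shows
  "(\<lambda>t. g t - c * t powr r) \<in> o[at_right 0](\<lambda>t. t powr r)
    \<longleftrightarrow> ((\<lambda>t. g t / t powr r) \<longlongrightarrow> c) (at_right 0)" (is "?L \<longleftrightarrow> ?R")
proof -
  have eq: "ev (\<lambda>t. (g t - c * t powr r) / t powr r = g t / t powr r - c)"
    using ev_pos by eventually_elim (simp add: diff_divide_distrib)
  have "?L \<longleftrightarrow> ((\<lambda>t. (g t - c * t powr r) / t powr r) \<longlongrightarrow> 0) (at_right 0)"
  proof
    assume ?L then show "((\<lambda>t. (g t - c * t powr r) / t powr r) \<longlongrightarrow> 0) (at_right 0)"
      by (rule smalloD_tendsto)
  next
    assume "((\<lambda>t. (g t - c * t powr r) / t powr r) \<longlongrightarrow> 0) (at_right 0)"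
    then show ?L by (rule smalloI_tendsto) (use ev_pos in \<open>auto elim!: eventually_mono\<close>)
  qed
  also have "\<dots> \<longleftrightarrow> ((\<lambda>t. g t / t powr r - c) \<longlongrightarrow> 0) (at_right 0)"
    by (rule tendsto_cong[OF eq])
  also have "\<dots> \<longleftrightarrow> ?R" by (simp add: LIM_zero_iff)
  finally show ?thesis .
qed

lemma asymptotic_bounds:
  fixes g :: "real \<Rightarrow> real"
  assumes "((\<lambda>t. g t / t powr r) \<longlongrightarrow> c) (at_right 0)" "c \<noteq> 0"
  shows "ev (\<lambda>t. \<bar>c\<bar> / 2 * t powr r \<le> \<bar>g t\<bar> \<and> \<bar>g t\<bar> \<le> 2 * \<bar>c\<bar> * t powr r)"
proof -
  have "((\<lambda>t. \<bar>g t / t powr r\<bar>) \<longlongrightarrow> \<bar>c\<bar>) (at_right 0)" using assms(1) by (rule tendsto_rabs)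
  then have "ev (\<lambda>t. \<bar>c\<bar> / 2 < \<bar>g t / t powr r\<bar>)" "ev (\<lambda>t. \<bar>g t / t powr r\<bar> < 2 * \<bar>c\<bar>)"
    by (rule order_tendstoD; use assms(2) in simp)+
  then show ?thesis
    using ev_pos by eventually_elim (simp add: abs_divide field_simps)
qed

lemma asymptotic_unique:
  fixes g :: "real \<Rightarrow> real"
  assumes "((\<lambda>t. g t / t powr r) \<longlongrightarrow> c) (at_right 0)" "c \<noteq> 0"
    and "((\<lambda>t. g t / t powr s) \<longlongrightarrow> d) (at_right 0)" "d \<noteq> 0"
  shows "r = s"
proof (rule antisym)
  note b = asymptotic_bounds[OF assms(1,2)] asymptotic_bounds[OF assms(3,4)]
  show "r \<le> s"
    by (rule powr_le_imp[of "\<bar>d\<bar> / 2" s "2 * \<bar>c\<bar>" r])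
      (use b assms in \<open>auto elim: eventually_elim2\<close>)
  show "s \<le> r"
    by (rule powr_le_imp[of "\<bar>c\<bar> / 2" r "2 * \<bar>d\<bar>" s])
      (use b assms in \<open>auto elim: eventually_elim2\<close>)
qed

lemma arc_eq_refl [simp]: "arc_eq \<gamma> \<gamma>"
  by (simp add: arc_eq_def)

lemma arc_eq_sym: "arc_eq \<gamma> \<delta> \<Longrightarrow> arc_eq \<delta> \<gamma>"
  unfolding arc_eq_def by (auto elim!: eventually_mono)

lemma arc_eq_trans: "arc_eq \<gamma> \<delta> \<Longrightarrow> arc_eq \<delta> \<eta> \<Longrightarrow> arc_eq \<gamma> \<eta>"
  unfolding arc_eq_def by (auto elim: eventually_elim2)

lemma ord_along_cong:
  assumes "arc_eq \<gamma> \<delta>" shows "ord_along S f \<gamma> = ord_along S f \<delta>"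
proof -
  have e: "ev (\<lambda>t. \<gamma> t = \<delta> t)" using assms by (simp add: arc_eq_def)
  then have "ev (\<lambda>t. f (\<gamma> t) = 0) \<longleftrightarrow> ev (\<lambda>t. f (\<delta> t) = 0)"
    by (intro eventually_subst) (auto elim!: eventually_mono)
  moreover have "((\<lambda>t. f (\<gamma> t) / t powr \<alpha>) \<longlongrightarrow> a) (at_right 0) \<longleftrightarrow> ((\<lambda>t. f (\<delta> t) / t powr \<alpha>) \<longlongrightarrow> a) (at_right 0)" for \<alpha> a
    using e by (intro tendsto_cong) (auto elim!: eventually_mono)
  ultimately show ?thesis unfolding ord_along_def smallo_powr_iff by simp
qed

lemma tord_cong:
  assumes "arc_eq \<gamma> \<gamma>'" "arc_eq \<delta> \<delta>'" shows "tord S \<gamma> \<delta> = tord S \<gamma>' \<delta>'"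
proof -
  have e: "ev (\<lambda>t. \<gamma> t = \<gamma>' t \<and> \<delta> t = \<delta>' t)"
    using assms unfolding arc_eq_def by (rule eventually_conj)
  have "((\<lambda>t. norm (\<gamma> t - \<delta> t) / t powr \<alpha>) \<longlongrightarrow> a) (at_right 0)
      \<longleftrightarrow> ((\<lambda>t. norm (\<gamma>' t - \<delta>' t) / t powr \<alpha>) \<longlongrightarrow> a) (at_right 0)" for \<alpha> a
    using e by (intro tendsto_cong) (auto elim!: eventually_mono)
  then show ?thesis unfolding tord_def smallo_powr_iff by simp
qed

lemma tord_commute: "tord S \<gamma> \<delta> = tord S \<delta> \<gamma>"
  by (simp add: tord_def norm_minus_commute)

definition germ_eq :: "(real \<times> real) set \<Rightarrow> (real \<times> real) set \<Rightarrow> bool" where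
  "germ_eq A B \<longleftrightarrow> (\<exists>\<epsilon>>0. A \<inter> ball 0 \<epsilon> = B \<inter> ball 0 \<epsilon>)"

text \<open>The angle between two points need not be definable, so the circle through
  \<open>p\<close> is parameterized rationally. By \<open>slope_pt_rot\<close> the point is
  \<open>p\<close> rotated by pi + 2 arctan u: as u runs through the reals, it traverses the circle
  without \<open>p\<close> counterclockwise.\<close>

definition slope_pt :: "real \<times> real \<Rightarrow> real \<Rightarrow> real \<times> real" where
  "slope_pt p u = (fst p * ((u * u - 1) / (u * u + 1)) - snd p * (- 2 * u / (u * u + 1)),
     fst p * (- 2 * u / (u * u + 1)) + snd p * ((u * u - 1) / (u * u + 1)))"

lemma slope_pt_rot: "slope_pt p u = rot p (pi + 2 * arctan u)"
proof -
  have pos: "0 < 1 + u\<^sup>2" by (simp add: add_pos_nonneg)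
  have c: "cos (2 * arctan u) = (1 - u * u) / (u * u + 1)"
    unfolding cos_double cos_arctan sin_arctan using pos
    by (simp add: power_divide diff_divide_distrib[symmetric] power2_eq_square add.commute)
  have s: "sin (2 * arctan u) = 2 * u / (u * u + 1)"
    unfolding sin_double cos_arctan sin_arctan using pos
    by (simp add: power2_eq_square[symmetric] add.commute)
  have "cos (pi + 2 * arctan u) = (u * u - 1) / (u * u + 1)"
    by (simp add: cos_add c)
  moreover have "sin (pi + 2 * arctan u) = - 2 * u / (u * u + 1)"
    by (simp add: sin_add s)
  ultimately show ?thesis unfolding slope_pt_def rot_def by simp
qed

lemma norm_slope_pt [simp]: "norm (slope_pt p u) = norm p"
  by (simp add: slope_pt_rot)

lemma ang_slope_pt: "p \<noteq> 0 \<Longrightarrow> ang p (slope_pt p u) = pi + 2 * arctan u"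
  unfolding slope_pt_rot using arctan_lbound[of u] arctan_ubound[of u] by (intro ang_rot) auto

lemma slope_pt_surj:
  assumes "norm q = norm p" "p \<noteq> 0" "q \<noteq> p"
  obtains u where "q = slope_pt p u"
proof -
  define u where "u = tan ((ang p q - pi) / 2)"
  have "0 < ang p q" using ang_eq_0_iff[of q p] assms ang_bounds(1)[of p q] by (simp add: less_le)
  then have "arctan u = (ang p q - pi) / 2"
    unfolding u_def using ang_bounds(2)[of p q] by (intro arctan_tan) auto
  then have "pi + 2 * arctan u = ang p q" by simp
  then have "slope_pt p u = q" using rot_ang[of q p] assms by (simp add: slope_pt_rot)
  then show ?thesis using that by blast
qed

text \<open>Turns a comparison of angles into a first-order condition on the three points, to which
  the dichotomy for definable sets applies. The point \<open>p\<close> itself has no parameter and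
  is listed separately.\<close>

lemma ang_le_iff_slope:
  assumes "norm q = norm p" "norm r = norm p" "p \<noteq> 0"
  shows "ang p q \<le> ang p r \<longleftrightarrow> q = p \<or> (\<exists>u v. q = slope_pt p u \<and> r = slope_pt p v \<and> u \<le> v)"
proof
  assume le: "ang p q \<le> ang p r"
  show "q = p \<or> (\<exists>u v. q = slope_pt p u \<and> r = slope_pt p v \<and> u \<le> v)"
  proof (cases "q = p")
    case False
    then have "0 < ang p q" using ang_eq_0_iff[of q p] assms ang_bounds(1)[of p q] by (simp add: less_le)
    then have "r \<noteq> p" using le assms ang_self by auto
    obtain u v where "q = slope_pt p u" "r = slope_pt p v"
      using slope_pt_surj assms False \<open>r \<noteq> p\<close> by metis
    then show ?thesis using le assms(3) by (auto simp: ang_slope_pt arctan_le_iff)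
  qed simp
next
  assume "q = p \<or> (\<exists>u v. q = slope_pt p u \<and> r = slope_pt p v \<and> u \<le> v)"
  then show "ang p q \<le> ang p r"
    using assms(3) by (auto simp: ang_slope_pt arctan_le_iff ang_bounds)
qed

section \<open>Arcs and dichotomies for their positions\<close>

context pb_o_minimal
begin

lemma DF_slope_pt: "DF (h1 :: 'a::real_tuple \<Rightarrow> real \<times> real) \<Longrightarrow> DF h2 \<Longrightarrow> DF (\<lambda>x. slope_pt (h1 x) (h2 x))"
  unfolding slope_pt_def by (intro def_intros DF_divide)

abbreviation arc :: "(real \<Rightarrow> real \<times> real) \<Rightarrow> bool" where
  "arc \<equiv> arc_germ S"

lemma arc_norm: "arc \<gamma> \<Longrightarrow> ev (\<lambda>t. norm (\<gamma> t) = t)"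
  by (force simp: arc_germ_def eventually_at_right_field)

lemma arc_nz: "arc \<gamma> \<Longrightarrow> ev (\<lambda>t. \<gamma> t \<noteq> 0)"
  using arc_norm ev_pos by (force elim: eventually_elim2)

lemma S3_iff_D:
  fixes P :: "real \<Rightarrow> bool" and g :: "real \<Rightarrow> real \<times> real"
  shows "{[t, fst (g t), snd (g t)] | t. P t} \<in> S 3 \<longleftrightarrow> D (\<lambda>z. P (fst z) \<and> snd z = g (fst z))"
proof -
  have "coords ` {z. P (fst z) \<and> snd z = g (fst z)} = {[t, fst (g t), snd (g t)] | t. P t}"
    by (auto simp: coords_prod_def coords_real_def image_iff)
  then show ?thesis unfolding D_def by (simp add: arity_prod_def arity_real_def numeral_3_eq_3)
qed

lemma arc_DF:
  assumes "arc \<gamma>" obtains \<gamma>' where "DF \<gamma>'" "ev (\<lambda>t. \<gamma> t = \<gamma>' t)"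
proof -
  obtain \<epsilon> where e: "0 < \<epsilon>" "{[t, fst (\<gamma> t), snd (\<gamma> t)] | t. t \<in> {0..<\<epsilon>}} \<in> S 3"
    using assms unfolding arc_germ_def by blast
  let ?g = "\<lambda>t. if t \<in> {0..<\<epsilon>} then \<gamma> t else 0"
  have "D (\<lambda>z. fst z \<in> {0..<\<epsilon>} \<and> snd z = \<gamma> (fst z))" using e(2) by (simp only: S3_iff_D)
  then have "D (\<lambda>z::real \<times> real \<times> real. (fst z \<in> {0..<\<epsilon>} \<and> snd z = \<gamma> (fst z)) \<or> (\<not> (0 \<le> fst z \<and> fst z < \<epsilon>) \<and> snd z = 0))"
    by (rule D_disj) (intro def_intros)
  moreover have "(\<lambda>z::real \<times> real \<times> real. (fst z \<in> {0..<\<epsilon>} \<and> snd z = \<gamma> (fst z)) \<or> (\<not> (0 \<le> fst z \<and> fst z < \<epsilon>) \<and> snd z = 0))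
      = (\<lambda>z. snd z = ?g (fst z))" by (auto simp: fun_eq_iff)
  ultimately have "DF ?g" unfolding DF_def by simp
  moreover have "ev (\<lambda>t. \<gamma> t = ?g t)"
    unfolding eventually_at_right_field using e(1) by (intro exI[of _ \<epsilon>]) auto
  ultimately show ?thesis using that by blast
qed

text \<open>Continuity at small positive t comes from \<open>eventually_isCont\<close>; the value 0
  for t \<le> 0 extends it to the origin, because the norm equals t.\<close>

lemma arcI:
  assumes "DF g" "ev (\<lambda>t. norm (g t) = t)"
  shows "arc (\<lambda>t. if 0 < t then g t else 0)" (is "arc ?h")
proof -
  have "ev (isCont (\<lambda>t. fst (g t)))" "ev (isCont (\<lambda>t. snd (g t)))"
    by (intro eventually_isCont DF_fst DF_snd assms)+
  then have "ev (\<lambda>t. isCont g t)"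
  proof eventually_elim
    case (elim t)
    from isCont_Pair[OF this] show ?case by simp
  qed
  then have "ev (\<lambda>t. isCont g t \<and> norm (g t) = t)" using assms(2) by (rule eventually_conj)
  then obtain \<epsilon> where e: "0 < \<epsilon>" "\<And>t. 0 < t \<Longrightarrow> t < \<epsilon> \<Longrightarrow> isCont g t \<and> norm (g t) = t"
    by (rule evE) blast
  have n: "norm (?h t) = t" if "t \<in> {0..<\<epsilon>}" for t using e that by (cases "t = 0") auto
  have "continuous (at t within {0..<\<epsilon>}) ?h" if t: "t \<in> {0..<\<epsilon>}" for t
  proof (cases "t = 0")
    case True
    have "((\<lambda>s. norm (?h s)) \<longlongrightarrow> 0) (at 0 within {0..<\<epsilon>})"
    proof (rule Lim_transform_eventually[OF tendsto_ident_at])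
      show "eventually (\<lambda>s. s = norm (?h s)) (at 0 within {0..<\<epsilon>})"
        unfolding eventually_at_filter
      proof (rule always_eventually, intro allI impI)
        fix s assume "s \<in> {0..<\<epsilon>}"
        from n[OF this] show "s = norm (?h s)" by (rule sym)
      qed
    qed
    then show ?thesis using True unfolding continuous_within by (simp add: tendsto_norm_zero_iff)
  next
    case False
    then have "0 < t" "t < \<epsilon>" using t by auto
    have "eventually (\<lambda>s. g s = ?h s) (nhds t)"
      using eventually_nhds_in_open[of "{0<..}" t] \<open>0 < t\<close> by (auto elim!: eventually_mono)
    from isCont_cong[OF this] have "isCont ?h t" using e(2)[OF \<open>0 < t\<close> \<open>t < \<epsilon>\<close>] by simp
    then show ?thesis by (rule continuous_at_imp_continuous_at_within)
  qed
  then have "continuous_on {0..<\<epsilon>} ?h" by (simp add: continuous_on_eq_continuous_within)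
  moreover have "D (\<lambda>z. fst z \<in> {0..<\<epsilon>} \<and> snd z = ?h (fst z))"
    unfolding atLeastLessThan_iff
    by (intro def_intros DF_if[where P = "\<lambda>z. 0 < fst (z :: real \<times> real \<times> real)"] DF_comp[OF assms(1)])
  ultimately show ?thesis
    unfolding arc_germ_def S3_iff_D using e(1) n by (intro exI[of _ \<epsilon>] conjI) auto
qed

lemma arcs_cases:
  fixes R :: "real \<Rightarrow> real \<times> real \<Rightarrow> real \<times> real \<Rightarrow> real \<times> real \<Rightarrow> bool"
  assumes "arc \<gamma>" "arc \<delta>" "arc \<eta>"
    and R: "D (\<lambda>z. R (fst z) (fst (snd z)) (fst (snd (snd z))) (snd (snd (snd z))))"
  shows "ev (\<lambda>t. R t (\<gamma> t) (\<delta> t) (\<eta> t)) \<or> ev (\<lambda>t. \<not> R t (\<gamma> t) (\<delta> t) (\<eta> t))"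
proof -
  obtain \<gamma>' where g: "DF \<gamma>'" "ev (\<lambda>t. \<gamma> t = \<gamma>' t)" using arc_DF[OF assms(1)] .
  obtain \<delta>' where d: "DF \<delta>'" "ev (\<lambda>t. \<delta> t = \<delta>' t)" using arc_DF[OF assms(2)] .
  obtain \<eta>' where h: "DF \<eta>'" "ev (\<lambda>t. \<eta> t = \<eta>' t)" using arc_DF[OF assms(3)] .
  have "DF (\<lambda>t. (t, \<gamma>' t, \<delta>' t, \<eta>' t))" by (intro def_intros g d h)
  from D_subst[OF R this] have "D (\<lambda>t. R t (\<gamma>' t) (\<delta>' t) (\<eta>' t))" by simp
  from eventually_right_cases[OF this, of 0] show ?thesis
  proof
    assume "ev (\<lambda>t. R t (\<gamma>' t) (\<delta>' t) (\<eta>' t))"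
    then have "ev (\<lambda>t. R t (\<gamma> t) (\<delta> t) (\<eta> t))" using g(2) d(2) h(2) by eventually_elim simp
    then show ?thesis ..
  next
    assume "ev (\<lambda>t. \<not> R t (\<gamma>' t) (\<delta>' t) (\<eta>' t))"
    then have "ev (\<lambda>t. \<not> R t (\<gamma> t) (\<delta> t) (\<eta> t))" using g(2) d(2) h(2) by eventually_elim simp
    then show ?thesis ..
  qed
qed

lemma arc_eq_cases:
  assumes "arc \<gamma>" "arc \<delta>" shows "arc_eq \<gamma> \<delta> \<or> ev (\<lambda>t. \<gamma> t \<noteq> \<delta> t)"
  unfolding arc_eq_def by (rule arcs_cases[OF assms assms(2)]) (intro def_intros)

lemma ang_le_cases:
  assumes "arc \<gamma>" "arc \<delta>" "arc \<eta>"
  shows "ev (\<lambda>t. ang (\<gamma> t) (\<delta> t) \<le> ang (\<gamma> t) (\<eta> t)) \<or> ev (\<lambda>t. ang (\<gamma> t) (\<eta> t) < ang (\<gamma> t) (\<delta> t))"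
proof -
  let ?R = "\<lambda>p q r. q = p \<or> (\<exists>u v. q = slope_pt p u \<and> r = slope_pt p v \<and> u \<le> v)"
  have "ev (\<lambda>t. ?R (\<gamma> t) (\<delta> t) (\<eta> t)) \<or> ev (\<lambda>t. \<not> ?R (\<gamma> t) (\<delta> t) (\<eta> t))"
    by (rule arcs_cases[OF assms]) (intro def_intros DF_slope_pt)
  moreover have "ev (\<lambda>t. ang (\<gamma> t) (\<delta> t) \<le> ang (\<gamma> t) (\<eta> t) \<longleftrightarrow> ?R (\<gamma> t) (\<delta> t) (\<eta> t))"
    using assms[THEN arc_norm] arc_nz[OF assms(1)]
    by eventually_elim (simp add: ang_le_iff_slope)
  ultimately show ?thesis
    unfolding not_le[symmetric] by (rule ev_iff_cases)
qed

text \<open>In the parameter of \<open>slope_pt\<close> a half turn is u = 0.\<close>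

lemma ang_le_pi_cases:
  assumes "arc \<gamma>" "arc \<delta>"
  shows "ev (\<lambda>t. ang (\<gamma> t) (\<delta> t) \<le> pi) \<or> ev (\<lambda>t. pi < ang (\<gamma> t) (\<delta> t))"
proof -
  let ?R = "\<lambda>p q. q = p \<or> (\<exists>u. q = slope_pt p u \<and> u \<le> 0)"
  have "ev (\<lambda>t. ?R (\<gamma> t) (\<delta> t)) \<or> ev (\<lambda>t. \<not> ?R (\<gamma> t) (\<delta> t))"
    by (rule arcs_cases[OF assms assms(2)]) (intro def_intros DF_slope_pt)
  moreover have "ev (\<lambda>t. ang (\<gamma> t) (\<delta> t) \<le> pi \<longleftrightarrow> ?R (\<gamma> t) (\<delta> t))"
    using assms[THEN arc_norm] arc_nz[OF assms(1)]
  proof eventually_elim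
    case (elim t)
    show ?case
    proof (cases "\<delta> t = \<gamma> t")
      case False
      then obtain u where u: "\<delta> t = slope_pt (\<gamma> t) u" using slope_pt_surj elim by metis
      have "v = u" if "slope_pt (\<gamma> t) u = slope_pt (\<gamma> t) v" for v
      proof -
        have "pi + 2 * arctan u = pi + 2 * arctan v" by (metis ang_slope_pt elim(3) that)
        then show ?thesis by (simp add: arctan_eq_iff)
      qed
      then have "?R (\<gamma> t) (\<delta> t) \<longleftrightarrow> u \<le> 0" unfolding u using False u by auto
      moreover have "ang (\<gamma> t) (\<delta> t) = pi + 2 * arctan u" unfolding u by (rule ang_slope_pt[OF elim(3)])
      ultimately show ?thesis by simp
    qed (use elim pi_ge_zero in simp)
  qed
  ultimately show ?thesis
    unfolding not_le[symmetric] by (rule ev_iff_cases)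
qed

section \<open>Orders of tangency\<close>

lemma tord_spec:
  assumes "arc \<gamma>" "arc \<delta>" "\<not> arc_eq \<gamma> \<delta>"
  obtains b where "0 < b" "((\<lambda>t. norm (\<gamma> t - \<delta> t) / t powr tord S \<gamma> \<delta>) \<longlongrightarrow> b) (at_right 0)"
    and "tord S \<gamma> \<delta> \<in> E" "1 \<le> tord S \<gamma> \<delta>"
proof -
  obtain \<gamma>' where g: "DF \<gamma>'" "ev (\<lambda>t. \<gamma> t = \<gamma>' t)" using arc_DF[OF assms(1)] .
  obtain \<delta>' where d: "DF \<delta>'" "ev (\<lambda>t. \<delta> t = \<delta>' t)" using arc_DF[OF assms(2)] .
  have eq: "ev (\<lambda>t. norm (\<gamma> t - \<delta> t) = norm (\<gamma>' t - \<delta>' t))"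
    using g(2) d(2) by eventually_elim simp
  have "ev (\<lambda>t. \<gamma> t \<noteq> \<delta> t)" using arc_eq_cases assms by blast
  then have "ev (\<lambda>t. 0 < norm (\<gamma>' t - \<delta>' t))" using g(2) d(2) by eventually_elim simp
  moreover have "DF (\<lambda>t. norm (\<gamma>' t - \<delta>' t))" by (intro DF_norm DF_minus_pair g d)
  ultimately obtain r b where rb: "r \<in> E" "0 < b"
    "((\<lambda>t. norm (\<gamma>' t - \<delta>' t) / t powr r) \<longlongrightarrow> b) (at_right 0)"
    using asymptotic_pos by blast
  have lim: "((\<lambda>t. norm (\<gamma> t - \<delta> t) / t powr r) \<longlongrightarrow> b) (at_right 0)"
    using rb(3) by (rule Lim_transform_eventually) (use eq in \<open>auto elim!: eventually_mono\<close>)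
  have "1 \<le> r"
  proof (rule powr_le_imp[of "\<bar>b\<bar> / 2" r 2 1])
    show "ev (\<lambda>t. \<bar>b\<bar> / 2 * t powr r \<le> 2 * t powr 1)"
      using asymptotic_bounds[OF lim less_imp_neq[OF rb(2), symmetric]] arc_norm[OF assms(1)] arc_norm[OF assms(2)] ev_pos
    proof eventually_elim
      case (elim t)
      have "norm (\<gamma> t - \<delta> t) \<le> norm (\<gamma> t) + norm (\<delta> t)" by (rule norm_triangle_ineq4)
      then show ?case using elim by simp
    qed
  qed (use rb in simp)
  have "tord S \<gamma> \<delta> = r"
    unfolding tord_def smallo_powr_iff
  proof (rule the_equality)
    show "r \<in> E \<and> 1 \<le> r \<and> (\<exists>b. b \<noteq> 0 \<and> ((\<lambda>t. norm (\<gamma> t - \<delta> t) / t powr r) \<longlongrightarrow> b) (at_right 0))"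
      using rb lim \<open>1 \<le> r\<close> by (intro conjI exI[of _ b]) auto
  qed (use asymptotic_unique[OF _ _ lim] rb(2) in blast)
  then show ?thesis using that[of b] rb lim \<open>1 \<le> r\<close> by simp
qed

lemma tord_bounds:
  assumes "arc \<gamma>" "arc \<delta>" "\<not> arc_eq \<gamma> \<delta>"
  obtains k K where "0 < k" "0 < K"
    "ev (\<lambda>t. k * t powr tord S \<gamma> \<delta> \<le> norm (\<gamma> t - \<delta> t) \<and> norm (\<gamma> t - \<delta> t) \<le> K * t powr tord S \<gamma> \<delta>)"
proof -
  obtain b where b: "0 < b" "((\<lambda>t. norm (\<gamma> t - \<delta> t) / t powr tord S \<gamma> \<delta>) \<longlongrightarrow> b) (at_right 0)"
    using tord_spec[OF assms] by blast
  from asymptotic_bounds[OF b(2)] b(1) show ?thesis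
    by (intro that[of "b / 2" "2 * b"]) auto
qed

lemma tord_in_E: "arc \<gamma> \<Longrightarrow> arc \<delta> \<Longrightarrow> \<not> arc_eq \<gamma> \<delta> \<Longrightarrow> tord S \<gamma> \<delta> \<in> E"
  and tord_ge_1: "arc \<gamma> \<Longrightarrow> arc \<delta> \<Longrightarrow> \<not> arc_eq \<gamma> \<delta> \<Longrightarrow> 1 \<le> tord S \<gamma> \<delta>"
  using tord_spec by blast+

lemma tord_eqI:
  assumes "arc \<gamma>" "arc \<delta>" "\<not> arc_eq \<gamma> \<delta>" "0 < k" "0 < K"
    and "ev (\<lambda>t. k * t powr e \<le> norm (\<gamma> t - \<delta> t) \<and> norm (\<gamma> t - \<delta> t) \<le> K * t powr e)"
  shows "tord S \<gamma> \<delta> = e"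
proof -
  obtain k' K' where k': "0 < k'" "0 < K'"
    "ev (\<lambda>t. k' * t powr tord S \<gamma> \<delta> \<le> norm (\<gamma> t - \<delta> t) \<and> norm (\<gamma> t - \<delta> t) \<le> K' * t powr tord S \<gamma> \<delta>)"
    using tord_bounds[OF assms(1-3)] .
  show ?thesis
  proof (rule antisym)
    show "tord S \<gamma> \<delta> \<le> e"
      by (rule powr_le_imp[of k e K']) (use assms(6) k'(3) assms(4) in \<open>auto elim: eventually_elim2\<close>)
    show "e \<le> tord S \<gamma> \<delta>"
      by (rule powr_le_imp[of k' _ K]) (use assms(6) k' in \<open>auto elim: eventually_elim2\<close>)
  qed
qed

lemma tord_le:
  assumes "arc \<gamma>" "arc \<delta>" "\<not> arc_eq \<gamma> \<delta>" "arc \<gamma>'" "arc \<delta>'" "\<not> arc_eq \<gamma>' \<delta>'"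
    and "0 < C" "ev (\<lambda>t. norm (\<gamma> t - \<delta> t) \<le> C * norm (\<gamma>' t - \<delta>' t))"
  shows "tord S \<gamma>' \<delta>' \<le> tord S \<gamma> \<delta>"
proof -
  obtain k K where k: "0 < k" "0 < K"
    "ev (\<lambda>t. k * t powr tord S \<gamma> \<delta> \<le> norm (\<gamma> t - \<delta> t) \<and> norm (\<gamma> t - \<delta> t) \<le> K * t powr tord S \<gamma> \<delta>)"
    using tord_bounds[OF assms(1-3)] .
  obtain k' K' where k': "0 < k'" "0 < K'"
    "ev (\<lambda>t. k' * t powr tord S \<gamma>' \<delta>' \<le> norm (\<gamma>' t - \<delta>' t) \<and> norm (\<gamma>' t - \<delta>' t) \<le> K' * t powr tord S \<gamma>' \<delta>')"
    using tord_bounds[OF assms(4-6)] .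
  have "ev (\<lambda>t. k * t powr tord S \<gamma> \<delta> \<le> C * K' * t powr tord S \<gamma>' \<delta>')"
    using k(3) k'(3) assms(8)
  proof eventually_elim
    case (elim t)
    have "C * norm (\<gamma>' t - \<delta>' t) \<le> C * (K' * t powr tord S \<gamma>' \<delta>')"
      using elim assms(7) by (intro mult_left_mono) auto
    then show ?case using elim by (simp add: mult.assoc)
  qed
  then show ?thesis using k(1) by (rule powr_le_imp)
qed

text \<open>The coordinates of \<gamma> t / t are definable and bounded, so their limits exist and
  are finite: the arc has a tangent direction \<open>e\<close>.\<close>

lemma arc_tangent:
  assumes "arc \<gamma>"
  obtains e where "((\<lambda>t. (1 / t) *\<^sub>R \<gamma> t) \<longlongrightarrow> e) (at_right 0)" "norm e = 1"
proof -
  obtain \<gamma>' where g: "DF \<gamma>'" "ev (\<lambda>t. \<gamma> t = \<gamma>' t)" using arc_DF[OF assms] .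
  have bd: "ev (\<lambda>t. norm ((1 / t) *\<^sub>R \<gamma>' t) = 1)"
    using g(2) arc_norm[OF assms] ev_pos by eventually_elim auto
  have conv: "\<exists>a. (h \<longlongrightarrow> a) (at_right 0)" if h: "DF h" "ev (\<lambda>t. \<bar>h t\<bar> \<le> 1)" for h :: "real \<Rightarrow> real"
  proof -
    obtain L where L: "((\<lambda>t. ereal (h t)) \<longlongrightarrow> L) (at_right 0)" using limit_right[OF h(1)] .
    have "L \<le> ereal 1" by (rule tendsto_upperbound[OF L]) (use h(2) in \<open>auto elim!: eventually_mono\<close>)
    moreover have "ereal (-1) \<le> L" by (rule tendsto_lowerbound[OF L]) (use h(2) in \<open>auto elim!: eventually_mono\<close>)
    ultimately obtain a where "L = ereal a" by (cases L) auto
    then show ?thesis using L by auto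
  qed
  have le: "\<bar>fst q\<bar> \<le> norm q" "\<bar>snd q\<bar> \<le> norm q" for q :: "real \<times> real"
    using norm_fst_le[of "fst q" "snd q"] norm_snd_le[of "snd q" "fst q"] by auto
  have "DF (\<lambda>t. fst (\<gamma>' t) / t)" "DF (\<lambda>t. snd (\<gamma>' t) / t)" by (intro DF_divide def_intros g)+
  moreover have "ev (\<lambda>t. \<bar>fst (\<gamma>' t) / t\<bar> \<le> 1)"
    using bd
  proof eventually_elim
    case (elim t)
    have "\<bar>fst ((1 / t) *\<^sub>R \<gamma>' t)\<bar> \<le> norm ((1 / t) *\<^sub>R \<gamma>' t)" by (rule le)
    also have "\<dots> = 1" by (rule elim)
    finally show ?case by simp
  qed
  moreover have "ev (\<lambda>t. \<bar>snd (\<gamma>' t) / t\<bar> \<le> 1)"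
    using bd
  proof eventually_elim
    case (elim t)
    have "\<bar>snd ((1 / t) *\<^sub>R \<gamma>' t)\<bar> \<le> norm ((1 / t) *\<^sub>R \<gamma>' t)" by (rule le)
    also have "\<dots> = 1" by (rule elim)
    finally show ?case by simp
  qed
  ultimately obtain a b where "((\<lambda>t. fst (\<gamma>' t) / t) \<longlongrightarrow> a) (at_right 0)" "((\<lambda>t. snd (\<gamma>' t) / t) \<longlongrightarrow> b) (at_right 0)"
    using conv by blast
  then have "((\<lambda>t. (fst (\<gamma>' t) / t, snd (\<gamma>' t) / t)) \<longlongrightarrow> (a, b)) (at_right 0)" by (rule tendsto_Pair)
  then have lim: "((\<lambda>t. (1 / t) *\<^sub>R \<gamma> t) \<longlongrightarrow> (a, b)) (at_right 0)"
  proof (rule Lim_transform_eventually)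
    show "ev (\<lambda>t. (fst (\<gamma>' t) / t, snd (\<gamma>' t) / t) = (1 / t) *\<^sub>R \<gamma> t)"
      using g(2) by eventually_elim (simp add: prod_eq_iff)
  qed
  moreover have "norm (a, b) = 1"
  proof (rule tendsto_unique[OF trivial_limit_at_right_real tendsto_norm[OF lim]])
    show "((\<lambda>t. norm ((1 / t) *\<^sub>R \<gamma> t)) \<longlongrightarrow> 1) (at_right 0)"
    proof (rule Lim_transform_eventually[OF tendsto_const])
      show "ev (\<lambda>t. 1 = norm ((1 / t) *\<^sub>R \<gamma> t))" using bd g(2) by eventually_elim metis
    qed
  qed
  ultimately show ?thesis using that by blast
qed

section \<open>Hoelder triangles as narrow sectors\<close>

lemma two_arcs_ev:
  assumes "arc \<gamma>" "arc \<delta>" "\<not> arc_eq \<gamma> \<delta>"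
  shows "ev (two_arcs \<gamma> \<delta>)"
proof -
  obtain e1 where e1: "0 < e1" "continuous_on {0..<e1} \<gamma>" "\<forall>t\<in>{0..<e1}. norm (\<gamma> t) = t"
    using assms(1) unfolding arc_germ_def by blast
  obtain e2 where e2: "0 < e2" "continuous_on {0..<e2} \<delta>" "\<forall>t\<in>{0..<e2}. norm (\<delta> t) = t"
    using assms(2) unfolding arc_germ_def by blast
  have "ev (\<lambda>t. \<gamma> t \<noteq> \<delta> t)" using arc_eq_cases assms by blast
  then obtain e3 where e3: "0 < e3" "\<And>t. 0 < t \<Longrightarrow> t < e3 \<Longrightarrow> \<gamma> t \<noteq> \<delta> t" by (rule evE) blast
  have "two_arcs \<gamma> \<delta> \<epsilon>" if "0 < \<epsilon>" "\<epsilon> < e1" "\<epsilon> < e2" "\<epsilon> < e3" for \<epsilon>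
  proof
    show "continuous_on {0..<\<epsilon>} \<gamma>" using e1(2) by (rule continuous_on_subset) (use that in auto)
    show "continuous_on {0..<\<epsilon>} \<delta>" using e2(2) by (rule continuous_on_subset) (use that in auto)
  qed (use that e1 e2 e3 in auto)
  note * = this
  show ?thesis
    using ev_pos ev_less[OF e1(1)] ev_less[OF e2(1)] ev_less[OF e3(1)] by eventually_elim (rule *)
qed

text \<open>Sectors whose opening stays bounded away from 2 pi. By \<open>holder_triangleD\<close>
  and \<open>holder_triangle_sec\<close> these are exactly the germs of Hoelder triangles: for
  exponent 1 both sectors of two arcs qualify, for a larger exponent only the one without a
  half-disc.\<close>

definition narrow :: "(real \<Rightarrow> real \<times> real) \<Rightarrow> (real \<Rightarrow> real \<times> real) \<Rightarrow> bool" where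
  "narrow \<gamma> \<delta> \<longleftrightarrow> arc \<gamma> \<and> arc \<delta> \<and> \<not> arc_eq \<gamma> \<delta> \<and> (\<exists>c>0. ev (\<lambda>t. ang (\<gamma> t) (\<delta> t) \<le> 2 * pi - c))"

text \<open>Two angles inside the sector differ by at most 2 pi - c, which is the range in which
  \<open>sin_half_lower\<close> bounds the chord from below. The constant is also cut off at pi, as
  that lemma requires.\<close>

lemma narrow_dist:
  assumes "narrow \<gamma> \<delta>"
  obtains k where "0 < k" "ev (\<lambda>t. \<forall>p q. norm p = t \<and> norm q = t \<and> ang (\<gamma> t) p \<le> ang (\<gamma> t) (\<delta> t)
      \<and> ang (\<gamma> t) q \<le> ang (\<gamma> t) (\<delta> t) \<longrightarrow> k * t * \<bar>ang (\<gamma> t) p - ang (\<gamma> t) q\<bar> \<le> norm (p - q))"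
proof -
  obtain c' where c': "0 < c'" "ev (\<lambda>t. ang (\<gamma> t) (\<delta> t) \<le> 2 * pi - c')"
    using assms unfolding narrow_def by blast
  define c where "c = min c' pi"
  have c: "0 < c" "c \<le> pi" "c \<le> c'" using c' by (auto simp: c_def)
  define k where "k = 2 * (sin (c / 2) / (2 * pi))"
  have g: "arc \<gamma>" using assms unfolding narrow_def by blast
  have sin_abs: "sin (\<bar>d\<bar> / 2) \<le> \<bar>sin (d / 2)\<bar>" for d :: real
  proof (cases "0 \<le> d")
    case False
    then have "\<bar>d\<bar> / 2 = - (d / 2)" by simp
    then have "sin (\<bar>d\<bar> / 2) = - sin (d / 2)" by (simp only: sin_minus)
    then show ?thesis by linarith
  qed simp
  have "0 < k" unfolding k_def using c by (auto intro!: divide_pos_pos sin_gt_zero)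
  moreover have "ev (\<lambda>t. \<forall>p q. norm p = t \<and> norm q = t \<and> ang (\<gamma> t) p \<le> ang (\<gamma> t) (\<delta> t)
      \<and> ang (\<gamma> t) q \<le> ang (\<gamma> t) (\<delta> t) \<longrightarrow> k * t * \<bar>ang (\<gamma> t) p - ang (\<gamma> t) q\<bar> \<le> norm (p - q))"
    using c'(2) arc_norm[OF g] arc_nz[OF g] ev_pos
  proof eventually_elim
    case (elim t)
    show ?case
    proof (intro allI impI)
      fix p q assume *: "norm p = t \<and> norm q = t \<and> ang (\<gamma> t) p \<le> ang (\<gamma> t) (\<delta> t) \<and> ang (\<gamma> t) q \<le> ang (\<gamma> t) (\<delta> t)"
      let ?x = "\<bar>ang (\<gamma> t) p - ang (\<gamma> t) q\<bar>"
      have "?x \<le> 2 * pi - c"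
        using * elim c ang_bounds(1)[of "\<gamma> t" p] ang_bounds(1)[of "\<gamma> t" q] by linarith
      then have "sin (c / 2) * ?x / (2 * pi) \<le> sin (?x / 2)" using c by (intro sin_half_lower) auto
      also have "sin (?x / 2) \<le> \<bar>sin ((ang (\<gamma> t) p - ang (\<gamma> t) q) / 2)\<bar>"
        by (rule sin_abs)
      finally have "2 * t * (sin (c / 2) * ?x / (2 * pi)) \<le> 2 * t * \<bar>sin ((ang (\<gamma> t) p - ang (\<gamma> t) q) / 2)\<bar>"
        using elim by (intro mult_left_mono) auto
      also have "\<dots> = norm (p - q)" using norm_diff_ang[of p "\<gamma> t" q] * elim by simp
      finally show "k * t * ?x \<le> norm (p - q)" unfolding k_def by (simp add: ac_simps)
    qed
  qed
  ultimately show ?thesis using that by blast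
qed

text \<open>Without narrowness the opening eventually exceeds pi. If the sides had order of tangency
  1, their distance would keep the complementary angle above a positive constant, which is
  narrowness. So the order exceeds 1, the complementary sector closes up around the tangent
  direction \<open>e\<close>, and the half-disc opposite to \<open>e\<close> is left inside the
  given sector.\<close>

lemma narrow_or_half_disc:
  assumes "arc \<gamma>" "arc \<delta>" "\<not> arc_eq \<gamma> \<delta>" "\<not> narrow \<gamma> \<delta>"
  shows "1 < tord S \<gamma> \<delta> \<and> ev (\<lambda>\<epsilon>. \<exists>v. v \<noteq> 0 \<and> {x \<in> ball 0 \<epsilon>. 0 < v \<bullet> x} \<subseteq> open_sec \<gamma> \<delta> \<epsilon>)"
proof -
  have "\<not> ev (\<lambda>t. ang (\<gamma> t) (\<delta> t) \<le> pi)"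
  proof
    assume "ev (\<lambda>t. ang (\<gamma> t) (\<delta> t) \<le> pi)"
    then have "narrow \<gamma> \<delta>" unfolding narrow_def using assms by (intro conjI exI[of _ pi]) auto
    then show False using assms by blast
  qed
  then have big: "ev (\<lambda>t. pi < ang (\<gamma> t) (\<delta> t))" using ang_le_pi_cases assms by blast
  have "ev (\<lambda>t. \<gamma> t \<noteq> \<delta> t)" using arc_eq_cases assms by blast
  have le_2pi: "a \<le> 2 * pi * x" if "a / (2 * pi) \<le> x" for a x
    using that by (simp add: field_simps)
  note pt = \<open>ev (\<lambda>t. \<gamma> t \<noteq> \<delta> t)\<close> arc_norm[OF assms(1)] arc_norm[OF assms(2)] arc_nz[OF assms(1)] arc_nz[OF assms(2)] ev_pos
  have B: "ev (\<lambda>t. ang (\<delta> t) (\<gamma> t) = 2 * pi - ang (\<gamma> t) (\<delta> t) \<and> 0 \<le> ang (\<delta> t) (\<gamma> t) \<and> ang (\<delta> t) (\<gamma> t) < pi)"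
    using big pt
  proof eventually_elim
    case (elim t)
    then show ?case using ang_swap[of "\<delta> t" "\<gamma> t"] ang_bounds[of "\<gamma> t" "\<delta> t"] by auto
  qed
  have dist: "ev (\<lambda>t. norm (\<gamma> t - \<delta> t) = 2 * t * sin (ang (\<delta> t) (\<gamma> t) / 2))"
    using B pt
  proof eventually_elim
    case (elim t)
    have "0 \<le> sin (ang (\<delta> t) (\<gamma> t) / 2)" using elim by (intro sin_ge_zero) auto
    then show ?case using norm_diff_ang[of "\<gamma> t" "\<delta> t" "\<delta> t"] elim by simp
  qed
  obtain b where b: "0 < b" "((\<lambda>t. norm (\<gamma> t - \<delta> t) / t powr tord S \<gamma> \<delta>) \<longlongrightarrow> b) (at_right 0)"
    "1 \<le> tord S \<gamma> \<delta>" using tord_spec[OF assms(1-3)] by blast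
  have gt: "1 < tord S \<gamma> \<delta>"
  proof (rule ccontr)
    assume "\<not> 1 < tord S \<gamma> \<delta>"
    then have "tord S \<gamma> \<delta> = 1" using b by simp
    have "ev (\<lambda>t. ang (\<gamma> t) (\<delta> t) \<le> 2 * pi - b / 2)"
      using asymptotic_bounds[OF b(2) less_imp_neq[OF b(1), symmetric]] B dist ev_pos
    proof eventually_elim
      case (elim t)
      have "b / 2 * t \<le> norm (\<gamma> t - \<delta> t)"
        using elim(1,4) \<open>tord S \<gamma> \<delta> = 1\<close> b(1) by simp
      then have "b / 2 * t \<le> 2 * sin (ang (\<delta> t) (\<gamma> t) / 2) * t" using elim(3) by (simp only: ac_simps)
      then have "b / 2 \<le> 2 * sin (ang (\<delta> t) (\<gamma> t) / 2)" using elim(4) by (simp only: mult_le_cancel_right_pos)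
      also have "\<dots> \<le> ang (\<delta> t) (\<gamma> t)"
        using sin_x_le_x[of "ang (\<delta> t) (\<gamma> t) / 2"] elim by simp
      finally show ?case using elim by simp
    qed
    then have "narrow \<gamma> \<delta>" unfolding narrow_def using assms b(1) by (intro conjI exI[of _ "b / 2"]) auto
    then show False using assms by blast
  qed
  \<comment> \<open>A quarter for the angle and a quarter for the deviation of \<gamma> from its
    tangent: points of the complementary sector on the circle of radius t are then within t / 2 of t
    e, hence have positive inner product with \<open>e\<close>.\<close>
  have "ev (\<lambda>t. ang (\<delta> t) (\<gamma> t) < 1 / 4)"
  proof -
    have "((\<lambda>t. t powr (tord S \<gamma> \<delta> - 1)) \<longlongrightarrow> 0) (at_right 0)"
      by (intro tendsto_zero_powrI[where b = "tord S \<gamma> \<delta> - 1"] tendsto_ident_at tendsto_const)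
        (use gt ev_pos in \<open>auto elim!: eventually_mono\<close>)
    then have "((\<lambda>t. 2 * b * pi * t powr (tord S \<gamma> \<delta> - 1)) \<longlongrightarrow> 2 * b * pi * 0) (at_right 0)"
      by (intro tendsto_mult tendsto_const)
    then have small: "ev (\<lambda>t. 2 * b * pi * t powr (tord S \<gamma> \<delta> - 1) < 1 / 4)"
      by (rule order_tendstoD(2)) simp
    show ?thesis using small
      using asymptotic_bounds[OF b(2) less_imp_neq[OF b(1), symmetric]] B dist ev_pos
    proof eventually_elim
      case (elim t)
      have "ang (\<delta> t) (\<gamma> t) / (2 * pi) \<le> sin (ang (\<delta> t) (\<gamma> t) / 2)"
        using sin_half_lower[of pi "ang (\<delta> t) (\<gamma> t)"] elim(3) by simp
      then have "ang (\<delta> t) (\<gamma> t) \<le> 2 * pi * sin (ang (\<delta> t) (\<gamma> t) / 2)" by (rule le_2pi)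
      also have "\<dots> = pi * (norm (\<gamma> t - \<delta> t) / t)" using elim(4,5) by simp
      also have "\<dots> \<le> pi * (2 * b * t powr tord S \<gamma> \<delta> / t)"
        using elim b(1) by (intro mult_left_mono divide_right_mono) auto
      also have "\<dots> = 2 * b * pi * t powr (tord S \<gamma> \<delta> - 1)" using elim by (simp add: powr_diff)
      finally show ?case using elim by simp
    qed
  qed
  moreover obtain e where e: "((\<lambda>t. (1 / t) *\<^sub>R \<gamma> t) \<longlongrightarrow> e) (at_right 0)" "norm e = 1"
    using arc_tangent[OF assms(1)] .
  have "ev (\<lambda>t. dist ((1 / t) *\<^sub>R \<gamma> t) e < 1 / 4)" by (rule tendstoD[OF e(1)]) simp
  ultimately have "ev (\<lambda>t. ang (\<delta> t) (\<gamma> t) < 1 / 4 \<and> norm (\<gamma> t - t *\<^sub>R e) < t / 4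
      \<and> norm (\<gamma> t) = t \<and> norm (\<delta> t) = t \<and> \<delta> t \<noteq> 0)"
    using pt
  proof eventually_elim
    case (elim t)
    have "\<gamma> t - t *\<^sub>R e = t *\<^sub>R ((1 / t) *\<^sub>R \<gamma> t - e)" using elim by (simp add: scaleR_diff_right)
    then have "norm (\<gamma> t - t *\<^sub>R e) = t * norm ((1 / t) *\<^sub>R \<gamma> t - e)"
      using elim by (metis abs_of_pos norm_scaleR)
    then show ?case using elim by (simp add: dist_norm)
  qed
  then obtain e0 where e0: "0 < e0" "\<And>t. 0 < t \<Longrightarrow> t < e0 \<Longrightarrow> ang (\<delta> t) (\<gamma> t) < 1 / 4 \<and> norm (\<gamma> t - t *\<^sub>R e) < t / 4
      \<and> norm (\<gamma> t) = t \<and> norm (\<delta> t) = t \<and> \<delta> t \<noteq> 0" by (rule evE) blast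
  have "ev (\<lambda>\<epsilon>. \<exists>v. v \<noteq> 0 \<and> {x \<in> ball 0 \<epsilon>. 0 < v \<bullet> x} \<subseteq> open_sec \<gamma> \<delta> \<epsilon>)"
    using two_arcs_ev[OF assms(1-3)] ev_less[OF e0(1)]
  proof eventually_elim
    case (elim \<epsilon>)
    have "{x \<in> ball 0 \<epsilon>. 0 < (- e) \<bullet> x} \<subseteq> open_sec \<gamma> \<delta> \<epsilon>"
    proof (rule subsetI, rule ccontr)
      fix p assume p: "p \<in> {x \<in> ball 0 \<epsilon>. 0 < (- e) \<bullet> x}" "p \<notin> open_sec \<gamma> \<delta> \<epsilon>"
      then have "p \<in> sec \<delta> \<gamma>"
        using two_arcs.sec_Int_ball[OF two_arcs.swap[OF elim(1)]] by blast
      define t where "t = norm p"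
      have "p \<noteq> 0" using p by auto
      then have t: "0 < t" "t < e0" using p elim(2) by (auto simp: t_def)
      have "ang (\<delta> t) p \<le> ang (\<delta> t) (\<gamma> t)" using \<open>p \<in> sec \<delta> \<gamma>\<close> \<open>p \<noteq> 0\<close> by (simp add: sec_def t_def)
      then have "\<bar>ang (\<delta> t) p - ang (\<delta> t) (\<gamma> t)\<bar> \<le> 1 / 4"
        using e0(2)[OF t] ang_bounds(1)[of "\<delta> t" p] by linarith
      moreover have "norm (p - \<gamma> t) \<le> norm (\<delta> t) * \<bar>ang (\<delta> t) p - ang (\<delta> t) (\<gamma> t)\<bar>"
        using e0(2)[OF t] by (intro norm_diff_le_ang) (auto simp: t_def)
      ultimately have "norm (p - \<gamma> t) \<le> t * (1 / 4)"
        using e0(2)[OF t] t by (smt (verit) mult_left_mono)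
      then have "norm (p - t *\<^sub>R e) < t"
        using e0(2)[OF t] t norm_triangle_ineq[of "p - \<gamma> t" "\<gamma> t - t *\<^sub>R e"] by simp
      moreover have "- (e \<bullet> (p - t *\<^sub>R e)) \<le> norm (p - t *\<^sub>R e)"
        using Cauchy_Schwarz_ineq2[of e "p - t *\<^sub>R e"] e(2) by simp
      moreover have "e \<bullet> (p - t *\<^sub>R e) = e \<bullet> p - t"
        using e(2) by (simp add: inner_diff_right dot_square_norm)
      moreover have "e \<bullet> p < 0" using p by simp
      ultimately show False by linarith
    qed
    moreover have "- e \<noteq> 0" using e(2) by auto
    ultimately show ?case by blast
  qed
  with gt show ?thesis by blast
qed

lemma holder_triangleD:
  assumes "holder_triangle S \<beta> \<gamma> \<delta> T"
  shows "\<beta> = tord S \<gamma> \<delta>"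
    and "narrow \<gamma> \<delta> \<and> germ_eq T (sec \<gamma> \<delta>) \<or> narrow \<delta> \<gamma> \<and> germ_eq T (sec \<delta> \<gamma>)"
proof -
  have h: "arc \<gamma>" "arc \<delta>" "\<not> arc_eq \<gamma> \<delta>" and \<beta>: "\<beta> = tord S \<gamma> \<delta>"
    and C: "ev (\<lambda>\<epsilon>. \<exists>C \<in> components (ball 0 \<epsilon> - (\<gamma> ` {0..<\<epsilon>} \<union> \<delta> ` {0..<\<epsilon>})).
          T \<inter> ball 0 \<epsilon> = closure C \<inter> ball 0 \<epsilon> \<and>
          (\<beta> > 1 \<longrightarrow> \<not> (\<exists>v. v \<noteq> 0 \<and> {x \<in> ball 0 \<epsilon>. 0 < v \<bullet> x} \<subseteq> C)))"
    using assms unfolding holder_triangle_def by auto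
  show "\<beta> = tord S \<gamma> \<delta>" by (rule \<beta>)
  have h': "\<not> arc_eq \<delta> \<gamma>" using h arc_eq_sym by blast
  let ?half = "\<lambda>\<epsilon> C. \<exists>v. v \<noteq> 0 \<and> {x \<in> ball 0 \<epsilon>. 0 < v \<bullet> x} \<subseteq> C"
  have h1: "ev (\<lambda>\<epsilon>. \<not> narrow \<gamma> \<delta> \<longrightarrow> 1 < \<beta> \<and> ?half \<epsilon> (open_sec \<gamma> \<delta> \<epsilon>))"
    using narrow_or_half_disc[OF h] \<beta> by (cases "narrow \<gamma> \<delta>") auto
  have h2: "ev (\<lambda>\<epsilon>. \<not> narrow \<delta> \<gamma> \<longrightarrow> 1 < \<beta> \<and> ?half \<epsilon> (open_sec \<delta> \<gamma> \<epsilon>))"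
    using narrow_or_half_disc[OF h(2,1) h'] \<beta> tord_commute[of S \<gamma> \<delta>] by (cases "narrow \<delta> \<gamma>") auto
  \<comment> \<open>The component chosen in the definition may vary with \<epsilon>, but the
    alternative proved for each small \<epsilon> does not mention it, so a single \<epsilon> is
    enough.\<close>
  have "ev (\<lambda>\<epsilon>. narrow \<gamma> \<delta> \<and> germ_eq T (sec \<gamma> \<delta>) \<or> narrow \<delta> \<gamma> \<and> germ_eq T (sec \<delta> \<gamma>))"
    using C two_arcs_ev[OF h] h1 h2
  proof eventually_elim
    case (elim \<epsilon>)
    interpret two_arcs \<gamma> \<delta> \<epsilon> by (rule elim(2))
    from elim(1) obtain C where C: "C = open_sec \<gamma> \<delta> \<epsilon> \<or> C = open_sec \<delta> \<gamma> \<epsilon>"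
      "T \<inter> ball 0 \<epsilon> = closure C \<inter> ball 0 \<epsilon>" "\<beta> > 1 \<longrightarrow> \<not> ?half \<epsilon> C"
      unfolding components_two_arcs by blast
    from C(1) show ?case
    proof
      assume "C = open_sec \<gamma> \<delta> \<epsilon>"
      then have "T \<inter> ball 0 \<epsilon> = sec \<gamma> \<delta> \<inter> ball 0 \<epsilon>" and nh: "\<beta> > 1 \<longrightarrow> \<not> ?half \<epsilon> (open_sec \<gamma> \<delta> \<epsilon>)"
        using C(2,3) closure_open_sec by simp_all
      then have "germ_eq T (sec \<gamma> \<delta>)" unfolding germ_eq_def using eps by blast
      moreover have "narrow \<gamma> \<delta>" using nh elim(3) by argo
      ultimately show ?thesis by simp
    next
      assume "C = open_sec \<delta> \<gamma> \<epsilon>"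
      then have "T \<inter> ball 0 \<epsilon> = sec \<delta> \<gamma> \<inter> ball 0 \<epsilon>" and nh: "\<beta> > 1 \<longrightarrow> \<not> ?half \<epsilon> (open_sec \<delta> \<gamma> \<epsilon>)"
        using C(2,3) two_arcs.closure_open_sec[OF swap] by simp_all
      then have "germ_eq T (sec \<delta> \<gamma>)" unfolding germ_eq_def using eps by blast
      moreover have "narrow \<delta> \<gamma>" using nh elim(4) by argo
      ultimately show ?thesis by simp
    qed
  qed
  then show "narrow \<gamma> \<delta> \<and> germ_eq T (sec \<gamma> \<delta>) \<or> narrow \<delta> \<gamma> \<and> germ_eq T (sec \<delta> \<gamma>)"
    by (metis eventually_const trivial_limit_at_right_real)
qed

text \<open>Only the absence of a half-disc needs an argument. If the order of tangency exceeds 1,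
  the comparison of chord and angle forces the opening below one radian, and such a sector contains
  no half-disc.\<close>

lemma holder_triangle_sec:
  assumes "narrow \<gamma> \<delta>"
  shows "holder_triangle S (tord S \<gamma> \<delta>) \<gamma> \<delta> (sec \<gamma> \<delta>)"
proof -
  have h: "arc \<gamma>" "arc \<delta>" "\<not> arc_eq \<gamma> \<delta>" using assms unfolding narrow_def by auto
  obtain k where k: "0 < k" "ev (\<lambda>t. \<forall>p q. norm p = t \<and> norm q = t \<and> ang (\<gamma> t) p \<le> ang (\<gamma> t) (\<delta> t)
      \<and> ang (\<gamma> t) q \<le> ang (\<gamma> t) (\<delta> t) \<longrightarrow> k * t * \<bar>ang (\<gamma> t) p - ang (\<gamma> t) q\<bar> \<le> norm (p - q))"
    using narrow_dist[OF assms] .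
  have nohalf: "ev (\<lambda>\<epsilon>. \<not> (\<exists>v. v \<noteq> 0 \<and> {x \<in> ball 0 \<epsilon>. 0 < v \<bullet> x} \<subseteq> open_sec \<gamma> \<delta> \<epsilon>))" if gt: "1 < tord S \<gamma> \<delta>"
  proof -
    obtain k' K where K: "0 < k'" "0 < K" "ev (\<lambda>t. k' * t powr tord S \<gamma> \<delta> \<le> norm (\<gamma> t - \<delta> t) \<and> norm (\<gamma> t - \<delta> t) \<le> K * t powr tord S \<gamma> \<delta>)"
      using tord_bounds[OF h] .
    have "((\<lambda>t. K * t powr (tord S \<gamma> \<delta> - 1)) \<longlongrightarrow> K * 0) (at_right 0)"
      by (intro tendsto_mult tendsto_const tendsto_zero_powrI[where b = "tord S \<gamma> \<delta> - 1"] tendsto_ident_at)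
        (use gt ev_pos in \<open>auto elim!: eventually_mono\<close>)
    then have "ev (\<lambda>t. K * t powr (tord S \<gamma> \<delta> - 1) < k)"
      by (rule order_tendstoD(2)) (use k in simp)
    then have "ev (\<lambda>t. ang (\<gamma> t) (\<delta> t) < 1 \<and> norm (\<gamma> t) = t \<and> \<gamma> t \<noteq> 0)"
      using K(3) k(2) arc_norm[OF h(1)] arc_norm[OF h(2)] arc_nz[OF h(1)] ev_pos
    proof eventually_elim
      case (elim t)
      have "k * t * \<bar>ang (\<gamma> t) (\<gamma> t) - ang (\<gamma> t) (\<delta> t)\<bar> \<le> norm (\<gamma> t - \<delta> t)"
        by (rule elim(3)[rule_format]) (use elim(4-6) ang_bounds(1)[of "\<gamma> t" "\<delta> t"] in simp)
      then have "k * t * ang (\<gamma> t) (\<delta> t) \<le> K * t powr tord S \<gamma> \<delta>"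
        using elim(2,6) ang_bounds(1)[of "\<gamma> t" "\<delta> t"] by simp
      also have "\<dots> = t * (K * t powr (tord S \<gamma> \<delta> - 1))" using elim by (simp add: powr_diff)
      also have "\<dots> < t * k" using elim(1,7) by (intro mult_strict_left_mono)
      finally have "ang (\<gamma> t) (\<delta> t) * (k * t) < 1 * (k * t)" by (simp add: ac_simps)
      then have "ang (\<gamma> t) (\<delta> t) < 1" using elim(7) k(1) by (simp add: mult_less_cancel_right)
      then show ?case using elim(4,6) by simp
    qed
    then obtain e0 where e0: "0 < e0" "\<And>t. 0 < t \<Longrightarrow> t < e0 \<Longrightarrow> ang (\<gamma> t) (\<delta> t) < 1 \<and> norm (\<gamma> t) = t \<and> \<gamma> t \<noteq> 0"
      by (rule evE) blast
    show ?thesis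
      using ev_pos ev_less[OF e0(1)]
    proof eventually_elim
      case (elim \<epsilon>)
      show ?case
      proof
        assume "\<exists>v. v \<noteq> 0 \<and> {x \<in> ball 0 \<epsilon>. 0 < v \<bullet> x} \<subseteq> open_sec \<gamma> \<delta> \<epsilon>"
        then obtain v where v: "v \<noteq> 0" "{x \<in> ball 0 \<epsilon>. 0 < v \<bullet> x} \<subseteq> open_sec \<gamma> \<delta> \<epsilon>" by blast
        define t where "t = \<epsilon> / 2"
        have t: "0 < t" "t < \<epsilon>" "t < e0" using elim by (auto simp: t_def)
        \<comment> \<open>\<open>p\<close> on the axis of the half-disc and its rotation
          \<open>q\<close> by 60 degrees both lie in the half-disc. Their distance is t, while two
          points of a sector of opening less than 1 on the circle of radius t are closer than
          t.\<close>
        define p where "p = (t / norm v) *\<^sub>R v"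
        define q where "q = rot p (pi / 3)"
        have np: "norm p = t" "norm q = t" using v t by (auto simp: p_def q_def)
        have vp: "v \<bullet> p = t * norm v"
          using v(1) by (simp add: p_def dot_square_norm power2_eq_square)
        moreover have "v \<bullet> q = (v \<bullet> p) * cos (pi / 3)"
        proof -
          have "fst v * snd p = snd v * fst p" by (simp add: p_def)
          then show ?thesis by (simp add: q_def rot_def inner_prod_def algebra_simps)
        qed
        ultimately have "v \<bullet> p = t * norm v" "v \<bullet> q = t * norm v / 2" by (simp_all add: cos_60)
        moreover have "0 < t * norm v" using t v by simp
        ultimately have "0 < v \<bullet> p" "0 < v \<bullet> q" by linarith+
        then have "p \<in> open_sec \<gamma> \<delta> \<epsilon>" "q \<in> open_sec \<gamma> \<delta> \<epsilon>" using v(2) np t by auto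
        then have "\<bar>ang (\<gamma> t) p - ang (\<gamma> t) q\<bar> < 1"
          using e0(2)[OF t(1,3)] np by (auto simp: open_sec_def)
        moreover have "norm (p - q) \<le> norm (\<gamma> t) * \<bar>ang (\<gamma> t) p - ang (\<gamma> t) q\<bar>"
          using e0(2)[OF t(1,3)] np by (intro norm_diff_le_ang) auto
        moreover have "norm (p - q) = t"
          using norm_rot_diff[of p 0 "pi / 3"] np sin_30 by (simp add: q_def)
        ultimately show False
          using e0(2)[OF t(1,3)] t(1) by (simp add: mult_less_cancel_left1)
      qed
    qed
  qed
  have nohalf': "ev (\<lambda>\<epsilon>. 1 < tord S \<gamma> \<delta> \<longrightarrow> \<not> (\<exists>v. v \<noteq> 0 \<and> {x \<in> ball 0 \<epsilon>. 0 < v \<bullet> x} \<subseteq> open_sec \<gamma> \<delta> \<epsilon>))"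
    using nohalf by (cases "1 < tord S \<gamma> \<delta>") auto
  have "ev (\<lambda>\<epsilon>. \<exists>C \<in> components (ball 0 \<epsilon> - (\<gamma> ` {0..<\<epsilon>} \<union> \<delta> ` {0..<\<epsilon>})).
          sec \<gamma> \<delta> \<inter> ball 0 \<epsilon> = closure C \<inter> ball 0 \<epsilon> \<and>
          (1 < tord S \<gamma> \<delta> \<longrightarrow> \<not> (\<exists>v. v \<noteq> 0 \<and> {x \<in> ball 0 \<epsilon>. 0 < v \<bullet> x} \<subseteq> C)))"
    using two_arcs_ev[OF h] nohalf'
  proof eventually_elim
    case (elim \<epsilon>)
    interpret two_arcs \<gamma> \<delta> \<epsilon> by (rule elim(1))
    show ?case using closure_open_sec elim(2) unfolding components_two_arcs by auto
  qed
  then show ?thesis unfolding holder_triangle_def using h by auto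
qed

end

section \<open>The ordered set of arcs in a narrow sector\<close>

lemma powr_less_ev:
  assumes "a < b" "0 < k"
  shows "ev (\<lambda>t. K * t powr b < k * t powr a)"
proof -
  have "((\<lambda>t. K * t powr (b - a)) \<longlongrightarrow> K * 0) (at_right 0)"
    by (intro tendsto_mult tendsto_const tendsto_zero_powrI[where b = "b - a"] tendsto_ident_at)
      (use assms ev_pos in \<open>auto elim!: eventually_mono\<close>)
  then have "ev (\<lambda>t. K * t powr (b - a) < k)"
    by (rule order_tendstoD(2)) (use assms in simp)
  then show ?thesis
    using ev_pos by eventually_elim (simp add: powr_diff field_simps)
qed

lemma germ_eq_refl [simp]: "germ_eq A A"
  unfolding germ_eq_def using zero_less_one by blast

lemma germ_eq_arc_in:
  assumes "germ_eq A B" "ev (\<lambda>t. norm (\<gamma> t) = t)"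
  shows "arc_in \<gamma> A \<longleftrightarrow> arc_in \<gamma> B"
proof -
  obtain \<epsilon> where e: "0 < \<epsilon>" "A \<inter> ball 0 \<epsilon> = B \<inter> ball 0 \<epsilon>" using assms(1) unfolding germ_eq_def by blast
  have "ev (\<lambda>t. \<gamma> t \<in> A \<longleftrightarrow> \<gamma> t \<in> B)"
    using assms(2) ev_less[OF e(1)]
  proof eventually_elim
    case (elim t)
    then have "\<gamma> t \<in> ball 0 \<epsilon>" by simp
    then show ?case using e(2) by blast
  qed
  then show ?thesis unfolding arc_in_def by (rule eventually_subst)
qed

lemma germ_subset_cong:
  assumes "germ_eq A A'" "germ_eq B B'" "germ_subset A B"
  shows "germ_subset A' B'"
proof -
  obtain e1 e2 e3 where e: "0 < e1" "A \<inter> ball 0 e1 = A' \<inter> ball 0 e1" "0 < e2" "B \<inter> ball 0 e2 = B' \<inter> ball 0 e2"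
    "0 < e3" "A \<inter> ball 0 e3 \<subseteq> B" using assms unfolding germ_eq_def germ_subset_def by metis
  define \<epsilon> where "\<epsilon> = min e1 (min e2 e3)"
  have sub: "ball 0 \<epsilon> \<subseteq> ball 0 e1" "ball 0 \<epsilon> \<subseteq> ball 0 e2" "ball 0 \<epsilon> \<subseteq> ball (0::real \<times> real) e3"
    by (auto simp: \<epsilon>_def)
  have "A' \<inter> ball 0 \<epsilon> \<subseteq> B'"
  proof
    fix p assume p: "p \<in> A' \<inter> ball 0 \<epsilon>"
    then have "p \<in> A" using e(2) sub(1) by blast
    then have "p \<in> B" using e(6) sub(3) p by blast
    then show "p \<in> B'" using e(4) sub(2) p by blast
  qed
  moreover have "0 < \<epsilon>" using e by (simp add: \<epsilon>_def)
  ultimately show ?thesis unfolding germ_subset_def by blast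
qed

lemma germ_eq_sym: "germ_eq A B \<Longrightarrow> germ_eq B A"
  unfolding germ_eq_def by metis

text \<open>Seen from \<gamma>, the arc \<open>v\<close> comes no later than \<open>w\<close> in the
  counterclockwise direction. On arcs this is a total preorder, and mutually comparable arcs are
  equal as germs.\<close>

definition le :: "(real \<Rightarrow> real \<times> real) \<Rightarrow> (real \<Rightarrow> real \<times> real) \<Rightarrow> (real \<Rightarrow> real \<times> real) \<Rightarrow> bool" where
  "le \<gamma> v w \<longleftrightarrow> ev (\<lambda>t. ang (\<gamma> t) (v t) \<le> ang (\<gamma> t) (w t))"

lemma le_refl [simp]: "le \<gamma> v v"
  by (simp add: le_def)

lemma le_trans: "le \<gamma> u v \<Longrightarrow> le \<gamma> v w \<Longrightarrow> le \<gamma> u w"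
  unfolding le_def by (auto elim: eventually_elim2)

lemma arc_eq_le: "arc_eq v w \<Longrightarrow> le \<gamma> v w"
  unfolding le_def arc_eq_def by (auto elim!: eventually_mono)

section \<open>Order of arcs by position and nested gaps\<close>

context pb_o_minimal
begin

lemma arcs_ev:
  assumes "arc \<gamma>" "arc v"
  shows "ev (\<lambda>t. norm (v t) = norm (\<gamma> t) \<and> norm (\<gamma> t) = t \<and> \<gamma> t \<noteq> 0 \<and> v t \<noteq> 0 \<and> 0 < t)"
  using arc_norm[OF assms(1)] arc_norm[OF assms(2)] arc_nz[OF assms(1)] arc_nz[OF assms(2)] ev_pos
  by eventually_elim simp

lemma le_base: assumes "arc \<gamma>" shows "le \<gamma> \<gamma> v"
  unfolding le_def using arc_nz[OF assms] by eventually_elim (simp add: ang_bounds)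

lemma le_cases: "arc \<gamma> \<Longrightarrow> arc v \<Longrightarrow> arc w \<Longrightarrow> le \<gamma> v w \<or> ev (\<lambda>t. ang (\<gamma> t) (w t) < ang (\<gamma> t) (v t))"
  unfolding le_def by (rule ang_le_cases)

lemma le_total:
  assumes "arc \<gamma>" "arc v" "arc w" shows "le \<gamma> v w \<or> le \<gamma> w v"
  using le_cases[OF assms]
proof
  assume "ev (\<lambda>t. ang (\<gamma> t) (w t) < ang (\<gamma> t) (v t))"
  then have "le \<gamma> w v" unfolding le_def by (rule eventually_mono) simp
  then show ?thesis ..
qed simp

lemma le_antisym:
  assumes "arc \<gamma>" "arc v" "arc w" "le \<gamma> v w" "le \<gamma> w v" shows "arc_eq v w"
  unfolding arc_eq_def
  using assms(4,5)[unfolded le_def] arcs_ev[OF assms(1,2)] arcs_ev[OF assms(1,3)]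
proof eventually_elim
  case (elim t)
  then show ?case using ang_inj[of "v t" "\<gamma> t" "w t"] by simp
qed

lemma arc_in_sec_iff:
  assumes "arc v" shows "arc_in v (sec \<gamma> \<delta>) \<longleftrightarrow> le \<gamma> v \<delta>"
  unfolding arc_in_def le_def
proof (rule eventually_subst)
  show "ev (\<lambda>t. v t \<in> sec \<gamma> \<delta> \<longleftrightarrow> ang (\<gamma> t) (v t) \<le> ang (\<gamma> t) (\<delta> t))"
    using arc_norm[OF assms] arc_nz[OF assms] by eventually_elim (simp add: sec_def)
qed

lemma le_between:
  assumes "arc \<gamma>" "arc v" "arc w" "arc z" "le \<gamma> v w"
  shows "le v z w \<longleftrightarrow> le \<gamma> v z \<and> le \<gamma> z w"
  unfolding le_def eventually_conj_iff[symmetric]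
proof (rule eventually_subst)
  show "ev (\<lambda>t. ang (v t) (z t) \<le> ang (v t) (w t) \<longleftrightarrow>
      ang (\<gamma> t) (v t) \<le> ang (\<gamma> t) (z t) \<and> ang (\<gamma> t) (z t) \<le> ang (\<gamma> t) (w t))"
    using assms(5)[unfolded le_def] arcs_ev[OF assms(1,2)] arcs_ev[OF assms(1,3)] arcs_ev[OF assms(1,4)]
    by eventually_elim (intro ang_between_iff; simp)
qed

lemma le_rebase:
  assumes "arc \<gamma>" "arc m" "arc v" "arc w" "le \<gamma> m v" "le \<gamma> m w"
  shows "le m v w \<longleftrightarrow> le \<gamma> v w"
  using le_between[OF assms(1,2,4,3,6)] assms(5) by blast

lemma narrow_sub:
  assumes "narrow \<gamma> \<delta>" "arc v" "arc w" "le \<gamma> v w" "le \<gamma> w \<delta>" "\<not> arc_eq v w"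
  shows "narrow v w"
proof -
  obtain c where c: "0 < c" "ev (\<lambda>t. ang (\<gamma> t) (\<delta> t) \<le> 2 * pi - c)" and g: "arc \<gamma>"
    using assms(1) unfolding narrow_def by blast
  have "ev (\<lambda>t. ang (v t) (w t) \<le> 2 * pi - c)"
    using c(2) assms(4,5)[unfolded le_def] arcs_ev[OF g assms(2)] arcs_ev[OF g assms(3)]
  proof eventually_elim
    case (elim t)
    then show ?case using ang_shift[of "v t" "\<gamma> t" "w t"] ang_bounds(1)[of "\<gamma> t" "v t"] by simp
  qed
  then show ?thesis unfolding narrow_def using assms c(1) by blast
qed

lemma sec_subset:
  assumes "arc \<gamma>" "arc v" "arc w" "le \<gamma> v w" "le \<gamma> w \<delta>"
  shows "germ_subset (sec v w) (sec \<gamma> \<delta>)"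
proof -
  have "ev (\<lambda>t. \<forall>p. norm p = t \<and> p \<in> sec v w \<longrightarrow> p \<in> sec \<gamma> \<delta>)"
    using assms(4,5)[unfolded le_def] arcs_ev[OF assms(1,2)] arcs_ev[OF assms(1,3)]
  proof eventually_elim
    case (elim t)
    show ?case
    proof (intro allI impI)
      fix p assume p: "norm p = t \<and> p \<in> sec v w"
      then have "ang (v t) p \<le> ang (v t) (w t)" using elim by (auto simp: sec_def)
      then have "ang (\<gamma> t) p \<le> ang (\<gamma> t) (w t)"
        using ang_between_iff[of "v t" "\<gamma> t" "w t" p] elim p by simp
      then show "p \<in> sec \<gamma> \<delta>" using p elim by (auto simp: sec_def)
    qed
  qed
  then obtain \<epsilon> where e: "0 < \<epsilon>" "\<And>t. 0 < t \<Longrightarrow> t < \<epsilon> \<Longrightarrow> \<forall>p. norm p = t \<and> p \<in> sec v w \<longrightarrow> p \<in> sec \<gamma> \<delta>"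
    by (rule evE) blast
  have "sec v w \<inter> ball 0 \<epsilon> \<subseteq> sec \<gamma> \<delta>"
  proof
    fix p assume p: "p \<in> sec v w \<inter> ball 0 \<epsilon>"
    show "p \<in> sec \<gamma> \<delta>"
    proof (cases "p = 0")
      case True then show ?thesis by (simp add: sec_def)
    next
      case False
      then have "0 < norm p" "norm p < \<epsilon>" "p \<in> sec v w" using p by auto
      then show ?thesis using e(2)[of "norm p"] by blast
    qed
  qed
  then show ?thesis unfolding germ_subset_def using e(1) by blast
qed

text \<open>If \<open>w\<close> came before \<open>v\<close>, the sector from \<open>v\<close> to
  \<open>w\<close> would run across the whole complement of the large sector and contain the
  bisector \<open>p\<close> of that complement.\<close>

lemma subsector_order_aux:
  assumes "narrow \<gamma> \<delta>" "narrow v w" "germ_subset (sec v w) (sec \<gamma> \<delta>)"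
  shows "le \<gamma> v w \<and> le \<gamma> w \<delta>"
proof -
  have g: "arc \<gamma>" "arc \<delta>" and a: "arc v" "arc w" using assms(1,2) unfolding narrow_def by auto
  obtain e where e: "0 < e" "sec v w \<inter> ball 0 e \<subseteq> sec \<gamma> \<delta>" using assms(3) unfolding germ_subset_def by blast
  have sub: "le \<gamma> z \<delta>" if z: "arc z" "le v z w" for z
  proof -
    have "arc_in z (sec v w)" using z arc_in_sec_iff by blast
    then have "arc_in z (sec \<gamma> \<delta>)"
      unfolding arc_in_def using arc_norm[OF z(1)] ev_less[OF e(1)]
    proof eventually_elim
      case (elim t)
      then have "z t \<in> sec v w \<inter> ball 0 e" by simp
      then show ?case using e(2) by blast
    qed
    then show ?thesis using z arc_in_sec_iff by blast
  qed
  have vd: "le \<gamma> v \<delta>" and wd: "le \<gamma> w \<delta>" using sub a le_base by auto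
  have "le \<gamma> v w"
  proof (rule ccontr)
    assume "\<not> le \<gamma> v w"
    then have "ev (\<lambda>t. ang (\<gamma> t) (w t) < ang (\<gamma> t) (v t))" using le_cases g a by blast
    then have "ev (\<lambda>t. False)"
      using vd[unfolded le_def] arcs_ev[OF g(1) a(1)] arcs_ev[OF g(1) a(2)] arcs_ev[OF g] ev_less[OF e(1)]
    proof eventually_elim
      case (elim t)
      let ?A = "ang (\<gamma> t) (\<delta> t)"
      define p where "p = rot (\<gamma> t) ((?A + 2 * pi) / 2)"
      have np: "norm p = t" using elim by (simp add: p_def)
      have ap: "ang (\<gamma> t) p = (?A + 2 * pi) / 2"
        unfolding p_def using elim(3) ang_bounds[of "\<gamma> t" "\<delta> t"] by (intro ang_rot) auto
      have A: "?A < ang (\<gamma> t) p" unfolding ap using ang_bounds(2)[of "\<gamma> t" "\<delta> t"] by simp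
      have "ang (v t) p = ang (\<gamma> t) p - ang (\<gamma> t) (v t)"
        using ang_shift[of "v t" "\<gamma> t" p] elim(2,3) np A by simp
      moreover have "ang (v t) (w t) = ang (\<gamma> t) (w t) - ang (\<gamma> t) (v t) + 2 * pi"
        using ang_shift[of "v t" "\<gamma> t" "w t"] elim(1,3,4) by simp
      ultimately have "ang (v t) p \<le> ang (v t) (w t)"
        using ang_bounds(2)[of "\<gamma> t" p] ang_bounds(1)[of "\<gamma> t" "w t"] by simp
      then have "p \<in> sec v w \<inter> ball 0 e" using np elim(6) by (simp add: sec_def)
      then have "p \<in> sec \<gamma> \<delta>" using e(2) by blast
      moreover have "p \<noteq> 0" using np elim(3) by auto
      ultimately show ?case using A np by (simp add: sec_def)
    qed
    then show False by simp
  qed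
  with wd show ?thesis by blast
qed

lemma subtriangleE:
  assumes "narrow \<gamma> \<delta>" "holder_triangle S \<beta> v w T'" "germ_subset T' (sec \<gamma> \<delta>)"
  obtains v' w' where "narrow v' w'" "le \<gamma> v' w'" "le \<gamma> w' \<delta>" "germ_eq T' (sec v' w')" "\<beta> = tord S v' w'"
proof -
  from holder_triangleD[OF assms(2)] obtain v' w' where
    *: "narrow v' w'" "germ_eq T' (sec v' w')" "\<beta> = tord S v' w'"
    using tord_commute[of S v w] by blast
  moreover have "le \<gamma> v' w' \<and> le \<gamma> w' \<delta>"
    using assms(1) *(1) germ_subset_cong[OF *(2) germ_eq_refl assms(3)] by (rule subsector_order_aux)
  ultimately show ?thesis using that by blast
qed

text \<open>In a narrow sector the distance of two arcs is t times their angular gap up to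
  constants, so the gap from x to z dominates both partial gaps. The opposite inequality is the
  triangle inequality.\<close>

lemma tord_nested:
  assumes "narrow \<gamma> \<delta>" "arc x" "arc y" "arc z" "le \<gamma> x y" "le \<gamma> y z" "le \<gamma> z \<delta>"
    and "\<not> arc_eq x y" "\<not> arc_eq y z"
  shows "tord S x z = min (tord S x y) (tord S y z)"
proof -
  have g: "arc \<gamma>" "arc \<delta>" using assms(1) unfolding narrow_def by auto
  have nxz: "\<not> arc_eq x z"
  proof
    assume "arc_eq x z"
    then have "le \<gamma> z x" using arc_eq_le arc_eq_sym by blast
    then have "le \<gamma> y x" using le_trans assms(6) by blast
    then show False using le_antisym g assms by blast
  qed
  obtain k where k: "0 < k" "ev (\<lambda>t. \<forall>p q. norm p = t \<and> norm q = t \<and> ang (\<gamma> t) p \<le> ang (\<gamma> t) (\<delta> t)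
      \<and> ang (\<gamma> t) q \<le> ang (\<gamma> t) (\<delta> t) \<longrightarrow> k * t * \<bar>ang (\<gamma> t) p - ang (\<gamma> t) q\<bar> \<le> norm (p - q))"
    using narrow_dist[OF assms(1)] .
  have small: "ev (\<lambda>t. norm (x t - y t) \<le> (1 / k) * norm (x t - z t) \<and> norm (y t - z t) \<le> (1 / k) * norm (x t - z t))"
    using k(2) assms(5-7)[unfolded le_def] arcs_ev[OF g(1) assms(2)] arcs_ev[OF g(1) assms(3)] arcs_ev[OF g(1) assms(4)]
  proof eventually_elim
    case (elim t)
    have "k * t * \<bar>ang (\<gamma> t) (x t) - ang (\<gamma> t) (z t)\<bar> \<le> norm (x t - z t)"
      by (rule elim(1)[rule_format]) (use elim(2-7) in simp)
    then have B: "t * (ang (\<gamma> t) (z t) - ang (\<gamma> t) (x t)) \<le> (1 / k) * norm (x t - z t)"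
      using elim(2,3) k(1) by (simp add: field_simps)
    have "norm (x t - y t) \<le> norm (\<gamma> t) * \<bar>ang (\<gamma> t) (x t) - ang (\<gamma> t) (y t)\<bar>"
      by (rule norm_diff_le_ang) (use elim(5-7) in simp_all)
    also have "\<dots> \<le> t * (ang (\<gamma> t) (z t) - ang (\<gamma> t) (x t))"
      using elim(2,3,5) by (simp add: mult_left_mono)
    finally have 1: "norm (x t - y t) \<le> (1 / k) * norm (x t - z t)" using B by simp
    have "norm (y t - z t) \<le> norm (\<gamma> t) * \<bar>ang (\<gamma> t) (y t) - ang (\<gamma> t) (z t)\<bar>"
      by (rule norm_diff_le_ang) (use elim(5-7) in simp_all)
    also have "\<dots> \<le> t * (ang (\<gamma> t) (z t) - ang (\<gamma> t) (x t))"
      using elim(2,3,5) by (simp add: mult_left_mono)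
    finally show ?case using 1 B by simp
  qed
  have "tord S x z \<le> tord S x y"
    by (rule tord_le[where C = "1 / k"]) (use assms nxz k(1) small in \<open>auto elim!: eventually_mono\<close>)
  moreover have "tord S x z \<le> tord S y z"
    by (rule tord_le[where C = "1 / k"]) (use assms nxz k(1) small in \<open>auto elim!: eventually_mono\<close>)
  moreover have "min (tord S x y) (tord S y z) \<le> tord S x z"
  proof -
    obtain k1 K1 where 1: "0 < k1" "0 < K1"
      "ev (\<lambda>t. k1 * t powr tord S x y \<le> norm (x t - y t) \<and> norm (x t - y t) \<le> K1 * t powr tord S x y)"
      using tord_bounds[OF assms(2,3,8)] .
    obtain k2 K2 where 2: "0 < k2" "0 < K2"
      "ev (\<lambda>t. k2 * t powr tord S y z \<le> norm (y t - z t) \<and> norm (y t - z t) \<le> K2 * t powr tord S y z)"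
      using tord_bounds[OF assms(3,4,9)] .
    obtain k3 K3 where 3: "0 < k3" "0 < K3"
      "ev (\<lambda>t. k3 * t powr tord S x z \<le> norm (x t - z t) \<and> norm (x t - z t) \<le> K3 * t powr tord S x z)"
      using tord_bounds[OF assms(2,4) nxz] .
    have "ev (\<lambda>t. k3 * t powr tord S x z \<le> (K1 + K2) * t powr min (tord S x y) (tord S y z))"
      using 1(3) 2(3) 3(3) ev_pos ev_less[OF zero_less_one]
    proof eventually_elim
      case (elim t)
      let ?m = "min (tord S x y) (tord S y z)"
      have "t powr tord S x y \<le> t powr ?m" "t powr tord S y z \<le> t powr ?m"
        using elim(4,5) by (intro powr_mono'; simp)+
      then have "K1 * t powr tord S x y \<le> K1 * t powr ?m" "K2 * t powr tord S y z \<le> K2 * t powr ?m"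
        using 1(2) 2(2) by (intro mult_left_mono; simp)+
      moreover have "norm (x t - z t) \<le> norm (x t - y t) + norm (y t - z t)"
        using norm_triangle_ineq[of "x t - y t" "y t - z t"] by simp
      ultimately show ?case using elim(1-3) unfolding distrib_right by linarith
    qed
    then show ?thesis using 3(1) by (rule powr_le_imp)
  qed
  ultimately show ?thesis by simp
qed

section \<open>Arcs at a prescribed order of contact\<close>

lemma arctan_lower: "0 \<le> s \<Longrightarrow> s \<le> 1 \<Longrightarrow> s / 2 \<le> arctan s"
proof -
  assume s: "0 \<le> s" "s \<le> 1"
  have le: "arctan s \<le> pi / 4" using arctan_le_iff[of s 1] s by (simp add: arctan_one)
  have ge: "0 \<le> arctan s" using s by simp
  have "1 / 2 \<le> cos (pi / 4)"
    using real_le_rsqrt[of 1 2] by (simp add: cos_45)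
  also have "cos (pi / 4) \<le> cos (arctan s)" using le ge by (intro cos_monotone_0_pi_le) auto
  finally have c: "1 / 2 \<le> cos (arctan s)" .
  have "s * cos (arctan s) = sin (arctan s)"
    using tan_arctan[of s] c by (simp add: tan_def field_simps)
  moreover have "s * (1 / 2) \<le> s * cos (arctan s)" using s c by (intro mult_left_mono) auto
  moreover have "sin (arctan s) \<le> arctan s" using ge by (rule sin_x_le_x)
  ultimately show ?thesis by simp
qed

text \<open>Rotating an arc \<open>b\<close> by the angle \<open>arctan (t\<^bsup>e-1\<^esup>)\<close> gives an arc at order of contact \<open>e\<close> with \<open>b\<close>.\<close>

lemma rotated_arc:
  fixes \<sigma> :: real
  assumes "arc b" "e \<in> E" "1 < e" "\<bar>\<sigma>\<bar> = 1"
  obtains z where "arc z" "ev (\<lambda>t. z t = rot (b t) (\<sigma> * arctan (t powr (e - 1))))"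
    "\<not> arc_eq z b" "tord S z b = e"
proof -
  obtain b' where b': "DF b'" "ev (\<lambda>t. b t = b' t)" using arc_DF[OF assms(1)] .
  \<comment> \<open>With x = t^(e - 1), cosine and sine of \<sigma> arctan x are 1 / sqrt (1 + x^2)
    and \<sigma> x / sqrt (1 + x^2). So the rotation is definable although its angle need not
    be.\<close>
  define c where "c t = 1 / norm (1::real, pw (e - 1) t)" for t
  define s where "s t = \<sigma> * pw (e - 1) t / norm (1::real, pw (e - 1) t)" for t
  define g where "g t = (fst (b' t) * c t - snd (b' t) * s t, fst (b' t) * s t + snd (b' t) * c t)" for t
  have "DF (pw (e - 1))" using E_diff[OF assms(2) E_1] E_iff by blast
  note pwDF = DF_comp[OF this DF_id]
  have "DF c" unfolding c_def[abs_def] by (intro DF_divide DF_norm def_intros pwDF)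
  moreover have "DF s" unfolding s_def[abs_def] by (intro DF_divide DF_norm def_intros pwDF)
  ultimately have "DF g" unfolding g_def[abs_def] by (intro def_intros b')
  have cs: "c t = cos (\<sigma> * arctan (t powr (e - 1))) \<and> s t = sin (\<sigma> * arctan (t powr (e - 1)))" if "0 < t" for t
  proof -
    have "norm (1::real, pw (e - 1) t) = sqrt (1 + (t powr (e - 1))\<^sup>2)"
      using that by (simp add: norm_Pair pw_def)
    moreover have "\<sigma> = 1 \<or> \<sigma> = - 1" using assms(4) by linarith
    ultimately show ?thesis using that
      by (auto simp: c_def s_def pw_def cos_arctan sin_arctan)
  qed
  have gr: "ev (\<lambda>t. g t = rot (b t) (\<sigma> * arctan (t powr (e - 1))))"
    using b'(2) ev_pos
  proof eventually_elim
    case (elim t)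
    then show ?case using cs[of t] by (simp add: g_def rot_def)
  qed
  define z where "z t = (if 0 < t then g t else 0)" for t
  have "ev (\<lambda>t. norm (g t) = t)" using gr arc_norm[OF assms(1)] by eventually_elim simp
  from arcI[OF \<open>DF g\<close> this] have z: "arc z" unfolding z_def .
  have zr: "ev (\<lambda>t. z t = rot (b t) (\<sigma> * arctan (t powr (e - 1))))"
    using gr ev_pos by eventually_elim (simp add: z_def)
  have bounds: "ev (\<lambda>t. 1 / (2 * pi) * t powr e \<le> norm (z t - b t) \<and> norm (z t - b t) \<le> 1 * t powr e)"
    using zr arc_norm[OF assms(1)] ev_pos ev_less[OF zero_less_one]
  proof eventually_elim
    case (elim t)
    define a where "a = arctan (t powr (e - 1))"
    have s1: "t powr (e - 1) \<le> 1" using elim(3,4) assms(3) by (intro powr_le1) auto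
    have a: "0 \<le> a" "a \<le> t powr (e - 1)" "a < pi / 2" "t powr (e - 1) / 2 \<le> a"
      unfolding a_def using s1 arctan_le_self[of "t powr (e - 1)"] arctan_ubound arctan_lower[of "t powr (e - 1)"] by auto
    have "norm (z t - b t) = 2 * t * \<bar>sin (\<sigma> * a / 2)\<bar>"
      using norm_rot_diff[of "b t" "\<sigma> * a" 0] elim(1,2) by (simp add: a_def)
    also have "\<bar>sin (\<sigma> * a / 2)\<bar> = sin (a / 2)"
    proof -
      have "0 \<le> sin (a / 2)" using a by (intro sin_ge_zero) auto
      moreover have "\<sigma> = 1 \<or> \<sigma> = - 1" using assms(4) by linarith
      ultimately show ?thesis by auto
    qed
    finally have d: "norm (z t - b t) = 2 * t * sin (a / 2)" .
    have te: "t * t powr (e - 1) = t powr e" using elim(3) by (simp add: powr_diff)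
    have "sin (a / 2) \<le> a / 2" using a by (intro sin_x_le_x) auto
    then have "2 * t * sin (a / 2) \<le> 2 * t * (a / 2)" using elim(3) by (intro mult_left_mono) auto
    also have "\<dots> \<le> t * t powr (e - 1)" using a(2) elim(3) by simp
    finally have up: "norm (z t - b t) \<le> t powr e" unfolding d te .
    have "a / (2 * pi) \<le> sin (a / 2)" using sin_half_lower[of pi a] a by simp
    then have "2 * t * (a / (2 * pi)) \<le> 2 * t * sin (a / 2)" using elim(3) by (intro mult_left_mono) auto
    moreover have "2 * t * (t powr (e - 1) / 2 / (2 * pi)) \<le> 2 * t * (a / (2 * pi))"
      using a(4) elim(3) by (intro mult_left_mono divide_right_mono) auto
    moreover have "2 * t * (t powr (e - 1) / 2 / (2 * pi)) = 1 / (2 * pi) * t powr e"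
      unfolding te[symmetric] by simp
    ultimately show ?case using up unfolding d by simp
  qed
  have "ev (\<lambda>t. z t \<noteq> b t)"
    using bounds ev_pos
  proof eventually_elim
    case (elim t)
    have "0 < 1 / (2 * pi) * t powr e" using elim(2) by simp
    then have "0 < norm (z t - b t)" using elim(1) by linarith
    then show ?case by auto
  qed
  then have ne: "\<not> arc_eq z b"
    unfolding arc_eq_def using eventually_False[of "at_right (0::real)"] trivial_limit_at_right_real
    by (auto dest: eventually_conj)
  moreover have "tord S z b = e"
    by (rule tord_eqI[OF z assms(1) ne _ _ bounds]) simp_all
  ultimately show ?thesis using that z zr by blast
qed

text \<open>The distance of \<open>v\<close> and \<open>w\<close> eventually exceeds t^e, hence
  their angular gap exceeds t^(e - 1), which is at least its arctangent. Rotating one of the two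
  arcs towards the other by this arctangent therefore does not overshoot.\<close>

lemma approach_aux:
  assumes "arc \<gamma>" "arc v" "arc w" "le \<gamma> v w" "\<not> arc_eq v w" "tord S v w < e"
  shows "ev (\<lambda>t. arctan (t powr (e - 1)) \<le> ang (\<gamma> t) (w t) - ang (\<gamma> t) (v t))"
proof -
  obtain k K where k: "0 < k" "0 < K"
    "ev (\<lambda>t. k * t powr tord S v w \<le> norm (v t - w t) \<and> norm (v t - w t) \<le> K * t powr tord S v w)"
    using tord_bounds[OF assms(2,3,5)] .
  show ?thesis
    using k(3) powr_less_ev[OF assms(6) k(1), of 1] assms(4)[unfolded le_def] arcs_ev[OF assms(1,2)] arcs_ev[OF assms(1,3)]
  proof eventually_elim
    case (elim t)
    have "t powr e < norm (v t - w t)" using elim(1,2) by simp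
    also have "\<dots> \<le> norm (\<gamma> t) * \<bar>ang (\<gamma> t) (v t) - ang (\<gamma> t) (w t)\<bar>"
      by (rule norm_diff_le_ang) (use elim(4,5) in simp_all)
    also have "\<dots> = t * (ang (\<gamma> t) (w t) - ang (\<gamma> t) (v t))" using elim(3,4) by simp
    finally have "t * t powr (e - 1) < t * (ang (\<gamma> t) (w t) - ang (\<gamma> t) (v t))"
      using elim(4) by (simp add: powr_diff)
    then have "t powr (e - 1) < ang (\<gamma> t) (w t) - ang (\<gamma> t) (v t)" using elim(4) by simp
    then show ?case using arctan_le_self[of "t powr (e - 1)"] by simp
  qed
qed

lemma approach_left:
  assumes "arc \<gamma>" "arc v" "arc w" "le \<gamma> v w" "\<not> arc_eq v w" "e \<in> E" "tord S v w < e"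
  obtains z where "arc z" "le \<gamma> v z" "le \<gamma> z w" "\<not> arc_eq z w" "tord S z w = e"
proof -
  have "1 < e" using tord_ge_1[OF assms(2,3,5)] assms(7) by simp
  then obtain z where z: "arc z" "ev (\<lambda>t. z t = rot (w t) (- 1 * arctan (t powr (e - 1))))"
    "\<not> arc_eq z w" "tord S z w = e" using rotated_arc[OF assms(3,6), of "- 1"] by auto
  have "ev (\<lambda>t. ang (\<gamma> t) (z t) = ang (\<gamma> t) (w t) - arctan (t powr (e - 1)))"
    using approach_aux[OF assms(1-5,7)] z(2) arcs_ev[OF assms(1,2)] arcs_ev[OF assms(1,3)]
  proof eventually_elim
    case (elim t)
    have "z t = rot (\<gamma> t) (ang (\<gamma> t) (w t) - arctan (t powr (e - 1)))"
      using elim(2,4) rot_rot[of "\<gamma> t" "ang (\<gamma> t) (w t)" "- arctan (t powr (e - 1))"] rot_ang[of "w t" "\<gamma> t"] by simp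
    moreover have "ang (\<gamma> t) (rot (\<gamma> t) (ang (\<gamma> t) (w t) - arctan (t powr (e - 1)))) = ang (\<gamma> t) (w t) - arctan (t powr (e - 1))"
    proof (rule ang_rot)
      have "0 \<le> arctan (t powr (e - 1))" by simp
      then show "0 \<le> ang (\<gamma> t) (w t) - arctan (t powr (e - 1))" "ang (\<gamma> t) (w t) - arctan (t powr (e - 1)) < 2 * pi"
        using elim(1) ang_bounds[of "\<gamma> t" "w t"] ang_bounds(1)[of "\<gamma> t" "v t"] by linarith+
    qed (use elim(3) in simp)
    ultimately show ?case by simp
  qed
  then have "ev (\<lambda>t. ang (\<gamma> t) (v t) \<le> ang (\<gamma> t) (z t) \<and> ang (\<gamma> t) (z t) \<le> ang (\<gamma> t) (w t))"
    using approach_aux[OF assms(1-5,7)] by eventually_elim simp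
  then have "le \<gamma> v z" "le \<gamma> z w" unfolding le_def by (auto elim!: eventually_mono)
  then show ?thesis using that z by blast
qed

lemma approach_right:
  assumes "arc \<gamma>" "arc v" "arc w" "le \<gamma> v w" "\<not> arc_eq v w" "e \<in> E" "tord S v w < e"
  obtains z where "arc z" "le \<gamma> v z" "le \<gamma> z w" "\<not> arc_eq v z" "tord S v z = e"
proof -
  have "1 < e" using tord_ge_1[OF assms(2,3,5)] assms(7) by simp
  then obtain z where z: "arc z" "ev (\<lambda>t. z t = rot (v t) (1 * arctan (t powr (e - 1))))"
    "\<not> arc_eq z v" "tord S z v = e" using rotated_arc[OF assms(2,6), of 1] by auto
  have "ev (\<lambda>t. ang (\<gamma> t) (z t) = ang (\<gamma> t) (v t) + arctan (t powr (e - 1)))"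
    using approach_aux[OF assms(1-5,7)] z(2) arcs_ev[OF assms(1,2)] arcs_ev[OF assms(1,3)]
  proof eventually_elim
    case (elim t)
    have "z t = rot (\<gamma> t) (ang (\<gamma> t) (v t) + arctan (t powr (e - 1)))"
      using elim(2,3) rot_rot[of "\<gamma> t" "ang (\<gamma> t) (v t)" "arctan (t powr (e - 1))"] rot_ang[of "v t" "\<gamma> t"] by simp
    moreover have "ang (\<gamma> t) (rot (\<gamma> t) (ang (\<gamma> t) (v t) + arctan (t powr (e - 1)))) = ang (\<gamma> t) (v t) + arctan (t powr (e - 1))"
    proof (rule ang_rot)
      have "0 \<le> arctan (t powr (e - 1))" by simp
      then show "0 \<le> ang (\<gamma> t) (v t) + arctan (t powr (e - 1))" "ang (\<gamma> t) (v t) + arctan (t powr (e - 1)) < 2 * pi"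
        using elim(1) ang_bounds[of "\<gamma> t" "w t"] ang_bounds(1)[of "\<gamma> t" "v t"] by linarith+
    qed (use elim(3) in simp)
    ultimately show ?case by simp
  qed
  then have "ev (\<lambda>t. ang (\<gamma> t) (v t) \<le> ang (\<gamma> t) (z t) \<and> ang (\<gamma> t) (z t) \<le> ang (\<gamma> t) (w t))"
    using approach_aux[OF assms(1-5,7)] by eventually_elim simp
  then have "le \<gamma> v z" "le \<gamma> z w" unfolding le_def by (auto elim!: eventually_mono)
  moreover have "\<not> arc_eq v z" "tord S v z = e" using z arc_eq_sym tord_commute by metis+
  ultimately show ?thesis using that z by blast
qed

end

section \<open>Orders of the function along arcs\<close>

lemma slope_pt_inj: "p \<noteq> 0 \<Longrightarrow> slope_pt p u = slope_pt p v \<longleftrightarrow> u = v"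
  using ang_slope_pt[of p u] ang_slope_pt[of p v] arctan_eq_iff[of u v] by auto

text \<open>In the parameter of \<open>slope_pt\<close> the base point sits at minus infinity, so
  the value at the start of the circle appears as a limit \<open>a\<close> at \<open>at_bot\<close>.
  Since \<open>h\<close> is close to \<open>a\<close> there, the crossings of the level
  \<open>c\<close> are bounded below, and as a closed set they contain their infimum.\<close>

lemma first_crossing:
  fixes h :: "real \<Rightarrow> real"
  assumes "continuous_on UNIV h" "(h \<longlongrightarrow> a) at_bot" "a < c \<and> c < h b \<or> h b < c \<and> c < a"
  defines "A \<equiv> {u. h u = c \<and> u \<le> b}"
  shows "A \<noteq> {}" "bdd_below A" "Inf A \<in> A"
proof -
  have "eventually (\<lambda>u. (a < c \<and> h u < c) \<or> (c < a \<and> c < h u)) at_bot"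
    using assms(3)
  proof (elim disjE conjE)
    assume "a < c"
    from order_tendstoD(2)[OF assms(2) this] show ?thesis by (rule eventually_mono) (use \<open>a < c\<close> in simp)
  next
    assume "c < a"
    from order_tendstoD(1)[OF assms(2) this] show ?thesis by (rule eventually_mono) (use \<open>c < a\<close> in simp)
  qed
  then obtain N where N: "\<And>u. u \<le> N \<Longrightarrow> (a < c \<and> h u < c) \<or> (c < a \<and> c < h u)"
    by (auto simp: eventually_at_bot_linorder)
  define u0 where "u0 = min N b"
  have cont: "continuous_on {u0..b} h" using assms(1) by (rule continuous_on_subset) simp
  have "\<exists>u\<ge>u0. u \<le> b \<and> h u = c"
  proof (cases "a < c")
    case True
    then show ?thesis using N[of u0] assms(3) by (intro IVT' cont) (auto simp: u0_def)
  next
    case False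
    then show ?thesis using N[of u0] assms(3) by (intro IVT2' cont) (auto simp: u0_def)
  qed
  then show ne: "A \<noteq> {}" unfolding A_def by blast
  have "N \<le> u" if "u \<in> A" for u using that N[of u] by (force simp: A_def)
  then show bd: "bdd_below A" by (auto simp: bdd_below_def)
  have "closed A"
  proof -
    have "A = {u. h u = c} \<inter> {..b}" by (auto simp: A_def)
    moreover have "closed {u. h u = c}" by (intro closed_Collect_eq assms(1) continuous_intros)
    ultimately show ?thesis by (simp add: closed_Int)
  qed
  then show "Inf A \<in> A" using ne bd closed_contains_Inf by blast
qed

locale function_germ = pb_o_minimal +
  fixes f :: "real \<times> real \<Rightarrow> real"
  assumes f_germ: "definable_continuous_germ S f"
begin

abbreviation ordf :: "(real \<Rightarrow> real \<times> real) \<Rightarrow> ereal" where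
  "ordf \<equiv> ord_along S f"

lemma f_DF:
  obtains f' \<epsilon> where "DF f'" "0 < \<epsilon>" "\<And>p. norm p < \<epsilon> \<Longrightarrow> f' p = f p" "continuous_on (ball 0 \<epsilon>) f"
proof -
  obtain \<epsilon> where e: "0 < \<epsilon>" "continuous_on (ball 0 \<epsilon>) f"
    "{[x, y, f (x, y)] | x y. (x, y) \<in> ball 0 \<epsilon>} \<in> S 3"
    using f_germ unfolding definable_continuous_germ_def by blast
  have "coords ` {z. fst z \<in> ball 0 \<epsilon> \<and> snd z = f (fst z)} = {[x, y, f (x, y)] | x y. (x, y) \<in> ball 0 \<epsilon>}"
    by (auto simp: coords_prod_def coords_real_def image_iff)
  then have *: "D (\<lambda>z. norm (fst z) < \<epsilon> \<and> snd z = f (fst z))"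
    using e(3) unfolding D_def by (simp add: arity_prod_def arity_real_def numeral_3_eq_3)
  define f' where "f' p = (if norm p < \<epsilon> then f p else 0)" for p
  have "D (\<lambda>z::(real \<times> real) \<times> real. (norm (fst z) < \<epsilon> \<and> snd z = f (fst z)) \<or> (\<not> norm (fst z) < \<epsilon> \<and> snd z = 0))"
    by (rule D_disj[OF *]) (intro def_intros DF_norm)
  moreover have "(\<lambda>z::(real \<times> real) \<times> real. (norm (fst z) < \<epsilon> \<and> snd z = f (fst z)) \<or> (\<not> norm (fst z) < \<epsilon> \<and> snd z = 0))
      = (\<lambda>z. snd z = f' (fst z))" by (auto simp: fun_eq_iff f'_def)
  ultimately have "DF f'" unfolding DF_def by simp
  then show ?thesis using that[of f' \<epsilon>] e by (simp add: f'_def)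
qed

lemma f_along_tendsto_0:
  assumes "arc v" shows "((\<lambda>t. f (v t)) \<longlongrightarrow> 0) (at_right 0)"
proof -
  obtain \<epsilon> where e: "0 < \<epsilon>" "continuous_on (ball 0 \<epsilon>) f"
    using f_germ unfolding definable_continuous_germ_def by blast
  then have "isCont f 0" by (simp add: continuous_on_eq_continuous_at)
  moreover have "(v \<longlongrightarrow> 0) (at_right 0)"
  proof (rule tendsto_norm_zero_cancel, rule Lim_transform_eventually[OF tendsto_ident_at])
    show "ev (\<lambda>t. t = norm (v t))" using arc_norm[OF assms] by eventually_elim simp
  qed
  ultimately have "((\<lambda>t. f (v t)) \<longlongrightarrow> f 0) (at_right 0)" by (rule isCont_tendsto_compose)
  then show ?thesis using f_germ unfolding definable_continuous_germ_def by simp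
qed

lemma ord_spec:
  assumes "arc v"
  shows "(ordf v = \<infinity> \<and> ev (\<lambda>t. f (v t) = 0)) \<or>
    (\<exists>\<alpha> k K. ordf v = ereal \<alpha> \<and> \<alpha> \<in> E \<and> 0 < \<alpha> \<and> 0 < k \<and> 0 < K \<and>
       ev (\<lambda>t. k * t powr \<alpha> \<le> \<bar>f (v t)\<bar> \<and> \<bar>f (v t)\<bar> \<le> K * t powr \<alpha>))"
proof (cases "ev (\<lambda>t. f (v t) = 0)")
  case True
  then show ?thesis unfolding ord_along_def by simp
next
  case False
  obtain f' \<epsilon> where f': "DF f'" "0 < \<epsilon>" "\<And>p. norm p < \<epsilon> \<Longrightarrow> f' p = f p" using f_DF by metis
  obtain v' where v': "DF v'" "ev (\<lambda>t. v t = v' t)" using arc_DF[OF assms] .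
  have eq: "ev (\<lambda>t. f' (v' t) = f (v t))"
    using v'(2) arc_norm[OF assms] ev_less[OF f'(2)]
  proof eventually_elim
    case (elim t)
    have "f' (v' t) = f (v' t)" by (rule f'(3)) (use elim in simp)
    then show ?case using elim by simp
  qed
  have "DF (\<lambda>t. f' (v' t))" by (intro DF_comp[OF f'(1)] v')
  moreover have "\<not> ev (\<lambda>t. f' (v' t) = 0)"
  proof
    assume "ev (\<lambda>t. f' (v' t) = 0)"
    with eq have "ev (\<lambda>t. f (v t) = 0)" by eventually_elim simp
    with False show False by blast
  qed
  ultimately obtain r c where rc: "r \<in> E" "c \<noteq> 0" "((\<lambda>t. f' (v' t) / t powr r) \<longlongrightarrow> c) (at_right 0)"
    by (rule asymptotic)
  have lim: "((\<lambda>t. f (v t) / t powr r) \<longlongrightarrow> c) (at_right 0)"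
    by (rule Lim_transform_eventually[OF rc(3)]) (use eq in \<open>auto elim!: eventually_mono\<close>)
  note b = asymptotic_bounds[OF lim rc(2)]
  \<comment> \<open>The function tends to 0 along the arc by continuity, whereas an exponent r \<le>
    0 would keep its absolute value above \<bar>c\<bar> / 2.\<close>
  have "0 < r"
  proof (rule ccontr)
    assume "\<not> 0 < r"
    have "ev (\<lambda>t. \<bar>c\<bar> / 2 \<le> \<bar>f (v t)\<bar>)"
      using b ev_pos ev_less[OF zero_less_one]
    proof eventually_elim
      case (elim t)
      have "t powr 0 \<le> t powr r" using elim(2,3) \<open>\<not> 0 < r\<close> by (intro powr_mono') auto
      then have "\<bar>c\<bar> / 2 * 1 \<le> \<bar>c\<bar> / 2 * t powr r" using elim(2) by (intro mult_left_mono) auto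
      then show ?case using elim(1) by linarith
    qed
    moreover have "((\<lambda>t. \<bar>f (v t)\<bar>) \<longlongrightarrow> \<bar>0\<bar>) (at_right 0)"
      by (rule tendsto_rabs[OF f_along_tendsto_0[OF assms]])
    ultimately have "\<bar>c\<bar> / 2 \<le> \<bar>0\<bar>" by (intro tendsto_lowerbound) auto
    then show False using rc(2) by simp
  qed
  have "(THE \<alpha>. \<alpha> \<in> E \<and> 0 < \<alpha> \<and> (\<exists>a. a \<noteq> 0 \<and> ((\<lambda>t. f (v t) / t powr \<alpha>) \<longlongrightarrow> a) (at_right 0))) = r"
  proof (rule the_equality)
    show "r \<in> E \<and> 0 < r \<and> (\<exists>a. a \<noteq> 0 \<and> ((\<lambda>t. f (v t) / t powr r) \<longlongrightarrow> a) (at_right 0))"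
      using rc lim \<open>0 < r\<close> by blast
  qed (use asymptotic_unique[OF _ _ lim rc(2)] in blast)
  then have "ordf v = ereal r" unfolding ord_along_def smallo_powr_iff using False by simp
  then show ?thesis
    using rc \<open>0 < r\<close> b by (intro disjI2 exI[of _ r] exI[of _ "\<bar>c\<bar> / 2"] exI[of _ "2 * \<bar>c\<bar>"]) simp
qed

lemma ord_in_order_values: "arc v \<Longrightarrow> ordf v \<in> order_values S"
  using ord_spec[of v] unfolding order_values_def by auto

lemma ord_eqI:
  assumes "arc v" "0 < k" "0 < K" "ev (\<lambda>t. k * t powr \<alpha> \<le> \<bar>f (v t)\<bar> \<and> \<bar>f (v t)\<bar> \<le> K * t powr \<alpha>)"
  shows "ordf v = ereal \<alpha>"
  using ord_spec[OF assms(1)]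
proof (elim disjE exE conjE)
  assume "ev (\<lambda>t. f (v t) = 0)"
  with assms(4) have "ev (\<lambda>t. False)"
    using ev_pos
  proof eventually_elim
    case (elim t)
    have "0 < k * t powr \<alpha>" using elim(3) assms(2) by simp
    then show ?case using elim(1,2) by simp
  qed
  then show ?thesis by simp
next
  fix \<beta> k' K' assume *: "ordf v = ereal \<beta>" "0 < k'" "0 < K'"
    "ev (\<lambda>t. k' * t powr \<beta> \<le> \<bar>f (v t)\<bar> \<and> \<bar>f (v t)\<bar> \<le> K' * t powr \<beta>)"
  have "\<beta> \<le> \<alpha>"
    by (rule powr_le_imp[of k \<alpha> K']) (use assms *(4) in \<open>auto elim: eventually_elim2\<close>)
  moreover have "\<alpha> \<le> \<beta>"
    by (rule powr_le_imp[of k' \<beta> K]) (use assms * in \<open>auto elim: eventually_elim2\<close>)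
  ultimately show ?thesis using *(1) by simp
qed

lemma ord_less:
  assumes "arc v" "ordf v < ereal q" shows "ev (\<lambda>t. t powr q < \<bar>f (v t)\<bar>)"
  using ord_spec[OF assms(1)]
proof (elim disjE exE conjE)
  fix \<beta> k' K' assume *: "ordf v = ereal \<beta>" "0 < k'"
    "ev (\<lambda>t. k' * t powr \<beta> \<le> \<bar>f (v t)\<bar> \<and> \<bar>f (v t)\<bar> \<le> K' * t powr \<beta>)"
  have "\<beta> < q" using assms(2) *(1) by simp
  from *(3) powr_less_ev[OF this *(2), of 1] show ?thesis by eventually_elim simp
qed (use assms in auto)

lemma ord_greater:
  assumes "arc v" "ereal q < ordf v" shows "ev (\<lambda>t. \<bar>f (v t)\<bar> < t powr q)"
  using ord_spec[OF assms(1)]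
proof (elim disjE exE conjE)
  fix \<beta> k' K' assume *: "ordf v = ereal \<beta>"
    "ev (\<lambda>t. k' * t powr \<beta> \<le> \<bar>f (v t)\<bar> \<and> \<bar>f (v t)\<bar> \<le> K' * t powr \<beta>)"
  have "q < \<beta>" using assms(2) *(1) by simp
  from *(2) powr_less_ev[OF this zero_less_one, of K'] show ?thesis by eventually_elim simp
next
  assume "ev (\<lambda>t. f (v t) = 0)"
  then show ?thesis using ev_pos by eventually_elim simp
qed

text \<open>The intermediate arc is traced by the first point, counted from \<open>v\<close>, at which
  \<open>\<bar>f\<bar> = t\<^sup>q\<close> on the circle of radius \<open>t\<close>.\<close>

lemma intermediate_arc:
  assumes v: "arc v" and w: "arc w" and q: "q \<in> E"
    and between: "ordf v < ereal q \<and> ereal q < ordf w \<or> ordf w < ereal q \<and> ereal q < ordf v"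
  obtains z where "arc z" "le v z w" "ordf z = ereal q"
proof -
  obtain f' \<epsilon> where f': "DF f'" "0 < \<epsilon>" "\<And>p. norm p < \<epsilon> \<Longrightarrow> f' p = f p" and cf: "continuous_on (ball 0 \<epsilon>) f"
    using f_DF by metis
  obtain v' where v': "DF v'" "ev (\<lambda>t. v t = v' t)" using arc_DF[OF v] .
  obtain w' where w': "DF w'" "ev (\<lambda>t. w t = w' t)" using arc_DF[OF w] .
  \<comment> \<open>\<open>b\<close> is the parameter of \<open>w\<close> as seen from
    \<open>v\<close>, so the bound on \<open>u\<close> keeps the crossing point in the sector from
    \<open>v\<close> to \<open>w\<close>.\<close>
  define P where "P t u \<longleftrightarrow> \<bar>f' (slope_pt (v' t) u)\<bar> = pw q t \<and> (\<exists>b. w' t = slope_pt (v' t) b \<and> u \<le> b)" for t u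
  define m where "m t = (if (\<exists>u. P t u) \<and> (\<exists>b. \<forall>u. P t u \<longrightarrow> b \<le> u) then Inf {u. P t u} else 0)" for t
  have "D (\<lambda>z. P (fst z) (snd z))"
    unfolding P_def
    by (intro def_intros DF_abs DF_pw q DF_slope_pt DF_comp[OF f'(1)] DF_comp[OF v'(1)] DF_comp[OF w'(1)])
  from DF_Inf[OF this] have m: "DF m" unfolding m_def[abs_def] .
  define g where "g t = slope_pt (v' t) (m t)" for t
  have "DF g" unfolding g_def[abs_def] by (intro DF_slope_pt v' m)
  have "ev (\<lambda>t. \<bar>f (v t)\<bar> < t powr q \<and> t powr q < \<bar>f (w t)\<bar> \<or> \<bar>f (w t)\<bar> < t powr q \<and> t powr q < \<bar>f (v t)\<bar>)"
    using between
  proof (elim disjE conjE)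
    assume "ordf v < ereal q" "ereal q < ordf w"
    from ord_less[OF v this(1)] ord_greater[OF w this(2)] show ?thesis by eventually_elim simp
  next
    assume "ordf w < ereal q" "ereal q < ordf v"
    from ord_less[OF w this(1)] ord_greater[OF v this(2)] show ?thesis by eventually_elim simp
  qed
  then have main: "ev (\<lambda>t. norm (g t) = t \<and> \<bar>f (g t)\<bar> = t powr q \<and> ang (v t) (g t) \<le> ang (v t) (w t))"
    using v'(2) w'(2) arcs_ev[OF v w] ev_less[OF f'(2)]
  proof eventually_elim
    case (elim t)
    let ?h = "\<lambda>u. \<bar>f (slope_pt (v t) u)\<bar>"
    have nv: "norm (v t) = t" "v t \<noteq> 0" "norm (w t) = norm (v t)" and t: "0 < t" "t < \<epsilon>" using elim(4,5) by auto
    have "w t \<noteq> v t" using elim(1) by auto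
    then obtain b where b: "w t = slope_pt (v t) b" using slope_pt_surj nv by metis
    have cont: "continuous_on UNIV ?h"
    proof -
      have "continuous_on UNIV (\<lambda>u. slope_pt (v t) u)"
        unfolding slope_pt_rot by (intro continuous_intros)
      then have "continuous_on UNIV (\<lambda>u. f (slope_pt (v t) u))"
        by (rule continuous_on_compose2[OF cf]) (use nv t in auto)
      then show ?thesis by (intro continuous_intros)
    qed
    have lim: "(?h \<longlongrightarrow> \<bar>f (v t)\<bar>) at_bot"
    proof -
      have "continuous_on UNIV (\<lambda>x. rot (v t) x)" by (intro continuous_intros)
      then have "isCont (\<lambda>x. rot (v t) x) 0" by (simp add: continuous_on_eq_continuous_at)
      moreover have "((\<lambda>u. pi + 2 * arctan u) \<longlongrightarrow> pi + 2 * - (pi / 2)) at_bot"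
        by (intro tendsto_intros tendsto_arctan_at_bot)
      ultimately have "((\<lambda>u. rot (v t) (pi + 2 * arctan u)) \<longlongrightarrow> rot (v t) 0) at_bot"
        by (intro isCont_tendsto_compose[where g = "\<lambda>x. rot (v t) x"]) simp_all
      then have "((\<lambda>u. slope_pt (v t) u) \<longlongrightarrow> v t) at_bot" by (simp add: slope_pt_rot)
      moreover have "isCont f (v t)"
        using cf nv t by (simp add: continuous_on_eq_continuous_at)
      ultimately show ?thesis by (intro tendsto_rabs) (rule isCont_tendsto_compose)
    qed
    have P: "P t u \<longleftrightarrow> ?h u = t powr q \<and> u \<le> b" for u
    proof -
      have "f' (slope_pt (v t) u) = f (slope_pt (v t) u)" by (rule f'(3)) (use nv t in simp)
      moreover have "(\<exists>b'. slope_pt (v t) b = slope_pt (v t) b' \<and> u \<le> b') \<longleftrightarrow> u \<le> b"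
        using slope_pt_inj[OF nv(2)] by auto
      ultimately show ?thesis
        unfolding P_def using elim(2,3) b t by (simp add: pw_def)
    qed
    have "\<bar>f (v t)\<bar> < t powr q \<and> t powr q < ?h b \<or> ?h b < t powr q \<and> t powr q < \<bar>f (v t)\<bar>"
      using elim(1) unfolding b[symmetric] .
    from first_crossing[OF cont lim this]
    have ne: "{u. P t u} \<noteq> {}" and bd: "bdd_below {u. P t u}" and i: "Inf {u. P t u} \<in> {u. P t u}"
      unfolding P by auto
    have "m t = Inf {u. P t u}" unfolding m_def using ne bd by (auto simp: bdd_below_def)
    then have mt: "?h (m t) = t powr q" "m t \<le> b" using i P by auto
    have gt: "g t = slope_pt (v t) (m t)" unfolding g_def using elim(2) by simp
    have "ang (v t) (g t) \<le> ang (v t) (w t)"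
      unfolding gt b using ang_slope_pt[OF nv(2)] mt(2) by (simp add: arctan_le_iff)
    then show ?case using gt mt(1) nv(1) by simp
  qed
  define z where "z t = (if 0 < t then g t else 0)" for t
  have "ev (\<lambda>t. norm (g t) = t)" using main by eventually_elim simp
  from arcI[OF \<open>DF g\<close> this] have z: "arc z" unfolding z_def .
  have "ev (\<lambda>t. \<bar>f (z t)\<bar> = t powr q \<and> ang (v t) (z t) \<le> ang (v t) (w t))"
    using main ev_pos by eventually_elim (simp add: z_def)
  then have "ev (\<lambda>t. \<bar>f (z t)\<bar> = t powr q)" "le v z w"
    unfolding le_def by (auto elim!: eventually_mono)
  moreover from this(1) have "ordf z = ereal q"
    by (intro ord_eqI[OF z zero_less_one zero_less_one]) (auto elim!: eventually_mono)
  ultimately show ?thesis using that z by blast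
qed

text \<open>The exponents over which the relative width is an infimum, with each test triangle
  replaced by its two sides and its order set by the orders of the arcs between them; see
  \<open>relative_width_sec\<close>.\<close>

definition wset :: "(real \<Rightarrow> real \<times> real) \<Rightarrow> (real \<Rightarrow> real \<times> real) \<Rightarrow> (real \<Rightarrow> real \<times> real) \<Rightarrow> ereal set" where
  "wset \<gamma> \<delta> \<eta> = {ereal (tord S v w) | v w. arc v \<and> arc w \<and> \<not> arc_eq v w \<and> le \<gamma> v w \<and> le \<gamma> w \<delta> \<and>
     le \<gamma> v \<eta> \<and> le \<gamma> \<eta> w \<and> (\<forall>z. arc z \<and> le \<gamma> v z \<and> le \<gamma> z w \<longrightarrow> ordf z = ordf \<eta>)}"

lemma order_set_sec:
  assumes "germ_eq T (sec \<gamma> \<delta>)"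
  shows "order_set S f T = {ordf v | v. arc v \<and> le \<gamma> v \<delta>}"
  unfolding order_set_def using germ_eq_arc_in[OF assms arc_norm] arc_in_sec_iff by blast

lemma relative_width_sec:
  assumes n: "narrow \<gamma> \<delta>" and T: "germ_eq T (sec \<gamma> \<delta>)" and \<eta>: "arc \<eta>"
  shows "relative_width S f T \<eta> = Inf (wset \<gamma> \<delta> \<eta>)"
proof -
  have g: "arc \<gamma>" "arc \<delta>" using n unfolding narrow_def by auto
  have "{ereal \<beta> | \<beta>. \<exists>\<gamma>1 \<gamma>2 T'. holder_triangle S \<beta> \<gamma>1 \<gamma>2 T' \<and> arc_in \<eta> T' \<and> germ_subset T' T \<and>
                        (\<exists>q. order_set S f T' = {q})} = wset \<gamma> \<delta> \<eta>" (is "?L = _")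
  proof (intro set_eqI iffI)
    fix b assume "b \<in> ?L"
    then obtain \<beta> \<gamma>1 \<gamma>2 T' q where *: "b = ereal \<beta>" "holder_triangle S \<beta> \<gamma>1 \<gamma>2 T'" "arc_in \<eta> T'"
      "germ_subset T' T" "order_set S f T' = {q}" by blast
    have "germ_subset T' (sec \<gamma> \<delta>)" using germ_subset_cong[OF germ_eq_refl T *(4)] .
    from subtriangleE[OF n *(2) this] obtain v w where
      vw: "narrow v w" "le \<gamma> v w" "le \<gamma> w \<delta>" "germ_eq T' (sec v w)" "\<beta> = tord S v w" .
    have a: "arc v" "arc w" "\<not> arc_eq v w" using vw(1) unfolding narrow_def by auto
    have "le v \<eta> w" using *(3) germ_eq_arc_in[OF vw(4) arc_norm[OF \<eta>]] arc_in_sec_iff[OF \<eta>] by blast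
    then have e: "le \<gamma> v \<eta>" "le \<gamma> \<eta> w" using le_between[OF g(1) a(1,2) \<eta> vw(2)] by auto
    have os: "{ordf z | z. arc z \<and> le v z w} = {q}" using order_set_sec[OF vw(4)] *(5) by simp
    have "ordf z = ordf \<eta>" if "arc z" "le \<gamma> v z" "le \<gamma> z w" for z
    proof -
      have "le v z w" using le_between[OF g(1) a(1,2) that(1) vw(2)] that by blast
      then have "ordf z = q" using os that(1) by blast
      moreover have "ordf \<eta> = q" using os \<open>le v \<eta> w\<close> \<eta> by blast
      ultimately show ?thesis by simp
    qed
    then show "b \<in> wset \<gamma> \<delta> \<eta>" unfolding wset_def using * vw a e by blast
  next
    fix b assume "b \<in> wset \<gamma> \<delta> \<eta>"
    then obtain v w where *: "b = ereal (tord S v w)" "arc v" "arc w" "\<not> arc_eq v w" "le \<gamma> v w" "le \<gamma> w \<delta>"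
      "le \<gamma> v \<eta>" "le \<gamma> \<eta> w" "\<And>z. arc z \<Longrightarrow> le \<gamma> v z \<Longrightarrow> le \<gamma> z w \<Longrightarrow> ordf z = ordf \<eta>"
      unfolding wset_def by blast
    have "holder_triangle S (tord S v w) v w (sec v w)"
      by (rule holder_triangle_sec[OF narrow_sub[OF n *(2,3,5,6,4)]])
    moreover have "le v \<eta> w" using le_between[OF g(1) *(2,3) \<eta> *(5)] * by blast
    then have "arc_in \<eta> (sec v w)" using arc_in_sec_iff[OF \<eta>] by blast
    moreover have "germ_subset (sec v w) T"
      using germ_subset_cong[OF germ_eq_refl germ_eq_sym[OF T] sec_subset[OF g(1) *(2,3,5,6)]] .
    moreover have "order_set S f (sec v w) = {ordf \<eta>}"
      unfolding order_set_sec[OF germ_eq_refl]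
      using le_between[OF g(1) *(2,3) _ *(5)] *(9) \<open>le v \<eta> w\<close> \<eta> by blast
    ultimately show "b \<in> ?L" using *(1) by blast
  qed
  then show ?thesis unfolding relative_width_def by simp
qed

lemma elementary_sec:
  assumes n: "narrow \<gamma> \<delta>" and T: "germ_eq T (sec \<gamma> \<delta>)" and el: "elementary S f T"
    and a: "arc v" "arc w" "arc z" "le \<gamma> v w" "le \<gamma> w \<delta>" "le \<gamma> v z" "le \<gamma> z w" "ordf v = ordf w"
  shows "ordf z = ordf v"
proof (cases "arc_eq v w")
  \<comment> \<open>\<open>elementary\<close> speaks of disjoint sides only. When the two arcs
    agree, the order squeezes \<open>z\<close> onto them.\<close>
  case True
  have g: "arc \<gamma>" using n unfolding narrow_def by auto
  have "le \<gamma> w v" using True arc_eq_le arc_eq_sym by blast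
  then have "arc_eq v z" using le_antisym[OF g a(1,3,6)] le_trans[OF a(7)] by blast
  then show ?thesis using ord_along_cong by metis
next
  case False
  have g: "arc \<gamma>" using n unfolding narrow_def by auto
  have "holder_triangle S (tord S v w) v w (sec v w)"
    by (rule holder_triangle_sec[OF narrow_sub[OF n a(1,2,4,5) False]])
  moreover have "germ_subset (sec v w) T"
    using germ_subset_cong[OF germ_eq_refl germ_eq_sym[OF T] sec_subset[OF g a(1,2,4,5)]] .
  moreover have "arc_disjoint v w" using arc_eq_cases[OF a(1,2)] False unfolding arc_disjoint_def by blast
  moreover have "arc_in v T" "arc_in w T"
    using germ_eq_arc_in[OF T arc_norm] arc_in_sec_iff a le_trans by blast+
  moreover have "arc_in z (sec v w)" using arc_in_sec_iff[OF a(3)] le_between[OF g a(1,2,3,4)] a by blast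
  ultimately show ?thesis using el a unfolding elementary_def by metis
qed

end

section \<open>Widths on a linearly ordered set of arcs\<close>

text \<open>An abstraction of the arcs in a narrow sector, ordered by position, with order of tangency \<open>d\<close>
  and order \<open>h\<close> of the function. It is invariant under reversal of \<open>lq\<close>.\<close>

definition strictly_between :: "ereal \<Rightarrow> ereal \<Rightarrow> ereal \<Rightarrow> bool" where
  "strictly_between a b p \<longleftrightarrow> a < p \<and> p < b \<or> b < p \<and> p < a"

locale arc_order =
  fixes A :: "'a set" and lq :: "'a \<Rightarrow> 'a \<Rightarrow> bool" and d :: "'a \<Rightarrow> 'a \<Rightarrow> real"
    and h :: "'a \<Rightarrow> ereal" and F :: "real set"
  assumes lq_refl: "x \<in> A \<Longrightarrow> lq x x"
    and lq_trans: "\<lbrakk>x \<in> A; y \<in> A; z \<in> A; lq x y; lq y z\<rbrakk> \<Longrightarrow> lq x z"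
    and lq_total: "x \<in> A \<Longrightarrow> y \<in> A \<Longrightarrow> lq x y \<or> lq y x"
    and d_sym: "d x y = d y x"
    and d_nested: "\<lbrakk>x \<in> A; y \<in> A; z \<in> A; lq x y; \<not> lq y x; lq y z; \<not> lq z y\<rbrakk> \<Longrightarrow> d x z = min (d x y) (d y z)"
    and d_cong: "\<lbrakk>x \<in> A; x' \<in> A; y \<in> A; lq x x'; lq x' x\<rbrakk> \<Longrightarrow> d x y = d x' y"
    and approach: "\<lbrakk>x \<in> A; y \<in> A; lq x y; \<not> lq y x; e \<in> F; d x y < e\<rbrakk> \<Longrightarrow> \<exists>z\<in>A. lq x z \<and> lq z y \<and> \<not> lq y z \<and> d z y = e"
    and approach': "\<lbrakk>x \<in> A; y \<in> A; lq x y; \<not> lq y x; e \<in> F; d x y < e\<rbrakk> \<Longrightarrow> \<exists>z\<in>A. lq x z \<and> \<not> lq z x \<and> lq z y \<and> d x z = e"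
    and intermediate: "\<lbrakk>x \<in> A; y \<in> A; lq x y; q \<in> F; strictly_between (h x) (h y) (ereal q)\<rbrakk> \<Longrightarrow> \<exists>z\<in>A. lq x z \<and> lq z y \<and> h z = ereal q"
    and h_cong: "\<lbrakk>x \<in> A; y \<in> A; lq x y; lq y x\<rbrakk> \<Longrightarrow> h x = h y"
    and h_values: "x \<in> A \<Longrightarrow> h x \<in> ereal ` {r \<in> F. 0 < r} \<union> {\<infinity>}"
    and F_dense: "\<And>x y::real. x < y \<Longrightarrow> \<exists>e\<in>F. x < e \<and> e < y"
begin

abbreviation V :: "ereal set" where "V \<equiv> ereal ` {r \<in> F. 0 < r} \<union> {\<infinity>}"

definition W :: "'a \<Rightarrow> 'a \<Rightarrow> 'a \<Rightarrow> ereal set" where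
  "W a b x = {ereal (d v w) | v w. v \<in> A \<and> w \<in> A \<and> \<not> lq w v \<and> lq v w \<and> lq a v \<and> lq w b \<and>
     lq v x \<and> lq x w \<and> (\<forall>z\<in>A. lq v z \<and> lq z w \<longrightarrow> h z = h x)}"

definition elem :: "'a \<Rightarrow> 'a \<Rightarrow> bool" where
  "elem a b \<longleftrightarrow> (\<forall>v\<in>A. \<forall>w\<in>A. \<forall>z\<in>A. lq a v \<and> lq w b \<and> lq v z \<and> lq z w \<and> h v = h w \<longrightarrow> h z = h v)"

text \<open>Facts about the part left of a cut arc carry over to the part right of it.\<close>

lemma reversed: "arc_order A (\<lambda>x y. lq y x) d h F"
proof
  show "d x y = d y x" for x y by (rule d_sym)
  show "d x z = min (d x y) (d y z)" if "x \<in> A" "y \<in> A" "z \<in> A" "lq y x" "\<not> lq x y" "lq z y" "\<not> lq y z" for x y z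
    unfolding d_sym[of x z] d_sym[of x y] d_sym[of y z] using d_nested[OF that(3,2,1,6,7,4,5)] by (simp only: min.commute)
  show "\<exists>z\<in>A. lq z x \<and> lq y z \<and> \<not> lq z y \<and> d z y = e"
    if "x \<in> A" "y \<in> A" "lq y x" "\<not> lq x y" "e \<in> F" "d x y < e" for x y e
  proof -
    have "d y x < e" using that(6) d_sym[of x y] by simp
    from approach'[OF that(2,1,3,4,5) this] show ?thesis using d_sym by (metis (no_types))
  qed
  show "\<exists>z\<in>A. lq z x \<and> \<not> lq x z \<and> lq y z \<and> d x z = e"
    if "x \<in> A" "y \<in> A" "lq y x" "\<not> lq x y" "e \<in> F" "d x y < e" for x y e
  proof -
    have "d y x < e" using that(6) d_sym[of x y] by simp
    from approach[OF that(2,1,3,4,5) this] show ?thesis using d_sym by (metis (no_types))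
  qed
  show "\<exists>z\<in>A. lq z x \<and> lq y z \<and> h z = ereal q"
    if "x \<in> A" "y \<in> A" "lq y x" "q \<in> F" "strictly_between (h x) (h y) (ereal q)" for x y q
  proof -
    have "strictly_between (h y) (h x) (ereal q)" using that(5) by (auto simp: strictly_between_def)
    then show ?thesis using intermediate[OF that(2,1,3,4)] by blast
  qed
  show "d x y = d x' y" if "x \<in> A" "x' \<in> A" "y \<in> A" "lq x' x" "lq x x'" for x x' y
    by (rule d_cong[OF that(1,2,3,5,4)])
  show "lq z x" if "x \<in> A" "y \<in> A" "z \<in> A" "lq y x" "lq z y" for x y z
    by (rule lq_trans[OF that(3,2,1,5,4)])
  show "h x = h y" if "x \<in> A" "y \<in> A" "lq y x" "lq x y" for x y
    by (rule h_cong[OF that(1,2,4,3)])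
  show "lq y x \<or> lq x y" if "x \<in> A" "y \<in> A" for x y
    using lq_total[OF that] by blast
qed (rule lq_refl h_values F_dense; assumption)+

lemma reversed_W: "arc_order.W A (\<lambda>x y. lq y x) d h b a x = W a b x"
proof -
  interpret rev: arc_order A "\<lambda>x y. lq y x" d h F by (rule reversed)
  show ?thesis
  proof (intro set_eqI iffI)
    fix e assume "e \<in> rev.W b a x"
    then obtain v w where "e = ereal (d v w)" "v \<in> A" "w \<in> A" "\<not> lq v w" "lq w v" "lq v b" "lq a w" "lq x v" "lq w x"
      "\<forall>z\<in>A. lq z v \<and> lq w z \<longrightarrow> h z = h x" unfolding rev.W_def by blast
    then have "e = ereal (d w v) \<and> w \<in> A \<and> v \<in> A \<and> \<not> lq v w \<and> lq w v \<and> lq a w \<and> lq v b \<and> lq w x \<and> lq x v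
      \<and> (\<forall>z\<in>A. lq w z \<and> lq z v \<longrightarrow> h z = h x)" using d_sym[of v w] by simp
    then show "e \<in> W a b x" unfolding W_def by blast
  next
    fix e assume "e \<in> W a b x"
    then obtain v w where "e = ereal (d v w)" "v \<in> A" "w \<in> A" "\<not> lq w v" "lq v w" "lq a v" "lq w b" "lq v x" "lq x w"
      "\<forall>z\<in>A. lq v z \<and> lq z w \<longrightarrow> h z = h x" unfolding W_def by blast
    then have "e = ereal (d w v) \<and> w \<in> A \<and> v \<in> A \<and> \<not> lq w v \<and> lq v w \<and> lq w b \<and> lq a v \<and> lq x w \<and> lq v x
      \<and> (\<forall>z\<in>A. lq z w \<and> lq v z \<longrightarrow> h z = h x)" using d_sym[of v w] by simp
    then show "e \<in> rev.W b a x" unfolding rev.W_def by blast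
  qed
qed

lemma reversed_elem: "arc_order.elem A (\<lambda>x y. lq y x) h b a \<longleftrightarrow> elem a b"
proof -
  interpret rev: arc_order A "\<lambda>x y. lq y x" d h F by (rule reversed)
  show ?thesis
  proof
    assume *: "rev.elem b a"
    show "elem a b" unfolding elem_def
    proof (intro ballI impI)
      fix v w z assume "v \<in> A" "w \<in> A" "z \<in> A" "lq a v \<and> lq w b \<and> lq v z \<and> lq z w \<and> h v = h w"
      then show "h z = h v" using *[unfolded rev.elem_def, rule_format, of w v z] by simp
    qed
  next
    assume *: "elem a b"
    show "rev.elem b a" unfolding rev.elem_def
    proof (intro ballI impI)
      fix v w z assume "v \<in> A" "w \<in> A" "z \<in> A" "lq v b \<and> lq a w \<and> lq z v \<and> lq w z \<and> h v = h w"
      then show "h z = h v" using *[unfolded elem_def, rule_format, of w v z] by simp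
    qed
  qed
qed

lemma V_dense:
  assumes "0 \<le> x" "x < y" shows "\<exists>p\<in>V. x < p \<and> p < y"
proof -
  obtain r where r: "x < ereal r" "ereal r < y" using ereal_dense2[OF assms(2)] by blast
  obtain s where s: "ereal r < ereal s" "ereal s < y" using ereal_dense2[OF r(2)] by blast
  then obtain e where e: "e \<in> F" "r < e" "e < s" using F_dense by auto
  have "0 < r" using assms(1) r(1) by (metis ereal_less(2) le_less_trans)
  then have "ereal e \<in> V" using e by auto
  moreover have "x < ereal e" using r(1) e(2) by (metis less_ereal.simps(1) less_trans)
  moreover have "ereal e < y" using s(2) e(3) by (metis less_ereal.simps(1) less_trans)
  ultimately show ?thesis by blast
qed

lemma V_pos: "p \<in> V \<Longrightarrow> 0 < p"
  by auto

lemma V_between: "0 \<le> a \<Longrightarrow> 0 \<le> b \<Longrightarrow> a \<noteq> b \<Longrightarrow> \<exists>p\<in>V. strictly_between a b p"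
  using V_dense[of a b] V_dense[of b a] unfolding strictly_between_def by (metis linorder_neqE)

lemma h_real: "x \<in> A \<Longrightarrow> h x < y \<Longrightarrow> \<exists>q\<in>F. h x = ereal q"
  using h_values[of x] by auto

lemma between_bounds:
  assumes el: "elem a b" and A: "x \<in> A" "y \<in> A" "z \<in> A" "a \<in> A" "b \<in> A"
    and l: "lq a x" "lq x y" "lq y z" "lq z b"
  shows "min (h x) (h z) \<le> h y" "h y \<le> max (h x) (h z)"
proof -
  have eq: "h y = h u" if "u \<in> A" "u' \<in> A" "lq a u" "lq u y" "lq y u'" "lq u' b" "h u = h u'" for u u'
    using el that A unfolding elem_def by blast
  have xz: "h x = h z \<Longrightarrow> h y = h x" using eq[of x z] A l by simp
  have left: "\<exists>u\<in>A. lq a u \<and> lq u y \<and> h u = h z" if sb: "strictly_between (h x) (h y) (h z)"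
  proof -
    have "h z < max (h x) (h y)" using sb by (auto simp: strictly_between_def less_max_iff_disj)
    then obtain q where q: "q \<in> F" "h z = ereal q" using h_real[OF A(3)] by blast
    obtain u where "u \<in> A" "lq x u" "lq u y" "h u = h z"
      using intermediate[OF A(1,2) l(2) q(1)] sb q(2) by auto
    then show ?thesis using lq_trans A l by blast
  qed
  have right: "\<exists>u\<in>A. lq y u \<and> lq u b \<and> h u = h x" if sb: "strictly_between (h y) (h z) (h x)"
  proof -
    have "h x < max (h y) (h z)" using sb by (auto simp: strictly_between_def less_max_iff_disj)
    then obtain q where q: "q \<in> F" "h x = ereal q" using h_real[OF A(1)] by blast
    obtain u where "u \<in> A" "lq y u" "lq u z" "h u = h x"
      using intermediate[OF A(2,3) l(3) q(1)] sb q(2) by auto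
    then show ?thesis using lq_trans A l by blast
  qed
  have L: "\<not> strictly_between (h x) (h y) (h z)"
  proof
    assume *: "strictly_between (h x) (h y) (h z)"
    then obtain u where "u \<in> A" "lq a u" "lq u y" "h u = h z" using left by blast
    then have "h y = h z" using eq[of u z] A l by simp
    then show False using * by (simp add: strictly_between_def)
  qed
  have R: "\<not> strictly_between (h y) (h z) (h x)"
  proof
    assume *: "strictly_between (h y) (h z) (h x)"
    then obtain u where "u \<in> A" "lq y u" "lq u b" "h u = h x" using right by blast
    then have "h y = h x" using eq[of x u] A l by simp
    then show False using * by (simp add: strictly_between_def)
  qed
  show "min (h x) (h z) \<le> h y" "h y \<le> max (h x) (h z)"
    using L R xz unfolding strictly_between_def min_def max_def by (auto simp: not_less not_le)
qed

text \<open>The nested formula is about strictly increasing triples, so ends that coincide as germs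
  are treated through \<open>d_cong\<close>.\<close>

lemma d_subinterval:
  assumes A: "x \<in> A" "v \<in> A" "w \<in> A" "y \<in> A" and l: "lq x v" "lq v w" "\<not> lq w v" "lq w y"
  shows "d x y \<le> d v w"
proof -
  have vy: "\<not> lq y v" using lq_trans A l by blast
  have vw: "lq v y" using lq_trans A l by blast
  have 1: "d v y \<le> d v w"
  proof (cases "lq y w")
    case True
    have "d y v = d w v" by (rule d_cong) (use A l True in auto)
    then show ?thesis using d_sym by simp
  next
    case False
    then show ?thesis using d_nested[OF A(2,3,4) l(2,3,4)] by simp
  qed
  have 2: "d x y \<le> d v y"
  proof (cases "lq v x")
    case True
    have "d x y = d v y" by (rule d_cong) (use A l True in auto)
    then show ?thesis by simp
  next
    case False
    then show ?thesis using d_nested[OF A(1,2,4) l(1) False vw vy] by simp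
  qed
  from 1 2 show ?thesis by simp
qed

text \<open>With equal orders at its ends, an elementary interval has constant order. So the whole
  interval is itself an admissible test, and by \<open>d_subinterval\<close> it has the least
  exponent.\<close>

lemma constant_width:
  assumes "a \<in> A" "m \<in> A" "lq a m" "\<not> lq m a" "elem a m" "h a = h m" "x \<in> A" "lq a x" "lq x m"
  shows "Inf (W a m x) = ereal (d a m)" "h x = h a"
proof -
  have c: "h z = h a" if "z \<in> A" "lq a z" "lq z m" for z
    using assms(5)[unfolded elem_def, rule_format, of a m z] assms(1,2,6) that lq_refl by simp
  show hx: "h x = h a" using c assms by blast
  have "a \<in> A \<and> m \<in> A \<and> \<not> lq m a \<and> lq a m \<and> lq a a \<and> lq m m \<and> lq a x \<and> lq x m
      \<and> (\<forall>z\<in>A. lq a z \<and> lq z m \<longrightarrow> h z = h x)"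
  proof (intro conjI ballI impI)
    fix z assume "z \<in> A" "lq a z \<and> lq z m"
    then have "h z = h a" using c by blast
    then show "h z = h x" using hx by simp
  qed (use assms(1-4,7-9) lq_refl in blast)+
  then have "ereal (d a m) \<in> W a m x" unfolding W_def by blast
  moreover have "ereal (d a m) \<le> e" if e: "e \<in> W a m x" for e
  proof -
    obtain v w where "e = ereal (d v w)" "v \<in> A" "w \<in> A" "\<not> lq w v" "lq v w" "lq a v" "lq w m"
      using e unfolding W_def by blast
    then show ?thesis using d_subinterval[OF assms(1) _ _ assms(2)] by simp
  qed
  ultimately show "Inf (W a m x) = ereal (d a m)"
    by (intro antisym Inf_lower Inf_greatest)
qed

text \<open>One-sided continuity of an affine function at \<open>q\<close>, coming from the side of
  \<open>a\<close>, with the neighbourhood written as the orders between \<open>p0\<close> and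
  \<open>q\<close>. At q = \<infinity> a nonzero slope would give an infinite value: plus infinity
  is not below \<open>e\<close> and minus infinity is excluded, so the function is constant.\<close>

lemma affine_near:
  assumes aff: "\<And>p. p \<in> V \<Longrightarrow> min a q \<le> p \<Longrightarrow> p \<le> max a q \<Longrightarrow> \<mu> p = ereal c * p + ereal k \<and> \<mu> p \<noteq> - \<infinity>"
    and "a \<in> V" "q \<in> V" "a \<noteq> q" and less: "\<mu> q < ereal e"
  shows "\<exists>p0. (p0 = a \<or> strictly_between a q p0) \<and> (\<forall>p\<in>V. strictly_between p0 q p \<longrightarrow> \<mu> p < ereal e)"
proof (cases q)
  case (real q')
  have m: "\<mu> q = ereal (c * q' + k)" using aff[of q] assms(3) real by auto
  \<comment> \<open>Within \<eta> of \<open>q'\<close> the affine function changes by less than its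
    distance to \<open>e\<close>; the added 1 covers the slope 0.\<close>
  define \<eta> where "\<eta> = (e - (c * q' + k)) / (\<bar>c\<bar> + 1)"
  have "c * q' + k < e" using less m by simp
  then have \<eta>: "0 < \<eta>" by (simp add: \<eta>_def)
  have near: "c * p + k < e" if "\<bar>p - q'\<bar> < \<eta>" for p
  proof -
    have "c * p - c * q' \<le> \<bar>c\<bar> * \<bar>p - q'\<bar>" by (metis abs_ge_self abs_mult right_diff_distrib)
    also have "\<dots> \<le> \<bar>c\<bar> * \<eta>" using that by (intro mult_left_mono) auto
    also have "\<dots> < (\<bar>c\<bar> + 1) * \<eta>" using \<eta> by simp
    also have "\<dots> = e - (c * q' + k)" unfolding \<eta>_def by (simp add: nonzero_eq_divide_eq add_nonneg_eq_0_iff)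
    finally show ?thesis by simp
  qed
  show ?thesis
  proof (cases "a < q")
    case True
    define p0 where "p0 = max a (ereal (q' - \<eta>))"
    have "\<mu> p < ereal e" if "p \<in> V" "strictly_between p0 q p" for p
    proof -
      have "p0 < q" using True real \<eta> by (simp add: p0_def)
      have pp: "a < p" "ereal (q' - \<eta>) < p" "p < q"
      proof -
        have "p0 < p" "p < q" using that(2) \<open>p0 < q\<close> by (auto simp: strictly_between_def)
        then show "a < p" "ereal (q' - \<eta>) < p" "p < q" by (auto simp: p0_def)
      qed
      then obtain p' where p': "p = ereal p'" using real by (cases p) auto
      then have "c * p' + k < e" using pp real \<eta> by (intro near) auto
      moreover have "\<mu> p = ereal (c * p' + k)" using aff[of p] that(1) pp p' True by auto
      ultimately show ?thesis by simp
    qed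
    moreover have "p0 = a \<or> strictly_between a q p0"
      using True real \<eta> by (auto simp: p0_def strictly_between_def max_def)
    ultimately show ?thesis by blast
  next
    case False
    then have "q < a" using assms(4) by simp
    define p0 where "p0 = min a (ereal (q' + \<eta>))"
    have "\<mu> p < ereal e" if "p \<in> V" "strictly_between p0 q p" for p
    proof -
      have "q < p0" using \<open>q < a\<close> real \<eta> by (simp add: p0_def)
      have pp: "p < a" "p < ereal (q' + \<eta>)" "q < p"
      proof -
        have "p < p0" "q < p" using that(2) \<open>q < p0\<close> by (auto simp: strictly_between_def)
        then show "p < a" "p < ereal (q' + \<eta>)" "q < p" by (auto simp: p0_def)
      qed
      then obtain p' where p': "p = ereal p'" using real by (cases p) auto
      then have "c * p' + k < e" using pp real \<eta> by (intro near) auto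
      moreover have "\<mu> p = ereal (c * p' + k)" using aff[of p] that(1) pp p' \<open>q < a\<close> by auto
      ultimately show ?thesis by simp
    qed
    moreover have "p0 = a \<or> strictly_between a q p0"
      using \<open>q < a\<close> real \<eta> by (auto simp: p0_def strictly_between_def min_def)
    ultimately show ?thesis by blast
  qed
next
  case PInf
  have m: "\<mu> q = ereal c * \<infinity> + ereal k" "\<mu> q \<noteq> - \<infinity>"
  proof -
    have "\<mu> q = ereal c * q + ereal k \<and> \<mu> q \<noteq> - \<infinity>" by (rule aff) (use assms(3) in auto)
    then show "\<mu> q = ereal c * \<infinity> + ereal k" "\<mu> q \<noteq> - \<infinity>" using PInf by metis+
  qed
  have "c = 0"
  proof (rule ccontr)
    assume "c \<noteq> 0"
    then consider "0 < c" | "c < 0" by linarith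
    then have "ereal c * \<infinity> = \<infinity> \<or> ereal c * \<infinity> = - \<infinity>" by cases simp_all
    then have "\<mu> q = \<infinity> \<or> \<mu> q = - \<infinity>" unfolding m(1) by (elim disjE) simp_all
    then show False using m(2) less by auto
  qed
  then have k: "ereal k < ereal e" using m(1) less by (simp add: zero_ereal_def[symmetric])
  have "\<mu> p < ereal e" if "p \<in> V" "strictly_between a q p" for p
  proof -
    have "\<mu> p = ereal c * p + ereal k"
      using aff[of p] that PInf by (auto simp: strictly_between_def)
    then show ?thesis using \<open>c = 0\<close> k by (simp add: zero_ereal_def[symmetric])
  qed
  then show ?thesis by blast
next
  case MInf
  then show ?thesis using assms(3) by auto
qed

text \<open>Left of an arc \<open>x\<close> of order \<open>q\<close>, the arcs whose orders lie strictly between those of \<open>a\<close> and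
  \<open>q\<close> accumulate at \<open>x\<close>; by continuity of the affine width function \<open>\<mu>\<close> the width of \<open>x\<close> does not
  change when everything to the right of \<open>m\<close> is cut off.\<close>

lemma split_left:
  assumes A: "a \<in> A" "m \<in> A" "b \<in> A" "x \<in> A" and l: "lq a m" "lq m b" "lq a x" "lq x m"
    and el: "elem a b" and ne: "h a \<noteq> h m"
    and \<mu>: "\<And>y. y \<in> A \<Longrightarrow> lq a y \<Longrightarrow> lq y b \<Longrightarrow> Inf (W a b y) = \<mu> (h y)"
    and att: "\<And>q. q \<in> V \<Longrightarrow> min (h a) (h b) \<le> q \<Longrightarrow> q \<le> max (h a) (h b) \<Longrightarrow> \<exists>y\<in>A. lq a y \<and> lq y b \<and> h y = q"
    and aff: "\<And>p. p \<in> V \<Longrightarrow> min (h a) (h b) \<le> p \<Longrightarrow> p \<le> max (h a) (h b) \<Longrightarrow> \<mu> p = ereal c * p + ereal k \<and> \<mu> p \<noteq> - \<infinity>"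
  shows "Inf (W a m x) = \<mu> (h x)"
proof -
  have ab: "lq a b" and xb: "lq x b" using lq_trans A l by blast+
  have sub: "W a m x \<subseteq> W a b x" unfolding W_def using lq_trans A l by blast
  show ?thesis
  proof (cases "h x = h m")
    case False
    \<comment> \<open>A test interval for \<open>x\<close> that reached past \<open>m\<close> would
      contain \<open>m\<close>, whose order is different. Hence no test is lost by the cut.\<close>
    have "W a b x \<subseteq> W a m x"
    proof
      fix e assume "e \<in> W a b x"
      then obtain v w where vw: "e = ereal (d v w)" "v \<in> A" "w \<in> A" "\<not> lq w v" "lq v w" "lq a v" "lq w b"
        "lq v x" "lq x w" "\<And>z. z \<in> A \<Longrightarrow> lq v z \<Longrightarrow> lq z w \<Longrightarrow> h z = h x" unfolding W_def by blast
      have "lq w m"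
      proof (rule ccontr)
        assume "\<not> lq w m"
        then have "lq m w" using lq_total A vw by blast
        moreover have "lq v m" using lq_trans[OF vw(2) A(4,2) vw(8) l(4)] .
        ultimately have "h m = h x" using vw(10) A by blast
        then show False using False by simp
      qed
      then show "e \<in> W a m x" unfolding W_def using vw by blast
    qed
    then show ?thesis using sub \<mu>[OF A(4) l(3) xb] by (metis antisym)
  next
    case True
    define q where "q = h x"
    have hq: "h a \<noteq> q" using ne True by (simp add: q_def)
    have hmin: "min (h a) (h b) \<le> q" "q \<le> max (h a) (h b)"
      unfolding q_def using between_bounds[OF el A(1,4,3,1,3) lq_refl[OF A(1)] l(3) xb lq_refl[OF A(3)]] by auto
    have "Inf (W a b x) \<le> Inf (W a m x)" using sub by (rule Inf_superset_mono)
    moreover have "\<not> Inf (W a b x) < Inf (W a m x)"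
    proof
      assume "Inf (W a b x) < Inf (W a m x)"
      then obtain r where r: "Inf (W a b x) < ereal r" "ereal r < Inf (W a m x)" using ereal_dense2 by blast
      obtain s where s: "ereal r < ereal s" "ereal s < Inf (W a m x)" using ereal_dense2[OF r(2)] by blast
      then obtain e where e: "e \<in> F" "r < e" "e < s" using F_dense by auto
      have e1: "\<mu> q < ereal e" using r(1) e(2) \<mu>[OF A(4) l(3) xb] unfolding q_def
        by (metis less_ereal.simps(1) less_trans)
      have e2: "ereal e < Inf (W a m x)" using s(2) e(3) by (metis less_ereal.simps(1) less_trans)
      have aff': "\<mu> p = ereal c * p + ereal k \<and> \<mu> p \<noteq> - \<infinity>" if "p \<in> V" "min (h a) q \<le> p" "p \<le> max (h a) q" for p
        using aff[OF that(1)] that(2,3) hmin by (auto simp: min_def max_def split: if_splits)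
      obtain p0 where p0: "p0 = h a \<or> strictly_between (h a) q p0"
        "\<And>p. p \<in> V \<Longrightarrow> strictly_between p0 q p \<Longrightarrow> \<mu> p < ereal e"
        using affine_near[OF aff' h_values[OF A(1)] _ hq e1] h_values[OF A(4)] unfolding q_def by blast
      have nax: "\<not> lq x a" using h_cong A l hq unfolding q_def by metis
      \<comment> \<open>\<open>z\<close> marks a stretch left of \<open>x\<close> with contact at
        least \<open>e\<close> and with an end of different order. If \<open>a\<close> is too far
        away, take contact exactly \<open>e\<close>: were the order of \<open>z\<close> equal to
        \<open>q\<close>, the interval from \<open>z\<close> to \<open>x\<close> would be a test of
        exponent \<open>e\<close>, below the assumed infimum. Otherwise \<open>a\<close> itself
        serves.\<close>
      obtain z where z: "z \<in> A" "lq a z" "lq z x" "\<not> lq x z" "e \<le> d z x" "h z \<noteq> q"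
      proof (cases "d a x < e")
        case True
        obtain z where z: "z \<in> A" "lq a z" "lq z x" "\<not> lq x z" "d z x = e"
          using approach[OF A(1,4) l(3) nax e(1) True] by blast
        have "h z \<noteq> q"
        proof
          assume "h z = q"
          then have "h y = h x" if "y \<in> A" "lq z y" "lq y x" for y
            using el[unfolded elem_def, rule_format, of z x y] z A xb \<open>h z = q\<close> that unfolding q_def by simp
          then have "ereal e \<in> W a m x"
            unfolding W_def using z A l lq_refl by blast
          then show False using e2 Inf_lower by (meson leD)
        qed
        then show ?thesis using that z by simp
      next
        case False
        then show ?thesis using that[of a] A l lq_refl nax hq by simp
      qed
      have hz: "min (h a) q \<le> h z" "h z \<le> max (h a) q"
        using between_bounds[OF el A(1) z(1) A(4,1,3) lq_refl[OF A(1)] z(2,3) xb] unfolding q_def by auto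
      \<comment> \<open>Of \<open>p0\<close> and \<open>h z\<close>, the one closer to
        \<open>q\<close>. An order strictly between it and \<open>q\<close> has width below
        \<open>e\<close> because of \<open>p0\<close>, and by monotonicity its arcs lie between
        \<open>z\<close> and \<open>x\<close> because of \<open>h z\<close>.\<close>
      define p1 where "p1 = (if h a < q then max p0 (h z) else min p0 (h z))"
      have "0 \<le> p1"
      proof -
        have "0 < h a" "0 < q" "0 < h z" unfolding q_def using h_values A z(1) V_pos by blast+
        then have "0 < p0" using p0(1) by (auto simp: strictly_between_def)
        then show ?thesis unfolding p1_def using \<open>0 < h z\<close> by (auto simp: less_imp_le min_def max_def)
      qed
      moreover have "p1 \<noteq> q" using p0(1) z(6) hq unfolding p1_def by (auto simp: strictly_between_def max_def min_def)
      moreover have "0 \<le> q" unfolding q_def using V_pos[OF h_values[OF A(4)]] by simp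
      ultimately obtain p where p: "p \<in> V" "strictly_between p1 q p" using V_between by blast
      have sp: "strictly_between p0 q p" "strictly_between (h z) q p" "strictly_between (h a) q p"
        using p(2) p0(1) hz z(6) hq unfolding p1_def strictly_between_def
        by (auto simp: min_def max_def split: if_splits)
      have "min (h a) (h b) \<le> p" "p \<le> max (h a) (h b)"
        using sp(3) hmin by (auto simp: strictly_between_def min_def max_def split: if_splits)
      then obtain y where y: "y \<in> A" "lq a y" "lq y b" "h y = p" using att[OF p(1)] by blast
      have "Inf (W a b y) < ereal e" using \<mu>[OF y(1-3)] p0(2)[OF p(1) sp(1)] y(4) by simp
      then obtain g where "g \<in> W a b y" "g < ereal e" unfolding Inf_less_iff by blast
      then obtain v w where vw: "d v w < e" "v \<in> A" "w \<in> A" "\<not> lq w v" "lq v w" "lq a v" "lq w b"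
        "lq v y" "lq y w" "\<And>u. u \<in> A \<Longrightarrow> lq v u \<Longrightarrow> lq u w \<Longrightarrow> h u = p" unfolding W_def y(4) by auto
      \<comment> \<open>The test interval from \<open>v\<close> to \<open>w\<close> carries only the
        order \<open>p\<close>, so it can contain neither \<open>x\<close> nor \<open>z\<close> and
        is trapped between them. Its contact is then at least that of \<open>z\<close> and
        \<open>x\<close>, which is at least \<open>e\<close>.\<close>
      have pq: "p \<noteq> q" "p \<noteq> h z" using sp by (auto simp: strictly_between_def)
      have "lq w x"
      proof (rule ccontr)
        assume "\<not> lq w x"
        then have xw: "lq x w" using lq_total A vw by blast
        have "\<not> lq v x" using vw(10)[OF A(4) _ xw] pq unfolding q_def by blast
        then have "lq x v" using lq_total A vw by blast
        then have "lq x y" using lq_trans[OF A(4) vw(2) y(1) _ vw(8)] by blast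
        from between_bounds[OF el A(1,4) y(1) A(1,3) lq_refl[OF A(1)] l(3) this y(3)]
        show False using sp(3) y(4) unfolding q_def[symmetric] strictly_between_def by (auto simp: min_def max_def split: if_splits)
      qed
      moreover have "lq z v"
      proof (rule ccontr)
        assume "\<not> lq z v"
        then have vz: "lq v z" using lq_total z vw by blast
        have "\<not> lq z w" using vw(10)[OF z(1) vz] pq by blast
        then have "lq w z" using lq_total z vw by blast
        then have "lq y z" using lq_trans[OF y(1) vw(3) z(1) vw(9)] by blast
        moreover have "lq z b" using lq_trans[OF z(1) A(4,3) z(3) xb] .
        ultimately have "min (h a) (h z) \<le> h y" "h y \<le> max (h a) (h z)"
          using between_bounds[OF el A(1) y(1) z(1) A(1,3) lq_refl[OF A(1)] y(2)] by blast+
        then show False using sp(2,3) y(4) hz hq unfolding strictly_between_def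
          by (auto simp: min_def max_def split: if_splits)
      qed
      ultimately have "d z x \<le> d v w" by (intro d_subinterval) (use z A vw in auto)
      then show False using z(5) vw(1) by simp
    qed
    ultimately have "Inf (W a m x) = Inf (W a b x)" by (metis antisym_conv2 not_less)
    then show ?thesis using \<mu>[OF A(4) l(3) xb] by simp
  qed
qed

text \<open>A value in the smaller range is attained somewhere between \<open>a\<close> and
  \<open>b\<close>. If that happens only to the right of \<open>m\<close>, monotonicity of the
  orders makes it equal to \<open>h m\<close>.\<close>

lemma split_left_values:
  assumes A: "a \<in> A" "m \<in> A" "b \<in> A" and l: "lq a m" "lq m b" and el: "elem a b"
    and att: "\<And>q. q \<in> V \<Longrightarrow> min (h a) (h b) \<le> q \<Longrightarrow> q \<le> max (h a) (h b) \<Longrightarrow> \<exists>y\<in>A. lq a y \<and> lq y b \<and> h y = q"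
  shows "{h x | x. x \<in> A \<and> lq a x \<and> lq x m} = {q \<in> V. min (h a) (h m) \<le> q \<and> q \<le> max (h a) (h m)}"
proof (intro set_eqI iffI)
  fix q assume "q \<in> {h x | x. x \<in> A \<and> lq a x \<and> lq x m}"
  then obtain x where "x \<in> A" "lq a x" "lq x m" "q = h x" by blast
  then show "q \<in> {q \<in> V. min (h a) (h m) \<le> q \<and> q \<le> max (h a) (h m)}"
    using between_bounds[OF el A(1) _ A(2,1,3) lq_refl[OF A(1)] _ _ l(2)] h_values[of x] by auto
next
  fix q assume q: "q \<in> {q \<in> V. min (h a) (h m) \<le> q \<and> q \<le> max (h a) (h m)}"
  have m: "min (h a) (h b) \<le> h m" "h m \<le> max (h a) (h b)"
    using between_bounds[OF el A(1,2,3,1,3) lq_refl[OF A(1)] l lq_refl[OF A(3)]] by auto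
  then have "min (h a) (h b) \<le> q" "q \<le> max (h a) (h b)"
    using q by (auto simp: min_def max_def split: if_splits)
  then obtain y where y: "y \<in> A" "lq a y" "lq y b" "h y = q" using att q by blast
  show "q \<in> {h x | x. x \<in> A \<and> lq a x \<and> lq x m}"
  proof (cases "lq y m")
    case True then show ?thesis using y by blast
  next
    case False
    then have "lq m y" using lq_total A y by blast
    from between_bounds[OF el A(1,2) y(1) A(1,3) lq_refl[OF A(1)] l(1) this y(3)]
    have "q = h m" using q y(4) by (auto simp: min_def max_def split: if_splits)
    then show ?thesis using A l lq_refl by blast
  qed
qed

end

section \<open>Confluence of the simplification of pizzas\<close>

lemma affine_le:
  fixes p q :: ereal
  assumes "0 \<le> p" "p \<le> q" "0 \<le> c"
  shows "ereal c * p + ereal k \<le> ereal c * q + ereal k"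
  using assms by (intro add_right_mono ereal_mult_left_mono) auto

lemma affine_ge:
  fixes p q :: ereal
  assumes "0 \<le> p" "p \<le> q" "c < 0"
  shows "ereal c * q + ereal k \<le> ereal c * p + ereal k"
proof -
  have "ereal (- c) * p \<le> ereal (- c) * q" using assms by (intro ereal_mult_left_mono) auto
  then have "- (ereal c * p) \<le> - (ereal c * q)" by (metis ereal_mult_minus_left uminus_ereal.simps(1))
  then have "ereal c * q \<le> ereal c * p" by simp
  then show ?thesis by (rule add_right_mono)
qed

text \<open>An affine function on a segment is least at an end. Hence a joined slice, whose exponent
  is the minimum over its outer ends, has the smaller of the two exponents.\<close>

lemma affine_min:
  fixes a b e :: ereal
  assumes "0 \<le> a" "0 \<le> b" "0 \<le> e" "a \<le> b \<and> b \<le> e \<or> e \<le> b \<and> b \<le> a"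
  shows "min (ereal c * a + ereal k) (ereal c * e + ereal k) \<le> ereal c * b + ereal k"
proof (cases "0 \<le> c")
  case True
  then show ?thesis using affine_le[of a b c k] affine_le[of e b c k] assms by (auto simp: min_le_iff_disj)
next
  case False
  then show ?thesis using affine_ge[of b a c k] affine_ge[of b e c k] assms by (auto simp: min_le_iff_disj)
qed

lemma rotate_split: "\<exists>ps qs. H = ps @ qs \<and> rotate n H = qs @ ps"
  by (metis append_take_drop_id rotate_drop_take)

lemma rotate_append': "rotate (length ps) (ps @ qs) = qs @ ps"
  by (rule rotate_append)

lemma rotate_undo: "rotate (n * (length xs - 1)) (rotate n xs) = xs"
proof (cases xs)
  case (Cons a as)
  have "n * (length xs - 1) + n = n * length xs" using Cons by (simp add: algebra_simps)
  then show ?thesis by (simp add: rotate_rotate rotate_id)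
qed simp

lemma list_all2_rotate:
  assumes "list_all2 R xs ys" shows "list_all2 R (rotate n xs) (rotate n ys)"
  using assms
proof (induction n)
  case (Suc n)
  have "list_all2 R (rotate1 us) (rotate1 vs)" if "list_all2 R us vs" for us vs
    using that by cases (auto intro: list_all2_appendI)
  then show ?case using Suc by simp
qed simp

lemma mod_add_inj:
  fixes a b k n :: nat
  assumes "a < k" "b < k" "(a + n) mod k = (b + n) mod k" shows "a = b"
  using assms
proof (induction a b rule: linorder_wlog)
  case (le a b)
  then have "k dvd (b + n) - (a + n)" using mod_eq_dvd_iff_nat[of "a + n" "b + n" k] by simp
  then have "k dvd b - a" by simp
  moreover have "b - a < k" using le by simp
  ultimately show ?case using le(1) nat_dvd_not_less[of "b - a" k] by auto
next
  case (sym a b) then show ?case by simp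
qed

definition flip :: "slice \<Rightarrow> slice" where
  "flip x = Slice (slice_exp x) (seg_to x) (seg_from x) (slice_sign x) (slice_width x)"

lemma flip_simps [simp]:
  "slice_exp (flip x) = slice_exp x" "seg_from (flip x) = seg_to x" "seg_to (flip x) = seg_from x"
  "slice_sign (flip x) = slice_sign x" "slice_width (flip x) = slice_width x" "flip (flip x) = x"
  by (simp_all add: flip_def)

text \<open>The same pizza read in the opposite cyclic direction.\<close>

definition mirror :: "slice list \<Rightarrow> slice list" where
  "mirror H = rev (map flip H)"

lemma mirror_simps [simp]:
  "mirror (xs @ ys) = mirror ys @ mirror xs" "mirror (mirror xs) = xs" "length (mirror xs) = length xs"
  "mirror (x # xs) = mirror xs @ [flip x]" "mirror [] = []"
  by (simp_all add: mirror_def rev_map[symmetric] comp_def)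

section \<open>Slices and the merging of two slices\<close>

context pb_o_minimal
begin

lemma order_values_dense:
  assumes "0 \<le> x" "x < y" shows "\<exists>r\<in>E. 0 < r \<and> x < ereal r \<and> ereal r < y"
proof -
  obtain r where r: "x < ereal r" "ereal r < y" using ereal_dense2[OF assms(2)] by blast
  obtain s where s: "ereal r < ereal s" "ereal s < y" using ereal_dense2[OF r(2)] by blast
  then obtain e where e: "e \<in> \<rat>" "r < e" "e < s" using Rats_dense_in_real[of r s] by auto
  have "0 < r" using assms(1) r(1) by (metis ereal_less(2) le_less_trans)
  moreover have "x < ereal e" using r(1) e(2) by (metis less_ereal.simps(1) less_trans)
  moreover have "ereal e < y" using s(2) e(3) by (metis less_ereal.simps(1) less_trans)
  ultimately show ?thesis using e Rats_subset_E by (intro bexI[of _ e]) auto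
qed

lemma order_values_pos: "q \<in> order_values S \<Longrightarrow> 0 < q"
  unfolding order_values_def by auto

definition valid :: "slice \<Rightarrow> bool" where
  "valid x \<longleftrightarrow> seg_from x \<in> order_values S \<and> seg_to x \<in> order_values S \<and>
     affine_width S (seg_set S x) (slice_width x) \<and>
     min (slice_width x (seg_from x)) (slice_width x (seg_to x)) = ereal (slice_exp x)"

text \<open>Widths are compared on the segment only, since their values elsewhere carry no meaning.
  The exponent is omitted because for valid slices the widths at the ends determine it; see
  \<open>slice_eqv_exp\<close>.\<close>

definition slice_eqv :: "slice \<Rightarrow> slice \<Rightarrow> bool" where
  "slice_eqv x y \<longleftrightarrow> seg_from x = seg_from y \<and> seg_to x = seg_to y \<and> slice_sign x = slice_sign y \<and>
     (\<forall>q\<in>seg_set S x. slice_width x q = slice_width y q)"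

definition all_valid :: "slice list \<Rightarrow> bool" where
  "all_valid H \<longleftrightarrow> (\<forall>x\<in>set H. valid x)"

definition ceq :: "slice list \<Rightarrow> slice list \<Rightarrow> bool" where
  "ceq H G \<longleftrightarrow> (\<exists>n. list_all2 slice_eqv (rotate n H) G)"

definition mg :: "slice \<Rightarrow> slice \<Rightarrow> slice \<Rightarrow> bool" where
  "mg x y z \<longleftrightarrow> merge1 S x y z \<or> merge2 x y z"

abbreviation step :: "slice list \<Rightarrow> slice list \<Rightarrow> bool" where
  "step \<equiv> simplify_step S"

definition nf :: "slice list \<Rightarrow> bool" where
  "nf H \<longleftrightarrow> \<not> (\<exists>H'. step H H')"

lemma seg_set_cong: "seg_from x = seg_from y \<Longrightarrow> seg_to x = seg_to y \<Longrightarrow> seg_set S x = seg_set S y"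
  by (simp add: seg_set_def)

lemma seg_set_flip [simp]: "seg_set S (flip x) = seg_set S x"
  by (simp add: seg_set_def min.commute max.commute)

lemma ends_in_seg_set: "valid x \<Longrightarrow> seg_from x \<in> seg_set S x" "valid x \<Longrightarrow> seg_to x \<in> seg_set S x"
  by (auto simp: valid_def seg_set_def)

lemma seg_set_join:
  assumes "seg_to x = seg_from y" "seg_from u = seg_from x" "seg_to u = seg_to y"
    and "seg_from x < seg_to x \<and> seg_from y < seg_to y \<or> seg_from x > seg_to x \<and> seg_from y > seg_to y"
  shows "seg_set S u = seg_set S x \<union> seg_set S y"
  using assms unfolding seg_set_def by (auto simp: min_def max_def)

lemma slice_eqv_refl [simp]: "slice_eqv x x"
  by (simp add: slice_eqv_def)

lemma slice_eqv_sym: "slice_eqv x y \<Longrightarrow> slice_eqv y x"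
  unfolding slice_eqv_def using seg_set_cong by metis

lemma slice_eqv_trans: "slice_eqv x y \<Longrightarrow> slice_eqv y z \<Longrightarrow> slice_eqv x z"
  unfolding slice_eqv_def using seg_set_cong by metis

lemma slice_eqv_exp: "valid x \<Longrightarrow> valid y \<Longrightarrow> slice_eqv x y \<Longrightarrow> slice_exp x = slice_exp y"
  using ends_in_seg_set[of x] unfolding valid_def slice_eqv_def by (metis ereal.inject)

lemma slice_eqv_points:
  assumes "valid x" "valid y" "seg_from x = a" "seg_to x = a" "seg_from y = a" "seg_to y = a"
    "slice_sign x = slice_sign y" "slice_exp x = slice_exp y"
  shows "slice_eqv x y"
proof -
  have "seg_set S x \<subseteq> {a}" using assms by (auto simp: seg_set_def)
  then show ?thesis using assms unfolding slice_eqv_def valid_def by auto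
qed

lemma valid_flip: "valid x \<Longrightarrow> valid (flip x)"
  by (simp add: valid_def min.commute)

lemma mg_ends: "mg x y z \<Longrightarrow> seg_to x = seg_from y \<and> slice_sign x = slice_sign y"
  by (auto simp: mg_def merge1_def merge2_def)

lemma mg_cases:
  assumes "mg x y z"
  obtains (join) \<mu> where "seg_from x < seg_to x \<and> seg_from y < seg_to y \<or> seg_from x > seg_to x \<and> seg_from y > seg_to y"
      "affine_width S (seg_set S x \<union> seg_set S y) \<mu>"
      "\<And>q. q \<in> seg_set S x \<Longrightarrow> slice_width x q = \<mu> q" "\<And>q. q \<in> seg_set S y \<Longrightarrow> slice_width y q = \<mu> q"
      "z = Slice (min (slice_exp x) (slice_exp y)) (seg_from x) (seg_to y) (slice_sign x) \<mu>"
  | (left) "seg_from x = seg_to x" "slice_width y (seg_from y) \<le> ereal (slice_exp x)" "z = y"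
  | (right) "seg_from y = seg_to y" "slice_width x (seg_to x) \<le> ereal (slice_exp y)" "z = x"
proof -
  from assms have "(merge1 S x y z) \<or> merge2 x y z" by (simp add: mg_def)
  then show ?thesis
  proof
    assume "merge1 S x y z"
    then show ?thesis unfolding merge1_def using join by blast
  next
    assume "merge2 x y z"
    then show ?thesis unfolding merge2_def using left right by blast
  qed
qed

lemma mg_join:
  assumes "slice_sign x = slice_sign y" "seg_to x = seg_from y"
    "seg_from x < seg_to x \<and> seg_from y < seg_to y \<or> seg_from x > seg_to x \<and> seg_from y > seg_to y"
    "affine_width S (seg_set S x \<union> seg_set S y) \<mu>"
    "\<And>q. q \<in> seg_set S x \<Longrightarrow> slice_width x q = \<mu> q" "\<And>q. q \<in> seg_set S y \<Longrightarrow> slice_width y q = \<mu> q"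
    "z = Slice (min (slice_exp x) (slice_exp y)) (seg_from x) (seg_to y) (slice_sign x) \<mu>"
  shows "mg x y z"
  unfolding mg_def merge1_def using assms by blast

lemma mg_left:
  "slice_sign x = slice_sign y \<Longrightarrow> seg_to x = seg_from y \<Longrightarrow> seg_from x = seg_to x \<Longrightarrow>
    slice_width y (seg_from y) \<le> ereal (slice_exp x) \<Longrightarrow> mg x y y"
  by (simp add: mg_def merge2_def)

lemma mg_right:
  "slice_sign x = slice_sign y \<Longrightarrow> seg_to x = seg_from y \<Longrightarrow> seg_from y = seg_to y \<Longrightarrow>
    slice_width x (seg_to x) \<le> ereal (slice_exp y) \<Longrightarrow> mg x y x"
  by (simp add: mg_def merge2_def)

text \<open>An end of the segment may be infinite, but two finite orders always exist, and they
  determine the coefficients of an affine width function.\<close>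

lemma finite_point:
  assumes "valid x" "seg_from x \<noteq> seg_to x"
  shows "\<exists>r s. r \<noteq> s \<and> ereal r \<in> seg_set S x \<and> ereal s \<in> seg_set S x"
proof -
  define a b where "a = min (seg_from x) (seg_to x)" and "b = max (seg_from x) (seg_to x)"
  have ab: "a < b" "0 \<le> a" using assms order_values_pos unfolding a_def b_def valid_def
    by (auto simp: min_def max_def less_imp_le)
  obtain r where r: "r \<in> E" "0 < r" "a < ereal r" "ereal r < b" using order_values_dense[OF ab(2,1)] by blast
  obtain s where s: "s \<in> E" "0 < s" "ereal r < ereal s" "ereal s < b"
    using order_values_dense[of "ereal r" b] r by auto
  have "a < ereal s" using r(3) s(3) by (rule less_trans)
  have "ereal r \<in> order_values S" "ereal s \<in> order_values S" using r s by (auto simp: order_values_def)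
  then show ?thesis using r s \<open>a < ereal s\<close> unfolding seg_set_def a_def[symmetric] b_def[symmetric]
    by (intro exI[of _ r] exI[of _ s]) (auto simp: less_imp_le)
qed

lemma affineD:
  assumes "affine_width S Q \<mu>" "ereal r \<in> Q"
  obtains c k where "c \<in> E" "k \<in> E" "\<And>q. q \<in> Q \<Longrightarrow> \<mu> q = ereal c * q + ereal k"
  using assms unfolding affine_width_def by (metis PInfty_neq_ereal(1) singletonD)

lemma mg_valid:
  assumes "valid x" "valid y" "mg x y z" shows "valid z"
  using assms(3)
proof (cases rule: mg_cases)
  case (join \<mu>)
  have e: "seg_to x = seg_from y" using mg_ends[OF assms(3)] by blast
  have seg: "seg_set S z = seg_set S x \<union> seg_set S y" using join e by (intro seg_set_join) auto
  have "seg_from x \<noteq> seg_to x" using join(1) by auto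
  then obtain r where "ereal r \<in> seg_set S x" using finite_point[OF assms(1)] by blast
  then obtain c k where ck: "\<And>q. q \<in> seg_set S x \<union> seg_set S y \<Longrightarrow> \<mu> q = ereal c * q + ereal k"
    using affineD[OF join(2)] by (metis UnI1)
  have mem: "seg_from x \<in> seg_set S x" "seg_to x \<in> seg_set S x" "seg_from y \<in> seg_set S y" "seg_to y \<in> seg_set S y"
    using ends_in_seg_set assms by auto
  have pos: "0 \<le> seg_from x" "0 \<le> seg_to x" "0 \<le> seg_to y"
    using assms(1,2) order_values_pos less_imp_le unfolding valid_def by blast+
  have "min (\<mu> (seg_from x)) (\<mu> (seg_to y)) \<le> \<mu> (seg_to x)"
    using affine_min[OF pos, of c k] join(1) e mem ck by (auto simp: less_imp_le)
  moreover have "min (\<mu> (seg_from x)) (\<mu> (seg_to x)) = ereal (slice_exp x)"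
    "min (\<mu> (seg_to x)) (\<mu> (seg_to y)) = ereal (slice_exp y)"
    using assms(1,2) join(3,4) mem e unfolding valid_def by metis+
  ultimately have "min (\<mu> (seg_from x)) (\<mu> (seg_to y)) = min (ereal (slice_exp x)) (ereal (slice_exp y))"
    by (metis min.assoc min.commute min_absorb2 min_def)
  moreover have "min (ereal (slice_exp x)) (ereal (slice_exp y)) = ereal (min (slice_exp x) (slice_exp y))"
    by (simp add: min_def)
  ultimately have ex: "min (\<mu> (seg_from x)) (\<mu> (seg_to y)) = ereal (min (slice_exp x) (slice_exp y))" by metis
  have z: "seg_from z = seg_from x" "seg_to z = seg_to y" "slice_width z = \<mu>" "slice_exp z = min (slice_exp x) (slice_exp y)"
    using join(5) by simp_all
  have "seg_from x \<in> order_values S" "seg_to y \<in> order_values S" using assms(1,2) unfolding valid_def by blast+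
  then show ?thesis unfolding valid_def seg unfolding z using join(2) ex by blast
qed (use assms in auto)

lemma mg_cong:
  assumes v: "valid x" "valid y" "valid x'" "valid y'" and eq: "slice_eqv x x'" "slice_eqv y y'" and m: "mg x y z"
  shows "\<exists>z'. mg x' y' z' \<and> slice_eqv z z'"
proof -
  have ex: "slice_exp x' = slice_exp x" "slice_exp y' = slice_exp y"
    using slice_eqv_exp v eq by metis+
  have f: "seg_from x' = seg_from x" "seg_to x' = seg_to x" "slice_sign x' = slice_sign x"
    "seg_from y' = seg_from y" "seg_to y' = seg_to y" "slice_sign y' = slice_sign y"
    using eq unfolding slice_eqv_def by auto
  have s: "seg_set S x' = seg_set S x" "seg_set S y' = seg_set S y" using f seg_set_cong by metis+
  have w: "\<And>q. q \<in> seg_set S x \<Longrightarrow> slice_width x' q = slice_width x q" "\<And>q. q \<in> seg_set S y \<Longrightarrow> slice_width y' q = slice_width y q"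
    using eq unfolding slice_eqv_def by auto
  have e: "seg_to x = seg_from y" "slice_sign x = slice_sign y" using mg_ends[OF m] by auto
  from m show ?thesis
  proof (cases rule: mg_cases)
    case (join \<mu>)
    have "mg x' y' z"
    proof (rule mg_join[where \<mu> = \<mu>])
      show "seg_from x' < seg_to x' \<and> seg_from y' < seg_to y' \<or> seg_from x' > seg_to x' \<and> seg_from y' > seg_to y'"
        using join(1) f by simp
      show "affine_width S (seg_set S x' \<union> seg_set S y') \<mu>" using join(2) s by simp
      show "slice_width x' q = \<mu> q" if "q \<in> seg_set S x'" for q using join(3) w(1) s that by simp
      show "slice_width y' q = \<mu> q" if "q \<in> seg_set S y'" for q using join(4) w(2) s that by simp
    qed (use e f ex join(5) in simp_all)
    then show ?thesis using slice_eqv_refl by blast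
  next
    case left
    have "mg x' y' y'"
      by (rule mg_left) (use left e f ex w(2) ends_in_seg_set(1)[OF v(2)] in simp_all)
    then show ?thesis using left(3) eq(2) by blast
  next
    case right
    have "mg x' y' x'"
      by (rule mg_right) (use right e f ex w(1) ends_in_seg_set(2)[OF v(1)] in simp_all)
    then show ?thesis using right(3) eq(1) by blast
  qed
qed

lemma mg_flip:
  assumes "mg x y z" shows "mg (flip y) (flip x) (flip z)"
  using assms
proof (cases rule: mg_cases)
  case (join \<mu>)
  have "flip z = Slice (min (slice_exp y) (slice_exp x)) (seg_to y) (seg_from x) (slice_sign y) \<mu>"
    using join(5) mg_ends[OF assms] by (simp add: flip_def min.commute)
  then show ?thesis
    by (intro mg_join[where \<mu> = \<mu>]) (use join(1-4) mg_ends[OF assms] in \<open>auto simp: Un_commute\<close>)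
next
  case left
  then show ?thesis using mg_right[of "flip y" "flip x"] mg_ends[OF assms] by simp
next
  case right
  then show ?thesis using mg_left[of "flip y" "flip x"] mg_ends[OF assms] by simp
qed

lemma point_width: "valid x \<Longrightarrow> seg_from x = seg_to x \<Longrightarrow> slice_width x (seg_to x) = ereal (slice_exp x)"
  by (simp add: valid_def)

text \<open>The alternatives exclude each other except that two point slices may absorb each other
  in either direction. Then both inequalities hold, the exponents agree, and the two slices are
  equivalent.\<close>

lemma mg_unique:
  assumes v: "valid x" "valid y" and m: "mg x y z" "mg x y z'"
  shows "slice_eqv z z'"
proof -
  have e: "seg_to x = seg_from y" "slice_sign x = slice_sign y" using mg_ends[OF m(1)] by auto
  have both: "slice_eqv x y" if "seg_from x = seg_to x" "slice_width y (seg_from y) \<le> ereal (slice_exp x)"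
    "seg_from y = seg_to y" "slice_width x (seg_to x) \<le> ereal (slice_exp y)"
    by (rule slice_eqv_points[OF v, of "seg_to x"]) (use that e point_width[OF v(1)] point_width[OF v(2)] in auto)
  from m(1) show ?thesis
  proof (cases rule: mg_cases)
    case (join \<mu>)
    from m(2) show ?thesis
    proof (cases rule: mg_cases)
      case J: (join \<mu>')
      have "seg_set S z = seg_set S x \<union> seg_set S y" using join e by (intro seg_set_join) auto
      then show ?thesis using join J unfolding slice_eqv_def by auto
    qed (use join in auto)
  next
    case left
    from m(2) show ?thesis
    proof (cases rule: mg_cases)
      case right
      then show ?thesis using left both slice_eqv_sym by simp
    qed (use left in auto)
  next
    case right
    from m(2) show ?thesis
    proof (cases rule: mg_cases)
      case left
      then show ?thesis using right both by simp
    qed (use right in auto)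
  qed
qed

text \<open>The critical pair of a pizza with two entries, where each is the successor of the other.
  The segments then run in opposite directions, so no join is possible and both are points; the one
  with the smaller exponent survives either way.\<close>

lemma mg_opposite:
  assumes v: "valid x" "valid y" and m: "mg x y u" "mg y x u'"
  shows "slice_eqv u u'"
proof -
  have e: "seg_to x = seg_from y" "seg_to y = seg_from x" "slice_sign x = slice_sign y"
    using mg_ends[OF m(1)] mg_ends[OF m(2)] by auto
  have pt: "seg_from x = seg_to x \<longleftrightarrow> seg_from y = seg_to y" using e by auto
  have nj: "\<not> (seg_from x < seg_to x \<and> seg_from y < seg_to y \<or> seg_from x > seg_to x \<and> seg_from y > seg_to y)"
    using e by auto
  have both: "slice_eqv x y" if "seg_from x = seg_to x" "slice_exp x = slice_exp y"
    by (rule slice_eqv_points[OF v, of "seg_to x"]) (use that e in auto)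
  have p: "seg_from x = seg_to x" using m(1) by (cases rule: mg_cases) (use nj pt in auto)
  have w: "slice_width x (seg_to x) = ereal (slice_exp x)" "slice_width y (seg_to y) = ereal (slice_exp y)"
    "seg_from y = seg_to y" using point_width v p pt by auto
  have u: "u = y \<and> slice_exp y \<le> slice_exp x \<or> u = x \<and> slice_exp x \<le> slice_exp y"
    using m(1) by (cases rule: mg_cases) (use nj w p in auto)
  have u': "u' = x \<and> slice_exp x \<le> slice_exp y \<or> u' = y \<and> slice_exp y \<le> slice_exp x"
    using m(2) by (cases rule: mg_cases) (use nj w p in auto)
  show ?thesis using u u' both[OF p] slice_eqv_sym by (metis antisym slice_eqv_refl)
qed

text \<open>The critical pair of two merges that share \<open>y\<close>. In the first alternative
  \<open>y\<close> is a point absorbed by either neighbour, and both results consist of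
  \<open>x\<close> and \<open>z\<close>. Otherwise the remaining two slices can be merged on both
  sides, with equivalent results.\<close>

lemma mg_overlap:
  assumes v: "valid x" "valid y" "valid z" and m: "mg x y u" "mg y z w"
  shows "u = x \<and> w = z \<or> (\<exists>p q. mg u z p \<and> mg x w q \<and> slice_eqv p q)"
proof -
  have e: "seg_to x = seg_from y" "slice_sign x = slice_sign y" "seg_to y = seg_from z" "slice_sign y = slice_sign z"
    using mg_ends[OF m(1)] mg_ends[OF m(2)] by auto
  from m(1) show ?thesis
  proof (cases rule: mg_cases)
    case J: (join \<mu>)
    from m(2) show ?thesis
    proof (cases rule: mg_cases)
      case K: (join \<mu>')
      have "seg_from y \<noteq> seg_to y" using J(1) by auto
      then obtain r s where rs: "r \<noteq> s" "ereal r \<in> seg_set S y" "ereal s \<in> seg_set S y"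
        using finite_point[OF v(2)] by blast
      obtain c k where ck: "c \<in> E" "k \<in> E" "\<And>q. q \<in> seg_set S x \<union> seg_set S y \<Longrightarrow> \<mu> q = ereal c * q + ereal k"
        using affineD[OF J(2) UnI2[OF rs(2)]] by metis
      obtain c' k' where ck': "\<And>q. q \<in> seg_set S y \<union> seg_set S z \<Longrightarrow> \<mu>' q = ereal c' * q + ereal k'"
        using affineD[OF K(2) UnI1[OF rs(2)]] by metis
      \<comment> \<open>Both affine functions agree with the width of \<open>y\<close> at two finite
        orders, so they have the same coefficients and extend to one function on all three
        segments.\<close>
      have "c * r + k = c' * r + k'" "c * s + k = c' * s + k'"
        using ck(3)[of "ereal r"] ck'[of "ereal r"] ck(3)[of "ereal s"] ck'[of "ereal s"] J(4) K(3) rs by force+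
      then have "(c - c') * (r - s) = 0" by (simp add: algebra_simps)
      then have "c = c'" using rs(1) by simp
      then have "k = k'" using \<open>c * r + k = c' * r + k'\<close> by simp
      define \<nu> where "\<nu> q = ereal c * q + ereal k" for q
      have \<nu>: "\<And>q. q \<in> seg_set S x \<union> seg_set S y \<Longrightarrow> \<mu> q = \<nu> q" "\<And>q. q \<in> seg_set S y \<union> seg_set S z \<Longrightarrow> \<mu>' q = \<nu> q"
        using ck(3) ck' \<open>c = c'\<close> \<open>k = k'\<close> by (auto simp: \<nu>_def)
      have su: "seg_set S u = seg_set S x \<union> seg_set S y" using J e by (intro seg_set_join) auto
      have sw: "seg_set S w = seg_set S y \<union> seg_set S z" using K e by (intro seg_set_join) auto
      have aff: "affine_width S (seg_set S x \<union> seg_set S y \<union> seg_set S z) \<nu>"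
        unfolding affine_width_def
      proof (intro conjI ballI disjI2)
        show "\<exists>c\<in>E. \<exists>k\<in>E. \<forall>q\<in>seg_set S x \<union> seg_set S y \<union> seg_set S z. \<nu> q = ereal c * q + ereal k"
          unfolding \<nu>_def using ck(1,2) by blast
      next
        fix q assume "q \<in> seg_set S x \<union> seg_set S y \<union> seg_set S z"
        then show "\<nu> q \<in> ereal ` E \<union> {\<infinity>}"
          using J(2) K(2) \<nu> unfolding affine_width_def by (metis Un_iff)
      qed
      define p where "p = Slice (min (slice_exp u) (slice_exp z)) (seg_from u) (seg_to z) (slice_sign u) \<nu>"
      have "mg u z p"
        by (rule mg_join[where \<mu> = \<nu>]) (use J K e su aff \<nu> in \<open>auto simp: p_def\<close>)
      moreover have "mg x w p"
        by (rule mg_join[where \<mu> = \<nu>]) (use J K e sw aff \<nu> in \<open>auto simp: p_def Un_assoc min.assoc\<close>)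
      ultimately show ?thesis using slice_eqv_refl by blast
    next
      case left
      then show ?thesis using J(1) by auto
    next
      case right
      have su: "seg_set S u = seg_set S x \<union> seg_set S y" using J e by (intro seg_set_join) auto
      have "slice_width u (seg_to u) = slice_width y (seg_to y)"
        using J(4)[OF ends_in_seg_set(2)[OF v(2)]] J(5) by simp
      then have "mg u z u" by (intro mg_right) (use J right e in auto)
      then show ?thesis using m(1) right(3) slice_eqv_refl by blast
    qed
  next
    case L: left
    from m(2) show ?thesis
    proof (cases rule: mg_cases)
      case K: (join \<mu>')
      have "slice_width w (seg_from w) = slice_width y (seg_from y)"
        using K(3)[OF ends_in_seg_set(1)[OF v(2)]] K(5) by simp
      then have "mg x w w" by (intro mg_left) (use K L e in auto)
      then show ?thesis using m(2) L(3) slice_eqv_refl by blast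
    next
      case left
      have "slice_width z (seg_from z) \<le> ereal (slice_exp x)"
        using left(2) L(2) point_width[OF v(2)] left(1) by (metis order_trans)
      then have "mg x w w" using left(3) by (auto intro!: mg_left simp: L left e)
      then show ?thesis using m(2) L(3) slice_eqv_refl by blast
    next
      case right
      then show ?thesis using m L(3) slice_eqv_refl by metis
    qed
  next
    case R: right
    from m(2) show ?thesis
    proof (cases rule: mg_cases)
      case (join \<mu>)
      then show ?thesis using R(1) by auto
    next
      case left
      then show ?thesis using R by simp
    next
      case right
      have "slice_width x (seg_to x) \<le> ereal (slice_exp z)"
        using right(2) R(2) point_width[OF v(2) R(1)] by (metis order_trans)
      then have "mg u z u" using R(3) by (auto intro!: mg_right simp: R right e)
      then show ?thesis using m(1) right(3) R(3) slice_eqv_refl by metis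
    qed
  qed
qed

section \<open>Simplification as rewriting of cyclic lists\<close>

lemma stepI: "H = ps @ qs \<Longrightarrow> qs @ ps = x # y # zs \<Longrightarrow> mg x y z \<Longrightarrow> step H (z # zs)"
  unfolding simplify_step_def mg_def using rotate_append' by metis

lemma stepE:
  assumes "step H H'"
  obtains ps qs x y z zs where "H = ps @ qs" "qs @ ps = x # y # zs" "mg x y z" "H' = z # zs"
  using assms rotate_split unfolding simplify_step_def mg_def by metis

lemma step_length: "step H H' \<Longrightarrow> length H' < length H"
  by (elim stepE) (metis append_Cons length_Cons length_append lessI add.commute length_rotate rotate_append)

lemma step_valid: "all_valid H \<Longrightarrow> step H H' \<Longrightarrow> all_valid H'"
proof (elim stepE)
  fix ps qs x y z zs assume *: "all_valid H" "H = ps @ qs" "qs @ ps = x # y # zs" "mg x y z" "H' = z # zs"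
  have "set (x # y # zs) = set H" using *(2) *(3)[symmetric] by auto
  then have "all_valid (x # y # zs)" using *(1) unfolding all_valid_def by simp
  then show "all_valid H'" using mg_valid *(4,5) unfolding all_valid_def by auto
qed

lemma steps_valid: "step\<^sup>*\<^sup>* H H' \<Longrightarrow> all_valid H \<Longrightarrow> all_valid H'"
  by (induction rule: rtranclp_induct) (auto intro: step_valid)

lemma list_all2_eqv_refl: "list_all2 slice_eqv xs xs"
  by (simp add: list_all2_refl)

lemma ceq_refl [simp]: "ceq H H"
  unfolding ceq_def using list_all2_eqv_refl[of H] by (metis rotate0 id_apply)

lemma ceq_swap: "ceq (ps @ qs) (qs @ ps)"
  unfolding ceq_def using list_all2_eqv_refl rotate_append' by metis

lemma ceq_eqv: "list_all2 slice_eqv H G \<Longrightarrow> ceq H G"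
  unfolding ceq_def by (metis rotate0 id_apply)

lemma ceq_sym: assumes "ceq H G" shows "ceq G H"
proof -
  obtain n where n: "list_all2 slice_eqv (rotate n H) G" using assms unfolding ceq_def by blast
  define m where "m = n * (length H - 1)"
  have "list_all2 slice_eqv (rotate m (rotate n H)) (rotate m G)" using n by (rule list_all2_rotate)
  then have "list_all2 slice_eqv H (rotate m G)" unfolding m_def by (simp only: rotate_undo)
  then have "list_all2 slice_eqv (rotate m G) H"
    unfolding list_all2_conv_all_nth using slice_eqv_sym by metis
  then show ?thesis unfolding ceq_def by blast
qed

lemma ceq_trans: assumes "ceq H G" "ceq G K" shows "ceq H K"
proof -
  obtain n m where n: "list_all2 slice_eqv (rotate n H) G" "list_all2 slice_eqv (rotate m G) K"
    using assms unfolding ceq_def by blast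
  have "list_all2 slice_eqv (rotate m (rotate n H)) (rotate m G)" using n(1) by (rule list_all2_rotate)
  then have "list_all2 slice_eqv (rotate m (rotate n H)) K"
    using n(2) by (rule list_all2_trans[rotated]) (rule slice_eqv_trans)
  then show ?thesis unfolding ceq_def by (metis rotate_rotate)
qed

lemma ceq_length: "ceq H G \<Longrightarrow> length H = length G"
  unfolding ceq_def by (metis length_rotate list_all2_lengthD)

lemma step_ceq:
  assumes v: "all_valid H" "all_valid G" and eq: "ceq H G" and st: "step H H'"
  shows "\<exists>G'. step G G' \<and> ceq H' G'"
proof -
  obtain ps qs x y z zs where *: "H = ps @ qs" "qs @ ps = x # y # zs" "mg x y z" "H' = z # zs"
    using st by (rule stepE)
  have "ceq (x # y # zs) G" using ceq_trans[OF ceq_swap eq[unfolded *(1)]] *(2) by simp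
  then obtain n where "list_all2 slice_eqv (rotate n G) (x # y # zs)" using ceq_sym unfolding ceq_def by blast
  then obtain x' y' zs' where r: "rotate n G = x' # y' # zs'" "slice_eqv x' x" "slice_eqv y' y" "list_all2 slice_eqv zs' zs"
    by (auto simp: list_all2_Cons2)
  have "set (x' # y' # zs') = set G" using r(1) by (metis set_rotate)
  then have v': "valid x'" "valid y'" using v(2) unfolding all_valid_def by auto
  have "set (x # y # zs) = set H" using *(1) *(2)[symmetric] by auto
  then have v'': "valid x" "valid y" using v(1) unfolding all_valid_def by auto
  obtain z' where z': "mg x' y' z'" "slice_eqv z z'"
    using mg_cong[OF v'' v' slice_eqv_sym[OF r(2)] slice_eqv_sym[OF r(3)] *(3)] by blast
  have "step G (z' # zs')" unfolding simplify_step_def using r(1) z'(1) unfolding mg_def by blast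
  moreover have "list_all2 slice_eqv (z' # zs') H'" using *(4) z'(2) r(4) slice_eqv_sym by simp
  then have "ceq H' (z' # zs')" using ceq_eqv ceq_sym by blast
  ultimately show ?thesis by blast
qed

text \<open>The lengths of \<open>ps\<close> and \<open>qs\<close> give the place of the second
  merge relative to the first: the same pair, the pair starting at \<open>y\<close>, the pair ending
  at \<open>x\<close>, or a disjoint pair. In a list of two entries, the pair starting at
  \<open>y\<close> is the opposite one. Disjoint merges commute up to rotation.\<close>

lemma local_confluence_aux:
  assumes v: "all_valid (x # y # zs)" and u: "mg x y u"
    and r: "x # y # zs = ps @ qs" "qs @ ps = x' # y' # zs'" and u': "mg x' y' u'"
  shows "\<exists>A B. step\<^sup>*\<^sup>* (u # zs) A \<and> step\<^sup>*\<^sup>* (u' # zs') B \<and> ceq A B"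
proof (cases ps)
  case Nil
  then have "x' = x" "y' = y" "zs' = zs" using r by auto
  then have "slice_eqv u u'" using mg_unique[of x y u u'] v u u' unfolding all_valid_def by simp
  then have "ceq (u # zs) (u' # zs')" using \<open>zs' = zs\<close> list_all2_eqv_refl by (intro ceq_eqv) simp
  then show ?thesis by blast
next
  case (Cons a ps1)
  then have a: "a = x" "ps1 @ qs = y # zs" using r(1) by auto
  show ?thesis
  proof (cases ps1)
    case Nil
    then have qs: "qs = y # zs" using a by simp
    show ?thesis
    proof (cases zs)
      case Nil
      then have "x' = y" "y' = x" "zs' = []" using r(2) qs \<open>ps1 = []\<close> Cons a by auto
      then have "slice_eqv u u'" using mg_opposite[of x y u u'] v u u' unfolding all_valid_def by simp
      then have "ceq (u # zs) (u' # zs')" using \<open>zs' = []\<close> Nil by (intro ceq_eqv) simp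
      then show ?thesis by blast
    next
      case Z: (Cons w ws)
      then have e: "x' = y" "y' = w" "zs' = ws @ [x]" using r(2) qs \<open>ps1 = []\<close> Cons a by auto
      have "u = x \<and> u' = w \<or> (\<exists>p q. mg u w p \<and> mg x u' q \<and> slice_eqv p q)"
        using mg_overlap[of x y w u u'] v u u' e Z unfolding all_valid_def by simp
      then show ?thesis
      proof (elim disjE exE conjE)
        assume "u = x" "u' = w"
        then have "ceq (u # zs) (u' # zs')" using ceq_swap[of "[x]" "w # ws"] e Z by simp
        then show ?thesis by blast
      next
        fix p q assume pq: "mg u w p" "mg x u' q" "slice_eqv p q"
        have "step (u # zs) (p # ws)" by (rule stepI[of _ "[]" "u # zs"]) (use Z pq in auto)
        moreover have "step (u' # zs') (q # ws)"
          by (rule stepI[of _ "u' # ws" "[x]"]) (use e pq in auto)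
        moreover have "ceq (p # ws) (q # ws)" using pq(3) list_all2_eqv_refl by (intro ceq_eqv) simp
        ultimately show ?thesis by blast
      qed
    qed
  next
    case P: (Cons b as)
    then have b: "b = y" "as @ qs = zs" using a by auto
    have ps: "ps = x # y # as" using Cons P a b by simp
    show ?thesis
    proof (cases qs)
      case Nil
      then have "x' = x" "y' = y" "zs' = zs" using r(2) ps b by auto
      then have "slice_eqv u u'" using mg_unique[of x y u u'] v u u' unfolding all_valid_def by simp
      then have "ceq (u # zs) (u' # zs')" using \<open>zs' = zs\<close> list_all2_eqv_refl by (intro ceq_eqv) simp
      then show ?thesis by blast
    next
      case Q: (Cons w qs1)
      show ?thesis
      proof (cases qs1)
        case Nil
        then have e: "x' = w" "y' = x" "zs' = y # as" "zs = as @ [w]" using r(2) ps Q b by auto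
        have "u' = w \<and> u = y \<or> (\<exists>p q. mg u' y p \<and> mg w u q \<and> slice_eqv p q)"
          using mg_overlap[of w x y u' u] v u u' e unfolding all_valid_def by simp
        then show ?thesis
        proof (elim disjE exE conjE)
          assume "u' = w" "u = y"
          then have "ceq (u # zs) (u' # zs')" using ceq_swap[of "y # as" "[w]"] e by simp
          then show ?thesis by blast
        next
          fix p q assume pq: "mg u' y p" "mg w u q" "slice_eqv p q"
          have "step (u' # zs') (p # as)" by (rule stepI[of _ "[]" "u' # zs'"]) (use e pq in auto)
          moreover have "step (u # zs) (q # as)"
            by (rule stepI[of _ "u # as" "[w]"]) (use e pq in auto)
          moreover have "ceq (q # as) (p # as)"
            using pq(3) list_all2_eqv_refl slice_eqv_sym by (intro ceq_eqv) simp
          ultimately show ?thesis by blast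
        qed
      next
        case R: (Cons w' bs)
        then have e: "x' = w" "y' = w'" "zs' = bs @ x # y # as" "zs = as @ w # w' # bs" using r(2) ps Q b by auto
        have "step (u # zs) (u' # bs @ u # as)"
          by (rule stepI[of _ "u # as" "w # w' # bs"]) (use e u' in auto)
        moreover have "step (u' # zs') (u # as @ u' # bs)"
          by (rule stepI[of _ "u' # bs" "x # y # as"]) (use e u in auto)
        moreover have "ceq (u' # bs @ u # as) (u # as @ u' # bs)"
          using ceq_swap[of "u' # bs" "u # as"] by simp
        ultimately show ?thesis by blast
      qed
    qed
  qed
qed

lemma local_confluence:
  assumes "all_valid H" "step H A" "step H B"
  shows "\<exists>A' B'. step\<^sup>*\<^sup>* A A' \<and> step\<^sup>*\<^sup>* B B' \<and> ceq A' B'"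
proof -
  obtain n x y z zs where 1: "rotate n H = x # y # zs" "mg x y z" "A = z # zs"
    using assms(2) unfolding simplify_step_def mg_def by metis
  obtain m x' y' z' zs' where 2: "rotate m H = x' # y' # zs'" "mg x' y' z'" "B = z' # zs'"
    using assms(3) unfolding simplify_step_def mg_def by metis
  have "rotate (m + n * (length H - 1)) (x # y # zs) = x' # y' # zs'"
    using rotate_undo[of n H] 1(1) 2(1) by (metis rotate_rotate)
  then obtain ps qs where "x # y # zs = ps @ qs" "qs @ ps = x' # y' # zs'"
    using rotate_split by metis
  moreover have "set (x # y # zs) = set H" using 1(1) by (metis set_rotate)
  then have "all_valid (x # y # zs)" using assms(1) unfolding all_valid_def by simp
  ultimately show ?thesis using local_confluence_aux 1 2 by metis
qed

lemma nf_exists: "\<exists>N. step\<^sup>*\<^sup>* H N \<and> nf N"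
proof (induction "length H" arbitrary: H rule: less_induct)
  case less
  show ?case
  proof (cases "nf H")
    case False
    then obtain H' where "step H H'" unfolding nf_def by blast
    then show ?thesis using less[OF step_length] by (meson converse_rtranclp_into_rtranclp)
  qed blast
qed

lemma nf_ceq: "all_valid H \<Longrightarrow> all_valid G \<Longrightarrow> ceq H G \<Longrightarrow> nf H \<Longrightarrow> nf G"
  unfolding nf_def using step_ceq ceq_sym by blast

text \<open>Newman's argument modulo \<open>ceq\<close>. The first step out of \<open>H\<close> is
  copied to \<open>G\<close> by \<open>step_ceq\<close>, so that local confluence applies to two
  steps out of the same list. The induction is on the length, which \<open>ceq\<close>
  preserves.\<close>

lemma unique_nf:
  assumes "all_valid H" "all_valid G" "ceq H G" "step\<^sup>*\<^sup>* H A" "nf A" "step\<^sup>*\<^sup>* G B" "nf B"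
  shows "ceq A B"
  using assms
proof (induction "length H" arbitrary: H G A B rule: less_induct)
  case less
  show ?case
  proof (cases "nf H")
    case True
    then have "nf G" using nf_ceq less.prems by blast
    have "A = H" using less.prems(4) True unfolding nf_def by (metis converse_rtranclpE)
    moreover have "B = G" using less.prems(6) \<open>nf G\<close> unfolding nf_def by (metis converse_rtranclpE)
    ultimately show ?thesis using less.prems by simp
  next
    case False
    then have "\<not> nf G" using nf_ceq ceq_sym less.prems by blast
    have "A \<noteq> H" "B \<noteq> G" using False \<open>\<not> nf G\<close> less.prems by auto
    obtain H1 where H1: "step H H1" "step\<^sup>*\<^sup>* H1 A" using less.prems(4) \<open>A \<noteq> H\<close> by (metis converse_rtranclpE)
    obtain G1 where G1: "step G G1" "step\<^sup>*\<^sup>* G1 B" using less.prems(6) \<open>B \<noteq> G\<close> by (metis converse_rtranclpE)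
    obtain G2 where G2: "step G G2" "ceq H1 G2" using step_ceq[OF less.prems(1-3) H1(1)] by blast
    obtain C1 C2 where C: "step\<^sup>*\<^sup>* G1 C1" "step\<^sup>*\<^sup>* G2 C2" "ceq C1 C2"
      using local_confluence[OF less.prems(2) G1(1) G2(1)] by blast
    obtain N1 where N1: "step\<^sup>*\<^sup>* C1 N1" "nf N1" using nf_exists by blast
    obtain N2 where N2: "step\<^sup>*\<^sup>* C2 N2" "nf N2" using nf_exists by blast
    have len: "length G = length H" using ceq_length less.prems(3) by simp
    have steps_len: "length Y \<le> length X" if "step\<^sup>*\<^sup>* X Y" for X Y
      using that by (induction rule: rtranclp_induct) (auto dest: step_length)
    have val: "all_valid H1" "all_valid G1" "all_valid G2" using step_valid less.prems H1 G1 G2 by blast+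
    have valC: "all_valid C1" "all_valid C2" using steps_valid C val by blast+
    have l: "length H1 < length H" "length G1 < length H" "length C1 < length H"
      using step_length[OF H1(1)] step_length[OF G1(1)] steps_len[OF C(1)] len by auto
    have "ceq B N1"
      by (rule less.hyps[OF l(2) val(2,2) ceq_refl G1(2) less.prems(7) rtranclp_trans[OF C(1) N1(1)] N1(2)])
    moreover have "ceq N1 N2"
      by (rule less.hyps[OF l(3) valC C(3) N1 N2])
    moreover have "ceq A N2"
      by (rule less.hyps[OF l(1) val(1,3) G2(2) H1(2) less.prems(5) rtranclp_trans[OF C(2) N2(1)] N2(2)])
    ultimately show ?thesis using ceq_trans ceq_sym by blast
  qed
qed

text \<open>A step also rotates the list, so simplification to a given list is meaningful only up to
  \<open>ceq\<close>.\<close>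

definition reduces :: "slice list \<Rightarrow> slice list \<Rightarrow> bool" where
  "reduces H G \<longleftrightarrow> (\<exists>H'. step\<^sup>*\<^sup>* H H' \<and> ceq H' G)"

lemma reduces_refl [simp]: "reduces H H"
  unfolding reduces_def by (metis ceq_refl rtranclp.rtrancl_refl)

lemma reduces_steps:
  assumes "all_valid G" "all_valid K" "ceq K G" "step\<^sup>*\<^sup>* G N" shows "\<exists>K'. step\<^sup>*\<^sup>* K K' \<and> ceq K' N"
  using assms(4)
proof (induction rule: rtranclp_induct)
  case base then show ?case using assms by blast
next
  case (step N N')
  then obtain K' where K': "step\<^sup>*\<^sup>* K K'" "ceq K' N" by blast
  have "all_valid N" "all_valid K'" using steps_valid step K' assms by blast+
  then obtain K'' where "simplify_step S K' K''" "ceq N' K''" using step_ceq[OF _ _ ceq_sym[OF K'(2)] step(2)] by blast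
  then show ?case using K' ceq_sym by (meson rtranclp.rtrancl_into_rtrancl)
qed

lemma reduces_trans:
  assumes "all_valid H" "all_valid G" "reduces H G" "reduces G K" shows "reduces H K"
proof -
  obtain H' where H': "step\<^sup>*\<^sup>* H H'" "ceq H' G" using assms(3) unfolding reduces_def by blast
  obtain G' where G': "step\<^sup>*\<^sup>* G G'" "ceq G' K" using assms(4) unfolding reduces_def by blast
  obtain K' where "step\<^sup>*\<^sup>* H' K'" "ceq K' G'"
    using reduces_steps[OF assms(2) steps_valid[OF H'(1) assms(1)] H'(2) G'(1)] by blast
  then show ?thesis unfolding reduces_def using H' G' ceq_trans by (meson rtranclp_trans)
qed

lemma reduces_nf_unique:
  assumes v: "all_valid H" "all_valid G" "ceq H G" and r: "reduces H A" "reduces G B"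
    and n: "nf A" "nf B" "all_valid A" "all_valid B"
  shows "ceq A B"
proof -
  obtain A' where A': "step\<^sup>*\<^sup>* H A'" "ceq A' A" using r(1) unfolding reduces_def by blast
  obtain B' where B': "step\<^sup>*\<^sup>* G B'" "ceq B' B" using r(2) unfolding reduces_def by blast
  have "nf A'" "nf B'" using nf_ceq ceq_sym A' B' n steps_valid v by blast+
  then have "ceq A' B'" using unique_nf v A' B' by blast
  then show ?thesis using A' B' ceq_trans ceq_sym by blast
qed

section \<open>Mirrored pizzas and combinatorial equivalence\<close>

lemma all_valid_mirror: "all_valid H \<Longrightarrow> all_valid (mirror H)"
  unfolding all_valid_def mirror_def by (auto intro: valid_flip)

lemma step_mirror:
  assumes "step H H'" shows "\<exists>G. step (mirror H) G \<and> ceq G (mirror H')"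
proof -
  obtain ps qs x y z zs where *: "H = ps @ qs" "qs @ ps = x # y # zs" "mg x y z" "H' = z # zs"
    using assms by (rule stepE)
  have m: "mirror ps @ mirror qs = mirror zs @ [flip y, flip x]"
    using arg_cong[OF *(2), of mirror] by simp
  obtain n where n: "rotate n (mirror H) = flip y # flip x # mirror zs"
  proof -
    have "rotate (length (mirror qs)) (mirror H) = mirror zs @ [flip y, flip x]"
      using m *(1) rotate_append'[of "mirror qs" "mirror ps"] by simp
    then have "rotate (length (mirror zs)) (rotate (length (mirror qs)) (mirror H)) = flip y # flip x # mirror zs"
      using rotate_append'[of "mirror zs" "[flip y, flip x]"] by simp
    then show ?thesis using that by (metis rotate_rotate)
  qed
  have "step (mirror H) (flip z # mirror zs)"
    unfolding simplify_step_def using n mg_flip[OF *(3)] unfolding mg_def by blast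
  moreover have "ceq (flip z # mirror zs) (mirror H')"
    using ceq_swap[of "[flip z]" "mirror zs"] *(4) by simp
  ultimately show ?thesis by blast
qed

lemma reduces_mirror:
  assumes "all_valid H" "step\<^sup>*\<^sup>* H A" shows "reduces (mirror H) (mirror A)"
  using assms(2)
proof (induction rule: rtranclp_induct)
  case (step B C)
  have v: "all_valid B" "all_valid C" using steps_valid step assms by (blast intro: step_valid)+
  obtain G where "simplify_step S (mirror B) G" "ceq G (mirror C)" using step_mirror[OF step(2)] by blast
  then have "reduces (mirror B) (mirror C)" unfolding reduces_def by blast
  then show ?case using reduces_trans step.IH all_valid_mirror v assms(1) by blast
qed simp

lemma nf_mirror: "nf A \<Longrightarrow> nf (mirror A)"
  unfolding nf_def using step_mirror[of "mirror A"] by auto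

lemma ceq_mirror: assumes "ceq H G" shows "ceq (mirror H) (mirror G)"
proof -
  obtain n where n: "list_all2 slice_eqv (rotate n H) G" using assms unfolding ceq_def by blast
  obtain ps qs where s: "H = ps @ qs" "rotate n H = qs @ ps" using rotate_split by metis
  have "slice_eqv (flip x) (flip y)" if "slice_eqv x y" for x y using that unfolding slice_eqv_def by simp
  then have "list_all2 slice_eqv (mirror (qs @ ps)) (mirror G)"
    using n[unfolded s(2)] unfolding mirror_def
    by (simp add: list_all2_rev list_all2_map1 list_all2_map2 list_all2_mono del: rev_append map_append)
  then have "ceq (mirror (qs @ ps)) (mirror G)" by (rule ceq_eqv)
  moreover have "ceq (mirror H) (mirror (qs @ ps))" unfolding s(1) using ceq_swap by simp
  ultimately show ?thesis using ceq_trans by blast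
qed

lemma ceq_equivalent:
  assumes v: "all_valid H" "all_valid H'" and eq: "ceq H H'"
  shows "combinatorially_equivalent S H H'"
proof -
  define k where "k = length H"
  have k: "length H' = k" using ceq_length[OF eq] by (simp add: k_def)
  obtain n where n: "list_all2 slice_eqv (rotate n H') H" using ceq_sym[OF eq] unfolding ceq_def by blast
  define j where "j i = (i + n) mod k" for i
  have e: "slice_eqv (H' ! j i) (H ! i)" if "i < k" for i
    using n that k unfolding list_all2_conv_all_nth j_def k_def by (simp add: nth_rotate add.commute)
  have jk: "j i < k" if "i < k" for i using that by (auto simp: j_def)
  have ex: "slice_exp (H' ! j i) = slice_exp (H ! i)" if "i < k" for i
    using slice_eqv_exp[OF _ _ e[OF that]] v jk[OF that] that k unfolding all_valid_def k_def by simp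
  have "inj_on j {..<k}"
  proof (rule inj_onI)
    fix a b assume ab: "a \<in> {..<k}" "b \<in> {..<k}" "j a = j b"
    then show "a = b" using mod_add_inj[of a k b n] by (simp add: j_def)
  qed
  then have "bij_betw j {..<k} {..<k}"
    using jk by (intro bij_betw_imageI endo_inj_surj) auto
  moreover have "cyclic_preserving k j"
    unfolding cyclic_preserving_def j_def by (auto simp: mod_simps)
  moreover have "\<forall>i<k. slice_sign (H' ! j i) = slice_sign (H ! i)"
    "\<forall>i<k. seg_from (H' ! j i) = seg_from (H ! i) \<and> seg_to (H' ! j i) = seg_to (H ! i)"
    using e unfolding slice_eqv_def by simp_all
  moreover have "\<forall>i<k. \<forall>q\<in>seg_set S (H ! i). slice_width (H' ! j i) q = slice_width (H ! i) q"
  proof (intro allI impI ballI)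
    fix i q assume "i < k" "q \<in> seg_set S (H ! i)"
    then show "slice_width (H' ! j i) q = slice_width (H ! i) q"
      using slice_eqv_sym[OF e[OF \<open>i < k\<close>]] unfolding slice_eqv_def by simp
  qed
  moreover have "\<forall>i<k. slice_exp (H' ! j i) = slice_exp (H ! i)" using ex by blast
  ultimately show ?thesis
    unfolding combinatorially_equivalent_def k k_def[symmetric] by blast
qed

lemma ceq_mirror_equivalent:
  assumes v: "all_valid H" "all_valid H'" and eq: "ceq (mirror H) H'"
  shows "combinatorially_equivalent S H H'"
proof -
  define k where "k = length H"
  have k: "length H' = k" using ceq_length[OF eq] by (simp add: k_def)
  obtain n where n: "list_all2 slice_eqv (rotate n H') (mirror H)" using ceq_sym[OF eq] unfolding ceq_def by blast
  \<comment> \<open>Entry i of \<open>H\<close> stands at position k - 1 - i of its mirror image,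
    and the mirror image is \<open>H'\<close> rotated by \<open>n\<close>.\<close>
  define j where "j i = (k - Suc i + n) mod k" for i
  have e: "slice_eqv (H' ! j i) (flip (H ! i))" if "i < k" for i
  proof -
    have "slice_eqv (rotate n H' ! (k - Suc i)) (mirror H ! (k - Suc i))"
      using n that k unfolding list_all2_conv_all_nth by simp
    moreover have "mirror H ! (k - Suc i) = flip (H ! i)"
      using that unfolding mirror_def k_def by (simp add: rev_nth Suc_diff_Suc)
    ultimately show ?thesis using that k by (simp add: nth_rotate j_def add.commute)
  qed
  have jk: "j i < k" if "i < k" for i using that by (auto simp: j_def)
  have ex: "slice_exp (H' ! j i) = slice_exp (H ! i)" if "i < k" for i
    using slice_eqv_exp[OF _ valid_flip e[OF that]] v jk[OF that] that k unfolding all_valid_def k_def by simp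
  have "inj_on j {..<k}"
  proof (rule inj_onI)
    fix a b assume ab: "a \<in> {..<k}" "b \<in> {..<k}" "j a = j b"
    then have "k - Suc a = k - Suc b" using mod_add_inj[of "k - Suc a" k "k - Suc b" n] by (simp add: j_def)
    then show "a = b" using ab by auto
  qed
  then have "bij_betw j {..<k} {..<k}"
    using jk by (intro bij_betw_imageI endo_inj_surj) auto
  moreover have "cyclic_reversing k j"
    unfolding cyclic_reversing_def
  proof (intro allI impI)
    fix i assume i: "i < k"
    show "j i = Suc (j (Suc i mod k)) mod k"
    proof (cases "Suc i = k")
      case True
      then have "j i = n mod k" "j (Suc i mod k) = (k - 1 + n) mod k" by (simp_all add: j_def)
      moreover have "Suc ((k - 1 + n) mod k) mod k = (k + n) mod k"
        using i by (simp add: mod_Suc_eq)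
      ultimately show ?thesis by simp
    next
      case False
      then have "Suc i < k" using i by simp
      then have "Suc (j (Suc i mod k)) mod k = Suc (k - Suc (Suc i) + n) mod k" by (simp add: j_def mod_Suc_eq)
      also have "Suc (k - Suc (Suc i) + n) = k - Suc i + n" using \<open>Suc i < k\<close> by simp
      finally show ?thesis by (simp add: j_def)
    qed
  qed
  moreover have "\<forall>i<k. slice_sign (H' ! j i) = slice_sign (H ! i)"
    "\<forall>i<k. seg_from (H' ! j i) = seg_to (H ! i) \<and> seg_to (H' ! j i) = seg_from (H ! i)"
    using e unfolding slice_eqv_def by simp_all
  moreover have "\<forall>i<k. \<forall>q\<in>seg_set S (H ! i). slice_width (H' ! j i) q = slice_width (H ! i) q"
  proof (intro allI impI ballI)
    fix i q assume "i < k" "q \<in> seg_set S (H ! i)"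
    then show "slice_width (H' ! j i) q = slice_width (H ! i) q"
      using slice_eqv_sym[OF e[OF \<open>i < k\<close>]] unfolding slice_eqv_def by simp
  qed
  moreover have "\<forall>i<k. slice_exp (H' ! j i) = slice_exp (H ! i)" using ex by blast
  ultimately show ?thesis
    unfolding combinatorially_equivalent_def k k_def[symmetric] by blast
qed

end

section \<open>Splitting a slice along an arc\<close>

context function_germ
begin

lemma narrow_arcs: "narrow \<gamma> \<delta> \<Longrightarrow> arc \<gamma>" "narrow \<gamma> \<delta> \<Longrightarrow> arc \<delta>" "narrow \<gamma> \<delta> \<Longrightarrow> \<not> arc_eq \<gamma> \<delta>"
  unfolding narrow_def by auto

lemma arc_order_sec:
  assumes n: "narrow \<gamma> \<delta>"
  shows "arc_order {v. arc v \<and> le \<gamma> v \<delta>} (le \<gamma>) (tord S) ordf E" (is "arc_order ?A _ _ _ _")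
proof
  note g = narrow_arcs[OF n]
  have neq: "\<not> arc_eq x y" if "\<not> le \<gamma> y x" for x y
    using that arc_eq_le arc_eq_sym by blast
  show "le \<gamma> x x" for x by simp
  show "le \<gamma> x z" if "x \<in> ?A" "y \<in> ?A" "z \<in> ?A" "le \<gamma> x y" "le \<gamma> y z" for x y z
    using le_trans that by blast
  show "le \<gamma> x y \<or> le \<gamma> y x" if "x \<in> ?A" "y \<in> ?A" for x y using le_total[OF g(1)] that by blast
  show "tord S x y = tord S y x" for x y by (rule tord_commute)
  show "tord S x z = min (tord S x y) (tord S y z)"
    if "x \<in> ?A" "y \<in> ?A" "z \<in> ?A" "le \<gamma> x y" "\<not> le \<gamma> y x" "le \<gamma> y z" "\<not> le \<gamma> z y" for x y z
    by (rule tord_nested[OF n]) (use that neq in auto)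
  show "tord S x y = tord S x' y" if "x \<in> ?A" "x' \<in> ?A" "y \<in> ?A" "le \<gamma> x x'" "le \<gamma> x' x" for x x' y
    by (rule tord_cong[OF le_antisym[OF g(1)] arc_eq_refl]) (use that in auto)
  show "\<exists>z\<in>?A. le \<gamma> x z \<and> le \<gamma> z y \<and> \<not> le \<gamma> y z \<and> tord S z y = e"
    if "x \<in> ?A" "y \<in> ?A" "le \<gamma> x y" "\<not> le \<gamma> y x" "e \<in> E" "tord S x y < e" for x y e
  proof -
    have a: "arc x" "arc y" "le \<gamma> y \<delta>" using that by auto
    note h = that
    obtain z where "arc z" "le \<gamma> x z" "le \<gamma> z y" "\<not> arc_eq z y" "tord S z y = e"
      using approach_left[OF g(1) a(1,2) h(3) neq[OF h(4)] h(5,6)] .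
    then show ?thesis using le_trans[OF _ a(3)] le_antisym[OF g(1) _ a(2)] by blast
  qed
  show "\<exists>z\<in>?A. le \<gamma> x z \<and> \<not> le \<gamma> z x \<and> le \<gamma> z y \<and> tord S x z = e"
    if "x \<in> ?A" "y \<in> ?A" "le \<gamma> x y" "\<not> le \<gamma> y x" "e \<in> E" "tord S x y < e" for x y e
  proof -
    have a: "arc x" "arc y" "le \<gamma> y \<delta>" using that by auto
    note h = that
    obtain z where "arc z" "le \<gamma> x z" "le \<gamma> z y" "\<not> arc_eq x z" "tord S x z = e"
      using approach_right[OF g(1) a(1,2) h(3) neq[OF h(4)] h(5,6)] .
    then show ?thesis using le_trans[OF _ a(3)] le_antisym[OF g(1) a(1)] by blast
  qed
  show "\<exists>z\<in>?A. le \<gamma> x z \<and> le \<gamma> z y \<and> ordf z = ereal q"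
    if "x \<in> ?A" "y \<in> ?A" "le \<gamma> x y" "q \<in> E" "strictly_between (ordf x) (ordf y) (ereal q)" for x y q
  proof -
    have a: "arc x" "arc y" "le \<gamma> y \<delta>" using that by auto
    note h = that
    obtain z where z: "arc z" "le x z y" "ordf z = ereal q"
      using intermediate_arc[OF a(1,2) h(4) h(5)[unfolded strictly_between_def]] .
    then show ?thesis using le_between[OF g(1) a(1,2) z(1) h(3)] le_trans[OF _ a(3)] by blast
  qed
  show "ordf x = ordf y" if "x \<in> ?A" "y \<in> ?A" "le \<gamma> x y" "le \<gamma> y x" for x y
    by (rule ord_along_cong[OF le_antisym[OF g(1)]]) (use that in auto)
  show "ordf x \<in> ereal ` {r \<in> E. 0 < r} \<union> {\<infinity>}" if "x \<in> ?A" for x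
    using ord_in_order_values that unfolding order_values_def by blast
  show "\<exists>e\<in>E. x < e \<and> e < y" if "x < y" for x y
    using Rats_dense_in_real[OF that] Rats_subset_E by blast
qed

text \<open>What \<open>associated_pizza\<close> requires of a single triangle, in terms of the
  order of arcs in the sector from \<gamma> counterclockwise to \<delta>; \<open>assocI\<close>
  obtains it from a Hoelder triangle.\<close>

definition assoc :: "(real \<Rightarrow> real \<times> real) \<Rightarrow> (real \<Rightarrow> real \<times> real) \<Rightarrow> slice \<Rightarrow> bool" where
  "assoc \<gamma> \<delta> x \<longleftrightarrow> narrow \<gamma> \<delta> \<and> valid x \<and> seg_from x = ordf \<gamma> \<and> seg_to x = ordf \<delta> \<and>
     {ordf v | v. arc v \<and> le \<gamma> v \<delta>} = seg_set S x \<and>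
     (\<forall>v w z. arc v \<and> arc w \<and> arc z \<and> le \<gamma> v w \<and> le \<gamma> w \<delta> \<and> le \<gamma> v z \<and> le \<gamma> z w \<and> ordf v = ordf w \<longrightarrow> ordf z = ordf v) \<and>
     (\<forall>\<eta>. arc \<eta> \<and> le \<gamma> \<eta> \<delta> \<longrightarrow> Inf (wset \<gamma> \<delta> \<eta>) = slice_width x (ordf \<eta>)) \<and>
     (\<exists>\<epsilon>>0. \<forall>p \<in> interior (sec \<gamma> \<delta>) \<inter> ball 0 \<epsilon>. sgn (f p) = of_int (slice_sign x))"

lemma assocD:
  assumes "assoc \<gamma> \<delta> x"
  shows "narrow \<gamma> \<delta>" "valid x" "seg_from x = ordf \<gamma>" "seg_to x = ordf \<delta>"
    "{ordf v | v. arc v \<and> le \<gamma> v \<delta>} = seg_set S x"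
    "\<And>v w z. arc v \<Longrightarrow> arc w \<Longrightarrow> arc z \<Longrightarrow> le \<gamma> v w \<Longrightarrow> le \<gamma> w \<delta> \<Longrightarrow> le \<gamma> v z \<Longrightarrow> le \<gamma> z w \<Longrightarrow> ordf v = ordf w \<Longrightarrow> ordf z = ordf v"
    "\<And>\<eta>. arc \<eta> \<Longrightarrow> le \<gamma> \<eta> \<delta> \<Longrightarrow> Inf (wset \<gamma> \<delta> \<eta>) = slice_width x (ordf \<eta>)"
    "\<exists>\<epsilon>>0. \<forall>p \<in> interior (sec \<gamma> \<delta>) \<inter> ball 0 \<epsilon>. sgn (f p) = of_int (slice_sign x)"
proof -
  note * = assms[unfolded assoc_def]
  note 2 = *[THEN conjunct2] note 3 = 2[THEN conjunct2] note 4 = 3[THEN conjunct2] note 5 = 4[THEN conjunct2]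
  note 6 = 5[THEN conjunct2] note 7 = 6[THEN conjunct2]
  show "narrow \<gamma> \<delta>" by (rule *[THEN conjunct1])
  show "valid x" by (rule 2[THEN conjunct1])
  show "seg_from x = ordf \<gamma>" by (rule 3[THEN conjunct1])
  show "seg_to x = ordf \<delta>" by (rule 4[THEN conjunct1])
  show "{ordf v | v. arc v \<and> le \<gamma> v \<delta>} = seg_set S x" by (rule 5[THEN conjunct1])
  show "ordf z = ordf v" if "arc v" "arc w" "arc z" "le \<gamma> v w" "le \<gamma> w \<delta>" "le \<gamma> v z" "le \<gamma> z w" "ordf v = ordf w" for v w z
    by (rule 6[THEN conjunct1, rule_format, of v w z]) (intro conjI that)
  show "Inf (wset \<gamma> \<delta> \<eta>) = slice_width x (ordf \<eta>)" if "arc \<eta>" "le \<gamma> \<eta> \<delta>" for \<eta>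
    by (rule 7[THEN conjunct1, rule_format]) (intro conjI that)
  show "\<exists>\<epsilon>>0. \<forall>p \<in> interior (sec \<gamma> \<delta>) \<inter> ball 0 \<epsilon>. sgn (f p) = of_int (slice_sign x)"
    by (rule 7[THEN conjunct2])
qed

lemma interior_sec_nonempty:
  assumes "narrow \<gamma> \<delta>" "0 < \<epsilon>" shows "interior (sec \<gamma> \<delta>) \<inter> ball 0 \<epsilon> \<noteq> {}"
proof -
  have "ev (\<lambda>e. two_arcs \<gamma> \<delta> e \<and> e < \<epsilon>)"
    using two_arcs_ev[OF narrow_arcs[OF assms(1)]] ev_less[OF assms(2)] by eventually_elim simp
  then obtain e where e: "two_arcs \<gamma> \<delta> e" "e < \<epsilon>"
    using eventually_happens'[OF trivial_limit_at_right_real] by blast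
  interpret two_arcs \<gamma> \<delta> e by (rule e)
  have sub: "open_sec \<gamma> \<delta> e \<subseteq> sec \<gamma> \<delta>" using sec_Int_ball' by blast
  have "open_sec \<gamma> \<delta> e \<subseteq> interior (sec \<gamma> \<delta>)" by (rule interior_maximal[OF sub open_open_sec])
  moreover have "open_sec \<gamma> \<delta> e \<subseteq> ball 0 \<epsilon>" using e(2) unfolding open_sec_def by auto
  ultimately show ?thesis using open_sec_nonempty by blast
qed

text \<open>The sign is read off at an interior point arbitrarily close to the origin, and the
  widths at arcs, since every order in the segment is attained by some arc of the sector.\<close>

lemma assoc_unique:
  assumes "assoc \<gamma> \<delta> x" "assoc \<gamma> \<delta> y" shows "slice_eqv x y"
proof -
  have n: "narrow \<gamma> \<delta>" by (rule assocD(1)[OF assms(1)])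
  obtain e1 e2 where e: "0 < e1" "\<forall>p \<in> interior (sec \<gamma> \<delta>) \<inter> ball 0 e1. sgn (f p) = of_int (slice_sign x)"
    "0 < e2" "\<forall>p \<in> interior (sec \<gamma> \<delta>) \<inter> ball 0 e2. sgn (f p) = of_int (slice_sign y)"
    using assocD(8)[OF assms(1)] assocD(8)[OF assms(2)] by blast
  obtain p where "p \<in> interior (sec \<gamma> \<delta>)" "p \<in> ball 0 (min e1 e2)"
    using interior_sec_nonempty[OF n, of "min e1 e2"] e(1,3) by (metis IntE equals0I min_less_iff_conj)
  then have "p \<in> interior (sec \<gamma> \<delta>) \<inter> ball 0 e1" "p \<in> interior (sec \<gamma> \<delta>) \<inter> ball 0 e2" by auto
  then have "sgn (f p) = of_int (slice_sign x)" "sgn (f p) = of_int (slice_sign y)" using e(2,4) by blast+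
  then have "(of_int (slice_sign x) :: real) = of_int (slice_sign y)" by simp
  moreover have "slice_width x q = slice_width y q" if "q \<in> seg_set S x" for q
  proof -
    have "q \<in> {ordf v | v. arc v \<and> le \<gamma> v \<delta>}" using that assocD(5)[OF assms(1)] by simp
    then obtain v where "arc v" "le \<gamma> v \<delta>" "q = ordf v" by blast
    then show ?thesis using assocD(7)[OF assms(1)] assocD(7)[OF assms(2)] by metis
  qed
  ultimately show ?thesis
    unfolding slice_eqv_def using assocD(3,4)[OF assms(1)] assocD(3,4)[OF assms(2)] by simp
qed

text \<open>Widths in a subsector refer to positions as seen from its own first side. Expressing
  them by positions seen from \<gamma> places both halves of a cut sector in one ordered
  set.\<close>

lemma wset_rebase:
  assumes n: "narrow \<gamma> \<delta>" and a: "arc a" "arc b" and l: "le \<gamma> a b" "le \<gamma> b \<delta>" and x: "arc x" "le \<gamma> a x" "le \<gamma> x b"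
  shows "wset a b x = arc_order.W {v. arc v \<and> le \<gamma> v \<delta>} (le \<gamma>) (tord S) ordf a b x"
proof -
  interpret ao: arc_order "{v. arc v \<and> le \<gamma> v \<delta>}" "le \<gamma>" "tord S" ordf E by (rule arc_order_sec[OF n])
  note g = narrow_arcs[OF n]
  have reb: "le a u v \<longleftrightarrow> le \<gamma> u v" if "arc u" "arc v" "le \<gamma> a u" "le \<gamma> a v" for u v
    by (rule le_rebase[OF g(1) a(1) that])
  have btw: "le a u b \<longleftrightarrow> le \<gamma> a u \<and> le \<gamma> u b" if "arc u" for u
    by (rule le_between[OF g(1) a that l(1)])
  have iff: "(arc v \<and> arc w \<and> \<not> arc_eq v w \<and> le a v w \<and> le a w b \<and> le a v x \<and> le a x w \<and>
        (\<forall>z. arc z \<and> le a v z \<and> le a z w \<longrightarrow> ordf z = ordf x)) \<longleftrightarrow>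
      (v \<in> {v. arc v \<and> le \<gamma> v \<delta>} \<and> w \<in> {v. arc v \<and> le \<gamma> v \<delta>} \<and> \<not> le \<gamma> w v \<and> le \<gamma> v w \<and> le \<gamma> a v \<and> le \<gamma> w b \<and>
       le \<gamma> v x \<and> le \<gamma> x w \<and> (\<forall>z\<in>{v. arc v \<and> le \<gamma> v \<delta>}. le \<gamma> v z \<and> le \<gamma> z w \<longrightarrow> ordf z = ordf x))" (is "?L \<longleftrightarrow> ?R") for v w
  proof
    assume L: ?L
    then have av: "arc v" "arc w" by auto
    have "le a v b" using L le_trans by blast
    then have v: "le \<gamma> a v" "le \<gamma> v b" using btw[OF av(1)] by auto
    have w: "le \<gamma> a w" "le \<gamma> w b" using btw[OF av(2)] L by auto
    have vw: "le \<gamma> v w" "le \<gamma> v x" "le \<gamma> x w" using reb av v w x L by auto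
    have "\<not> le \<gamma> w v" using le_antisym[OF g(1) av vw(1)] L by blast
    moreover have "ordf z = ordf x" if "arc z" "le \<gamma> v z" "le \<gamma> z w" for z
    proof -
      have "le \<gamma> a z" using v(1) that(2) by (rule le_trans)
      then have "le a v z" "le a z w" using reb av v w that by auto
      then show ?thesis using L that(1) by blast
    qed
    ultimately show ?R using av v w vw le_trans[OF _ l(2)] by blast
  next
    assume R: ?R
    then have av: "arc v" "arc w" by auto
    have v: "le \<gamma> a v" and w: "le \<gamma> w b" "le \<gamma> v w" using R by auto
    have w': "le \<gamma> a w" using v w(2) by (rule le_trans)
    have "\<not> arc_eq v w" using R arc_eq_le arc_eq_sym by blast
    moreover have "le a v w" "le a v x" "le a x w" "le a w b" using reb btw av v w w' x R by auto
    moreover have "ordf z = ordf x" if "arc z" "le a v z" "le a z w" for z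
    proof -
      have "le a z b" using that(3) \<open>le a w b\<close> by (rule le_trans)
      then have z: "le \<gamma> a z" "le \<gamma> z b" using btw[OF that(1)] by auto
      then have "le \<gamma> v z" "le \<gamma> z w" using reb[OF av(1) that(1) v] reb[OF that(1) av(2) _ w'] that by auto
      moreover have "le \<gamma> z \<delta>" using z(2) l(2) by (rule le_trans)
      ultimately show ?thesis using R that(1) by blast
    qed
    ultimately show ?L using av by blast
  qed
  show ?thesis unfolding wset_def ao.W_def by (simp only: iff)
qed

text \<open>Elementarity and the sign are inherited by subsectors. What remains for a candidate
  slice is its validity, the attained orders and the widths.\<close>

lemma sub_assoc:
  assumes as: "assoc \<gamma> \<delta> x" and a: "arc a" "arc b" and l: "le \<gamma> a b" "le \<gamma> b \<delta>" "\<not> arc_eq a b"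
    and y: "valid y" "seg_from y = ordf a" "seg_to y = ordf b" "slice_sign y = slice_sign x"
    and os: "{ordf v | v. arc v \<and> le \<gamma> a v \<and> le \<gamma> v b} = seg_set S y"
    and w: "\<And>v. arc v \<Longrightarrow> le \<gamma> a v \<Longrightarrow> le \<gamma> v b \<Longrightarrow>
      Inf (arc_order.W {v. arc v \<and> le \<gamma> v \<delta>} (le \<gamma>) (tord S) ordf a b v) = slice_width y (ordf v)"
  shows "assoc a b y"
proof -
  have n: "narrow \<gamma> \<delta>" by (rule assocD(1)[OF as])
  note g = narrow_arcs[OF n]
  have btw: "le a u b \<longleftrightarrow> le \<gamma> a u \<and> le \<gamma> u b" if "arc u" for u
    by (rule le_between[OF g(1) a that l(1)])
  have reb: "le a u v \<longleftrightarrow> le \<gamma> u v" if "arc u" "arc v" "le \<gamma> a u" "le \<gamma> a v" for u v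
    by (rule le_rebase[OF g(1) a(1) that])
  have 1: "narrow a b" by (rule narrow_sub[OF n a l])
  have 2: "{ordf v | v. arc v \<and> le a v b} = seg_set S y" using os btw by blast
  have 3: "ordf z = ordf v" if "arc v" "arc w" "arc z" "le a v w" "le a w b" "le a v z" "le a z w" "ordf v = ordf w" for v w z
  proof -
    have "le a v b" "le a z b" using that le_trans by blast+
    then have i: "le \<gamma> a v" "le \<gamma> a z" "le \<gamma> a w" "le \<gamma> w b" using btw that by blast+
    then have "le \<gamma> v w" "le \<gamma> v z" "le \<gamma> z w" "le \<gamma> w \<delta>" using reb that le_trans[OF _ l(2)] by blast+
    then show ?thesis using assocD(6)[OF as that(1-3)] that(8) by blast
  qed
  have 4: "Inf (wset a b \<eta>) = slice_width y (ordf \<eta>)" if "arc \<eta>" "le a \<eta> b" for \<eta>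
  proof -
    have i: "le \<gamma> a \<eta>" "le \<gamma> \<eta> b" using btw that by auto
    show ?thesis unfolding wset_rebase[OF n a l(1,2) that(1) i] by (rule w[OF that(1) i])
  qed
  have 5: "\<exists>\<epsilon>>0. \<forall>p \<in> interior (sec a b) \<inter> ball 0 \<epsilon>. sgn (f p) = of_int (slice_sign y)"
  proof -
    obtain e where e: "0 < e" "\<forall>p \<in> interior (sec \<gamma> \<delta>) \<inter> ball 0 e. sgn (f p) = of_int (slice_sign x)"
      using assocD(8)[OF as] by blast
    obtain e' where e': "0 < e'" "sec a b \<inter> ball 0 e' \<subseteq> sec \<gamma> \<delta>"
      using sec_subset[OF g(1) a l(1,2)] unfolding germ_subset_def by blast
    have "interior (sec a b) \<inter> ball 0 e' \<subseteq> interior (sec \<gamma> \<delta>)"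
      using e'(2) interior_subset by (intro interior_maximal open_Int) blast+
    then have "\<forall>p \<in> interior (sec a b) \<inter> ball 0 (min e e'). sgn (f p) = of_int (slice_sign y)"
    proof (intro ballI)
      fix p assume p: "p \<in> interior (sec a b) \<inter> ball 0 (min e e')"
      then have "p \<in> interior (sec \<gamma> \<delta>) \<inter> ball 0 e" using \<open>_ \<subseteq> interior (sec \<gamma> \<delta>)\<close> by auto
      then show "sgn (f p) = of_int (slice_sign y)" using e(2) y(4) by simp
    qed
    then show ?thesis using e(1) e'(1) by (intro exI[of _ "min e e'"]) simp
  qed
  show ?thesis unfolding assoc_def
    by (intro conjI allI impI 1 2 5 y(1-3); elim conjE) (rule 3 4; assumption)+
qed

lemma valid_point:
  assumes "q \<in> order_values S" "b \<in> E" shows "valid (Slice b q q s (\<lambda>_. ereal b))"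
proof -
  have "ereal b = ereal 0 * q + ereal b" for q by (simp add: zero_ereal_def[symmetric])
  then have "affine_width S Q (\<lambda>_. ereal b)" for Q
    unfolding affine_width_def using assms(2) E_0 by blast
  then show ?thesis unfolding valid_def using assms by simp
qed

lemma seg_set_point: "q \<in> order_values S \<Longrightarrow> seg_set S (Slice b q q s \<mu>) = {q}"
  by (auto simp: seg_set_def)

text \<open>If the order is the same at both sides and at \<open>m\<close>, both halves are points,
  and the one with the smaller exponent is the whole slice. If the order of \<open>m\<close> equals
  that of exactly one side, the half next to this side is a point absorbed by the other half, whose
  slice is \<open>x\<close> itself. If it lies strictly between, the halves carry restrictions of
  one affine function and Operation 1 joins them.\<close>

lemma assoc_split:
  assumes as: "assoc \<gamma> \<delta> x" and m: "arc m" "le \<gamma> m \<delta>" "\<not> arc_eq \<gamma> m" "\<not> arc_eq m \<delta>"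
  shows "\<exists>x1 x2 x'. assoc \<gamma> m x1 \<and> assoc m \<delta> x2 \<and> mg x1 x2 x' \<and> slice_eqv x' x"
proof -
  have n: "narrow \<gamma> \<delta>" and vx: "valid x" and ft: "seg_from x = ordf \<gamma>" "seg_to x = ordf \<delta>"
    and os: "{ordf v | v. arc v \<and> le \<gamma> v \<delta>} = seg_set S x" by (rule assocD[OF as])+
  note g = narrow_arcs[OF n]
  let ?A = "{v. arc v \<and> le \<gamma> v \<delta>}"
  interpret ao: arc_order ?A "le \<gamma>" "tord S" ordf E by (rule arc_order_sec[OF n])
  interpret rev: arc_order ?A "\<lambda>x y. le \<gamma> y x" "tord S" ordf E by (rule ao.reversed)
  have V: "ao.V = order_values S" unfolding order_values_def ..
  define \<mu> where "\<mu> = slice_width x"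
  have A: "\<gamma> \<in> ?A" "m \<in> ?A" "\<delta> \<in> ?A" using g m le_base by auto
  have lb: "le \<gamma> \<gamma> v" for v by (rule le_base[OF g(1)])
  have el: "ao.elem \<gamma> \<delta>" unfolding ao.elem_def using assocD(6)[OF as] le_trans by blast
  have W: "wset \<gamma> \<delta> v = ao.W \<gamma> \<delta> v" if "arc v" "le \<gamma> v \<delta>" for v
    by (rule wset_rebase[OF n g(1,2) lb le_refl that(1) lb that(2)])
  have mu: "Inf (ao.W \<gamma> \<delta> v) = \<mu> (ordf v)" if "v \<in> ?A" for v
    using assocD(7)[OF as, of v] W[of v] that unfolding \<mu>_def by simp
  have seg: "seg_set S x = {q \<in> order_values S. min (ordf \<gamma>) (ordf \<delta>) \<le> q \<and> q \<le> max (ordf \<gamma>) (ordf \<delta>)}"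
    unfolding seg_set_def ft ..
  have att: "\<exists>y\<in>?A. le \<gamma> \<gamma> y \<and> le \<gamma> y \<delta> \<and> ordf y = q"
    if "q \<in> ao.V" "min (ordf \<gamma>) (ordf \<delta>) \<le> q" "q \<le> max (ordf \<gamma>) (ordf \<delta>)" for q
  proof -
    have "q \<in> {ordf v | v. arc v \<and> le \<gamma> v \<delta>}" unfolding os seg using that V by blast
    then show ?thesis using lb by blast
  qed
  have att': "\<exists>y\<in>?A. le \<gamma> y \<delta> \<and> le \<gamma> \<gamma> y \<and> ordf y = q"
    if "q \<in> ao.V" "min (ordf \<delta>) (ordf \<gamma>) \<le> q" "q \<le> max (ordf \<delta>) (ordf \<gamma>)" for q
    using att[OF that(1)] that(2,3) by (metis min.commute max.commute)
  have ab: "arc \<gamma>" "arc m" "arc \<delta>" "le \<gamma> \<gamma> m" "le \<gamma> m \<delta>" "le \<gamma> \<gamma> \<delta>" using g m lb by auto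
  have nle: "\<not> le \<gamma> m \<gamma>" "\<not> le \<gamma> \<delta> m" using le_antisym[OF g(1)] ab m by blast+
  have el1: "ao.elem \<gamma> m" using el unfolding ao.elem_def using le_trans[OF _ m(2)] by blast
  have el2: "ao.elem m \<delta>" using el unfolding ao.elem_def using lb by blast
  have ov: "ordf \<gamma> \<in> order_values S" "ordf m \<in> order_values S" "ordf \<delta> \<in> order_values S" using ord_in_order_values ab by auto
  define pt where "pt q b = Slice b q q (slice_sign x) (\<lambda>_. ereal b)" for q b
  have pt: "seg_from (pt q b) = q" "seg_to (pt q b) = q" "slice_sign (pt q b) = slice_sign x"
    "slice_exp (pt q b) = b" "slice_width (pt q b) = (\<lambda>_. ereal b)" for q b by (simp_all add: pt_def)
  define b1 b2 where "b1 = tord S \<gamma> m" and "b2 = tord S m \<delta>"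
  have bE: "b1 \<in> E" "b2 \<in> E" unfolding b1_def b2_def using tord_in_E ab m by auto
  have left_pt: "assoc \<gamma> m (pt (ordf m) b1)" if eq: "ordf \<gamma> = ordf m"
  proof (rule sub_assoc[OF as ab(1,2,4,5) m(3)])
    have c: "Inf (ao.W \<gamma> m v) = ereal b1 \<and> ordf v = ordf \<gamma>" if "arc v" "le \<gamma> v m" for v
      unfolding b1_def using ao.constant_width[OF A(1,2) ab(4) nle(1) el1 eq _ lb that(2)] that le_trans[OF that(2) m(2)] by blast
    show "valid (pt (ordf m) b1)" unfolding pt_def by (rule valid_point[OF ov(2) bE(1)])
    show "{ordf v | v. arc v \<and> le \<gamma> \<gamma> v \<and> le \<gamma> v m} = seg_set S (pt (ordf m) b1)"
      unfolding pt_def seg_set_point[OF ov(2)]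
    proof (intro set_eqI iffI)
      fix q assume "q \<in> {ordf v | v. arc v \<and> le \<gamma> \<gamma> v \<and> le \<gamma> v m}"
      then obtain v where "arc v" "le \<gamma> v m" "q = ordf v" by blast
      then show "q \<in> {ordf m}" using c[of v] eq by simp
    next
      fix q assume "q \<in> {ordf m}"
      then show "q \<in> {ordf v | v. arc v \<and> le \<gamma> \<gamma> v \<and> le \<gamma> v m}" using m(1) ab(4) le_refl by blast
    qed
    show "Inf (ao.W \<gamma> m v) = slice_width (pt (ordf m) b1) (ordf v)" if "arc v" "le \<gamma> \<gamma> v" "le \<gamma> v m" for v
      using c[OF that(1,3)] by (simp add: pt)
  qed (simp_all add: pt eq)
  have right_pt: "assoc m \<delta> (pt (ordf m) b2)" if eq: "ordf m = ordf \<delta>"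
  proof (rule sub_assoc[OF as ab(2,3,5) le_refl m(4)])
    have c: "Inf (ao.W m \<delta> v) = ereal b2 \<and> ordf v = ordf m" if "arc v" "le \<gamma> m v" "le \<gamma> v \<delta>" for v
      unfolding b2_def using ao.constant_width[OF A(2,3) ab(5) nle(2) el2 eq _ that(2,3)] that by blast
    show "valid (pt (ordf m) b2)" unfolding pt_def by (rule valid_point[OF ov(2) bE(2)])
    show "{ordf v | v. arc v \<and> le \<gamma> m v \<and> le \<gamma> v \<delta>} = seg_set S (pt (ordf m) b2)"
      unfolding pt_def seg_set_point[OF ov(2)]
    proof (intro set_eqI iffI)
      fix q assume "q \<in> {ordf v | v. arc v \<and> le \<gamma> m v \<and> le \<gamma> v \<delta>}"
      then obtain v where "arc v" "le \<gamma> m v" "le \<gamma> v \<delta>" "q = ordf v" by blast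
      then show "q \<in> {ordf m}" using c[of v] by simp
    next
      fix q assume "q \<in> {ordf m}"
      then show "q \<in> {ordf v | v. arc v \<and> le \<gamma> m v \<and> le \<gamma> v \<delta>}" using m(1,2) le_refl by blast
    qed
    show "Inf (ao.W m \<delta> v) = slice_width (pt (ordf m) b2) (ordf v)" if "arc v" "le \<gamma> m v" "le \<gamma> v \<delta>" for v
      using c[OF that] by (simp add: pt)
  qed (simp_all add: pt eq)
  show ?thesis
  proof (cases "ordf \<gamma> = ordf \<delta>")
    case True
    have eq: "ordf m = ordf \<gamma>" "Inf (ao.W \<gamma> \<delta> m) = ereal (tord S \<gamma> \<delta>)"
      using ao.constant_width[OF A(1,3) ab(6) _ el True A(2) lb m(2)] le_antisym[OF g(1) ab(1,3,6)] g(3) by blast+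
    have "tord S \<gamma> \<delta> = min b1 b2"
      unfolding b1_def b2_def using ao.d_nested[OF A ab(4) nle(1) ab(5) nle(2)] .
    then have mum: "\<mu> (ordf m) = ereal (min b1 b2)" using mu[OF A(2)] eq(2) by simp
    have eqv: "slice_eqv (pt (ordf m) b) x" if "b = min b1 b2" for b
    proof -
      have "seg_set S (pt (ordf m) b) = {ordf m}" unfolding pt_def by (rule seg_set_point[OF ov(2)])
      moreover have "slice_width x (ordf m) = ereal b" using mum unfolding \<mu>_def that .
      moreover have "seg_from x = ordf m" "seg_to x = ordf m" using ft eq(1) True by metis+
      ultimately show ?thesis unfolding slice_eqv_def pt by (metis singletonD)
    qed
    have L: "assoc \<gamma> m (pt (ordf m) b1)" "assoc m \<delta> (pt (ordf m) b2)"
      using left_pt right_pt eq(1) True by simp_all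
    show ?thesis
    proof (cases "b2 \<le> b1")
      case True
      have "mg (pt (ordf m) b1) (pt (ordf m) b2) (pt (ordf m) b2)"
        by (rule mg_left) (use True in \<open>simp_all add: pt\<close>)
      then show ?thesis using L eqv[of b2] True by (metis min.absorb2)
    next
      case False
      have "mg (pt (ordf m) b1) (pt (ordf m) b2) (pt (ordf m) b1)"
        by (rule mg_right) (use False in \<open>simp_all add: pt\<close>)
      then show ?thesis using L eqv[of b1] False by (metis min.absorb1 nle_le)
    qed
  next
    case ne: False
    have "ordf \<gamma> \<in> seg_set S x" "ordf \<delta> \<in> seg_set S x" using ends_in_seg_set[OF vx] ft by simp_all
    have "seg_from x \<noteq> seg_to x" using ne ft by simp
    then obtain r where r: "ereal r \<in> seg_set S x" using finite_point[OF vx] by blast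
    have affx: "affine_width S (seg_set S x) \<mu>" using vx unfolding valid_def \<mu>_def by blast
    obtain c k where ck: "c \<in> E" "k \<in> E" "\<And>q. q \<in> seg_set S x \<Longrightarrow> \<mu> q = ereal c * q + ereal k"
      using affineD[OF affx r] by metis
    have ninf: "\<mu> q \<noteq> - \<infinity>" if "q \<in> seg_set S x" for q
      using affx that unfolding affine_width_def by fastforce
    have aff: "\<mu> p = ereal c * p + ereal k \<and> \<mu> p \<noteq> - \<infinity>"
      if "p \<in> ao.V" "min (ordf \<gamma>) (ordf \<delta>) \<le> p" "p \<le> max (ordf \<gamma>) (ordf \<delta>)" for p
    proof -
      have "p \<in> seg_set S x" unfolding seg using that V by blast
      then show ?thesis using ck(3) ninf by blast
    qed
    have aff': "\<mu> p = ereal c * p + ereal k \<and> \<mu> p \<noteq> - \<infinity>"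
      if "p \<in> ao.V" "min (ordf \<delta>) (ordf \<gamma>) \<le> p" "p \<le> max (ordf \<delta>) (ordf \<gamma>)" for p
      using aff[OF that(1)] that(2,3) by (metis min.commute max.commute)
    have WL: "Inf (ao.W \<gamma> m v) = \<mu> (ordf v)" if "ordf \<gamma> \<noteq> ordf m" "arc v" "le \<gamma> v m" for v
    proof (rule ao.split_left[OF A _ ab(4,5) lb that(3) el that(1) _ att aff])
      show "v \<in> ?A" using that le_trans[OF that(3) m(2)] by blast
    qed (use mu in blast)+
    \<comment> \<open>The right half is the left half for the reversed order.\<close>
    have WR: "Inf (ao.W m \<delta> v) = \<mu> (ordf v)" if "ordf m \<noteq> ordf \<delta>" "arc v" "le \<gamma> m v" "le \<gamma> v \<delta>" for v
    proof -
      have "Inf (rev.W \<delta> m v) = \<mu> (ordf v)"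
      proof (rule rev.split_left[OF A(3,2,1) _ ab(5,4) that(4,3) _ that(1)[symmetric] _ att' aff'])
        show "v \<in> ?A" using that by blast
        show "rev.elem \<delta> \<gamma>" using el ao.reversed_elem by blast
        show "Inf (rev.W \<delta> \<gamma> y) = \<mu> (ordf y)" if "y \<in> ?A" for y
          unfolding ao.reversed_W by (rule mu[OF that])
      qed
      then show ?thesis unfolding ao.reversed_W .
    qed
    have VL: "{ordf v | v. arc v \<and> le \<gamma> \<gamma> v \<and> le \<gamma> v m} = {q \<in> order_values S. min (ordf \<gamma>) (ordf m) \<le> q \<and> q \<le> max (ordf \<gamma>) (ordf m)}"
    proof -
      have "{ordf v | v. v \<in> ?A \<and> le \<gamma> \<gamma> v \<and> le \<gamma> v m} = {q \<in> ao.V. min (ordf \<gamma>) (ordf m) \<le> q \<and> q \<le> max (ordf \<gamma>) (ordf m)}"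
        by (rule ao.split_left_values[OF A ab(4,5) el att])
      moreover have "{ordf v | v. v \<in> ?A \<and> le \<gamma> \<gamma> v \<and> le \<gamma> v m} = {ordf v | v. arc v \<and> le \<gamma> \<gamma> v \<and> le \<gamma> v m}"
        using le_trans[OF _ m(2)] by blast
      ultimately show ?thesis unfolding V by simp
    qed
    have VR: "{ordf v | v. arc v \<and> le \<gamma> m v \<and> le \<gamma> v \<delta>} = {q \<in> order_values S. min (ordf m) (ordf \<delta>) \<le> q \<and> q \<le> max (ordf m) (ordf \<delta>)}"
    proof -
      have "rev.elem \<delta> \<gamma>" using el ao.reversed_elem by blast
      then have "{ordf v | v. v \<in> ?A \<and> le \<gamma> v \<delta> \<and> le \<gamma> m v} = {q \<in> ao.V. min (ordf \<delta>) (ordf m) \<le> q \<and> q \<le> max (ordf \<delta>) (ordf m)}"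
        by (rule rev.split_left_values[OF A(3,2,1) ab(5,4) _ att'])
      moreover have "{ordf v | v. v \<in> ?A \<and> le \<gamma> v \<delta> \<and> le \<gamma> m v} = {ordf v | v. arc v \<and> le \<gamma> m v \<and> le \<gamma> v \<delta>}" by blast
      ultimately show ?thesis unfolding V by (simp add: min.commute max.commute)
    qed
    consider "ordf \<gamma> = ordf m" | "ordf m = ordf \<delta>" | "ordf \<gamma> \<noteq> ordf m" "ordf m \<noteq> ordf \<delta>" by blast
    then show ?thesis
    proof cases
      case 1
      then have ne': "ordf m \<noteq> ordf \<delta>" using ne by simp
      have "assoc m \<delta> x"
      proof (rule sub_assoc[OF as ab(2,3,5) le_refl m(4) vx])
        show "{ordf v | v. arc v \<and> le \<gamma> m v \<and> le \<gamma> v \<delta>} = seg_set S x" unfolding VR seg 1 ..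
        show "Inf (ao.W m \<delta> v) = slice_width x (ordf v)" if "arc v" "le \<gamma> m v" "le \<gamma> v \<delta>" for v
          using WR[OF ne' that] unfolding \<mu>_def .
      qed (use ft 1 in simp_all)
      moreover have "mg (pt (ordf m) b1) x x"
      proof (rule mg_left)
        \<comment> \<open>The order is constant from \<gamma> to \<open>m\<close>, so this sector is
          a test triangle for \<gamma> in the whole, and its exponent \<open>b1\<close> bounds the
          width there. This is the inequality that Operation 2 demands.\<close>
        have "\<mu> (ordf \<gamma>) \<le> ereal b1"
        proof -
          have "ordf z = ordf \<gamma>" if "z \<in> ?A" "le \<gamma> \<gamma> z" "le \<gamma> z m" for z
            using el1[unfolded ao.elem_def, rule_format, of \<gamma> m z] A that 1 lb by simp
          then have "ereal b1 \<in> ao.W \<gamma> \<delta> \<gamma>"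
            unfolding ao.W_def b1_def using A nle(1) lb m(2) le_refl by blast
          then show ?thesis using mu[OF A(1)] Inf_lower by metis
        qed
        then show "slice_width x (seg_from x) \<le> ereal (slice_exp (pt (ordf m) b1))"
          using ft unfolding \<mu>_def by (simp add: pt)
      qed (use ft 1 in \<open>simp_all add: pt\<close>)
      ultimately show ?thesis using left_pt[OF 1] slice_eqv_refl by blast
    next
      case 2
      then have ne': "ordf \<gamma> \<noteq> ordf m" using ne by simp
      have "assoc \<gamma> m x"
      proof (rule sub_assoc[OF as ab(1,2,4,5) m(3) vx])
        show "{ordf v | v. arc v \<and> le \<gamma> \<gamma> v \<and> le \<gamma> v m} = seg_set S x" unfolding VL seg 2 ..
        show "Inf (ao.W \<gamma> m v) = slice_width x (ordf v)" if "arc v" "le \<gamma> \<gamma> v" "le \<gamma> v m" for v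
          using WL[OF ne' that(1,3)] unfolding \<mu>_def .
      qed (use ft 2 in simp_all)
      moreover have "mg x (pt (ordf m) b2) x"
      proof (rule mg_right)
        have "\<mu> (ordf \<delta>) \<le> ereal b2"
        proof -
          have "ordf z = ordf \<delta>" if "z \<in> ?A" "le \<gamma> m z" "le \<gamma> z \<delta>" for z
            using el2[unfolded ao.elem_def, rule_format, of m \<delta> z] A that 2 by simp
          then have "ereal b2 \<in> ao.W \<gamma> \<delta> \<delta>"
            unfolding ao.W_def b2_def using A nle(2) lb m(2) le_refl by blast
          then show ?thesis using mu[OF A(3)] Inf_lower by metis
        qed
        then show "slice_width x (seg_to x) \<le> ereal (slice_exp (pt (ordf m) b2))"
          using ft unfolding \<mu>_def by (simp add: pt)
      qed (use ft 2 in \<open>simp_all add: pt\<close>)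
      ultimately show ?thesis using right_pt[OF 2] slice_eqv_refl by blast
    next
      case 3
      have bt: "min (ordf \<gamma>) (ordf \<delta>) \<le> ordf m" "ordf m \<le> max (ordf \<gamma>) (ordf \<delta>)"
        using ao.between_bounds[OF el A A(1,3) le_refl ab(4,5) le_refl] by auto
      have dir: "ordf \<gamma> < ordf m \<and> ordf m < ordf \<delta> \<or> ordf \<gamma> > ordf m \<and> ordf m > ordf \<delta>"
        using bt 3 ne by (auto simp: min_def max_def split: if_splits)
      \<comment> \<open>An order strictly between two others is finite. Hence the width at
        \<open>m\<close> is finite, and so are the exponents \<open>e1\<close> and \<open>e2\<close>
        of the halves.\<close>
      then obtain q' where q': "ordf m = ereal q'" using ov(2) unfolding order_values_def by auto
      have mseg: "ordf m \<in> seg_set S x" unfolding seg using bt ov by blast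
      have mf: "\<mu> (ordf m) = ereal (c * q' + k)" using ck(3)[OF mseg] q' by simp
      have "min (\<mu> (ordf \<gamma>)) (\<mu> (ordf m)) \<noteq> \<infinity>" "min (\<mu> (ordf \<gamma>)) (\<mu> (ordf m)) \<noteq> - \<infinity>"
        using mf ninf[OF \<open>ordf \<gamma> \<in> seg_set S x\<close>] by (auto simp: min_def)
      then obtain e1 where e1: "min (\<mu> (ordf \<gamma>)) (\<mu> (ordf m)) = ereal e1" by (cases "min (\<mu> (ordf \<gamma>)) (\<mu> (ordf m))") auto
      have "min (\<mu> (ordf m)) (\<mu> (ordf \<delta>)) \<noteq> \<infinity>" "min (\<mu> (ordf m)) (\<mu> (ordf \<delta>)) \<noteq> - \<infinity>"
        using mf ninf[OF \<open>ordf \<delta> \<in> seg_set S x\<close>] by (auto simp: min_def)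
      then obtain e2 where e2: "min (\<mu> (ordf m)) (\<mu> (ordf \<delta>)) = ereal e2" by (cases "min (\<mu> (ordf m)) (\<mu> (ordf \<delta>))") auto
      define x1 where "x1 = Slice e1 (ordf \<gamma>) (ordf m) (slice_sign x) \<mu>"
      define x2 where "x2 = Slice e2 (ordf m) (ordf \<delta>) (slice_sign x) \<mu>"
      have join: "seg_set S x = seg_set S x1 \<union> seg_set S x2"
        by (rule seg_set_join) (use ft dir in \<open>simp_all add: x1_def x2_def\<close>)
      have affsub: "affine_width S Q \<mu>" if "Q \<subseteq> seg_set S x" for Q
        using affx ck that unfolding affine_width_def by blast
      have v1: "valid x1" unfolding valid_def using ov e1 affsub[of "seg_set S x1"] join by (simp add: x1_def)
      have v2: "valid x2" unfolding valid_def using ov e2 affsub[of "seg_set S x2"] join by (simp add: x2_def)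
      have "assoc \<gamma> m x1"
      proof (rule sub_assoc[OF as ab(1,2,4,5) m(3) v1])
        show "{ordf v | v. arc v \<and> le \<gamma> \<gamma> v \<and> le \<gamma> v m} = seg_set S x1" unfolding VL seg_set_def x1_def by simp
        show "Inf (ao.W \<gamma> m v) = slice_width x1 (ordf v)" if "arc v" "le \<gamma> \<gamma> v" "le \<gamma> v m" for v
          using WL[OF 3(1) that(1,3)] by (simp add: x1_def)
      qed (simp_all add: x1_def)
      moreover have "assoc m \<delta> x2"
      proof (rule sub_assoc[OF as ab(2,3,5) le_refl m(4) v2])
        show "{ordf v | v. arc v \<and> le \<gamma> m v \<and> le \<gamma> v \<delta>} = seg_set S x2" unfolding VR seg_set_def x2_def by simp
        show "Inf (ao.W m \<delta> v) = slice_width x2 (ordf v)" if "arc v" "le \<gamma> m v" "le \<gamma> v \<delta>" for v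
          using WR[OF 3(2) that] by (simp add: x2_def)
      qed (simp_all add: x2_def)
      moreover define z where "z = Slice (min e1 e2) (ordf \<gamma>) (ordf \<delta>) (slice_sign x) \<mu>"
      have "mg x1 x2 z"
        by (rule mg_join[where \<mu> = \<mu>]) (use dir affsub join in \<open>simp_all add: x1_def x2_def z_def\<close>)
      moreover have "slice_eqv z x" unfolding slice_eqv_def z_def \<mu>_def using ft by simp
      ultimately show ?thesis by blast
    qed
  qed
qed

end

section \<open>Subdivisions of the plane into sectors with slices\<close>

lemma sorted_wrt_set_unique:
  assumes "sorted_wrt R xs" "sorted_wrt R ys" "set xs = set ys"
    and "\<And>x y. x \<in> set xs \<Longrightarrow> y \<in> set xs \<Longrightarrow> R x y \<Longrightarrow> \<not> R y x"
  shows "xs = ys"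
  using assms
proof (induction xs arbitrary: ys)
  case (Cons x xs)
  have "ys \<noteq> []" using Cons.prems(3) by auto
  then obtain y ys' where ys: "ys = y # ys'" by (metis neq_Nil_conv)
  have asym: "\<And>u v. u \<in> set (x # xs) \<Longrightarrow> v \<in> set (x # xs) \<Longrightarrow> R u v \<Longrightarrow> \<not> R v u" by (rule Cons.prems(4))
  have eq: "set (x # xs) = set (y # ys')" using Cons.prems(3) ys by simp
  have "x = y"
  proof (rule ccontr)
    assume "x \<noteq> y"
    then have "x \<in> set ys'" "y \<in> set xs" using eq by auto
    then have "R y x" "R x y" using Cons.prems(1,2) ys by auto
    then show False using asym[of x y] \<open>y \<in> set xs\<close> by simp
  qed
  moreover have "x \<notin> set xs" using asym[of x x] Cons.prems(1) by auto
  moreover have "y \<notin> set ys'" using asym[of y y] Cons.prems(2) unfolding ys \<open>x = y\<close> by auto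
  ultimately have "set xs = set ys'" using eq by auto
  moreover have "sorted_wrt R xs" "sorted_wrt R ys'" using Cons.prems(1,2) unfolding ys by simp_all
  moreover have "\<not> R v u" if "u \<in> set xs" "v \<in> set xs" "R u v" for u v
    using asym[OF _ _ that(3)] that(1,2) by simp
  ultimately have "xs = ys'" using Cons.IH by blast
  then show ?case using \<open>x = y\<close> ys by simp
qed simp

text \<open>The arc at which the first sector of the list begins, or the closing arc
  \<open>e\<close> for an empty list.\<close>

primrec nx :: "'a \<Rightarrow> ('a \<times> 'b) list \<Rightarrow> 'a" where
  "nx e [] = e" | "nx e (p # L) = fst p"

context function_germ
begin

text \<open>Arcs that agree as germs become equal functions. Refining subdivisions then amounts to
  taking unions of finite sets of arcs, and the order by position becomes strict.\<close>

definition rep :: "(real \<Rightarrow> real \<times> real) \<Rightarrow> real \<Rightarrow> real \<times> real" where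
  "rep \<gamma> = (SOME \<delta>. arc \<delta> \<and> arc_eq \<gamma> \<delta>)"

lemma rep: assumes "arc \<gamma>" shows "arc (rep \<gamma>)" "arc_eq \<gamma> (rep \<gamma>)"
proof -
  have "arc (rep \<gamma>) \<and> arc_eq \<gamma> (rep \<gamma>)"
    unfolding rep_def by (rule someI[of "\<lambda>\<delta>. arc \<delta> \<and> arc_eq \<gamma> \<delta>" \<gamma>]) (simp add: assms)
  then show "arc (rep \<gamma>)" "arc_eq \<gamma> (rep \<gamma>)" by auto
qed

lemma rep_cong: assumes "arc_eq \<gamma> \<delta>" shows "rep \<gamma> = rep \<delta>"
proof -
  have "arc_eq \<gamma> \<eta> \<longleftrightarrow> arc_eq \<delta> \<eta>" for \<eta> using assms arc_eq_sym arc_eq_trans by blast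
  then show ?thesis unfolding rep_def by simp
qed

definition reps :: "(real \<Rightarrow> real \<times> real) set" where
  "reps = {g. arc g \<and> rep g = g}"

lemma rep_in_reps: "arc \<gamma> \<Longrightarrow> rep \<gamma> \<in> reps"
  unfolding reps_def using rep rep_cong[of \<gamma> "rep \<gamma>"] by auto

lemma repsD: "g \<in> reps \<Longrightarrow> arc g" "g \<in> reps \<Longrightarrow> h \<in> reps \<Longrightarrow> arc_eq g h \<Longrightarrow> g = h"
  unfolding reps_def using rep_cong[of g h] by auto

definition base :: "real \<Rightarrow> real \<times> real" where
  "base = rep (\<lambda>t. if 0 < t then (t, 0) else 0)"

lemma base_in_reps: "base \<in> reps"
  unfolding base_def
proof (rule rep_in_reps[OF arcI])
  show "DF (\<lambda>t::real. (t, 0::real))" by (intro def_intros)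
  show "ev (\<lambda>t::real. norm (t, 0::real) = t)" using ev_pos by eventually_elim (simp add: norm_Pair)
qed

lemma arc_base: "arc base"
  using base_in_reps repsD by blast

primrec chain :: "(real \<Rightarrow> real \<times> real) \<Rightarrow> ((real \<Rightarrow> real \<times> real) \<times> slice) list \<Rightarrow> bool" where
  "chain e [] \<longleftrightarrow> True"
| "chain e (p # L) \<longleftrightarrow> assoc (fst p) (nx e L) (snd p) \<and> chain e L"

lemma nx_append: "nx e (A @ B) = nx (nx e B) A"
  by (cases A) simp_all

lemma chain_append: "chain e (A @ B) \<longleftrightarrow> chain (nx e B) A \<and> chain e B"
  by (induction A) (auto simp: nx_append)

definition lt :: "(real \<Rightarrow> real \<times> real) \<Rightarrow> (real \<Rightarrow> real \<times> real) \<Rightarrow> bool" where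
  "lt g h \<longleftrightarrow> le base g h \<and> g \<noteq> h"

lemma lt_asym: "g \<in> reps \<Longrightarrow> h \<in> reps \<Longrightarrow> lt g h \<Longrightarrow> \<not> lt h g"
  unfolding lt_def using le_antisym[OF arc_base] repsD by blast

lemma lt_trans:
  assumes "g \<in> reps" "h \<in> reps" "k \<in> reps" "lt g h" "lt h k" shows "lt g k"
  using assms lt_asym le_trans unfolding lt_def by blast

lemma not_le_lt: "g \<in> reps \<Longrightarrow> h \<in> reps \<Longrightarrow> \<not> le base g h \<Longrightarrow> lt h g"
  unfolding lt_def using le_total[OF arc_base, of g h] repsD(1) by auto

text \<open>The last sector ends at \<^const>\<open>base\<close>, where the first one begins.\<close>

definition good :: "((real \<Rightarrow> real \<times> real) \<times> slice) list \<Rightarrow> bool" where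
  "good L \<longleftrightarrow> L \<noteq> [] \<and> fst (hd L) = base \<and> sorted_wrt lt (map fst L) \<and> chain base L \<and> fst ` set L \<subseteq> reps"

lemma chain_valid: "chain e L \<Longrightarrow> all_valid (map snd L)"
  unfolding all_valid_def by (induction L) (auto dest: assocD(2))

lemma good_valid: "good L \<Longrightarrow> all_valid (map snd L)"
  unfolding good_def using chain_valid by blast

text \<open>An arc beyond \<open>g\<close>, as seen from \<gamma>, is met on the way from
  \<open>g\<close> back to \<gamma>. This places arcs inside the last sector, which closes up at the
  base.\<close>

lemma le_wrap:
  assumes "arc \<gamma>" "arc g" "arc v" "\<not> arc_eq \<gamma> g" "le \<gamma> g v" shows "le g v \<gamma>"
proof -
  have "ev (\<lambda>t. \<gamma> t \<noteq> g t)" using arc_eq_cases assms(1,2,4) by blast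
  then show ?thesis
    unfolding le_def using assms(5)[unfolded le_def] arcs_ev[OF assms(1,2)] arcs_ev[OF assms(1,3)]
  proof eventually_elim
    case (elim t)
    then have "ang (g t) (v t) = ang (\<gamma> t) (v t) - ang (\<gamma> t) (g t)" using ang_shift[of "g t" "\<gamma> t" "v t"] by simp
    moreover have "ang (g t) (\<gamma> t) = 2 * pi - ang (\<gamma> t) (g t)" using ang_swap[of "g t" "\<gamma> t"] elim by simp
    ultimately show ?case using ang_bounds(2)[of "\<gamma> t" "v t"] by simp
  qed
qed

lemma reduces_join:
  assumes "mg x1 x2 x'" "slice_eqv x' x" shows "reduces (xs @ x1 # x2 # ys) (xs @ x # ys)"
proof -
  have "step (xs @ x1 # x2 # ys) (x' # ys @ xs)" by (rule stepI[of _ xs "x1 # x2 # ys"]) (use assms in auto)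
  moreover have "ceq (x' # ys @ xs) (x # ys @ xs)"
    using assms(2) list_all2_eqv_refl by (intro ceq_eqv) simp
  moreover have "ceq (x # ys @ xs) (xs @ x # ys)" using ceq_swap[of "x # ys" xs] by simp
  ultimately show ?thesis unfolding reduces_def using ceq_trans by blast
qed

text \<open>The sector to be cut belongs to the last arc of the list that is not beyond
  \<open>\<eta>\<close>; cutting it by \<open>assoc_split\<close> refines the list, and one merge
  undoes the refinement.\<close>

lemma good_insert:
  assumes L: "good L" and e: "\<eta> \<in> reps"
  shows "\<exists>L'. good L' \<and> fst ` set L' = insert \<eta> (fst ` set L) \<and> reduces (map snd L') (map snd L)"
proof (cases "\<eta> \<in> fst ` set L")
  case True
  then have "fst ` set L = insert \<eta> (fst ` set L)" by (simp only: insert_absorb)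
  then show ?thesis using L reduces_refl by (intro exI[of _ L]) simp
next
  case new: False
  note G = L[unfolded good_def]
  define A where "A = takeWhile (\<lambda>p. le base (fst p) \<eta>) L"
  define B where "B = dropWhile (\<lambda>p. le base (fst p) \<eta>) L"
  have AB: "L = A @ B" by (simp add: A_def B_def)
  have R: "fst p \<in> reps" if "p \<in> set L" for p using G that by blast
  have "A \<noteq> []"
  proof -
    obtain p L0 where "L = p # L0" "fst p = base" using G by (cases L) auto
    then show ?thesis unfolding A_def using le_base[OF arc_base] by simp
  qed
  then obtain A' g x where A': "A = A' @ [(g, x)]" by (metis rev_exhaust surj_pair)
  define d where "d = nx base B"
  have Leq: "L = A' @ (g, x) # B" using AB A' by simp
  have g: "g \<in> reps" "arc g" using R[of "(g, x)"] Leq repsD by auto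
  have ae: "arc \<eta>" using e repsD by blast
  have leA: "le base (fst p) \<eta>" if "p \<in> set A" for p using that set_takeWhileD unfolding A_def by metis
  have ge: "le base g \<eta>" using leA[of "(g, x)"] A' by simp
  have as: "assoc g d x" and chs: "chain g A'" "chain base B"
    using G unfolding Leq d_def by (auto simp: chain_append)
  have hdB: "\<not> le base (fst p) \<eta>" if "B = p # B'" for p B'
    using hd_dropWhile[of "\<lambda>p. le base (fst p) \<eta>" L] that unfolding B_def[symmetric] by simp
  have sB: "lt \<eta> (fst p)" if p: "p \<in> set B" for p
  proof -
    obtain q B' where q: "B = q # B'" using p by (cases B) auto
    have rq: "fst q \<in> reps" "fst p \<in> reps" using R[of q] R[of p] Leq q p by auto
    have 1: "lt \<eta> (fst q)" using not_le_lt[OF rq(1) e hdB[OF q]] .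
    have "p = q \<or> lt (fst q) (fst p)"
      using G p q unfolding Leq by (auto simp: sorted_wrt_append)
    then show ?thesis using 1 lt_trans[OF e rq] by blast
  qed
  have d: "d \<in> reps" "le g \<eta> d" "\<eta> \<noteq> d"
  proof -
    have "d \<in> reps \<and> le g \<eta> d \<and> \<eta> \<noteq> d"
    proof (cases B)
      \<comment> \<open>No arc of the list lies beyond \<open>\<eta>\<close>, so
        \<open>\<eta>\<close> falls into the last sector, whose second side is the base
        again.\<close>
      case Nil
      then have "d = base" by (simp add: d_def)
      have "\<not> arc_eq base g" using assocD(1)[OF as] arc_eq_sym unfolding \<open>d = base\<close> narrow_def by blast
      then have "le g \<eta> base" using le_wrap[OF arc_base g(2) ae _ ge] by blast
      moreover have "base \<in> fst ` set L" using G by (metis hd_in_set imageI)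
      ultimately show ?thesis using base_in_reps new \<open>d = base\<close> by auto
    next
      case (Cons p B')
      have p: "fst p \<in> reps" "d = fst p" "lt \<eta> d" using R[of p] Leq Cons sB[of p] by (auto simp: d_def)
      then have "arc d" using repsD by simp
      have "le base \<eta> d" using p(3) by (simp add: lt_def)
      moreover have "le base g d" using ge \<open>le base \<eta> d\<close> by (rule le_trans)
      ultimately have "le g \<eta> d" using le_between[OF arc_base g(2) \<open>arc d\<close> ae] ge by blast
      then show ?thesis using p by (simp add: lt_def)
    qed
    then show "d \<in> reps" "le g \<eta> d" "\<eta> \<noteq> d" by auto
  qed
  have "g \<noteq> \<eta>" using new Leq by auto
  then have "\<not> arc_eq g \<eta>" "\<not> arc_eq \<eta> d" using repsD(2) g e d by blast+
  then obtain x1 x2 x' where s: "assoc g \<eta> x1" "assoc \<eta> d x2" "mg x1 x2 x'" "slice_eqv x' x"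
    using assoc_split[OF as ae d(2)] by blast
  define L' where "L' = A' @ (g, x1) # (\<eta>, x2) # B"
  have st: "fst ` set L' = insert \<eta> (fst ` set L)" unfolding L'_def Leq by auto
  have "good L'"
    unfolding good_def
  proof (intro conjI)
    show "L' \<noteq> []" by (simp add: L'_def)
    show "fst (hd L') = base" using G unfolding L'_def Leq by (cases A') auto
    show "chain base L'" using s(1,2) chs unfolding L'_def d_def by (simp add: chain_append)
    have "lt (fst p) \<eta>" if "p \<in> set A" for p
    proof -
      have "fst p \<noteq> \<eta>" using that new AB by auto
      then show ?thesis using leA[OF that] by (simp add: lt_def)
    qed
    from this[of "(g, x)"] this have "\<forall>p\<in>set A'. lt (fst p) \<eta>" "lt g \<eta>" unfolding A' by simp_all
    then show "sorted_wrt lt (map fst L')"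
      using G sB unfolding L'_def Leq by (auto simp: sorted_wrt_append)
    show "fst ` set L' \<subseteq> reps" unfolding st using G e by blast
  qed
  moreover have "reduces (map snd L') (map snd L)"
    unfolding L'_def Leq using reduces_join[OF s(3,4)] by simp
  ultimately show ?thesis using st by blast
qed

lemma good_insert_set:
  assumes L: "good L" and F: "finite F" "F \<subseteq> reps"
  shows "\<exists>L'. good L' \<and> fst ` set L' = F \<union> fst ` set L \<and> reduces (map snd L') (map snd L)"
  using F
proof (induction F rule: finite_induct)
  case empty
  then show ?case using L reduces_refl by auto
next
  case (insert \<eta> F)
  then obtain L' where L': "good L'" "fst ` set L' = F \<union> fst ` set L" "reduces (map snd L') (map snd L)" by auto
  have "\<eta> \<in> reps" using insert.prems by simp
  then obtain L'' where L'': "good L''" "fst ` set L'' = insert \<eta> (fst ` set L')" "reduces (map snd L'') (map snd L')"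
    using good_insert[OF L'(1)] by blast
  have "reduces (map snd L'') (map snd L)"
    using reduces_trans[OF good_valid[OF L''(1)] good_valid[OF L'(1)] L''(3) L'(3)] .
  then show ?case using L'' L' by auto
qed

lemma chain_unique:
  assumes "chain e L" "chain e L'" "map fst L = map fst L'"
  shows "list_all2 slice_eqv (map snd L) (map snd L')"
  using assms
proof (induction L arbitrary: L')
  case (Cons p L)
  then obtain p' M where M: "L' = p' # M" "fst p = fst p'" "map fst L = map fst M" by (cases L') auto
  have "nx e L = nx e M" using M(3) by (cases L; cases M) auto
  moreover have "assoc (fst p) (nx e L) (snd p)" "assoc (fst p') (nx e M) (snd p')"
    using Cons.prems(1,2) unfolding M(1) by simp_all
  ultimately have "slice_eqv (snd p) (snd p')" unfolding M(2) using assoc_unique by metis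
  then show ?case using Cons M by simp
qed simp

lemma good_unique:
  assumes "good L" "good L'" "fst ` set L = fst ` set L'"
  shows "ceq (map snd L) (map snd L')"
proof -
  have "map fst L = map fst L'"
  proof (rule sorted_wrt_set_unique[of lt])
    show "set (map fst L) = set (map fst L')" using assms(3) by simp
    have "set (map fst L) \<subseteq> reps" using assms(1) unfolding good_def by simp
    then show "\<not> lt y x" if "x \<in> set (map fst L)" "y \<in> set (map fst L)" "lt x y" for x y
      using lt_asym that by blast
  qed (use assms in \<open>simp_all add: good_def\<close>)
  moreover have "chain base L" "chain base L'" using assms(1,2) unfolding good_def by simp_all
  ultimately show ?thesis using ceq_eqv chain_unique by metis
qed

lemma good_reduces_unique:
  assumes L: "good L" "good L'" and r: "reduces (map snd L) A" "reduces (map snd L') B"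
    and n: "nf A" "nf B" "all_valid A" "all_valid B"
  shows "ceq A B"
proof -
  have R: "fst ` set L \<subseteq> reps" "fst ` set L' \<subseteq> reps" using L unfolding good_def by auto
  obtain M where M: "good M" "fst ` set M = fst ` set L' \<union> fst ` set L" "reduces (map snd M) (map snd L)"
    using good_insert_set[OF L(1) _ R(2)] by auto
  obtain M' where M': "good M'" "fst ` set M' = fst ` set L \<union> fst ` set L'" "reduces (map snd M') (map snd L')"
    using good_insert_set[OF L(2) _ R(1)] by auto
  have "ceq (map snd M) (map snd M')" using good_unique[OF M(1) M'(1)] M(2) M'(2) by auto
  moreover have "reduces (map snd M) A" "reduces (map snd M') B"
    using reduces_trans[OF good_valid[OF M(1)] good_valid[OF L(1)] M(3) r(1)]
      reduces_trans[OF good_valid[OF M'(1)] good_valid[OF L(2)] M'(3) r(2)] by auto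
  ultimately show ?thesis using reduces_nf_unique[OF good_valid[OF M(1)] good_valid[OF M'(1)]] n by blast
qed

end

section \<open>Pizzas as subdivisions\<close>

text \<open>Two sectors that end at the same arc share points just before it. The shift
  \<open>s\<close> is half of the smaller opening, so that the point also differs from
  \<open>a\<close>.\<close>

lemma overlap_before:
  assumes n: "norm a = t" "norm b = t" "norm c = t" "0 < t" and ne: "a \<noteq> c" "b \<noteq> c"
  shows "\<exists>p. norm p = t \<and> ang a p \<le> ang a c \<and> ang b p \<le> ang b c \<and> p \<noteq> a \<and> p \<noteq> c"
proof -
  define \<alpha> \<beta> s where "\<alpha> = ang a c" and "\<beta> = ang b c" and "s = min \<alpha> \<beta> / 2"
  have nz: "a \<noteq> 0" "b \<noteq> 0" using n by auto
  have "\<alpha> \<noteq> 0" "\<beta> \<noteq> 0" using ang_eq_0_iff[of c a] ang_eq_0_iff[of c b] n nz ne by (auto simp: \<alpha>_def \<beta>_def)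
  then have pos: "0 < \<alpha>" "0 < \<beta>" "\<alpha> < 2 * pi" "\<beta> < 2 * pi"
    using ang_bounds[of a c] ang_bounds[of b c] by (auto simp: \<alpha>_def \<beta>_def)
  then have s: "0 < s" "s < \<alpha>" "s < \<beta>" by (auto simp: s_def)
  define p where "p = rot c (- s)"
  have "c = rot a \<alpha>" "c = rot b \<beta>" using rot_ang[of c a] rot_ang[of c b] n nz by (simp_all add: \<alpha>_def \<beta>_def)
  then have p: "p = rot a (\<alpha> - s)" "p = rot b (\<beta> - s)"
    using rot_rot[of a \<alpha> "- s"] rot_rot[of b \<beta> "- s"] unfolding p_def by auto
  have "ang a p = \<alpha> - s" unfolding p(1) using s pos by (intro ang_rot nz) auto
  moreover have "ang b p = \<beta> - s" unfolding p(2) using s pos by (intro ang_rot nz) auto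
  moreover have "norm p = t" using n by (simp add: p_def)
  ultimately show ?thesis using s ang_self[OF nz(1)] unfolding \<alpha>_def \<beta>_def by (intro exI[of _ p]) auto
qed

text \<open>The counterpart for two sectors that start at the same arc.\<close>

lemma overlap_after:
  assumes n: "norm a = t" "norm b = t" "norm c = t" "0 < t" and ne: "a \<noteq> c" "b \<noteq> c"
  shows "\<exists>p. norm p = t \<and> ang c p \<le> ang c a \<and> ang c p \<le> ang c b \<and> p \<noteq> a \<and> p \<noteq> c"
proof -
  define \<alpha> \<beta> s where "\<alpha> = ang c a" and "\<beta> = ang c b" and "s = min \<alpha> \<beta> / 2"
  have nz: "c \<noteq> 0" using n by auto
  have "\<alpha> \<noteq> 0" "\<beta> \<noteq> 0" using ang_eq_0_iff[of a c] ang_eq_0_iff[of b c] n nz ne by (auto simp: \<alpha>_def \<beta>_def)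
  then have pos: "0 < \<alpha>" "0 < \<beta>" "\<alpha> < 2 * pi"
    using ang_bounds[of c a] ang_bounds[of c b] by (auto simp: \<alpha>_def \<beta>_def)
  then have s: "0 < s" "s < \<alpha>" "s < \<beta>" by (auto simp: s_def)
  define p where "p = rot c s"
  have p: "ang c p = s" "norm p = t" unfolding p_def using s pos n by (auto intro!: ang_rot nz)
  then have "ang c p \<le> ang c a" "ang c p \<le> ang c b" "p \<noteq> a" "p \<noteq> c"
    using s ang_self[OF nz] unfolding \<alpha>_def \<beta>_def by auto
  then show ?thesis using p(2) by blast
qed

lemma (in pb_o_minimal) arc_norm_ball: assumes "arc \<gamma>" shows "ev (\<lambda>\<epsilon>. \<forall>t\<in>{0..<\<epsilon>}. norm (\<gamma> t) = t)"
proof -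
  obtain e where e: "0 < e" "\<forall>t\<in>{0..<e}. norm (\<gamma> t) = t" using assms unfolding arc_germ_def by blast
  show ?thesis using ev_less[OF e(1)] by eventually_elim (use e(2) in auto)
qed

lemma germ_eqI: assumes "ev (\<lambda>t. \<forall>p. norm p = t \<longrightarrow> (p \<in> A \<longleftrightarrow> p \<in> B))" "0 \<in> A \<longleftrightarrow> 0 \<in> B" shows "germ_eq A B"
proof -
  obtain e where e: "0 < e" "\<And>t. 0 < t \<Longrightarrow> t < e \<Longrightarrow> \<forall>p. norm p = t \<longrightarrow> (p \<in> A \<longleftrightarrow> p \<in> B)"
    using assms(1) by (rule evE) blast
  have "p \<in> A \<longleftrightarrow> p \<in> B" if "p \<in> ball 0 e" for p
  proof (cases "p = 0")
    case False
    then have "0 < norm p" "norm p < e" using that by auto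
    then show ?thesis using e(2) by blast
  qed (use assms(2) in simp)
  then show ?thesis unfolding germ_eq_def using e(1) by blast
qed

lemma germ_eqD: assumes "germ_eq A B" shows "ev (\<lambda>t. \<forall>p. norm p = t \<longrightarrow> (p \<in> A \<longleftrightarrow> p \<in> B))"
proof -
  obtain e where e: "0 < e" "A \<inter> ball 0 e = B \<inter> ball 0 e" using assms unfolding germ_eq_def by blast
  show ?thesis using ev_less[OF e(1)]
  proof eventually_elim
    case (elim t)
    show ?case
    proof (intro allI impI)
      fix p :: "real \<times> real" assume "norm p = t"
      then have "p \<in> ball 0 e" using elim by simp
      then show "p \<in> A \<longleftrightarrow> p \<in> B" using e(2) by blast
    qed
  qed
qed

lemma germ_eq_trans: "germ_eq A B \<Longrightarrow> germ_eq B C \<Longrightarrow> germ_eq A C"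
proof -
  assume "germ_eq A B" "germ_eq B C"
  then obtain e1 e2 where e: "0 < e1" "A \<inter> ball 0 e1 = B \<inter> ball 0 e1" "0 < e2" "B \<inter> ball 0 e2 = C \<inter> ball 0 e2"
    unfolding germ_eq_def by blast
  have "A \<inter> ball 0 (min e1 e2) = C \<inter> ball 0 (min e1 e2)"
    using e(2,4) by (auto simp: set_eq_iff)
  then show ?thesis unfolding germ_eq_def using e(1,3) by (intro exI[of _ "min e1 e2"]) simp
qed

lemma sec_cong:
  assumes "arc_eq \<gamma> \<gamma>'" "arc_eq \<delta> \<delta>'" shows "germ_eq (sec \<gamma> \<delta>) (sec \<gamma>' \<delta>')"
proof (rule germ_eqI)
  show "ev (\<lambda>t. \<forall>p. norm p = t \<longrightarrow> (p \<in> sec \<gamma> \<delta> \<longleftrightarrow> p \<in> sec \<gamma>' \<delta>'))"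
    using assms[unfolded arc_eq_def] by eventually_elim (simp add: sec_def)
qed (simp add: sec_def)

section \<open>Cyclic families of sectors and their cut along the base ray\<close>

context function_germ
begin

lemma narrow_cong:
  assumes "narrow \<gamma> \<delta>" "arc_eq \<gamma> \<gamma>'" "arc_eq \<delta> \<delta>'" "arc \<gamma>'" "arc \<delta>'" shows "narrow \<gamma>' \<delta>'"
proof -
  obtain c where c: "0 < c" "ev (\<lambda>t. ang (\<gamma> t) (\<delta> t) \<le> 2 * pi - c)" using assms(1) unfolding narrow_def by blast
  have "ev (\<lambda>t. ang (\<gamma>' t) (\<delta>' t) \<le> 2 * pi - c)"
    using c(2) assms(2,3)[unfolded arc_eq_def] by eventually_elim simp
  moreover have "\<not> arc_eq \<gamma>' \<delta>'"
    using narrow_arcs(3)[OF assms(1)] assms(2,3) arc_eq_sym arc_eq_trans by blast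
  ultimately show ?thesis unfolding narrow_def using assms(4,5) c(1) by blast
qed

lemma assocI:
  assumes n: "narrow \<gamma> \<delta>" and T: "germ_eq T (sec \<gamma> \<delta>)" and x: "valid x" "seg_from x = ordf \<gamma>" "seg_to x = ordf \<delta>"
    and el: "elementary S f T" and os: "order_set S f T = seg_set S x"
    and w: "\<And>v. arc v \<Longrightarrow> arc_in v T \<Longrightarrow> relative_width S f T v = slice_width x (ordf v)"
    and sg: "\<exists>\<epsilon>>0. \<forall>p \<in> interior T \<inter> ball 0 \<epsilon>. sgn (f p) = of_int (slice_sign x)"
  shows "assoc \<gamma> \<delta> x"
proof -
  have 1: "{ordf v | v. arc v \<and> le \<gamma> v \<delta>} = seg_set S x" using order_set_sec[OF T] os by simp
  have 2: "ordf z = ordf v" if "arc v" "arc w" "arc z" "le \<gamma> v w" "le \<gamma> w \<delta>" "le \<gamma> v z" "le \<gamma> z w" "ordf v = ordf w" for v w z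
    by (rule elementary_sec[OF n T el that])
  have 3: "Inf (wset \<gamma> \<delta> \<eta>) = slice_width x (ordf \<eta>)" if "arc \<eta>" "le \<gamma> \<eta> \<delta>" for \<eta>
  proof -
    have "arc_in \<eta> T" using germ_eq_arc_in[OF T arc_norm[OF that(1)]] arc_in_sec_iff[OF that(1)] that(2) by blast
    then show ?thesis using w[OF that(1)] relative_width_sec[OF n T that(1)] by simp
  qed
  have 4: "\<exists>\<epsilon>>0. \<forall>p \<in> interior (sec \<gamma> \<delta>) \<inter> ball 0 \<epsilon>. sgn (f p) = of_int (slice_sign x)"
  proof -
    obtain e where e: "0 < e" "\<forall>p \<in> interior T \<inter> ball 0 e. sgn (f p) = of_int (slice_sign x)" using sg by blast
    obtain e' where e': "0 < e'" "T \<inter> ball 0 e' = sec \<gamma> \<delta> \<inter> ball 0 e'" using T unfolding germ_eq_def by blast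
    have sub: "interior (sec \<gamma> \<delta>) \<inter> ball 0 e' \<subseteq> interior T"
    proof (rule interior_maximal)
      show "interior (sec \<gamma> \<delta>) \<inter> ball 0 e' \<subseteq> T" using e'(2) interior_subset[of "sec \<gamma> \<delta>"] by blast
    qed (intro open_Int open_interior open_ball)
    have "sgn (f p) = of_int (slice_sign x)" if "p \<in> interior (sec \<gamma> \<delta>) \<inter> ball 0 (min e e')" for p
    proof -
      have "p \<in> interior T \<inter> ball 0 e" using that sub by auto
      then show ?thesis using e(2) by blast
    qed
    then show ?thesis using e(1) e'(1) by (intro exI[of _ "min e e'"]) simp
  qed
  show ?thesis unfolding assoc_def
    by (intro conjI allI impI n 1 4 x; elim conjE) (rule 2 3; assumption)+
qed

text \<open>A cyclic subdivision before it is cut open at the base. The last condition says, on each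
  small circle, that the sectors cover it and that two of them meet at most in common sides.\<close>

definition sectors :: "nat \<Rightarrow> (nat \<Rightarrow> real \<Rightarrow> real \<times> real) \<Rightarrow> (nat \<Rightarrow> slice) \<Rightarrow> bool" where
  "sectors k G x \<longleftrightarrow> 2 \<le> k \<and> (\<forall>i<k. G i \<in> reps \<and> assoc (G i) (G (Suc i mod k)) (x i)) \<and>
     ev (\<lambda>t. \<forall>p. norm p = t \<longrightarrow>
       (\<exists>i<k. ang (G i t) p \<le> ang (G i t) (G (Suc i mod k) t)) \<and>
       (\<forall>i<k. \<forall>j<k. i \<noteq> j \<and> ang (G i t) p \<le> ang (G i t) (G (Suc i mod k) t) \<and>
          ang (G j t) p \<le> ang (G j t) (G (Suc j mod k) t) \<longrightarrow>
          (\<exists>m\<in>{i, Suc i mod k} \<inter> {j, Suc j mod k}. p = G m t)))"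

lemma sectors_shift:
  assumes "sectors k G x" shows "sectors k (\<lambda>i. G ((i + s) mod k)) (\<lambda>i. x ((i + s) mod k))"
proof -
  define h where "h i = (i + s) mod k" for i
  have k: "2 \<le> k" and as: "\<And>i. i < k \<Longrightarrow> G i \<in> reps \<and> assoc (G i) (G (Suc i mod k)) (x i)"
    using assms unfolding sectors_def by auto
  have hk: "h i < k" for i using k by (simp add: h_def)
  have hS: "h (Suc i mod k) = Suc (h i) mod k" for i by (simp add: h_def mod_simps)
  have inj: "inj_on h {..<k}"
  proof (rule inj_onI)
    fix a b assume "a \<in> {..<k}" "b \<in> {..<k}" "h a = h b"
    then show "a = b" using mod_add_inj[of a k b s] by (simp add: h_def)
  qed
  then have surj: "h ` {..<k} = {..<k}" using hk by (intro endo_inj_surj) auto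
  have "ev (\<lambda>t. \<forall>p. norm p = t \<longrightarrow>
       (\<exists>i<k. ang (G (h i) t) p \<le> ang (G (h i) t) (G (h (Suc i mod k)) t)) \<and>
       (\<forall>i<k. \<forall>j<k. i \<noteq> j \<and> ang (G (h i) t) p \<le> ang (G (h i) t) (G (h (Suc i mod k)) t) \<and>
          ang (G (h j) t) p \<le> ang (G (h j) t) (G (h (Suc j mod k)) t) \<longrightarrow>
          (\<exists>m\<in>{i, Suc i mod k} \<inter> {j, Suc j mod k}. p = G (h m) t)))"
    using assms[unfolded sectors_def, THEN conjunct2, THEN conjunct2]
  proof (rule eventually_mono, intro allI impI conjI)
    fix t and p :: "real \<times> real"
    assume *: "\<forall>p. norm p = t \<longrightarrow>
       (\<exists>i<k. ang (G i t) p \<le> ang (G i t) (G (Suc i mod k) t)) \<and>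
       (\<forall>i<k. \<forall>j<k. i \<noteq> j \<and> ang (G i t) p \<le> ang (G i t) (G (Suc i mod k) t) \<and>
          ang (G j t) p \<le> ang (G j t) (G (Suc j mod k) t) \<longrightarrow>
          (\<exists>m\<in>{i, Suc i mod k} \<inter> {j, Suc j mod k}. p = G m t))" and n: "norm p = t"
    note ** = *[rule_format, OF n]
    obtain i where i: "i < k" "ang (G i t) p \<le> ang (G i t) (G (Suc i mod k) t)" using ** by blast
    then obtain i' where "i' < k" "i = h i'" using surj by (metis imageE lessThan_iff)
    then show "\<exists>i<k. ang (G (h i) t) p \<le> ang (G (h i) t) (G (h (Suc i mod k)) t)" using i hS by auto
    fix i j assume ij: "i < k" "j < k" "i \<noteq> j \<and> ang (G (h i) t) p \<le> ang (G (h i) t) (G (h (Suc i mod k)) t) \<and>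
          ang (G (h j) t) p \<le> ang (G (h j) t) (G (h (Suc j mod k)) t)"
    have "h i \<noteq> h j" using inj_onD[OF inj, of i j] ij by auto
    then obtain m where m: "m \<in> {h i, Suc (h i) mod k} \<inter> {h j, Suc (h j) mod k}" "p = G m t"
      using **[THEN conjunct2, rule_format, OF hk[of i] hk[of j]] ij(3) hS by metis
    have "{h i, Suc (h i) mod k} \<inter> {h j, Suc (h j) mod k} = h ` {i, Suc i mod k} \<inter> h ` {j, Suc j mod k}" using hS by simp
    also have "\<dots> = h ` ({i, Suc i mod k} \<inter> {j, Suc j mod k})"
      by (rule inj_on_image_Int[symmetric, OF inj]) (use ij k in auto)
    finally obtain m' where "m' \<in> {i, Suc i mod k} \<inter> {j, Suc j mod k}" "m = h m'" using m(1) by (metis imageE)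
    then show "\<exists>m\<in>{i, Suc i mod k} \<inter> {j, Suc j mod k}. p = G (h m) t" using m(2) by metis
  qed
  moreover have "G (h i) \<in> reps \<and> assoc (G (h i)) (G (h (Suc i mod k))) (x (h i))" for i using as[OF hk[of i]] hS by simp
  ultimately show ?thesis unfolding sectors_def h_def[symmetric] using k by blast
qed

lemma chain_map:
  assumes "a \<le> k" "\<And>i. a \<le> i \<Longrightarrow> i < k \<Longrightarrow> assoc (c i) (if Suc i < k then c (Suc i) else e) (y i)"
  shows "chain e (map (\<lambda>i. (c i, y i)) [a..<k])"
  using assms
proof (induction "k - a" arbitrary: a)
  case (Suc n)
  then have lt: "a < k" by simp
  have "nx e (map (\<lambda>i. (c i, y i)) [Suc a..<k]) = (if Suc a < k then c (Suc a) else e)"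
    by (auto simp: upt_conv_Cons)
  moreover have "chain e (map (\<lambda>i. (c i, y i)) [Suc a..<k])"
    by (rule Suc.hyps(1)) (use Suc.hyps(2) Suc.prems(2) lt in auto)
  ultimately show ?case using Suc.prems(2)[of a] lt by (simp add: upt_conv_Cons)
qed simp

text \<open>A descent from \<open>c j\<close> to \<open>c (Suc j)\<close>, as seen from the base,
  means that sector j contains the base. So does the last sector, hence the base is on a common side
  of both. It is not on the first side of the last sector, so it is on \<open>c 0\<close> with j =
  0; but then there is no descent.\<close>

lemma sectors_sorted:
  assumes C: "sectors k c y" and b: "le (c (k - 1)) base (c 0)" "\<not> arc_eq base (c (k - 1))" and j: "Suc j < k"
  shows "lt (c j) (c (Suc j))"
proof -
  have k: "2 \<le> k" and as: "\<And>i. i < k \<Longrightarrow> c i \<in> reps \<and> assoc (c i) (c (Suc i mod k)) (y i)"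
    using C unfolding sectors_def by auto
  have a: "arc (c i)" if "i < k" for i using as[OF that] repsD(1) by blast
  have aj: "arc (c j)" "arc (c (Suc j))" "arc (c (k - 1))" "arc (c 0)" using a j k by auto
  have "\<not> arc_eq (c j) (c (Suc j))" using assocD(1)[of "c j" "c (Suc j)" "y j"] as[of j] j narrow_arcs(3) by auto
  then have ne: "c j \<noteq> c (Suc j)" by auto
  have "le base (c j) (c (Suc j))"
  proof (rule ccontr)
    assume "\<not> le base (c j) (c (Suc j))"
    then have 1: "ev (\<lambda>t. ang (base t) (c (Suc j) t) < ang (base t) (c j t))"
      using le_cases[OF arc_base aj(1,2)] by blast
    have 2: "ev (\<lambda>t. base t \<noteq> c (k - 1) t)" using arc_eq_cases[OF arc_base aj(3)] b(2) by blast
    note 3 = C[unfolded sectors_def, THEN conjunct2, THEN conjunct2]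
    have "ev (\<lambda>t. False)"
      using 1 2 3 b(1)[unfolded le_def] arcs_ev[OF arc_base aj(1)] arcs_ev[OF arc_base aj(2)]
    proof eventually_elim
      case (elim t)
      have nz: "c j t \<noteq> base t" using elim(1,5) ang_bounds(1)[of "base t" "c (Suc j) t"] by auto
      have "ang (c j t) (base t) = 2 * pi - ang (base t) (c j t)"
        using ang_swap[of "c j t" "base t"] elim(5) nz by simp
      moreover have "ang (c j t) (c (Suc j) t) = ang (base t) (c (Suc j) t) - ang (base t) (c j t) + 2 * pi"
        using ang_shift[of "c j t" "base t" "c (Suc j) t"] elim(1,5,6) by simp
      ultimately have "ang (c j t) (base t) \<le> ang (c j t) (c (Suc j) t)"
        using ang_bounds(1)[of "base t" "c (Suc j) t"] by linarith
      then have s1: "ang (c j t) (base t) \<le> ang (c j t) (c (Suc j mod k) t)" using j by simp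
      have s2: "ang (c (k - 1) t) (base t) \<le> ang (c (k - 1) t) (c (Suc (k - 1) mod k) t)" using elim(4) k by simp
      have "norm (base t) = t" using elim(5) by simp
      from elim(3)[rule_format, OF this, THEN conjunct2, rule_format, of j "k - 1"]
      have "\<exists>m\<in>{j, Suc j mod k} \<inter> {k - 1, Suc (k - 1) mod k}. base t = c m t"
        using s1 s2 j by simp
      then obtain m where "m \<in> {j, Suc j mod k} \<inter> {k - 1, Suc (k - 1) mod k}" "base t = c m t" by blast
      moreover from this have "m = 0" "j = 0" using j k elim(2) by auto
      ultimately show False using nz by simp
    qed
    then show False by simp
  qed
  then show ?thesis unfolding lt_def using ne by blast
qed

text \<open>If the base is the side \<open>c 0\<close>, the family read from index 0 is already a
  good list. Otherwise the base lies inside the last sector, which is cut there.\<close>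

lemma sectors_good_aux:
  assumes C: "sectors k c y" and b: "le (c (k - 1)) base (c 0)" "\<not> arc_eq base (c (k - 1))"
  shows "\<exists>L. good L \<and> reduces (map snd L) (map y [0..<k])"
proof -
  have k: "2 \<le> k" and as: "\<And>i. i < k \<Longrightarrow> c i \<in> reps \<and> assoc (c i) (c (Suc i mod k)) (y i)"
    using C unfolding sectors_def by auto
  have lt: "lt (c i) (c j)" if "i < j" "j < k" for i j
    using that
  proof (induction j)
    case (Suc j)
    have 1: "lt (c j) (c (Suc j))" by (rule sectors_sorted[OF C b Suc.prems(2)])
    show ?case
    proof (cases "i = j")
      case False
      then have 2: "lt (c i) (c j)" using Suc by simp
      have "c i \<in> reps" "c j \<in> reps" "c (Suc j) \<in> reps" using as Suc.prems by auto
      then show ?thesis using 2 1 by (rule lt_trans)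
    qed (use 1 in simp)
  qed simp
  then have so: "sorted_wrt lt (map c [0..<k])" by (simp add: sorted_wrt_iff_nth_less)
  have hd: "[0..<k] = 0 # [1..<k]" using k by (simp add: upt_conv_Cons)
  have last: "[0..<k] = [0..<k - 1] @ [k - 1]" using k upt_Suc_append[of 0 "k - 1"] by simp
  show ?thesis
  proof (cases "arc_eq base (c 0)")
    case True
    then have eq: "c 0 = base" using repsD(2)[OF base_in_reps _ True] as[of 0] k by simp
    define L where "L = map (\<lambda>i. (c i, y i)) [0..<k]"
    have "good L"
      unfolding good_def
    proof (intro conjI)
      show "L \<noteq> []" using k by (simp add: L_def)
      show "fst (hd L) = base" using eq hd by (simp add: L_def)
      show "sorted_wrt lt (map fst L)" using so by (simp add: L_def comp_def)
      show "chain base L"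
        unfolding L_def
      proof (rule chain_map)
        fix i assume i: "i < k"
        have "c (Suc i mod k) = (if Suc i < k then c (Suc i) else base)"
          using i eq by (cases "Suc i = k") auto
        then show "assoc (c i) (if Suc i < k then c (Suc i) else base) (y i)" using as[OF i] by simp
      qed simp
      show "fst ` set L \<subseteq> reps" using as by (auto simp: L_def)
    qed
    moreover have "map snd L = map y [0..<k]" by (simp add: L_def)
    ultimately show ?thesis by (metis reduces_refl)
  next
    case False
    have asl: "assoc (c (k - 1)) (c 0) (y (k - 1))" using as[of "k - 1"] k by simp
    have "\<not> arc_eq (c (k - 1)) base" using b(2) arc_eq_sym by blast
    then obtain x1 x2 x' where x: "assoc (c (k - 1)) base x1" "assoc base (c 0) x2" "mg x1 x2 x'" "slice_eqv x' (y (k - 1))"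
      using assoc_split[OF asl arc_base b(1) _ False] by blast
    define y' where "y' = y(k - 1 := x1)"
    \<comment> \<open>The second half of the cut sector starts at the base and opens the list; its
      first half \<open>x1\<close> closes it. The two are neighbours cyclically, so a single step
      merges them.\<close>
    define L where "L = (base, x2) # map (\<lambda>i. (c i, y' i)) [0..<k]"
    have "base \<noteq> c 0" using False by auto
    then have b0: "lt base (c 0)" unfolding lt_def using le_base[OF arc_base] by blast
    have bi: "lt base (c i)" if "i < k" for i
    proof (cases "i = 0")
      case False
      then show ?thesis using lt_trans[OF base_in_reps _ _ b0 lt[of 0 i]] as[of 0] as[of i] that by simp
    qed (use b0 in simp)
    have "good L"
      unfolding good_def
    proof (intro conjI)
      show "L \<noteq> []" "fst (hd L) = base" by (simp_all add: L_def)
      show "sorted_wrt lt (map fst L)" using so bi by (simp add: L_def comp_def)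
      have "chain base (map (\<lambda>i. (c i, y' i)) [0..<k])"
      proof (rule chain_map)
        fix i assume i: "i < k"
        show "assoc (c i) (if Suc i < k then c (Suc i) else base) (y' i)"
        proof (cases "Suc i < k")
          case True
          then have "y' i = y i" by (auto simp: y'_def)
          then show ?thesis using as[OF i] True by simp
        next
          case False
          then have "i = k - 1" using i by simp
          then show ?thesis using x(1) False by (simp add: y'_def)
        qed
      qed simp
      then show "chain base L" using x(2) hd by (simp add: L_def)
      show "fst ` set L \<subseteq> reps" using as base_in_reps by (auto simp: L_def)
    qed
    moreover have "reduces (map snd L) (map y [0..<k])"
    proof -
      let ?zs = "map y [0..<k - 1]"
      have e: "map snd L = x2 # ?zs @ [x1]" by (simp add: L_def last y'_def comp_def)
      have "step (map snd L) (x' # ?zs)"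
        by (rule stepI[of _ "x2 # ?zs" "[x1]"]) (use e x(3) in auto)
      moreover have "ceq (x' # ?zs) (y (k - 1) # ?zs)"
        using x(4) list_all2_eqv_refl by (intro ceq_eqv) simp
      moreover have "ceq (y (k - 1) # ?zs) (map y [0..<k])"
        using ceq_swap[of "[y (k - 1)]" ?zs] by (simp add: last)
      ultimately show ?thesis unfolding reduces_def using ceq_trans by blast
    qed
    ultimately show ?thesis by blast
  qed
qed

text \<open>Some sector contains the base. If the base is its first side, the preceding sector
  contains it as its second side and is chosen instead. A rotation of the indices then makes the
  chosen sector the last one.\<close>

lemma sectors_good:
  assumes C: "sectors k G x" shows "\<exists>L. good L \<and> reduces (map snd L) (map x [0..<k])"
proof -
  have k: "2 \<le> k" and as: "\<And>i. i < k \<Longrightarrow> G i \<in> reps \<and> assoc (G i) (G (Suc i mod k)) (x i)"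
    using C unfolding sectors_def by auto
  have a: "arc (G i)" if "i < k" for i using as[OF that] repsD(1) by blast
  have mk: "i mod k < k" for i using k by simp
  have "\<exists>r<k. le (G r) base (G (Suc r mod k))"
  proof (rule ccontr)
    assume n: "\<not> (\<exists>r<k. le (G r) base (G (Suc r mod k)))"
    have "ev (\<lambda>t. ang (G r t) (G (Suc r mod k) t) < ang (G r t) (base t))" if "r < k" for r
      using le_cases[OF a[OF that] arc_base a[OF mk]] n that by blast
    then have "ev (\<lambda>t. \<forall>r\<in>{..<k}. ang (G r t) (G (Suc r mod k) t) < ang (G r t) (base t))"
      by (intro eventually_ball_finite) auto
    moreover note C[unfolded sectors_def, THEN conjunct2, THEN conjunct2]
    ultimately have "ev (\<lambda>t. False)" using arc_norm[OF arc_base]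
    proof eventually_elim
      case (elim t)
      obtain i where "i < k" "ang (G i t) (base t) \<le> ang (G i t) (G (Suc i mod k) t)"
        using elim(2)[rule_format, OF elim(3)] by blast
      then show ?case using elim(1) by force
    qed
    then show False by simp
  qed
  then obtain r0 where r0: "r0 < k" "le (G r0) base (G (Suc r0 mod k))" by blast
  obtain r where r: "r < k" "le (G r) base (G (Suc r mod k))" "\<not> arc_eq base (G r)"
  proof (cases "arc_eq base (G r0)")
    case True
    \<comment> \<open>The cyclic predecessor of \<open>r0\<close>.\<close>
    define r where "r = (r0 + (k - 1)) mod k"
    have "Suc r mod k = r0" unfolding r_def using r0(1) k by (simp add: mod_Suc_eq)
    moreover have "r < k" unfolding r_def by (rule mk)
    moreover have "\<not> arc_eq (G r) (G r0)" using as[OF \<open>r < k\<close>] calculation(1) assocD(1) narrow_arcs(3) by metis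
    then have "\<not> arc_eq base (G r)" using True arc_eq_sym arc_eq_trans by blast
    ultimately show ?thesis using that[of r] arc_eq_le[OF True] by simp
  qed (use r0 that in blast)
  define h where "h i = (i + Suc r) mod k" for i
  have h: "h (k - 1) = r" "h 0 = Suc r mod k"
  proof -
    have "k - 1 + Suc r = r + k" using k by simp
    then show "h (k - 1) = r" using r(1) by (simp add: h_def)
  qed (simp add: h_def)
  have "\<exists>L. good L \<and> reduces (map snd L) (map (\<lambda>i. x (h i)) [0..<k])"
    by (rule sectors_good_aux[OF sectors_shift[OF C, of "Suc r", folded h_def]]) (use r h in simp_all)
  moreover have "map (\<lambda>i. x (h i)) [0..<k] = rotate (Suc r) (map x [0..<k])"
    using k by (intro nth_equalityI) (simp_all add: nth_rotate h_def add.commute del: rotate_Suc)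
  moreover have "ceq (rotate (Suc r) (map x [0..<k])) (map x [0..<k])"
    using rotate_split[of "map x [0..<k]" "Suc r"] ceq_swap by metis
  ultimately show ?thesis unfolding reduces_def using ceq_trans by metis
qed

end

section \<open>From a pizza to a family of sectors\<close>

context function_germ
begin

text \<open>Consecutive triangles of a Hoelder complex lie on opposite sides of their common arc, so either all
  of them extend counterclockwise from \<open>\<gamma>s ! i\<close> to \<open>\<gamma>s ! (i + 1)\<close>, or all of them extend clockwise.\<close>

lemma pizza_sectors:
  assumes H: "associated_pizza S f H"
  shows "\<exists>G X. (X = H \<or> X = mirror H) \<and> sectors (length H) G (\<lambda>i. X ! i)"
proof -
  define k where "k = length H"
  obtain \<gamma>s Ts where ap: "abstract_pizza S H" and hc: "holder_complex S (map slice_exp H) \<gamma>s Ts"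
    and pz: "\<forall>i<length H. let x = H ! i; T = Ts ! i in
           elementary S f T \<and> order_set S f T = seg_set S x \<and>
           seg_from x = ord_along S f (\<gamma>s ! i) \<and>
           seg_to x = ord_along S f (\<gamma>s ! (Suc i mod length H)) \<and>
           (\<forall>\<gamma>. arc_germ S \<gamma> \<and> arc_in \<gamma> T \<longrightarrow>
                relative_width S f T \<gamma> = slice_width x (ord_along S f \<gamma>)) \<and>
           (\<exists>\<epsilon>>0. \<forall>p \<in> interior T \<inter> ball 0 \<epsilon>. sgn (f p) = of_int (slice_sign x))"
    using H unfolding associated_pizza_def by blast
  have k0: "k \<noteq> 0" and ht: "\<And>i. i < k \<Longrightarrow> holder_triangle S (map slice_exp H ! i) (\<gamma>s ! i) (\<gamma>s ! (Suc i mod k)) (Ts ! i)"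
    and cov: "ev (\<lambda>\<epsilon>. ball 0 \<epsilon> \<subseteq> (\<Union>i<k. Ts ! i) \<and>
         (\<forall>i<k. \<forall>j<k. i \<noteq> j \<longrightarrow>
            Ts ! i \<inter> Ts ! j \<inter> ball 0 \<epsilon> =
              {0} \<union> (\<Union>m \<in> {i, Suc i mod k} \<inter> {j, Suc j mod k}. (\<gamma>s ! m) ` {0..<\<epsilon>})))"
    using hc unfolding holder_complex_def by (simp_all add: k_def Let_def)
  have mk: "i mod k < k" for i using k0 by simp
  have ga: "arc (\<gamma>s ! i)" "\<not> arc_eq (\<gamma>s ! i) (\<gamma>s ! (Suc i mod k))" if "i < k" for i
    using ht[OF that] unfolding holder_triangle_def by auto
  have k: "2 \<le> k"
  proof (rule ccontr)
    assume "\<not> 2 \<le> k"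
    then have "k = 1" using k0 by simp
    then show False using ga(2)[of 0] by simp
  qed
  have val: "valid (H ! i)" if "i < k" for i
    using ap that unfolding abstract_pizza_def valid_def Let_def k_def by blast
  define g where "g i = rep (\<gamma>s ! i)" for i
  have g: "g i \<in> reps" "arc (g i)" "arc_eq (\<gamma>s ! i) (g i)" if "i < k" for i
    unfolding g_def using rep[OF ga(1)[OF that]] rep_in_reps[OF ga(1)[OF that]] by auto
  have ordg: "ordf (\<gamma>s ! i) = ordf (g i)" if "i < k" for i using ord_along_cong g(3)[OF that] by blast
  have gne: "\<not> arc_eq (g i) (g (Suc i mod k))" if "i < k" for i
    using ga(2)[OF that] g(3)[OF that] g(3)[OF mk] arc_eq_sym arc_eq_trans by blast
  define P where "P i \<longleftrightarrow> narrow (g i) (g (Suc i mod k)) \<and> germ_eq (Ts ! i) (sec (g i) (g (Suc i mod k)))" for i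
  define N where "N i \<longleftrightarrow> narrow (g (Suc i mod k)) (g i) \<and> germ_eq (Ts ! i) (sec (g (Suc i mod k)) (g i))" for i
  have PN: "P i \<or> N i" if i: "i < k" for i
    using holder_triangleD(2)[OF ht[OF i]]
  proof (elim disjE conjE)
    assume "narrow (\<gamma>s ! i) (\<gamma>s ! (Suc i mod k))" "germ_eq (Ts ! i) (sec (\<gamma>s ! i) (\<gamma>s ! (Suc i mod k)))"
    then have "P i" unfolding P_def
      using narrow_cong germ_eq_trans sec_cong g(2,3)[OF i] g(2,3)[OF mk] by blast
    then show ?thesis ..
  next
    assume "narrow (\<gamma>s ! (Suc i mod k)) (\<gamma>s ! i)" "germ_eq (Ts ! i) (sec (\<gamma>s ! (Suc i mod k)) (\<gamma>s ! i))"
    then have "N i" unfolding N_def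
      using narrow_cong germ_eq_trans sec_cong g(2,3)[OF i] g(2,3)[OF mk] by blast
    then show ?thesis ..
  qed
  have meet: "ev (\<lambda>t. \<forall>p. norm p = t \<longrightarrow> (\<exists>i<k. p \<in> Ts ! i) \<and>
      (\<forall>i<k. \<forall>j<k. i \<noteq> j \<and> p \<in> Ts ! i \<and> p \<in> Ts ! j \<longrightarrow> (\<exists>m\<in>{i, Suc i mod k} \<inter> {j, Suc j mod k}. p = g m t)))"
  proof -
    have "ev (\<lambda>\<epsilon>. \<forall>i\<in>{..<k}. \<forall>t\<in>{0..<\<epsilon>}. norm ((\<gamma>s ! i) t) = t)"
      using arc_norm_ball ga(1) by (intro eventually_ball_finite) auto
    then have "ev (\<lambda>\<epsilon>. (\<forall>i\<in>{..<k}. \<forall>t\<in>{0..<\<epsilon>}. norm ((\<gamma>s ! i) t) = t) \<and> 0 < \<epsilon> \<and>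
        ball 0 \<epsilon> \<subseteq> (\<Union>i<k. Ts ! i) \<and>
         (\<forall>i<k. \<forall>j<k. i \<noteq> j \<longrightarrow>
            Ts ! i \<inter> Ts ! j \<inter> ball 0 \<epsilon> =
              {0} \<union> (\<Union>m \<in> {i, Suc i mod k} \<inter> {j, Suc j mod k}. (\<gamma>s ! m) ` {0..<\<epsilon>})))"
      using ev_pos cov by eventually_elim (intro conjI; elim conjE; assumption)
    from eventually_happens'[OF trivial_limit_at_right_real this] obtain e where e: "\<forall>i\<in>{..<k}. \<forall>t\<in>{0..<e}. norm ((\<gamma>s ! i) t) = t" "0 < e" "ball 0 e \<subseteq> (\<Union>i<k. Ts ! i)"
      "\<forall>i<k. \<forall>j<k. i \<noteq> j \<longrightarrow> Ts ! i \<inter> Ts ! j \<inter> ball 0 e =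
              {0} \<union> (\<Union>m \<in> {i, Suc i mod k} \<inter> {j, Suc j mod k}. (\<gamma>s ! m) ` {0..<e})"
      by (elim exE conjE) (rule that; assumption)
    have "ev (\<lambda>t. \<forall>m\<in>{..<k}. (\<gamma>s ! m) t = g m t)"
      using g(3)[unfolded arc_eq_def] by (intro eventually_ball_finite) auto
    then show ?thesis using ev_pos ev_less[OF e(2)]
    proof eventually_elim
      case (elim t)
      show ?case
      proof (intro allI impI conjI)
        fix p :: "real \<times> real" assume n: "norm p = t"
        then have b: "p \<in> ball 0 e" using elim by simp
        then show "\<exists>i<k. p \<in> Ts ! i" using e(3) by blast
        fix i j assume ij: "i < k" "j < k" "i \<noteq> j \<and> p \<in> Ts ! i \<and> p \<in> Ts ! j"
        have "p \<in> Ts ! i \<inter> Ts ! j \<inter> ball 0 e" using ij(3) b by blast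
        moreover have "p \<noteq> 0" using n elim by auto
        ultimately obtain m where m: "m \<in> {i, Suc i mod k} \<inter> {j, Suc j mod k}" "p \<in> (\<gamma>s ! m) ` {0..<e}"
          using e(4)[rule_format, OF ij(1,2)] ij(3) by blast
        then obtain t' where t': "t' \<in> {0..<e}" "p = (\<gamma>s ! m) t'" by blast
        have "m < k" using m(1) ij mk by blast
        then have "t' = t" using e(1) t' n by auto
        then have "p = g m t" using t' elim(1) \<open>m < k\<close> by simp
        then show "\<exists>m\<in>{i, Suc i mod k} \<inter> {j, Suc j mod k}. p = g m t" using m(1) by blast
      qed
    qed
  qed
  have memP: "ev (\<lambda>t. \<forall>p. norm p = t \<longrightarrow> (p \<in> Ts ! i \<longleftrightarrow> ang (g i t) p \<le> ang (g i t) (g (Suc i mod k) t)))"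
    if "P i" for i
    using germ_eqD[OF that[unfolded P_def, THEN conjunct2]] ev_pos
    by eventually_elim (auto simp: sec_def)
  have memN: "ev (\<lambda>t. \<forall>p. norm p = t \<longrightarrow> (p \<in> Ts ! i \<longleftrightarrow> ang (g (Suc i mod k) t) p \<le> ang (g (Suc i mod k) t) (g i t)))"
    if "N i" for i
    using germ_eqD[OF that[unfolded N_def, THEN conjunct2]] ev_pos
    by eventually_elim (auto simp: sec_def)
  \<comment> \<open>\<open>P i\<close> with \<open>N\<close> at the next index would put both
    triangles just before their common arc, \<open>N i\<close> with \<open>P\<close> at the next
    index would put both just after it. Either way they share points off their sides.\<close>
  have turn: "\<not> (P i \<and> N (Suc i mod k)) \<and> \<not> (N i \<and> P (Suc i mod k))" if i: "i < k" for i
  proof -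
    define j l where "j = Suc i mod k" and "l = Suc j mod k"
    have jl: "j < k" "l < k" by (simp_all add: j_def l_def mk)
    have "i \<noteq> j" using i k by (cases "Suc i = k") (auto simp: j_def)
    have ne: "ev (\<lambda>t. g i t \<noteq> g j t)" "ev (\<lambda>t. g j t \<noteq> g l t)"
      using arc_eq_cases g(2) gne i jl unfolding j_def l_def by blast+
    have no: "ev (\<lambda>t. norm (g i t) = t)" "ev (\<lambda>t. norm (g j t) = t)" "ev (\<lambda>t. norm (g l t) = t)"
      using arc_norm g(2) i jl by auto
    \<comment> \<open>Common sides of triangle i and its successor j can only be \<open>g j\<close>
      and, in a complex of two triangles, also \<open>g i\<close>. The shared point therefore has to
      avoid both.\<close>
    have excl: False if n: "norm p = t" and p: "p \<in> Ts ! i" "p \<in> Ts ! j" "p \<noteq> g i t" "p \<noteq> g j t"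
      and m: "\<forall>p. norm p = t \<longrightarrow> (\<exists>i<k. p \<in> Ts ! i) \<and>
        (\<forall>i<k. \<forall>j<k. i \<noteq> j \<and> p \<in> Ts ! i \<and> p \<in> Ts ! j \<longrightarrow> (\<exists>m\<in>{i, Suc i mod k} \<inter> {j, Suc j mod k}. p = g m t))" for p t
    proof -
      have "\<exists>m\<in>{i, Suc i mod k} \<inter> {j, Suc j mod k}. p = g m t"
        using m[rule_format, OF n, THEN conjunct2, rule_format, OF i jl(1)] \<open>i \<noteq> j\<close> p(1,2) by blast
      then show False using p(3,4) unfolding j_def[symmetric] by auto
    qed
    have False if h: "P i" "N j"
    proof -
      have "ev (\<lambda>t. False)" using memP[OF h(1)] memN[OF h(2)] ne no meet ev_pos
      proof eventually_elim
        case (elim t)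
        obtain p where p: "norm p = t" "ang (g i t) p \<le> ang (g i t) (g j t)" "ang (g l t) p \<le> ang (g l t) (g j t)"
          "p \<noteq> g i t" "p \<noteq> g j t"
          using overlap_before[OF elim(5,7,6,9) elim(3) elim(4)[symmetric]] by blast
        then have "p \<in> Ts ! i" "p \<in> Ts ! j" using elim(1,2) unfolding j_def[symmetric] l_def[symmetric] by blast+
        then show False using excl[OF p(1) _ _ p(4,5) elim(8)] by blast
      qed
      then show False by simp
    qed
    moreover have False if h: "N i" "P j"
    proof -
      have "ev (\<lambda>t. False)" using memN[OF h(1)] memP[OF h(2)] ne no meet ev_pos
      proof eventually_elim
        case (elim t)
        obtain p where p: "norm p = t" "ang (g j t) p \<le> ang (g j t) (g i t)" "ang (g j t) p \<le> ang (g j t) (g l t)"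
          "p \<noteq> g i t" "p \<noteq> g j t"
          using overlap_after[OF elim(5,7,6,9) elim(3) elim(4)[symmetric]] by blast
        then have "p \<in> Ts ! i" "p \<in> Ts ! j" using elim(1,2) unfolding j_def[symmetric] l_def[symmetric] by blast+
        then show False using excl[OF p(1) _ _ p(4,5) elim(8)] by blast
      qed
      then show False by simp
    qed
    ultimately show ?thesis unfolding j_def[symmetric] by blast
  qed
  have el: "elementary S f (Ts ! i)" "order_set S f (Ts ! i) = seg_set S (H ! i)"
    "seg_from (H ! i) = ordf (g i)" "seg_to (H ! i) = ordf (g (Suc i mod k))"
    "\<And>v. arc v \<Longrightarrow> arc_in v (Ts ! i) \<Longrightarrow> relative_width S f (Ts ! i) v = slice_width (H ! i) (ordf v)"
    "\<exists>\<epsilon>>0. \<forall>p \<in> interior (Ts ! i) \<inter> ball 0 \<epsilon>. sgn (f p) = of_int (slice_sign (H ! i))" if "i < k" for i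
    using pz[rule_format, of i] that ordg[OF that] ordg[OF mk, of "Suc i"] unfolding k_def[symmetric] Let_def by simp_all
  consider "\<forall>i<k. P i" | "\<forall>i<k. N i"
  proof (cases "P 0")
    case True
    have "P i" if "i < k" for i using that
    proof (induction i)
      case (Suc i)
      then have "\<not> N (Suc i)" using turn[of i] by simp
      then show ?case using PN[OF Suc.prems] by blast
    qed (rule True)
    then show ?thesis using that(1) by blast
  next
    case False
    have "N i" if "i < k" for i using that
    proof (induction i)
      case 0 then show ?case using PN False by blast
    next
      case (Suc i)
      then have "\<not> P (Suc i)" using turn[of i] by simp
      then show ?case using PN[OF Suc.prems] by blast
    qed
    then show ?thesis using that(2) by blast
  qed
  then show ?thesis
  proof cases
    case 1
    have "g i \<in> reps \<and> assoc (g i) (g (Suc i mod k)) (H ! i)" if "i < k" for i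
    proof -
      have "narrow (g i) (g (Suc i mod k))" "germ_eq (Ts ! i) (sec (g i) (g (Suc i mod k)))"
        using 1 that unfolding P_def by auto
      then show ?thesis using assocI val[OF that] el[OF that] g(1)[OF that] by blast
    qed
    moreover have "ev (\<lambda>t. \<forall>i\<in>{..<k}. \<forall>p. norm p = t \<longrightarrow> (p \<in> Ts ! i \<longleftrightarrow> ang (g i t) p \<le> ang (g i t) (g (Suc i mod k) t)))"
      using memP 1 by (intro eventually_ball_finite) auto
    then have "ev (\<lambda>t. \<forall>p. norm p = t \<longrightarrow>
       (\<exists>i<k. ang (g i t) p \<le> ang (g i t) (g (Suc i mod k) t)) \<and>
       (\<forall>i<k. \<forall>j<k. i \<noteq> j \<and> ang (g i t) p \<le> ang (g i t) (g (Suc i mod k) t) \<and>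
          ang (g j t) p \<le> ang (g j t) (g (Suc j mod k) t) \<longrightarrow>
          (\<exists>m\<in>{i, Suc i mod k} \<inter> {j, Suc j mod k}. p = g m t)))"
      using meet
    proof eventually_elim
      case (elim t)
      show ?case
      proof (intro allI impI)
        fix p :: "real \<times> real" assume n: "norm p = t"
        have "p \<in> Ts ! i \<longleftrightarrow> ang (g i t) p \<le> ang (g i t) (g (Suc i mod k) t)" if "i < k" for i
          using elim(1) that n by blast
        then show "(\<exists>i<k. ang (g i t) p \<le> ang (g i t) (g (Suc i mod k) t)) \<and>
          (\<forall>i<k. \<forall>j<k. i \<noteq> j \<and> ang (g i t) p \<le> ang (g i t) (g (Suc i mod k) t) \<and>
            ang (g j t) p \<le> ang (g j t) (g (Suc j mod k) t) \<longrightarrow>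
            (\<exists>m\<in>{i, Suc i mod k} \<inter> {j, Suc j mod k}. p = g m t))"
          using elim(2)[rule_format, OF n] by metis
      qed
    qed
    ultimately have "sectors k g (\<lambda>i. H ! i)" unfolding sectors_def using k by blast
    then show ?thesis unfolding k_def by blast
  next
    case 2
    \<comment> \<open>In the clockwise case the arcs are enumerated backwards, \<open>u i\<close>
      being - i modulo k, and the triangles by \<open>w i\<close> = k - 1 - i. Entry i of the
      mirrored pizza then belongs to the sector from \<open>g (u i)\<close> to
      \<open>g (w i)\<close>, and \<open>w i\<close> is \<open>u\<close> at the next index.\<close>
    define u where "u i = (k - i) mod k" for i
    define w where "w i = k - Suc i" for i
    have w: "w i < k" "u (Suc i mod k) = w i" "Suc (w i) mod k = u i" "u i < k" if "i < k" for i
    proof -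
      show "w i < k" "u i < k" using that by (simp_all add: w_def u_def)
      show "Suc (w i) mod k = u i" using that by (simp add: w_def u_def Suc_diff_Suc)
      show "u (Suc i mod k) = w i"
      proof (cases "Suc i = k")
        case False
        then show ?thesis using that by (simp add: u_def w_def)
      qed (simp add: u_def w_def)
    qed
    have uu: "u (u i) = i" if "i < k" for i using that by (cases "i = 0") (simp_all add: u_def)
    have "g (u i) \<in> reps \<and> assoc (g (u i)) (g (u (Suc i mod k))) (mirror H ! i)" if i: "i < k" for i
    proof -
      have "narrow (g (u i)) (g (w i))" "germ_eq (Ts ! w i) (sec (g (u i)) (g (w i)))"
        using 2 w[OF i] unfolding N_def by auto
      moreover have "mirror H ! i = flip (H ! w i)"
        using i unfolding mirror_def k_def w_def by (simp add: rev_nth)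
      ultimately show ?thesis
        using assocI[of "g (u i)" "g (w i)" "Ts ! w i" "flip (H ! w i)"] valid_flip[OF val[OF w(1)[OF i]]] el[OF w(1)[OF i]]
          g(1)[OF w(4)[OF i]] w[OF i] by simp
    qed
    moreover have "ev (\<lambda>t. \<forall>i\<in>{..<k}. \<forall>p. norm p = t \<longrightarrow>
        (p \<in> Ts ! i \<longleftrightarrow> ang (g (Suc i mod k) t) p \<le> ang (g (Suc i mod k) t) (g i t)))"
      using memN 2 by (intro eventually_ball_finite) auto
    then have "ev (\<lambda>t. \<forall>p. norm p = t \<longrightarrow>
       (\<exists>i<k. ang (g (u i) t) p \<le> ang (g (u i) t) (g (u (Suc i mod k)) t)) \<and>
       (\<forall>i<k. \<forall>j<k. i \<noteq> j \<and> ang (g (u i) t) p \<le> ang (g (u i) t) (g (u (Suc i mod k)) t) \<and>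
          ang (g (u j) t) p \<le> ang (g (u j) t) (g (u (Suc j mod k)) t) \<longrightarrow>
          (\<exists>m\<in>{i, Suc i mod k} \<inter> {j, Suc j mod k}. p = g (u m) t)))"
      using meet
    proof eventually_elim
      case (elim t)
      show ?case
      proof (intro allI impI conjI)
        fix p :: "real \<times> real" assume n: "norm p = t"
        have T: "p \<in> Ts ! w i \<longleftrightarrow> ang (g (u i) t) p \<le> ang (g (u i) t) (g (u (Suc i mod k)) t)" if "i < k" for i
          using elim(1)[rule_format, of "w i" p] w[OF that] n by simp
        obtain i where i: "i < k" "p \<in> Ts ! i" using elim(2)[rule_format, OF n] by blast
        have "w (w i) = i" using i(1) by (simp add: w_def)
        then show "\<exists>i<k. ang (g (u i) t) p \<le> ang (g (u i) t) (g (u (Suc i mod k)) t)"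
          using T[of "w i"] i w(1)[OF i(1)] by (intro exI[of _ "w i"]) simp
        fix i j assume ij: "i < k" "j < k" "i \<noteq> j \<and> ang (g (u i) t) p \<le> ang (g (u i) t) (g (u (Suc i mod k)) t) \<and>
          ang (g (u j) t) p \<le> ang (g (u j) t) (g (u (Suc j mod k)) t)"
        have "p \<in> Ts ! w i" "p \<in> Ts ! w j" using T ij by blast+
        moreover have "w i \<noteq> w j" using ij by (auto simp: w_def)
        ultimately obtain m where m: "m \<in> {w i, Suc (w i) mod k} \<inter> {w j, Suc (w j) mod k}" "p = g m t"
          using elim(2)[rule_format, OF n, THEN conjunct2, rule_format, OF w(1)[OF ij(1)] w(1)[OF ij(2)]] by blast
        have uw: "u (w i) = Suc i mod k" if "i < k" for i using w(2)[OF that] uu[OF mk, of "Suc i"] by metis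
        have um: "u m \<in> {i, Suc i mod k}" if i: "i < k" and mi: "m \<in> {w i, Suc (w i) mod k}" for i
        proof -
          have "m = w i \<or> m = u i" using mi unfolding w(3)[OF i] by blast
          then have "u m = Suc i mod k \<or> u m = i" using uu[OF i] uw[OF i] by metis
          then show ?thesis by blast
        qed
        have "u m \<in> {i, Suc i mod k} \<inter> {j, Suc j mod k}" using um[OF ij(1)] um[OF ij(2)] m(1) by blast
        moreover have "m < k" using m(1) w(1)[OF ij(1)] mk by blast
        then have "p = g (u (u m)) t" using m(2) uu by simp
        ultimately show "\<exists>m\<in>{i, Suc i mod k} \<inter> {j, Suc j mod k}. p = g (u m) t" by blast
      qed
    qed
    ultimately have "sectors k (\<lambda>i. g (u i)) (\<lambda>i. mirror H ! i)" unfolding sectors_def using k by blast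
    then show ?thesis unfolding k_def by blast
  qed
qed

lemma minimal_pizza_good:
  assumes "minimal_pizza S f H"
  shows "\<exists>L A. good L \<and> (A = H \<or> A = mirror H) \<and> reduces (map snd L) A \<and> nf A \<and> all_valid A \<and> all_valid H"
proof -
  obtain H0 where nfH: "nf H" and as: "associated_pizza S f H0" and st: "step\<^sup>*\<^sup>* H0 H"
    using assms unfolding minimal_pizza_def simplified_pizza_def nf_def by blast
  have v0: "all_valid H0"
    unfolding all_valid_def
  proof
    fix x assume "x \<in> set H0"
    then obtain i where "i < length H0" "x = H0 ! i" by (metis in_set_conv_nth)
    then show "valid x"
      using as unfolding associated_pizza_def abstract_pizza_def valid_def Let_def by blast
  qed
  have v: "all_valid H" by (rule steps_valid[OF st v0])
  obtain G X where X: "X = H0 \<or> X = mirror H0" "sectors (length H0) G (\<lambda>i. X ! i)" using pizza_sectors[OF as] by blast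
  have "length X = length H0" using X(1) by auto
  then have "map (\<lambda>i. X ! i) [0..<length H0] = X" by (metis map_nth)
  then obtain L where L: "good L" "reduces (map snd L) X" using sectors_good[OF X(2)] by auto
  from X(1) show ?thesis
  proof
    assume e: "X = H0"
    have "reduces H0 H" unfolding reduces_def using st ceq_refl by blast
    then have "reduces (map snd L) H" using reduces_trans[OF good_valid[OF L(1)] v0] L(2) e by blast
    then show ?thesis using L(1) nfH v by blast
  next
    assume e: "X = mirror H0"
    have "reduces (map snd L) (mirror H)"
      using reduces_trans[OF good_valid[OF L(1)] all_valid_mirror[OF v0]] L(2) e reduces_mirror[OF v0 st] by blast
    then show ?thesis using L(1) nf_mirror[OF nfH] all_valid_mirror[OF v] v by blast
  qed
qed

lemma minimal_pizza_unique:
  assumes "minimal_pizza S f H" "minimal_pizza S f H'" shows "combinatorially_equivalent S H H'"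
proof -
  obtain L A where A: "good L" "A = H \<or> A = mirror H" "reduces (map snd L) A" "nf A" "all_valid A" "all_valid H"
    using minimal_pizza_good[OF assms(1)] by blast
  obtain L' B where B: "good L'" "B = H' \<or> B = mirror H'" "reduces (map snd L') B" "nf B" "all_valid B" "all_valid H'"
    using minimal_pizza_good[OF assms(2)] by blast
  have eq: "ceq A B" by (rule good_reduces_unique[OF A(1) B(1) A(3) B(3) A(4) B(4) A(5) B(5)])
  \<comment> \<open>If both lists are direct or both are mirrored, the cyclic order is preserved; if
    exactly one is mirrored, it is reversed.\<close>
  have "ceq H H' \<or> ceq (mirror H) H'"
    using A(2) B(2) eq ceq_mirror[OF eq] by auto
  then show ?thesis using ceq_equivalent ceq_mirror_equivalent A(6) B(6) by blast
qed

end

theorem theorem4p8: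
  fixes S :: "nat \<Rightarrow> real list set set"
    and f :: "real \<times> real \<Rightarrow> real"
    and H H' :: "slice list"
  assumes "o_minimal_structure S"
    and "polynomially_bounded S"
    and "definable_continuous_germ S f"
    and "minimal_pizza S f H"
    and "minimal_pizza S f H'"
  shows "combinatorially_equivalent S H H'"
proof -
  interpret function_germ S f by unfold_locales (rule assms)+
  show ?thesis using assms(4,5) by (rule minimal_pizza_unique)
qed

end
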